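(* Let $d \ge 1$ and let $L, M \subseteq \mathbb{R}^d$ be lattices of the same volume. Then there exists a bounded Lebesgue measurable set $E \subseteq \mathbb{R}^d$ which tiles $\mathbb{R}^d$ when translated by $L$ and when translated by $M$, i.e. $$\sum_{\ell \in L} \mathbf{1}_E(x-\ell) = 1 \quad\text{and}\quad \sum_{m \in M} \mathbf{1}_E(x-m) = 1 \quad \text{for almost all } x \in \mathbb{R}^d,$$ and such that the family of functions $$x \mapsto e^{2\pi i\, \mu\cdot x}\, \mathbf{1}_E(x-\ell), \qquad \ell \in L,\ \mu \in M^*,$$ is an orthogonal basis of $L^2(\mathbb{R}^d)$.
   Context: A lattice in $\mathbb{R}^d$ is a discrete subgroup of $\mathbb{R}^d$ which linearly spans $\mathbb{R}^d$; equivalently, a set $A\mathbb{Z}^d$ with $A$ a non-singular real $d\times d$ matrix. The volume of the lattice $A\mathbb{Z}^d$ is $|\det A|$. The dual lattice of a lattice $M$ is $M^* = \{x \in \mathbb{R}^d : x\cdot m \in \mathbb{Z} \text{ for all } m \in M\}$. $\mathbf{1}_E$ denotes the indicator function of $E$. $L^2(\mathbb{R}^d)$ is the complex Hilbert space of square-integrable functions with respect to Lebesgue measure; an orthogonal basis is a family of nonzero, pairwise orthogonal vectors whose linear span is dense. *)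

theory Defs
  imports "HOL-Analysis.Analysis"
begin

definition is_lattice :: "(real ^ 'n) set \<Rightarrow> bool" where
  "is_lattice L \<longleftrightarrow> 0 \<in> L \<and> (\<forall>x\<in>L. \<forall>y\<in>L. x - y \<in> L) \<and> discrete L \<and> span L = UNIV"

definition int_vecs :: "(real ^ 'n) set" where
  "int_vecs = {z. \<forall>i. z $ i \<in> \<int>}"

definition lattice_of :: "real ^ 'n ^ 'n \<Rightarrow> (real ^ 'n) set" where
  "lattice_of A = (\<lambda>z. A *v z) ` int_vecs"

text \<open>The lemmas \<open>is_lattice_iff\<close> and \<open>lattice_volume_eq\<close> below show that the
  description in this definition exists for every lattice and that it is unique.\<close>

definition lattice_volume :: "(real ^ 'n) set \<Rightarrow> real" where
  "lattice_volume L = (THE v. \<exists>A. det A \<noteq> 0 \<and> L = lattice_of A \<and> v = \<bar>det A\<bar>)"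

definition dual_lattice :: "(real ^ 'n) set \<Rightarrow> (real ^ 'n) set" where
  "dual_lattice M = {x. \<forall>m\<in>M. x \<bullet> m \<in> \<int>}"

definition tiles_by :: "(real ^ 'n) set \<Rightarrow> (real ^ 'n) set \<Rightarrow> bool" where
  "tiles_by E L \<longleftrightarrow>
     (AE x in lebesgue. ((\<lambda>l. indicat_real E (x - l)) has_sum 1) L)"

text \<open>Elements of \<open>L\<^sup>2\<close> are represented by functions; equality in \<open>L\<^sup>2\<close> is
  equality almost everywhere.\<close>

definition square_integrable :: "'a measure \<Rightarrow> ('a \<Rightarrow> complex) \<Rightarrow> bool" where
  "square_integrable M f \<longleftrightarrow>
     f \<in> borel_measurable M \<and> integrable M (\<lambda>x. (cmod (f x))\<^sup>2)"

definition l2_inner :: "'a measure \<Rightarrow> ('a \<Rightarrow> complex) \<Rightarrow> ('a \<Rightarrow> complex) \<Rightarrow> complex" where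
  "l2_inner M f g = (LINT x|M. f x * cnj (g x))"

definition l2_norm :: "'a measure \<Rightarrow> ('a \<Rightarrow> complex) \<Rightarrow> real" where
  "l2_norm M f = sqrt (LINT x|M. (cmod (f x))\<^sup>2)"

definition orthogonal_basis_L2 :: "'a measure \<Rightarrow> 'i set \<Rightarrow> ('i \<Rightarrow> 'a \<Rightarrow> complex) \<Rightarrow> bool" where
  "orthogonal_basis_L2 M I f \<longleftrightarrow>
     (\<forall>i\<in>I. square_integrable M (f i) \<and> \<not> (AE x in M. f i x = 0)) \<and>
     (\<forall>i\<in>I. \<forall>j\<in>I. i \<noteq> j \<longrightarrow> l2_inner M (f i) (f j) = 0) \<and>
     (\<forall>g. square_integrable M g \<longrightarrow>
        (\<forall>e>0. \<exists>S c. finite S \<and> S \<subseteq> I \<and>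
           l2_norm M (\<lambda>x. g x - (\<Sum>i\<in>S. c i * f i x)) < e))"

lemma Ints_det:
  fixes P :: "real ^ 'n ^ 'n"
  assumes "\<And>i j. P $ i $ j \<in> \<int>"
  shows "det P \<in> \<int>"
  unfolding det_def using assms by (intro Ints_sum Ints_mult Ints_prod) auto

lemma axis_int_vecs: "axis j (1::real) \<in> int_vecs"
  by (auto simp: int_vecs_def axis_def)

lemma matrix_inv_both:
  fixes A :: "real ^ 'n ^ 'n"
  assumes "invertible A"
  shows matrix_inv_right: "A ** matrix_inv A = mat 1"
    and matrix_inv_left: "matrix_inv A ** A = mat 1"
  using someI_ex[OF assms[unfolded invertible_def]] unfolding matrix_inv_def by auto

lemma lattice_of_det_le:
  fixes A B :: "real ^ 'n ^ 'n"
  assumes "det A \<noteq> 0" "det B \<noteq> 0" "lattice_of A \<subseteq> lattice_of B"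
  shows "\<bar>det B\<bar> \<le> \<bar>det A\<bar>"
proof -
  define P where "P = matrix_inv B ** A"
  have B: "invertible B" using assms(2) by (simp add: invertible_det_nz)
  have BP: "B ** P = A"
    unfolding P_def by (simp add: matrix_mul_assoc matrix_inv_right B)
  have "P $ i $ j \<in> \<int>" for i j
  proof -
    have "A *v axis j 1 \<in> lattice_of B"
      using assms(3) axis_int_vecs unfolding lattice_of_def by blast
    then obtain z where z: "z \<in> int_vecs" "A *v axis j 1 = B *v z"
      unfolding lattice_of_def by blast
    have "P *v axis j 1 = z"
      unfolding P_def matrix_vector_mul_assoc[symmetric] z(2)
      by (simp add: matrix_vector_mul_assoc matrix_inv_left B)
    then have "column j P = z" by (simp add: matrix_vector_mult_basis)
    then show ?thesis using z(1) by (auto simp: int_vecs_def column_def)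
  qed
  then have "det P \<in> \<int>" by (rule Ints_det)
  moreover have d: "det A = det B * det P" using BP det_mul by metis
  moreover have "det P \<noteq> 0" using d assms(1) by auto
  ultimately have "1 \<le> \<bar>det P\<bar>" by (rule_tac Ints_nonzero_abs_ge1)
  then show ?thesis
    by (simp add: d abs_mult mult_le_cancel_left1)
qed

lemma lattice_volume_eq:
  fixes A :: "real ^ 'n ^ 'n"
  assumes "det A \<noteq> 0"
  shows "lattice_volume (lattice_of A) = \<bar>det A\<bar>"
  unfolding lattice_volume_def
proof (rule the_equality)
  fix v assume "\<exists>B. det B \<noteq> 0 \<and> lattice_of A = lattice_of B \<and> v = \<bar>det B\<bar>"
  then show "v = \<bar>det A\<bar>"
    using assms lattice_of_det_le by (metis antisym order_refl)
qed (use assms in blast)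

lemma is_lattice_lattice_of:
  fixes A :: "real ^ 'n ^ 'n"
  assumes "det A \<noteq> 0"
  shows "is_lattice (lattice_of A)"
proof -
  have A: "invertible A" using assms by (simp add: invertible_det_nz)
  have inv: "matrix_inv A *v (A *v x) = x" for x
    by (simp add: matrix_vector_mul_assoc matrix_inv_left A)
  have inv': "A *v (matrix_inv A *v x) = x" for x
    by (simp add: matrix_vector_mul_assoc matrix_inv_right A)
  have "0 \<in> lattice_of A"
    unfolding lattice_of_def by (rule image_eqI[of _ _ 0]) (auto simp: int_vecs_def)
  moreover have "x - y \<in> lattice_of A" if "x \<in> lattice_of A" "y \<in> lattice_of A" for x y
  proof -
    obtain u v where uv: "x = A *v u" "y = A *v v" "u \<in> int_vecs" "v \<in> int_vecs"
      using \<open>x \<in> lattice_of A\<close> \<open>y \<in> lattice_of A\<close> unfolding lattice_of_def by blast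
    have "u - v \<in> int_vecs" "x - y = A *v (u - v)"
      using uv by (auto simp: int_vecs_def matrix_vector_mult_diff_distrib)
    then show ?thesis unfolding lattice_of_def by blast
  qed
  moreover have "uniform_discrete (lattice_of A)"
  proof -
    obtain K where K: "K > 0" "\<And>x. norm (matrix_inv A *v x) \<le> norm x * K"
      using bounded_linear.pos_bounded[OF matrix_vector_mul_bounded_linear] by blast
    show ?thesis unfolding uniform_discrete_def
    proof (intro exI[of _ "1/K"] conjI ballI impI)
      fix x y assume xy: "x \<in> lattice_of A" "y \<in> lattice_of A" "dist x y < 1 / K"
      obtain u v where uv: "x = A *v u" "y = A *v v" "u \<in> int_vecs" "v \<in> int_vecs"
        using xy unfolding lattice_of_def by blast
      have "u - v = matrix_inv A *v (x - y)"
        by (simp add: uv matrix_vector_mult_diff_distrib inv)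
      then have "norm (u - v) \<le> norm (x - y) * K" using K by simp
      also have "\<dots> < 1" using xy(3) K(1) by (simp add: dist_norm field_simps)
      finally have n: "norm (u - v) < 1" .
      have "u $ i = v $ i" for i
      proof -
        have "\<bar>(u - v) $ i\<bar> < 1" using n component_le_norm_cart[of "u - v" i] by linarith
        moreover have "(u - v) $ i \<in> \<int>" using uv by (auto simp: int_vecs_def)
        ultimately have "(u - v) $ i = 0" using Ints_nonzero_abs_less1 by blast
        then show ?thesis by simp
      qed
      then have "u = v" by (simp add: vec_eq_iff)
      then show "x = y" using uv by simp
    qed (use K in auto)
  qed
  then have "discrete (lattice_of A)" by (rule uniform_discrete_imp_discrete)
  moreover have "span (lattice_of A) = UNIV"
  proof -
    have "columns A \<subseteq> lattice_of A"
      unfolding columns_def lattice_of_def using axis_int_vecs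
      by (force simp flip: matrix_vector_mult_basis)
    moreover have "span (columns A) = UNIV"
      using A matrix_right_invertible_span_columns[of A]
      by (metis matrix_inv_right  vec.span_eq span_vec_eq)
    ultimately show ?thesis by (metis span_mono top.extremum_uniqueI)
  qed
  ultimately show ?thesis unfolding is_lattice_def by blast
qed

lemma is_lattice_imp_lattice_of:
  fixes L :: "(real ^ 'n) set"
  assumes "is_lattice L"
  obtains A where "det A \<noteq> 0" "L = lattice_of A"
proof -
  have L0: "0 \<in> L" and Ld: "\<And>x y. x \<in> L \<Longrightarrow> y \<in> L \<Longrightarrow> x - y \<in> L"
    and disc: "discrete L" and sp: "span L = UNIV"
    using assms unfolding is_lattice_def by auto
  have Lm: "- x \<in> L" if "x \<in> L" for x using Ld[OF L0 that] by simp
  have La: "x + y \<in> L" if "x \<in> L" "y \<in> L" for x y using Ld[OF that(1) Lm[OF that(2)]] by simp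
  have Ln: "of_nat k *\<^sub>R x \<in> L" if "x \<in> L" for k x
    by (induction k) (auto simp: L0 La that algebra_simps)
  have Li: "k *\<^sub>R x \<in> L" if "x \<in> L" and k: "k \<in> \<int>" for k x
  proof -
    obtain m where m: "k = of_int m" using k by (auto elim: Ints_cases)
    show ?thesis
    proof (cases "m \<ge> 0")
      case True then show ?thesis using Ln[OF that(1), of "nat m"] m by simp
    next
      case False then show ?thesis using Ln[OF Lm[OF that(1)], of "nat (-m)"] m by simp
    qed
  qed
  have Ls: "sum f S \<in> L" if "\<And>i. i \<in> S \<Longrightarrow> f i \<in> L" "finite S" for f :: "'n \<Rightarrow> real ^ 'n" and S
    using that(2,1) by (induction S rule: finite_induct) (auto simp: L0 La)
  have colL: "A *v z \<in> L" if "\<And>j. column j A \<in> L" "z \<in> int_vecs" for A :: "real ^ 'n ^ 'n" and z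
  proof -
    have "A *v z = (\<Sum>j\<in>UNIV. z $ j *\<^sub>R column j A)"
      by (simp add: matrix_mult_sum scalar_mult_eq_scaleR)
    also have "\<dots> \<in> L" using that by (intro Ls Li) (auto simp: int_vecs_def)
    finally show ?thesis .
  qed
  have unif: "uniform_discrete L"
  proof -
    obtain e where e: "e > 0" "\<And>y. y \<in> L \<Longrightarrow> dist 0 y < e \<Longrightarrow> y = 0"
      using discreteD[OF disc L0] unfolding isolated_in_dist_Ex_iff by auto
    show ?thesis unfolding uniform_discrete_def
    proof (intro exI[of _ e] conjI ballI impI)
      fix x y assume "x \<in> L" "y \<in> L" "dist x y < e"
      then show "x = y" using e(2)[OF Ld[of x y]] by (simp add: dist_norm norm_minus_commute)
    qed (rule e)
  qed
  obtain A0 :: "real ^ 'n ^ 'n" where A0: "det A0 \<noteq> 0" "\<And>j. column j A0 \<in> L"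
  proof -
    obtain B where B: "B \<subseteq> L" "independent B" "L \<subseteq> span B" "card B = dim L"
      using basis_exists[of L] by blast
    have spB: "span B = UNIV" using B sp by (metis span_mono span_span top.extremum_uniqueI)
    have "card B = CARD('n)"
      using B(4) dim_span[of L] sp by (simp add: dim_UNIV)
    moreover have "finite B" using B(2) by (rule finiteI_independent)
    ultimately obtain f where f: "bij_betw f (UNIV :: 'n set) B"
      by (metis finite_same_card_bij finite_class.finite_UNIV)
    define A0 :: "real ^ 'n ^ 'n" where "A0 = (\<chi> i j. f j $ i)"
    have c: "column j A0 = f j" for j by (simp add: A0_def column_def vec_eq_iff)
    have "columns A0 = B" using f by (auto simp: columns_def c bij_betw_def)
    then have "\<exists>B'. A0 ** B' = mat 1"
      using spB matrix_right_invertible_span_columns[of A0] by (simp add: span_vec_eq)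
    then have "det A0 \<noteq> 0"
      by (metis invertible_det_nz invertible_right_inverse)
    moreover have "column j A0 \<in> L" for j using f B(1) by (auto simp: c bij_betw_def)
    ultimately show ?thesis using that by blast
  qed
  have inv0: "invertible A0" using A0 by (simp add: invertible_det_nz)
  define F where "F = L \<inter> ((\<lambda>z. A0 *v z) ` cbox 0 1)"
  have "bounded ((\<lambda>z. A0 *v z) ` cbox 0 1)"
    by (intro bounded_linear_image bounded_cbox matrix_vector_mul_bounded_linear)
  then have finF: "finite F"
    unfolding F_def using unif uniform_discrete_finite_iff
    by (metis bounded_Int inf_le1 uniform_discrete_subset)
  define N where "N = (fact (card F) :: nat)"
  have N: "N > 0" by (simp add: N_def)
  have coords: "of_nat N *\<^sub>R (matrix_inv A0 *v x) \<in> int_vecs" if x: "x \<in> L" for x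
  proof -
    define c where "c = matrix_inv A0 *v x"
    have Ac: "A0 *v c = x"
      unfolding c_def by (simp add: matrix_vector_mul_assoc matrix_inv_right inv0)
    define r where "r k = A0 *v (\<chi> i. frac (real k * c $ i))" for k :: nat
    have rF: "r k \<in> F" for k
    proof -
      have "(\<chi> i. frac (real k * c $ i)) =
          real k *\<^sub>R c - (\<chi> i. of_int \<lfloor>real k * c $ i\<rfloor>)"
        by (simp add: vec_eq_iff frac_def)
      then have "r k = real k *\<^sub>R x - A0 *v (\<chi> i. of_int \<lfloor>real k * c $ i\<rfloor>)"
        by (simp add: r_def matrix_vector_mult_diff_distrib matrix_vector_mult_scaleR Ac)
      also have "\<dots> \<in> L"
        by (intro Ld Ln x colL A0) (auto simp: int_vecs_def)
      finally have "r k \<in> L" .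
      moreover have "r k \<in> (\<lambda>z. A0 *v z) ` cbox 0 1"
        unfolding r_def
        by (intro imageI) (auto simp: mem_box_cart frac_lt_1 less_imp_le)
      ultimately show ?thesis by (simp add: F_def)
    qed
    have "\<not> inj_on r {0..card F}"
    proof
      assume "inj_on r {0..card F}"
      then have "card {0..card F} \<le> card F"
        by (intro card_inj_on_le[of r]) (use rF finF in auto)
      then show False by simp
    qed
    then obtain k l where kl: "k \<in> {0..card F}" "l \<in> {0..card F}" "k < l" "r k = r l"
      unfolding inj_on_def by (metis linorder_neqE_nat)
    have eq: "(\<chi> i. frac (real k * c $ i)) = (\<chi> i. frac (real l * c $ i))"
      using arg_cong[OF kl(4), of "\<lambda>v. matrix_inv A0 *v v"]
      by (simp add: r_def matrix_vector_mul_assoc matrix_inv_left inv0)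
    define m where "m = l - k"
    have m: "1 \<le> m" "m \<le> card F" using kl by (auto simp: m_def)
    have mc: "real m * c $ i \<in> \<int>" for i
    proof -
      have "frac (real k * c $ i) = frac (real l * c $ i)"
        using eq by (simp add: vec_eq_iff)
      then have "real l * c $ i - real k * c $ i = of_int (\<lfloor>real l * c $ i\<rfloor> - \<lfloor>real k * c $ i\<rfloor>)"
        by (simp add: frac_def)
      then have "real l * c $ i - real k * c $ i \<in> \<int>" by (metis Ints_of_int)
      then show ?thesis using kl by (simp add: m_def of_nat_diff algebra_simps)
    qed
    obtain q where q: "N = m * q"
      using dvd_fact[OF m] unfolding N_def by (auto elim: dvdE)
    have "real N * c $ i \<in> \<int>" for i
      using Ints_mult[OF Ints_of_nat[of q] mc[of i]] by (simp add: q mult_ac)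
    then show ?thesis by (simp add: int_vecs_def c_def)
  qed
  define D where "D = \<bar>det A0\<bar> / real N ^ CARD('n)"
  have D: "D > 0" using A0 N by (simp add: D_def)
  have detD: "\<exists>k::nat. \<bar>det A\<bar> = real k * D" if "\<And>j. column j A \<in> L" for A :: "real ^ 'n ^ 'n"
  proof -
    define P where "P = matrix_inv A0 ** A"
    have "A0 ** P = A" unfolding P_def by (simp add: matrix_mul_assoc matrix_inv_right inv0)
    then have dA: "det A = det A0 * det P" using det_mul by metis
    define Q where "Q = (\<chi> i. real N *s P $ i)"
    have "det Q = real N ^ CARD('n) * det P"
      unfolding Q_def using det_rows_mul[of "\<lambda>_. real N" "\<lambda>i. P $ i"] by simp
    moreover have "det Q \<in> \<int>"
    proof (rule Ints_det)
      fix i j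
      have "column j P = matrix_inv A0 *v column j A"
        unfolding P_def by (simp flip: matrix_vector_mult_basis add: matrix_vector_mul_assoc)
      then have "real N *\<^sub>R column j P \<in> int_vecs" using coords that by simp
      then show "Q $ i $ j \<in> \<int>" by (auto simp: Q_def int_vecs_def column_def)
    qed
    ultimately have "\<bar>real N ^ CARD('n) * det P\<bar> \<in> \<int>" by simp
    then obtain m where m: "\<bar>real N ^ CARD('n) * det P\<bar> = of_int m" by (auto elim: Ints_cases)
    then have "m \<ge> 0" by (metis abs_ge_zero of_int_0_le_iff)
    then have "real (nat m) = real N ^ CARD('n) * \<bar>det P\<bar>" using m by (simp add: abs_mult)
    then have "\<bar>det A\<bar> = real (nat m) * D"
      using N by (simp add: D_def dA abs_mult)
    then show ?thesis by blast
  qed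
  define good where
    "good k \<longleftrightarrow> (\<exists>A :: real ^ 'n ^ 'n. det A \<noteq> 0 \<and> (\<forall>j. column j A \<in> L) \<and> \<bar>det A\<bar> = real k * D)"
    for k :: nat
  have "\<exists>k. good k" using detD[of A0] A0 unfolding good_def by blast
  then obtain k where k: "good k" "\<And>l. good l \<Longrightarrow> k \<le> l"
    using LeastI_ex Least_le by metis
  obtain A :: "real ^ 'n ^ 'n" where A: "det A \<noteq> 0" "\<And>j. column j A \<in> L" "\<bar>det A\<bar> = real k * D"
    using k(1) unfolding good_def by blast
  have inv: "invertible A" using A by (simp add: invertible_det_nz)
  have "L \<subseteq> lattice_of A"
  proof
    fix x assume x: "x \<in> L"
    define c where "c = matrix_inv A *v x"
    have Ac: "A *v c = x"
      unfolding c_def by (simp add: matrix_vector_mul_assoc matrix_inv_right inv)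
    have "c $ j \<in> \<int>" for j
    proof (rule ccontr)
      assume j: "c $ j \<notin> \<int>"
      define w where "w = c - axis j (of_int \<lfloor>c $ j\<rfloor>)"
      have wj: "w $ j = frac (c $ j)" by (simp add: w_def axis_def frac_def)
      have Aw: "A *v w \<in> L"
        unfolding w_def matrix_vector_mult_diff_distrib Ac
        by (intro Ld x colL A) (auto simp: int_vecs_def axis_def)
      define A' :: "real ^ 'n ^ 'n" where
        "A' = (\<chi> i l. if l = j then (A *v w) $ i else A $ i $ l)"
      have dA': "det A' = frac (c $ j) * det A"
        unfolding A'_def using cramer_lemma[of j A w] wj by simp
      have "column l A' = (if l = j then A *v w else column l A)" for l
        by (simp add: A'_def column_def vec_eq_iff)
      then have colA': "column l A' \<in> L" for l using Aw A by simp
      have fr: "frac (c $ j) > 0" "frac (c $ j) < 1" using j by (auto simp: frac_lt_1)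
      obtain l where l: "\<bar>det A'\<bar> = real l * D" using detD colA' by blast
      have "det A' \<noteq> 0" using dA' fr A(1) by simp
      then have "k \<le> l" using k(2) l colA' unfolding good_def by blast
      then have "\<bar>det A\<bar> \<le> \<bar>det A'\<bar>" using l A(3) D by (simp add: mult_right_mono)
      then show False using dA' fr A(1) by (simp add: abs_mult mult_le_cancel_right2)
    qed
    then have "c \<in> int_vecs" by (simp add: int_vecs_def)
    then show "x \<in> lattice_of A" using Ac unfolding lattice_of_def by blast
  qed
  moreover have "lattice_of A \<subseteq> L"
    using colL[OF A(2)] unfolding lattice_of_def by blast
  ultimately show ?thesis using that A(1) by blast
qed

lemma is_lattice_iff:
  fixes L :: "(real ^ 'n) set"
  shows "is_lattice L \<longleftrightarrow> (\<exists>A. det A \<noteq> 0 \<and> L = lattice_of A)"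
  using is_lattice_lattice_of is_lattice_imp_lattice_of by metis

end

theory Submission
  imports Defs
begin

text \<open>
  Write \<open>D = L + M\<close>. It suffices to find a bounded fundamental domain \<open>F\<^sub>L\<close> of \<open>L\<close> and one \<open>F\<^sub>M\<close> of
  \<open>M\<close> together with a Borel bijection between them that moves points by finitely many elements
  \<open>s = l + m\<close> of \<open>D\<close>: moving each piece of \<open>F\<^sub>L\<close> by \<open>l\<close> only gives a set that is a fundamental domain
  for both lattices. (All of this is up to null sets.)

  Choose a basis of \<open>M\<close> such that some of its members have a multiple in \<open>L\<close>, while the others, indexed
  by \<open>I\<close>, are independent modulo \<open>L\<close>. The former enlarge \<open>L\<close> to a lattice \<open>La\<close>, the latter act freely on
  the torus \<open>\<real>\<^sup>d / La\<close>. In the fibres over this torus \<open>F\<^sub>L\<close> has a constant number of points. Since the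
  volumes agree, averaging the box \<open>F\<^sub>M\<close> over translates by \<open>F\<^sub>L\<close> gives the same constant, and a box
  differs from its translate by a bounded coboundary: so the difference of the two counting functions is the
  divergence of a bounded real flow on the orbits of the free action.

  The flow is made integral as in measurable circle squaring. Almost every point lies in a cube
  from a family of cubes with well separated boundaries. The flow is rounded on the boundary edges of
  every such cube by pushing fractional parts along a tree of 4-cycles, then inside the cubes by
  the integrality of flows on finite graphs. Finally all mass is gathered at sparse markers whose
  cells have so much more volume than boundary that the integral flow can be carried out.

  For the basis, a nontrivial wave that is periodic under \<open>M\<close> has mean zero on every tile of \<open>M\<close>, and the
  waves are complete in \<open>L\<^sup>2(E + l)\<close> since \<open>E + l\<close> is the torus \<open>\<real>\<^sup>d / M\<close> up to a null set.
\<close>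

section \<open>Rounding a flow on a finite graph\<close>

text \<open>The obstacle is to choose measurably and boundedly at once. The orbits of L + M are
  dense in general, so measurable representatives of orbits are out of reach; every choice is
  instead made as a function of finitely many values of a countable type, and such a function is
  Borel however it was chosen. A transport uses finitely many displacements, which keeps the common
  tile bounded and lets it be cut into finitely many Borel pieces. The real flow stays bounded for
  translates of any length because the jump of a box under a translation telescopes, one coordinate
  at a time, with summands of size at most 1. Integrality of flows is a theorem on finite graphs
  with integral divergence at every vertex; orbits are infinite, and the cubes serve to cut them
  into finite pieces. For this the values on the cut edges must be integral beforehand, without
  changing the divergence. In rank at least 2 the edges that leave a cube are linked by squares
  meeting the cut in two edges, along which fractions can be carried until their integral total is
  reached at a root; in rank at most 1 the floor of the flow already does it.\<close>

lemma homogeneous_nontrivial: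
  fixes a :: "'v \<Rightarrow> 'e \<Rightarrow> real"
  assumes "finite V" "finite E" "card V < card E"
  shows "\<exists>c. (\<exists>e\<in>E. c e \<noteq> 0) \<and> (\<forall>v\<in>V. (\<Sum>e\<in>E. a v e * c e) = 0)"
  using assms
proof (induction V arbitrary: E a rule: finite_induct)
  case empty
  then have "E \<noteq> {}" by auto
  then show ?case by (intro exI[of _ "\<lambda>_. 1"]) auto
next
  case (insert v V)
  show ?case
  proof (cases "\<forall>e\<in>E. a v e = 0")
    case True
    have "card V < card E" using insert.prems insert.hyps by simp
    from insert.IH[OF insert.prems(1) this]
    obtain c where c: "\<exists>e\<in>E. c e \<noteq> 0" "\<forall>v\<in>V. (\<Sum>e\<in>E. a v e * c e) = 0"
      by blast
    have "(\<Sum>e\<in>E. a v e * c e) = 0" using True by simp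
    then show ?thesis using c by blast
  next
    case False
    then obtain e0 where e0: "e0 \<in> E" "a v e0 \<noteq> 0" by auto
    define E' where "E' = E - {e0}"
    \<comment> \<open>Gaussian elimination: row v is solved for the unknown e0 and inserted into the
      other rows. One row and one unknown disappear, so the strict inequality of cardinalities
      survives.\<close>
    define a' where "a' u e = a u e - a u e0 * (a v e / a v e0)" for u e
    have E: "E = insert e0 E'" "e0 \<notin> E'" "finite E'"
      using e0 insert.prems by (auto simp: E'_def)
    have "card V < card E'" using insert E by auto
    then obtain c where c: "\<exists>e\<in>E'. c e \<noteq> 0" "\<forall>v\<in>V. (\<Sum>e\<in>E'. a' v e * c e) = 0"
      using insert.IH[OF E(3)] by blast
    define c' where "c' = c(e0 := - (\<Sum>e\<in>E'. a v e * c e) / a v e0)"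
    have s: "(\<Sum>e\<in>E. a u e * c' e) = (\<Sum>e\<in>E'. a u e * c e) + a u e0 * c' e0" for u
    proof -
      have "(\<Sum>e\<in>E'. a u e * c' e) = (\<Sum>e\<in>E'. a u e * c e)"
        using E by (intro sum.cong) (auto simp: c'_def)
      then show ?thesis using E by simp
    qed
    have "(\<Sum>e\<in>E. a u e * c' e) = 0" if "u \<in> V" for u
    proof -
      have "0 = (\<Sum>e\<in>E'. a' u e * c e)" using c that by simp
      also have "\<dots> = (\<Sum>e\<in>E'. a u e * c e) - a u e0 * ((\<Sum>e\<in>E'. a v e * c e) / a v e0)"
        unfolding a'_def
        by (simp add: algebra_simps sum_subtractf sum_distrib_left sum_divide_distrib)
      finally show ?thesis unfolding s by (simp add: c'_def)
    qed
    moreover have "(\<Sum>e\<in>E. a v e * c' e) = 0"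
      unfolding s using e0 by (simp add: c'_def)
    moreover have "\<exists>e\<in>E. c' e \<noteq> 0" using c E by (auto simp: c'_def)
    ultimately show ?thesis by blast
  qed
qed

definition netflow :: "'e set \<Rightarrow> ('e \<Rightarrow> 'v) \<Rightarrow> ('e \<Rightarrow> 'v) \<Rightarrow> ('e \<Rightarrow> real) \<Rightarrow> 'v \<Rightarrow> real" where
  "netflow E s d x v = (\<Sum>e | e \<in> E \<and> s e = v. x e) - (\<Sum>e | e \<in> E \<and> d e = v. x e)"

lemma netflow_add_scaled:
  "netflow E s d (\<lambda>e. x e + t * c e) v = netflow E s d x v + t * netflow E s d c v"
  by (simp add: netflow_def sum.distrib sum_distrib_left[symmetric] algebra_simps)

lemma netflow_coeff:
  assumes "finite E"
  shows "netflow E s d c v = (\<Sum>e\<in>E. (of_bool (s e = v) - of_bool (d e = v)) * c e)"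
proof -
  have "(\<Sum>e | e \<in> E \<and> P e. c e) = (\<Sum>e\<in>E. of_bool (P e) * c e)" for P
    unfolding sum.inter_filter[OF assms] by (intro sum.cong) auto
  then show ?thesis
    by (simp add: netflow_def algebra_simps sum_subtractf)
qed

text \<open>The non-integral edges meet every vertex at least twice, so there are at least as many of
  them as vertices, and they support a non-zero circulation. Moving along it until an edge becomes
  integral removes a non-integral edge.\<close>

lemma flow_rounding:
  fixes x :: "'e \<Rightarrow> real" and s d :: "'e \<Rightarrow> 'v"
  assumes "finite E" and "\<And>e. e \<in> E \<Longrightarrow> s e \<noteq> d e"
    and "\<And>v. netflow E s d x v \<in> \<int>"
  shows "\<exists>y. (\<forall>e\<in>E. y e \<in> \<int> \<and> of_int \<lfloor>x e\<rfloor> \<le> y e \<and> y e \<le> of_int \<lceil>x e\<rceil>) \<and>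
    (\<forall>v. netflow E s d y v = netflow E s d x v)"
  using assms
proof (induction "card {e\<in>E. x e \<notin> \<int>}" arbitrary: x rule: less_induct)
  case less
  define F where "F = {e\<in>E. x e \<notin> \<int>}"
  have fF: "finite F" using less.prems by (simp add: F_def)
  show ?case
  proof (cases "F = {}")
    case True
    then show ?thesis
      by (intro exI[of _ x]) (auto simp: F_def)
  next
    case False
    then obtain e1 where e1: "e1 \<in> F" by auto
    define V where "V = s ` F \<union> d ` F"
    have fV: "finite V" by (simp add: V_def fF)
    \<comment> \<open>A fractional edge that is alone at v would be, up to sign, the difference of
      the integral net flow at v and a sum of integers.\<close>
    have deg: "2 \<le> card {e\<in>F. s e = v} + card {e\<in>F. d e = v}" if v: "v \<in> V" for v
    proof (rule ccontr)
      assume "\<not> ?thesis"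
      moreover have "card {e\<in>F. s e = v} + card {e\<in>F. d e = v} \<noteq> 0"
        using v fF by (auto simp: V_def)
      moreover have "card ({e\<in>F. s e = v} \<union> {e\<in>F. d e = v}) = card {e\<in>F. s e = v} + card {e\<in>F. d e = v}"
        using fF less.prems(2) by (intro card_Un_disjoint) (fastforce simp: F_def)+
      ultimately have "card ({e\<in>F. s e = v} \<union> {e\<in>F. d e = v}) = 1" by linarith
      then obtain e where e: "{e\<in>F. s e = v} \<union> {e\<in>F. d e = v} = {e}"
        by (rule card_1_singletonE)
      have split: "netflow E s d x v = netflow (E - {e}) s d x v + (of_bool (s e = v) - of_bool (d e = v)) * x e"
      proof -
        have "e \<in> E" using e by (auto simp: F_def)
        then show ?thesis using less.prems(1)
          by (simp add: netflow_coeff sum.remove[of E e])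
      qed
      have "netflow (E - {e}) s d x v \<in> \<int>"
        unfolding netflow_def
      proof (intro Ints_diff Ints_sum)
        fix e' assume "e' \<in> {e' \<in> E - {e}. s e' = v}"
        then show "x e' \<in> \<int>" using e by (auto simp: F_def)
      next
        fix e' assume "e' \<in> {e' \<in> E - {e}. d e' = v}"
        then show "x e' \<in> \<int>" using e by (auto simp: F_def)
      qed
      then have "(of_bool (s e = v) - of_bool (d e = v)) * x e \<in> \<int>"
        using split less.prems(3)[of v] by (metis Ints_diff add_diff_cancel_left')
      moreover have "s e = v \<or> d e = v" "s e \<noteq> d e" "x e \<notin> \<int>"
        using e less.prems(2)[of e] by (auto simp: F_def)
      ultimately show False by (auto simp: minus_in_Ints_iff)
    qed
    have "2 * card V \<le> (\<Sum>v\<in>V. card {e\<in>F. s e = v} + card {e\<in>F. d e = v})"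
      using sum_mono[of V "\<lambda>_. 2", OF deg] by (simp add: mult.commute)
    also have "\<dots> = card F + card F"
    proof -
      have "(\<Sum>v\<in>V. card {e\<in>F. g e = v}) = card F" if "g ` F \<subseteq> V" for g
        using sum.group[OF fF fV that, of "\<lambda>_. 1::nat"] by (simp only: card_eq_sum)
      from this[of s] this[of d] show ?thesis
        unfolding sum.distrib by (simp add: V_def)
    qed
    finally have le: "card V \<le> card F" by simp
    \<comment> \<open>Every edge leaves one vertex and enters another, so the equations at all
      vertices add up to 0 = 0. Dropping the one at v0 makes the system strictly underdetermined,
      and the equation at v0 is recovered from the others.\<close>
    define v0 where "v0 = s e1"
    have v0: "v0 \<in> V" using e1 by (simp add: V_def v0_def)
    have "card (V - {v0}) < card F"
    proof -
      have "card V > 0" using v0 fV card_gt_0_iff by blast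
      then show ?thesis using le v0 by (simp add: card_Diff_singleton)
    qed
    from homogeneous_nontrivial[OF finite_Diff[OF fV] fF this, of "\<lambda>v e. of_bool (s e = v) - of_bool (d e = v)"]
    obtain c0 :: "'e \<Rightarrow> real" where c0: "\<exists>e\<in>F. c0 e \<noteq> 0"
      "\<forall>v\<in>V - {v0}. (\<Sum>e\<in>F. (of_bool (s e = v) - of_bool (d e = v)) * c0 e) = 0"
      by blast
    define c where "c e = (if e \<in> F then c0 e else 0)" for e
    have ncF: "netflow E s d c v = (\<Sum>e\<in>F. (of_bool (s e = v) - of_bool (d e = v)) * c0 e)" for v
      unfolding netflow_coeff[OF less.prems(1)]
    proof (rule sum.mono_neutral_cong_right[OF less.prems(1)])
      show "F \<subseteq> E" by (simp add: F_def)
    qed (simp_all add: c_def)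
    have nc: "netflow E s d c v = 0" for v
    proof -
      consider "v \<notin> V" | "v \<in> V - {v0}" | "v = v0" by auto
      then show ?thesis
      proof cases
        case 1
        then show ?thesis unfolding ncF by (intro sum.neutral) (auto simp: V_def)
      next
        case 2
        then show ?thesis unfolding ncF using c0 by blast
      next
        case 3
        have "(\<Sum>v\<in>V. netflow E s d c v) = (\<Sum>e\<in>F. \<Sum>v\<in>V. (of_bool (s e = v) - of_bool (d e = v)) * c0 e)"
          unfolding ncF by (rule sum.swap)
        also have "\<dots> = (\<Sum>e\<in>F. 0)"
        proof (rule sum.cong[OF refl])
          fix e assume "e \<in> F"
          then have "s e \<in> V" "d e \<in> V" by (auto simp: V_def)
          then show "(\<Sum>v\<in>V. (of_bool (s e = v) - of_bool (d e = v)) * c0 e) = 0"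
            using fV by (simp add: sum_distrib_right[symmetric] sum_subtractf of_bool_def sum.delta)
        qed
        finally have "netflow E s d c v0 + (\<Sum>v\<in>V - {v0}. netflow E s d c v) = 0"
          using v0 fV by (simp add: sum.remove)
        then show ?thesis using c0 3 unfolding ncF by simp
      qed
    qed
    define G where "G = {e\<in>F. c e \<noteq> 0}"
    have G: "finite G" "G \<noteq> {}" using fF c0 by (auto simp: G_def c_def)
    \<comment> \<open>\<open>\<tau> e\<close> is the time at which edge e, followed along the
      circulation c, reaches the end of its interval between floor and ceiling. At the least of
      these times one more edge is integral and no edge has passed an integer.\<close>
    define \<tau> where "\<tau> e = (if c e > 0 then of_int \<lceil>x e\<rceil> - x e else x e - of_int \<lfloor>x e\<rfloor>) / \<bar>c e\<bar>" for e
    define t where "t = Min (\<tau> ` G)"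
    have t_le: "t \<le> \<tau> e" if "e \<in> G" for e using that G by (simp add: t_def)
    obtain e2 where e2: "e2 \<in> G" "t = \<tau> e2"
    proof -
      have "t \<in> \<tau> ` G" unfolding t_def using G by (intro Min_in) auto
      then show ?thesis using that by blast
    qed
    have "\<tau> e \<ge> 0" for e
      unfolding \<tau>_def by (intro divide_nonneg_nonneg) auto
    then have t0: "t \<ge> 0" unfolding e2(2) by blast
    define x' where "x' e = x e + t * c e" for e
    have bounds: "of_int \<lfloor>x e\<rfloor> \<le> x' e \<and> x' e \<le> of_int \<lceil>x e\<rceil>" for e
    proof (cases "e \<in> G")
      case False
      then have "c e = 0" by (auto simp: G_def c_def)
      then show ?thesis by (simp add: x'_def)
    next
      case True
      then have ce: "c e \<noteq> 0" by (simp add: G_def)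
      have *: "t * \<bar>c e\<bar> \<le> (if c e > 0 then of_int \<lceil>x e\<rceil> - x e else x e - of_int \<lfloor>x e\<rfloor>)"
        using t_le[OF True] ce unfolding \<tau>_def by (subst (asm) pos_le_divide_eq) auto
      show ?thesis
      proof (cases "c e > 0")
        case True
        have "x e \<le> x' e" using True t0 by (simp add: x'_def)
        moreover have "x' e \<le> of_int \<lceil>x e\<rceil>" using * True by (simp add: x'_def)
        ultimately show ?thesis using of_int_floor_le[of "x e"] by linarith
      next
        case False
        then have "x' e \<le> x e" using t0 by (simp add: x'_def mult_nonneg_nonpos)
        moreover have "of_int \<lfloor>x e\<rfloor> \<le> x' e" using * False by (simp add: x'_def)
        ultimately show ?thesis using le_of_int_ceiling[of "x e"] by linarith
      qed
    qed
    have int2: "x' e2 \<in> \<int>"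
    proof -
      have "c e2 \<noteq> 0" using e2 by (simp add: G_def)
      then have "x' e2 = (if c e2 > 0 then of_int \<lceil>x e2\<rceil> else of_int \<lfloor>x e2\<rfloor>)"
        unfolding x'_def e2(2) \<tau>_def by (cases "c e2 > 0") simp_all
      then show ?thesis by (cases "c e2 > 0") simp_all
    qed
    have sub: "{e\<in>E. x' e \<notin> \<int>} \<subset> F"
    proof
      show "{e\<in>E. x' e \<notin> \<int>} \<subseteq> F" by (auto simp: F_def x'_def c_def)
      show "{e\<in>E. x' e \<notin> \<int>} \<noteq> F" using int2 e2 by (auto simp: G_def)
    qed
    have nx': "netflow E s d x' v = netflow E s d x v" for v
      unfolding x'_def netflow_add_scaled nc by simp
    have "\<exists>y. (\<forall>e\<in>E. y e \<in> \<int> \<and> of_int \<lfloor>x' e\<rfloor> \<le> y e \<and> y e \<le> of_int \<lceil>x' e\<rceil>) \<and>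
      (\<forall>v. netflow E s d y v = netflow E s d x' v)"
    proof (rule less.hyps[OF _ less.prems(1,2)])
      show "netflow E s d x' v \<in> \<int>" for v using less.prems(3) nx' by simp
      show "card {e \<in> E. x' e \<notin> \<int>} < card {e \<in> E. x e \<notin> \<int>}"
        using psubset_card_mono[OF fF sub] by (simp add: F_def)
    qed
    then obtain y where y: "\<forall>e\<in>E. y e \<in> \<int> \<and> of_int \<lfloor>x' e\<rfloor> \<le> y e \<and> y e \<le> of_int \<lceil>x' e\<rceil>"
      "\<forall>v. netflow E s d y v = netflow E s d x' v" by (elim exE conjE)
    have "y e \<in> \<int> \<and> of_int \<lfloor>x e\<rfloor> \<le> y e \<and> y e \<le> of_int \<lceil>x e\<rceil>" if "e \<in> E" for e
    proof -
      have "\<lfloor>x e\<rfloor> \<le> \<lfloor>x' e\<rfloor>" "\<lceil>x' e\<rceil> \<le> \<lceil>x e\<rceil>"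
        using bounds[of e] by (auto simp: le_floor_iff ceiling_le_iff)
      then have "(of_int \<lfloor>x e\<rfloor> :: real) \<le> of_int \<lfloor>x' e\<rfloor>" "(of_int \<lceil>x' e\<rceil> :: real) \<le> of_int \<lceil>x e\<rceil>"
        by simp_all
      moreover note bspec[OF y(1) that]
      ultimately show ?thesis by (meson order.trans)
    qed
    moreover have "\<forall>v. netflow E s d y v = netflow E s d x v"
      using y(2) nx' by simp
    ultimately show ?thesis by blast
  qed
qed

section \<open>Rounding a flow along the boundary of a cube\<close>

text \<open>The cube of radius r in the group Z^I. The group is represented inside
  \<open>int ^ 'n\<close> by the vectors that vanish off I, so that I may be any set of directions,
  even empty.\<close>

definition gbox :: "'n set \<Rightarrow> int \<Rightarrow> (int ^ 'n) set" where
  "gbox I r = {v. (\<forall>i\<in>I. \<bar>v $ i\<bar> \<le> r) \<and> (\<forall>i. i \<notin> I \<longrightarrow> v $ i = 0)}"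

definition nbrs :: "'n set \<Rightarrow> (int ^ 'n) set" where
  "nbrs I = (\<lambda>i. axis i 1) ` I \<union> (\<lambda>i. axis i (-1)) ` I"

lemma finite_gbox: "finite (gbox I r :: (int ^ 'n) set)"
proof -
  have "gbox I r \<subseteq> vec_lambda ` (UNIV \<rightarrow>\<^sub>E {-\<bar>r\<bar>..\<bar>r\<bar>})"
  proof
    fix v :: "int ^ 'n" assume v: "v \<in> gbox I r"
    have "\<bar>v $ i\<bar> \<le> \<bar>r\<bar>" for i
      using v by (cases "i \<in> I") (force simp: gbox_def)+
    then have "(\<lambda>i. v $ i) \<in> UNIV \<rightarrow>\<^sub>E {-\<bar>r\<bar>..\<bar>r\<bar>}"
      by (auto simp: abs_le_iff minus_le_iff)
    moreover have "v = vec_lambda (\<lambda>i. v $ i)" by simp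
    ultimately show "v \<in> vec_lambda ` (UNIV \<rightarrow>\<^sub>E {-\<bar>r\<bar>..\<bar>r\<bar>})" by blast
  qed
  then show ?thesis
    by (rule finite_subset) (intro finite_imageI finite_PiE; simp)
qed

lemma gbox_0 [simp]: "0 \<in> gbox I r \<longleftrightarrow> I = {} \<or> 0 \<le> r"
  by (auto simp: gbox_def)

lemma gbox_mono: "r \<le> r' \<Longrightarrow> gbox I r \<subseteq> gbox I r'"
  by (force simp: gbox_def)

lemma gbox_uminus [simp]: "- v \<in> gbox I r \<longleftrightarrow> v \<in> gbox I r"
  by (auto simp: gbox_def)

lemma gbox_add: "u \<in> gbox I r \<Longrightarrow> v \<in> gbox I r' \<Longrightarrow> u + v \<in> gbox I (r + r')"
  unfolding gbox_def by (fastforce intro: order.trans[OF abs_triangle_ineq] add_mono)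

lemma gbox_diff: "u \<in> gbox I r \<Longrightarrow> v \<in> gbox I r' \<Longrightarrow> u - v \<in> gbox I (r + r')"
  using gbox_add[of u I r "- v" r'] by simp

lemma finite_nbrs: "finite (nbrs I)"
  by (simp add: nbrs_def)

lemma nbrs_uminus [simp]: "- a \<in> nbrs (I :: 'n::finite set) \<longleftrightarrow> a \<in> nbrs I"
proof -
  have "- a \<in> nbrs I" if "a \<in> nbrs I" for a :: "int ^ 'n"
    using that by (auto simp: nbrs_def axis_def vec_eq_iff image_iff)
  from this[of a] this[of "- a"] show ?thesis by auto
qed

lemma nbrs_gbox: "a \<in> nbrs I \<Longrightarrow> a \<in> gbox I 1"
  by (auto simp: nbrs_def gbox_def axis_def)

lemma nbrs_nonzero: "a \<in> nbrs I \<Longrightarrow> a \<noteq> 0"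
  by (auto simp: nbrs_def axis_eq_0_iff)

text \<open>Discrete divergence theorem: an edge inside V is counted from both of its ends with
  opposite signs, so only the edges leaving V remain.\<close>

lemma sum_boundary:
  fixes f :: "'v::ab_group_add \<Rightarrow> 'v \<Rightarrow> real"
  assumes "finite V" "finite N" "\<And>a. a \<in> N \<Longrightarrow> - a \<in> N"
    and anti: "\<And>v a. a \<in> N \<Longrightarrow> f (v + a) (- a) = - f v a"
  shows "(\<Sum>v\<in>V. \<Sum>a\<in>N. f v a) = (\<Sum>(v, a) | v \<in> V \<and> a \<in> N \<and> v + a \<notin> V. f v a)"
proof -
  define A where "A = {(v, a). v \<in> V \<and> a \<in> N \<and> v + a \<in> V}"
  define B where "B = {(v, a). v \<in> V \<and> a \<in> N \<and> v + a \<notin> V}"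
  have fin: "finite (V \<times> N)" using assms by simp
  have AB: "V \<times> N = A \<union> B" "A \<inter> B = {}" by (auto simp: A_def B_def)
  have fA: "finite A" "finite B" using fin AB by (metis finite_Un)+
  have "(\<Sum>(v, a)\<in>A. f v a) = (\<Sum>(v, a)\<in>A. f (v + a) (- a))"
    by (rule sum.reindex_bij_witness[of _ "\<lambda>(v, a). (v + a, - a)" "\<lambda>(v, a). (v + a, - a)"])
       (use assms(3) in \<open>auto simp: A_def\<close>)
  also have "\<dots> = - (\<Sum>(v, a)\<in>A. f v a)"
    by (auto simp: sum_negf[symmetric] A_def anti intro!: sum.cong)
  finally have "(\<Sum>(v, a)\<in>A. f v a) = 0" by simp
  moreover have "(\<Sum>v\<in>V. \<Sum>a\<in>N. f v a) = (\<Sum>(v, a)\<in>A. f v a) + (\<Sum>(v, a)\<in>B. f v a)"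
    unfolding sum.cartesian_product AB(1) using fA AB(2) by (rule sum.union_disjoint)
  ultimately show ?thesis by (simp add: B_def)
qed

section \<open>Pushing fractional parts along a rooted tree\<close>

text \<open>What node b passes to its parent: the fractional part of its own value plus all that its
  children pass to it. The recursion runs over a number n of rounds instead of the tree, which makes
  the result a finite combination of additions and fractional parts, hence Borel in u.\<close>

primrec treesum :: "'b set \<Rightarrow> 'b \<Rightarrow> ('b \<Rightarrow> 'b) \<Rightarrow> ('b \<Rightarrow> real) \<Rightarrow> nat \<Rightarrow> 'b \<Rightarrow> real" where
  "treesum B z p u 0 = (\<lambda>b. 0)"
| "treesum B z p u (Suc n) = (\<lambda>b. frac (u b + (\<Sum>c | c \<in> B \<and> c \<noteq> z \<and> p c = b. treesum B z p u n c)))"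

lemma treesum_bounds: "0 \<le> treesum B z p u n b \<and> treesum B z p u n b < 1"
  by (cases n) (auto simp: frac_lt_1)

text \<open>A node waits only for its children, whose rank is larger. Nodes of the top rank R are
  final after one round, those of rank k after R - k + 1 rounds.\<close>

lemma treesum_stable:
  assumes par: "\<And>b. b \<in> B \<Longrightarrow> b \<noteq> z \<Longrightarrow> p b \<in> B \<and> rk (p b) < rk b"
    and R: "\<And>b. b \<in> B \<Longrightarrow> rk b \<le> R"
  shows "b \<in> B \<Longrightarrow> R - rk b < n \<Longrightarrow> treesum B z p u n b = treesum B z p u (Suc n) b"
proof (induction n arbitrary: b)
  case 0
  then show ?case by simp
next
  case (Suc n)
  have "treesum B z p u n c = treesum B z p u (Suc n) c" if "c \<in> B" "c \<noteq> z" "p c = b" for c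
  proof (rule Suc.IH)
    have "rk b < rk c" "rk c \<le> R" using par[OF that(1,2)] that R by auto
    then show "R - rk c < n" using Suc.prems(2) by linarith
  qed fact
  then have "(\<Sum>c | c \<in> B \<and> c \<noteq> z \<and> p c = b. treesum B z p u n c) =
      (\<Sum>c | c \<in> B \<and> c \<noteq> z \<and> p c = b. treesum B z p u (Suc n) c)"
    by (intro sum.cong) auto
  then show ?case by simp
qed

text \<open>Own value plus receipts minus what is passed on; once the rounds are stationary, this is
  the floor of value plus receipts.\<close>

definition treeround :: "'b set \<Rightarrow> 'b \<Rightarrow> ('b \<Rightarrow> 'b) \<Rightarrow> nat \<Rightarrow> ('b \<Rightarrow> real) \<Rightarrow> 'b \<Rightarrow> real" where
  "treeround B z p n u b =
     u b + (\<Sum>c | c \<in> B \<and> c \<noteq> z \<and> p c = b. treesum B z p u n c) - treesum B z p u n b"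

lemma treeround_Ints:
  assumes "\<And>b. b \<in> B \<Longrightarrow> b \<noteq> z \<Longrightarrow> p b \<in> B \<and> rk (p b) < rk b"
    and "\<And>b. b \<in> B \<Longrightarrow> rk b \<le> R" and "b \<in> B"
  shows "treeround B z p (Suc R) u b \<in> \<int>"
proof -
  have "treesum B z p u (Suc R) b = treesum B z p u (Suc (Suc R)) b"
    by (rule treesum_stable[where rk = rk and R = R]) (use assms in auto)
  then have "treeround B z p (Suc R) u b = of_int \<lfloor>u b + (\<Sum>c | c \<in> B \<and> c \<noteq> z \<and> p c = b. treesum B z p u (Suc R) c)\<rfloor>"
    unfolding treeround_def by (simp add: frac_def)
  then show ?thesis by simp
qed

text \<open>What the root would pass on is the sum of u minus the sum of the rounded values, so it
  is an integer, and it lies in [0, 1).\<close>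

lemma treesum_root:
  assumes "finite B" "z \<in> B" and par: "\<And>b. b \<in> B \<Longrightarrow> b \<noteq> z \<Longrightarrow> p b \<in> B \<and> rk (p b) < rk b"
    and "\<And>b. b \<in> B \<Longrightarrow> rk b \<le> R" and "(\<Sum>b\<in>B. u b) \<in> \<int>"
  shows "treesum B z p u (Suc R) z = 0"
proof -
  let ?s = "treesum B z p u (Suc R)"
  have "(\<Sum>b\<in>B. treeround B z p (Suc R) u b) \<in> \<int>"
    by (intro Ints_sum treeround_Ints[where rk = rk]) (use assms in auto)
  moreover have "(\<Sum>b\<in>B. \<Sum>c | c \<in> B \<and> c \<noteq> z \<and> p c = b. ?s c) = (\<Sum>c\<in>B - {z}. ?s c)"
  proof -
    have "(\<Sum>b\<in>B. \<Sum>c | c \<in> B - {z} \<and> p c = b. ?s c) = (\<Sum>c\<in>B - {z}. ?s c)"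
      by (rule sum.group) (use assms par in auto)
    then show ?thesis by (simp add: conj_assoc)
  qed
  moreover have "(\<Sum>c\<in>B. ?s c) = ?s z + (\<Sum>c\<in>B - {z}. ?s c)"
    using assms by (simp add: sum.remove)
  ultimately have "(\<Sum>b\<in>B. u b) - ?s z \<in> \<int>"
    unfolding treeround_def by (simp add: sum.distrib sum_subtractf del: treesum.simps)
  then have "?s z \<in> \<int>" using assms(5) by (metis Ints_diff diff_diff_eq2 add_diff_cancel_left')
  then show ?thesis
    using treesum_bounds[of B z p u "Suc R" z] by (metis Ints_nonzero_abs_less1 abs_of_nonneg)
qed

text \<open>The unit circulation v -> v + b -> v + a + b -> v + a -> v as an antisymmetric function
  of a vertex and a direction: the first four terms are its edges, the other four the same edges
  reversed.\<close>

definition plaquette :: "int ^ 'n \<Rightarrow> int ^ 'n \<Rightarrow> int ^ 'n \<Rightarrow> int ^ 'n \<Rightarrow> int ^ 'n \<Rightarrow> real" where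
  "plaquette v a b u c =
     of_bool (u = v + a \<and> c = - a) + of_bool (u = v \<and> c = b) +
     of_bool (u = v + b \<and> c = a) + of_bool (u = v + a + b \<and> c = - b) -
     (of_bool (u = v \<and> c = a) + of_bool (u = v + b \<and> c = - b) +
      of_bool (u = v + a + b \<and> c = - a) + of_bool (u = v + a \<and> c = b))"

lemma plaquette_anti: "plaquette v a b (u + c) (- c) = - plaquette v a b u c"
proof -
  have e: "u + c = x \<and> - c = y \<longleftrightarrow> u = x + y \<and> c = - y" for x y by auto
  show ?thesis unfolding plaquette_def e by (simp add: algebra_simps)
qed

lemma plaquette_div:
  assumes "a \<in> nbrs I" "b \<in> nbrs I"
  shows "(\<Sum>c\<in>nbrs I. plaquette v a b u c) = 0"
proof -
  have *: "(\<Sum>c\<in>nbrs I. of_bool (u = x \<and> c = y)) = (of_bool (u = x) :: real)" if "y \<in> nbrs I" for x y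
    using that finite_nbrs[of I] by (cases "u = x") (simp_all add: of_bool_def sum.delta)
  show ?thesis
    unfolding plaquette_def sum.distrib sum_subtractf by (simp only: * assms nbrs_uminus)
qed

lemma plaquette_nonzero:
  "plaquette v a b u c \<noteq> 0 \<Longrightarrow> u \<in> {v, v + a, v + b, v + a + b} \<and> c \<in> {a, -a, b, -b}"
proof (rule ccontr)
  assume nz: "plaquette v a b u c \<noteq> 0" and "\<not> (u \<in> {v, v + a, v + b, v + a + b} \<and> c \<in> {a, -a, b, -b})"
  then have "\<not> (u = v + a \<and> c = - a)" "\<not> (u = v \<and> c = b)" "\<not> (u = v + b \<and> c = a)"
    "\<not> (u = v + a + b \<and> c = - b)" "\<not> (u = v \<and> c = a)" "\<not> (u = v + b \<and> c = - b)"
    "\<not> (u = v + a + b \<and> c = - a)" "\<not> (u = v + a \<and> c = b)" by blast+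
  then have "plaquette v a b u c = 0" unfolding plaquette_def by (simp only: of_bool_def if_False)
  with nz show False ..
qed

lemma plaquette_bound: "\<bar>plaquette v a b u c\<bar> \<le> 8"
proof -
  have "0 \<le> (of_bool P :: real) \<and> of_bool P \<le> (1 :: real)" for P by simp
  note * = this[of "u = v + a \<and> c = - a"] this[of "u = v \<and> c = b"] this[of "u = v + b \<and> c = a"]
    this[of "u = v + a + b \<and> c = - b"] this[of "u = v \<and> c = a"] this[of "u = v + b \<and> c = - b"]
    this[of "u = v + a + b \<and> c = - a"] this[of "u = v + a \<and> c = b"]
  show ?thesis unfolding plaquette_def using * by linarith
qed

section \<open>The edges leaving a cube, arranged as a tree\<close>

definition boundary :: "'n set \<Rightarrow> int \<Rightarrow> ((int ^ 'n) \<times> (int ^ 'n)) set" where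
  "boundary I r = {(v, a). v \<in> gbox I r \<and> a \<in> nbrs I \<and> v + a \<notin> gbox I r}"

definition boundary_root :: "'n set \<Rightarrow> int \<Rightarrow> (int ^ 'n) \<times> (int ^ 'n)" where
  "boundary_root I r = ((\<chi> i. if i \<in> I then r else 0), axis (SOME i. i \<in> I) 1)"

text \<open>A potential for the walk to the root: a step within a face raises one coordinate and
  keeps the direction, so the first summand drops; a turn from a downward to an upward direction
  drops the second; the last turn, at the top corner, drops the third.\<close>

definition boundary_rank :: "'n set \<Rightarrow> int \<Rightarrow> (int ^ 'n) \<times> (int ^ 'n) \<Rightarrow> nat" where
  "boundary_rank I r = (\<lambda>(v, a). nat (3 * (\<Sum>j\<in>I. r - v $ j)) + (if \<exists>i. a $ i < 0 then 2 else 0) +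
     (if a = axis (SOME i. i \<in> I) 1 then 0 else 1))"

text \<open>Crossing one square with sides a and b from the outgoing edge (v, a): either parallel to
  itself, or, if v + b is outside the cube, round the corner to the other outgoing edge at
  v.\<close>

definition boundary_step :: "'n set \<Rightarrow> int \<Rightarrow> (int ^ 'n) \<times> (int ^ 'n) \<Rightarrow> int ^ 'n \<Rightarrow> (int ^ 'n) \<times> (int ^ 'n)" where
  "boundary_step I r = (\<lambda>(v, a) b. if v + b \<in> gbox I r then (v + b, a) else (v, b))"

lemma finite_boundary: "finite (boundary I r)"
  by (rule finite_subset[of _ "gbox I r \<times> nbrs I"]) (auto simp: boundary_def finite_gbox finite_nbrs)

lemma bdryE:
  assumes "(v, a) \<in> boundary I r"
  obtains i where "i \<in> I" "v \<in> gbox I r" "a = axis i 1 \<and> v $ i = r \<or> a = axis i (-1) \<and> v $ i = - r"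
proof -
  have v: "v \<in> gbox I r" and a: "a \<in> nbrs I" and va: "v + a \<notin> gbox I r"
    using assms by (auto simp: boundary_def)
  obtain i where i: "i \<in> I" "a = axis i 1 \<or> a = axis i (-1)"
    using a by (auto simp: nbrs_def)
  have "\<not> \<bar>v $ i + a $ i\<bar> \<le> r"
  proof
    assume "\<bar>v $ i + a $ i\<bar> \<le> r"
    then have "v + a \<in> gbox I r"
      using v i unfolding gbox_def by (auto simp: axis_def)
    with va show False ..
  qed
  moreover have "\<bar>v $ i\<bar> \<le> r" using v i by (auto simp: gbox_def)
  ultimately have "a = axis i 1 \<and> v $ i = r \<or> a = axis i (-1) \<and> v $ i = - r"
    using i(2) by (auto simp: axis_def)
  then show ?thesis using that i v by blast
qed

lemma bdryI:
  assumes "i \<in> I" "v \<in> gbox I r" "a = axis i 1 \<and> v $ i = r \<or> a = axis i (-1) \<and> v $ i = - r"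
  shows "(v, a) \<in> boundary I r"
proof -
  have "v + a \<notin> gbox I r" using assms by (auto simp: gbox_def axis_def intro!: bexI[of _ i])
  then show ?thesis using assms by (auto simp: boundary_def nbrs_def)
qed

lemma boundary_root_in_boundary:
  assumes "I \<noteq> {}" "0 \<le> r"
  shows "boundary_root I r \<in> boundary I r"
  unfolding boundary_root_def
proof (rule bdryI)
  show "(SOME i. i \<in> I) \<in> I" using assms by (simp add: some_in_eq)
  then show "axis (SOME i. i \<in> I) 1 = axis (SOME i. i \<in> I) 1 \<and>
      (\<chi> i. if i \<in> I then r else 0) $ (SOME i. i \<in> I) = r \<or>
    axis (SOME i. i \<in> I) 1 = axis (SOME i. i \<in> I) (- 1) \<and>
      (\<chi> i. if i \<in> I then r else 0) $ (SOME i. i \<in> I) = - r" by simp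
  show "(\<chi> i. if i \<in> I then r else 0) \<in> gbox I r" using assms by (auto simp: gbox_def)
qed

lemma gbox_add_axis:
  assumes "v \<in> gbox I r" "j \<in> I" "v $ j < r" "0 \<le> r"
  shows "v + axis j 1 \<in> gbox I r"
  using assms unfolding gbox_def by (auto simp: axis_def)

text \<open>Moving one coordinate up inside a face, and then around an edge of the cube, leads to the
  root in a way that always crosses a single plaquette.\<close>

lemma boundary_step_exists:
  assumes I: "card I \<ge> 2" and r: "r \<ge> 1" and va: "(v, a) \<in> boundary I r" "(v, a) \<noteq> boundary_root I r"
  shows "\<exists>b\<in>nbrs I. boundary_step I r (v, a) b \<in> boundary I r \<and> boundary_rank I r (boundary_step I r (v, a) b) < boundary_rank I r (v, a) \<and>
     v + a + b \<notin> gbox I r \<and> (\<forall>i. a $ i \<noteq> 0 \<longrightarrow> b $ i = 0)"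
proof -
  define i0 where "i0 = (SOME i. i \<in> I)"
  have fI: "finite I" by simp
  have i0: "i0 \<in> I" unfolding i0_def using I by (subst some_in_eq) auto
  obtain i where i: "i \<in> I" "v \<in> gbox I r" "a = axis i 1 \<and> v $ i = r \<or> a = axis i (-1) \<and> v $ i = - r"
    using va(1) by (rule bdryE)
  have vle: "v $ j \<le> r" if "j \<in> I" for j using i(2) that by (auto simp: gbox_def)
  have ai: "a $ j \<noteq> 0 \<longleftrightarrow> j = i" for j using i(3) by (auto simp: axis_def split: if_splits)
  have out: "v + a + axis j 1 \<notin> gbox I r" if "j \<noteq> i" for j
    using i that r by (auto simp: gbox_def axis_def intro!: bexI[of _ i])
  \<comment> \<open>\<open>face\<close>: another coordinate is below r and can be raised.
    \<open>down\<close>: all others are at r but the edge points down, and it turns to some upward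
    direction j other than i, which exists since card I is at least 2. \<open>top\<close>: at the
    top corner the direction becomes that of the root.\<close>
  consider (face) j where "j \<in> I" "j \<noteq> i" "v $ j < r"
    | (down) j where "j \<in> I" "j \<noteq> i" "v $ j = r" "a = axis i (-1)" "v $ i = - r"
    | (top) "\<forall>j\<in>I. v $ j = r" "a = axis i 1"
  proof -
    obtain j where j: "j \<in> I" "j \<noteq> i"
    proof -
      have "card (I - {i}) \<noteq> 0" using I i(1) by simp
      then have "I - {i} \<noteq> {}" by auto
      then show ?thesis using that by blast
    qed
    show ?thesis
    proof (cases "\<exists>j\<in>I. j \<noteq> i \<and> v $ j < r")
      case False
      then have "v $ j = r" if "j \<in> I" "j \<noteq> i" for j using vle that by force
      then show ?thesis using i(3) that(2)[of j] that(3) j by metis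
    qed (use that in blast)
  qed
  then show ?thesis
  proof cases
    case face
    have "v + axis j 1 \<in> gbox I r" using face i r by (intro gbox_add_axis) auto
    then have st: "boundary_step I r (v, a) (axis j 1) = (v + axis j 1, a)" by (simp add: boundary_step_def)
    have "(v + axis j 1, a) \<in> boundary I r"
      by (rule bdryI[OF i(1) \<open>v + axis j 1 \<in> gbox I r\<close>]) (use i face in \<open>auto simp: axis_def\<close>)
    moreover have "boundary_rank I r (v + axis j 1, a) < boundary_rank I r (v, a)"
    proof -
      have "(\<Sum>k\<in>I. r - (v + axis j 1) $ k) = (\<Sum>k\<in>I. (r - v $ k) - (if k = j then 1 else 0))"
        by (intro sum.cong) (auto simp: axis_def)
      also have "\<dots> = (\<Sum>k\<in>I. r - v $ k) - 1"
        using face by (simp add: sum_subtractf)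
      finally have "(\<Sum>k\<in>I. r - (v + axis j 1) $ k) = (\<Sum>k\<in>I. r - v $ k) - 1" .
      moreover have "(\<Sum>k\<in>I. r - v $ k) > 0"
        using face vle by (intro sum_pos2[of _ j]) auto
      ultimately show ?thesis by (simp add: boundary_rank_def)
    qed
    moreover have "axis j 1 \<in> nbrs I" using face by (auto simp: nbrs_def)
    ultimately show ?thesis using face ai out[of j] st
      by (intro bexI[of _ "axis j 1"]) (auto simp: axis_def)
  next
    case down
    have "v + axis j 1 \<notin> gbox I r" using down by (auto simp: gbox_def axis_def intro!: bexI[of _ j])
    then have st: "boundary_step I r (v, a) (axis j 1) = (v, axis j 1)" by (simp add: boundary_step_def)
    have "(v, axis j 1) \<in> boundary I r"
      by (rule bdryI[OF down(1) i(2)]) (use down in auto)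
    moreover have "boundary_rank I r (v, axis j 1) < boundary_rank I r (v, a)"
    proof -
      have "\<exists>k. a $ k < 0" using down by (intro exI[of _ i]) (simp add: axis_def)
      moreover have "a \<noteq> axis (SOME i. i \<in> I) 1"
      proof
        assume *: "a = axis (SOME i. i \<in> I) 1"
        obtain k where "a $ k < 0" using \<open>\<exists>k. a $ k < 0\<close> by blast
        then show False unfolding * by (auto simp: axis_def split: if_splits)
      qed
      moreover have "\<not> (\<exists>k. axis j (1::int) $ k < 0)" by (auto simp: axis_def)
      ultimately show ?thesis by (simp add: boundary_rank_def)
    qed
    moreover have "axis j 1 \<in> nbrs I" using down by (auto simp: nbrs_def)
    ultimately show ?thesis using down ai out[of j] st
      by (intro bexI[of _ "axis j 1"]) (auto simp: axis_def)
  next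
    case top
    have "v = (\<chi> i. if i \<in> I then r else 0)"
      using top i(2) by (auto simp: vec_eq_iff gbox_def)
    then have ne: "i \<noteq> i0" using va(2) top unfolding boundary_root_def i0_def by auto
    have "v + axis i0 1 \<notin> gbox I r" using top i0 by (auto simp: gbox_def axis_def intro!: bexI[of _ i0])
    then have st: "boundary_step I r (v, a) (axis i0 1) = (v, axis i0 1)" by (simp add: boundary_step_def)
    have "(v, axis i0 1) \<in> boundary I r"
      by (rule bdryI[OF i0 i(2)]) (use top i0 in auto)
    moreover have "boundary_rank I r (v, axis i0 1) < boundary_rank I r (v, a)"
    proof -
      have "a \<noteq> axis i0 1" using top ne by (simp add: axis_eq_axis)
      moreover have "\<not> (\<exists>k. axis j (1::int) $ k < 0)" for j :: 'a by (auto simp: axis_def)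
      ultimately show ?thesis using top by (simp add: boundary_rank_def i0_def)
    qed
    moreover have "axis i0 1 \<in> nbrs I" using i0 by (auto simp: nbrs_def)
    ultimately show ?thesis using ne ai out[of i0] st
      by (intro bexI[of _ "axis i0 1"]) (auto simp: axis_def)
  qed
qed

definition boundary_dir :: "'n set \<Rightarrow> int \<Rightarrow> (int ^ 'n) \<times> (int ^ 'n) \<Rightarrow> int ^ 'n" where
  "boundary_dir I r = (\<lambda>(v, a). SOME b. b \<in> nbrs I \<and> boundary_step I r (v, a) b \<in> boundary I r \<and>
     boundary_rank I r (boundary_step I r (v, a) b) < boundary_rank I r (v, a) \<and>
     v + a + b \<notin> gbox I r \<and> (\<forall>i. a $ i \<noteq> 0 \<longrightarrow> b $ i = 0))"

definition boundary_parent :: "'n set \<Rightarrow> int \<Rightarrow> (int ^ 'n) \<times> (int ^ 'n) \<Rightarrow> (int ^ 'n) \<times> (int ^ 'n)" where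
  "boundary_parent I r \<beta> = boundary_step I r \<beta> (boundary_dir I r \<beta>)"

text \<open>One round more than the largest rank, so the tree sums are final at every edge.\<close>

definition boundary_value :: "'n set \<Rightarrow> int \<Rightarrow> ((int ^ 'n) \<times> (int ^ 'n) \<Rightarrow> real) \<Rightarrow> (int ^ 'n) \<times> (int ^ 'n) \<Rightarrow> real" where
  "boundary_value I r = treeround (boundary I r) (boundary_root I r) (boundary_parent I r) (Suc (Max (boundary_rank I r ` boundary I r)))"

lemma boundary_dir_props:
  assumes "card I \<ge> 2" "r \<ge> 1" "(v, a) \<in> boundary I r" "(v, a) \<noteq> boundary_root I r"
  shows "boundary_dir I r (v, a) \<in> nbrs I" "boundary_parent I r (v, a) \<in> boundary I r"
    "boundary_rank I r (boundary_parent I r (v, a)) < boundary_rank I r (v, a)"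
    "v + a + boundary_dir I r (v, a) \<notin> gbox I r" "\<And>i. a $ i \<noteq> 0 \<Longrightarrow> boundary_dir I r (v, a) $ i = 0"
proof -
  have "\<exists>b. b \<in> nbrs I \<and> boundary_step I r (v, a) b \<in> boundary I r \<and>
     boundary_rank I r (boundary_step I r (v, a) b) < boundary_rank I r (v, a) \<and>
     v + a + b \<notin> gbox I r \<and> (\<forall>i. a $ i \<noteq> 0 \<longrightarrow> b $ i = 0)"
    using boundary_step_exists[OF assms] by blast
  from someI_ex[OF this]
  show "boundary_dir I r (v, a) \<in> nbrs I" "boundary_parent I r (v, a) \<in> boundary I r"
    "boundary_rank I r (boundary_parent I r (v, a)) < boundary_rank I r (v, a)"
    "v + a + boundary_dir I r (v, a) \<notin> gbox I r" "\<And>i. a $ i \<noteq> 0 \<Longrightarrow> boundary_dir I r (v, a) $ i = 0"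
    unfolding boundary_parent_def by (simp_all add: boundary_dir_def)
qed

text \<open>Both v + a and v + a + b lie outside the cube, so just two sides of the square cross its
  boundary: (v, a) and its parent. Adding the plaquette moves one unit of outflow from the one to
  the other, with no change elsewhere on the boundary.\<close>

lemma plaquette_boundary:
  assumes I: "card I \<ge> 2" "r \<ge> 1" and va: "(v, a) \<in> boundary I r" "(v, a) \<noteq> boundary_root I r"
    and uc: "(u, c) \<in> boundary I r"
  shows "plaquette v a (boundary_dir I r (v, a)) u c = of_bool (boundary_parent I r (v, a) = (u, c)) - of_bool ((v, a) = (u, c))"
proof -
  define b where "b = boundary_dir I r (v, a)"
  note b = boundary_dir_props[OF I va, folded b_def]
  have v: "v \<in> gbox I r" "v + a \<notin> gbox I r" using va by (auto simp: boundary_def)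
  have u: "u \<in> gbox I r" "u + c \<notin> gbox I r" using uc by (auto simp: boundary_def)
  have f: "\<not> (u = v + a \<and> c = - a)" "\<not> (u = v + a + b \<and> c = - b)" "\<not> (u = v + b \<and> c = - b)"
    "\<not> (u = v + a + b \<and> c = - a)" "\<not> (u = v + a \<and> c = b)"
    using u v b(4) by auto
  have p: "plaquette v a b u c = of_bool (u = v \<and> c = b) + of_bool (u = v + b \<and> c = a) - of_bool (u = v \<and> c = a)"
    unfolding plaquette_def by (simp add: f)
  show ?thesis
  proof (cases "v + b \<in> gbox I r")
    case True
    then have "boundary_parent I r (v, a) = (v + b, a)" unfolding boundary_parent_def by (simp add: boundary_step_def b_def)
    moreover have "\<not> (u = v \<and> c = b)" using True u by auto
    ultimately show ?thesis unfolding b_def[symmetric] p by (auto simp: of_bool_def)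
  next
    case False
    then have "boundary_parent I r (v, a) = (v, b)" unfolding boundary_parent_def by (simp add: boundary_step_def b_def)
    moreover have "\<not> (u = v + b \<and> c = a)" using False u by auto
    ultimately show ?thesis unfolding b_def[symmetric] p by (auto simp: of_bool_def)
  qed
qed

text \<open>Each fraction pushed in the tree is realised by a multiple of a plaquette, which has no
  divergence. The flow out of the cube is a sum of integral divergences, so nothing remains at the
  root. The correction lives on the vertices of maximum norm r or r + 1, and its bound does not grow
  with r, since only plaquettes within distance 2 of a point reach it. On the boundary the new
  values are a definite function of the old ones, which is what keeps them measurable.\<close>

lemma cube_correction:
  fixes f :: "int ^ 'n \<Rightarrow> int ^ 'n \<Rightarrow> real"
  assumes I: "card I \<ge> 2" "r \<ge> 1"
    and anti: "\<And>v a. a \<in> nbrs I \<Longrightarrow> f (v + a) (- a) = - f v a"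
    and div: "\<And>v. v \<in> gbox I r \<Longrightarrow> (\<Sum>a\<in>nbrs I. f v a) \<in> \<int>"
  shows "\<exists>\<delta>. (\<forall>u c. \<delta> (u + c) (- c) = - \<delta> u c) \<and> (\<forall>u. (\<Sum>c\<in>nbrs I. \<delta> u c) = 0) \<and>
    (\<forall>u c. \<delta> u c \<noteq> 0 \<longrightarrow> u \<in> gbox I (r + 1) \<and> u \<notin> gbox I (r - 1)) \<and>
    (\<forall>u c. \<bar>\<delta> u c\<bar> \<le> 8 * real (card (gbox I 2 \<times> nbrs I))) \<and>
    (\<forall>(u, c)\<in>boundary I r. f u c + \<delta> u c = boundary_value I r (\<lambda>(v, a). f v a) (u, c) \<and>
       boundary_value I r (\<lambda>(v, a). f v a) (u, c) \<in> \<int>)"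
proof -
  define B where "B = boundary I r"
  define z where "z = boundary_root I r"
  define U where "U = (\<lambda>(v, a). f v a)"
  define R where "R = Max (boundary_rank I r ` B)"
  define s where "s = treesum B z (boundary_parent I r) U (Suc R)"
  define \<delta> where "\<delta> u c = (\<Sum>(v, a)\<in>B - {z}. s (v, a) * plaquette v a (boundary_dir I r (v, a)) u c)" for u c
  have fB: "finite B" by (simp add: B_def finite_boundary)
  have "I \<noteq> {}" using I by auto
  then have zB: "z \<in> B" using I by (auto simp: z_def B_def boundary_root_in_boundary)
  have par: "boundary_parent I r b \<in> B \<and> boundary_rank I r (boundary_parent I r b) < boundary_rank I r b" if "b \<in> B" "b \<noteq> z" for b
    using that boundary_dir_props(2,3)[OF I, of "fst b" "snd b"] by (auto simp: B_def z_def)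
  have R: "boundary_rank I r b \<le> R" if "b \<in> B" for b using that fB by (simp add: R_def)
  have "(\<Sum>b\<in>B. U b) = (\<Sum>v\<in>gbox I r. \<Sum>a\<in>nbrs I. f v a)"
    unfolding U_def B_def boundary_def
    by (rule sum_boundary[symmetric]) (auto simp: finite_gbox finite_nbrs anti)
  then have sumU: "(\<Sum>b\<in>B. U b) \<in> \<int>" using div by (auto intro: Ints_sum)
  have s0: "s z = 0"
    unfolding s_def by (rule treesum_root[OF fB zB, where rk = "boundary_rank I r", OF par R sumU])
  have s01: "0 \<le> s b \<and> s b < 1" for b unfolding s_def by (rule treesum_bounds)
  have supp: "u \<in> {v, v + a, v + boundary_dir I r (v, a), v + a + boundary_dir I r (v, a)}" "c \<in> nbrs I"
    if "plaquette v a (boundary_dir I r (v, a)) u c \<noteq> 0" "(v, a) \<in> B - {z}" for v a u c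
  proof -
    have "a \<in> nbrs I" "boundary_dir I r (v, a) \<in> nbrs I"
      using that(2) boundary_dir_props[OF I, of v a] by (auto simp: B_def boundary_def z_def)
    then show "u \<in> {v, v + a, v + boundary_dir I r (v, a), v + a + boundary_dir I r (v, a)}" "c \<in> nbrs I"
      using plaquette_nonzero[OF that(1)] by auto
  qed
  have near: "u \<in> gbox I (r + 1) \<and> u \<notin> gbox I (r - 1) \<and> u - v \<in> gbox I 2"
    if "plaquette v a (boundary_dir I r (v, a)) u c \<noteq> 0" "(v, a) \<in> B - {z}" for v a u c
  proof -
    define b where "b = boundary_dir I r (v, a)"
    have va: "(v, a) \<in> boundary I r" "(v, a) \<noteq> boundary_root I r" using that by (auto simp: B_def z_def)
    note b = boundary_dir_props[OF I va, folded b_def]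
    have u: "u \<in> {v, v + a, v + b, v + a + b}" using supp(1)[OF that] by (simp add: b_def)
    obtain i where i: "i \<in> I" "v \<in> gbox I r" "a = axis i 1 \<and> v $ i = r \<or> a = axis i (-1) \<and> v $ i = - r"
      using va(1) by (rule bdryE)
    \<comment> \<open>b is perpendicular to a, so all corners of the square keep the absolute value
      of their i-th coordinate at r or more; this is what excludes the cube of radius r - 1.\<close>
    have bi: "b $ i = 0" using i(3) by (intro b(5)) (auto simp: axis_def)
    have b1: "b \<in> gbox I 1" by (rule nbrs_gbox[OF b(1)])
    have a1: "a \<in> gbox I 1" using va by (auto simp: boundary_def intro: nbrs_gbox)
    have aj: "a $ j = 0" if "j \<noteq> i" for j using i(3) that by (auto simp: axis_def)
    have "u \<notin> gbox I (r - 1)"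
    proof
      assume "u \<in> gbox I (r - 1)"
      then have "\<bar>u $ i\<bar> \<le> r - 1" using i by (auto simp: gbox_def)
      then show False using u i(3) bi I by (auto simp: axis_def)
    qed
    moreover have "u - v \<in> gbox I 2"
    proof -
      have "u - v \<in> {0, a, b, a + b}" using u by auto
      then show ?thesis
        using a1 b1 gbox_add[OF a1 b1] gbox_mono[of 1 2 I] by auto
    qed
    moreover have "u \<in> gbox I (r + 1)"
    proof -
      have "\<bar>u $ j\<bar> \<le> r + 1" if "j \<in> I" for j
      proof -
        have "\<bar>v $ j\<bar> \<le> r" "\<bar>a $ j\<bar> \<le> 1" "\<bar>b $ j\<bar> \<le> 1" using i(2) a1 b1 that by (auto simp: gbox_def)
        moreover have "a $ j = 0 \<or> b $ j = 0" using aj[of j] bi by auto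
        ultimately show ?thesis using u by (auto simp: abs_le_iff)
      qed
      moreover have "u $ j = 0" if "j \<notin> I" for j using u i(2) a1 b1 that by (auto simp: gbox_def)
      ultimately show ?thesis by (simp add: gbox_def)
    qed
    ultimately show ?thesis by blast
  qed
  have "\<delta> (u + c) (- c) = - \<delta> u c" for u c
    unfolding \<delta>_def by (simp add: sum_negf[symmetric] plaquette_anti case_prod_unfold)
  moreover have "(\<Sum>c\<in>nbrs I. \<delta> u c) = 0" for u
  proof -
    have "(\<Sum>c\<in>nbrs I. \<delta> u c) = (\<Sum>(v, a)\<in>B - {z}. s (v, a) * (\<Sum>c\<in>nbrs I. plaquette v a (boundary_dir I r (v, a)) u c))"
      unfolding \<delta>_def by (subst sum.swap) (simp add: sum_distrib_left case_prod_unfold)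
    also have "\<dots> = 0"
    proof (intro sum.neutral ballI, unfold split_paired_all split_conv)
      fix v a assume "(v, a) \<in> B - {z}"
      then have "a \<in> nbrs I" "boundary_dir I r (v, a) \<in> nbrs I"
        using boundary_dir_props(1)[OF I, of v a] by (auto simp: B_def z_def boundary_def)
      then show "s (v, a) * (\<Sum>c\<in>nbrs I. plaquette v a (boundary_dir I r (v, a)) u c) = 0"
        by (simp add: plaquette_div)
    qed
    finally show ?thesis .
  qed
  moreover have "u \<in> gbox I (r + 1) \<and> u \<notin> gbox I (r - 1)" if nz: "\<delta> u c \<noteq> 0" for u c
  proof -
    have "\<exists>b\<in>B - {z}. (case b of (v, a) \<Rightarrow> s (v, a) * plaquette v a (boundary_dir I r (v, a)) u c) \<noteq> 0"
      using nz unfolding \<delta>_def by (meson sum.neutral)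
    then obtain b where "b \<in> B - {z}" "(case b of (v, a) \<Rightarrow> s (v, a) * plaquette v a (boundary_dir I r (v, a)) u c) \<noteq> 0"
      by blast
    then show ?thesis using near[of "fst b" "snd b" u c] by (simp add: case_prod_unfold)
  qed
  moreover have "\<bar>\<delta> u c\<bar> \<le> 8 * real (card (gbox I 2 \<times> nbrs I))" for u c
  proof -
    define D where "D = {(v, a)\<in>B - {z}. plaquette v a (boundary_dir I r (v, a)) u c \<noteq> 0}"
    have fD: "finite D" using fB by (simp add: D_def case_prod_unfold)
    have "\<delta> u c = (\<Sum>(v, a)\<in>D. s (v, a) * plaquette v a (boundary_dir I r (v, a)) u c)"
      unfolding \<delta>_def by (rule sum.mono_neutral_right) (use fB in \<open>auto simp: D_def\<close>)
    then have "\<bar>\<delta> u c\<bar> \<le> (\<Sum>(v, a)\<in>D. \<bar>s (v, a) * plaquette v a (boundary_dir I r (v, a)) u c\<bar>)"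
      by (simp add: case_prod_unfold)
    also have "\<dots> \<le> (\<Sum>b\<in>D. 8)"
    proof (rule sum_mono, clarify)
      fix v a
      have "\<bar>s (v, a)\<bar> * \<bar>plaquette v a (boundary_dir I r (v, a)) u c\<bar> \<le> 1 * 8"
        using s01[of "(v, a)"] by (intro mult_mono plaquette_bound) auto
      then show "\<bar>s (v, a) * plaquette v a (boundary_dir I r (v, a)) u c\<bar> \<le> 8" by (simp add: abs_mult)
    qed
    also have "\<dots> = 8 * real (card D)" by simp
    also have "card D \<le> card (gbox I 2 \<times> nbrs I)"
    proof (rule card_inj_on_le)
      show "inj_on (\<lambda>(v, a). (u - v, a)) D" by (auto simp: inj_on_def)
      show "(\<lambda>(v, a). (u - v, a)) ` D \<subseteq> gbox I 2 \<times> nbrs I"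
        using near by (auto simp: D_def B_def boundary_def)
    qed (simp add: finite_gbox finite_nbrs)
    finally show ?thesis by simp
  qed
  moreover have "f u c + \<delta> u c = boundary_value I r U (u, c) \<and> boundary_value I r U (u, c) \<in> \<int>" if uc: "(u, c) \<in> boundary I r" for u c
  proof -
    have "\<delta> u c = (\<Sum>b\<in>B - {z}. s b * of_bool (boundary_parent I r b = (u, c)) - s b * of_bool (b = (u, c)))"
      unfolding \<delta>_def case_prod_unfold
    proof (rule sum.cong[OF refl])
      fix b assume "b \<in> B - {z}"
      then show "s (fst b, snd b) * plaquette (fst b) (snd b) (boundary_dir I r (fst b, snd b)) u c =
          s b * of_bool (boundary_parent I r b = (u, c)) - s b * of_bool (b = (u, c))"
        using plaquette_boundary[OF I _ _ uc, of "fst b" "snd b"] by (simp add: B_def z_def right_diff_distrib)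
    qed
    also have "\<dots> = (\<Sum>b\<in>B - {z}. s b * of_bool (boundary_parent I r b = (u, c))) - (\<Sum>b\<in>B - {z}. s b * of_bool (b = (u, c)))"
      by (rule sum_subtractf)
    also have "(\<Sum>b\<in>B - {z}. s b * of_bool (boundary_parent I r b = (u, c))) = (\<Sum>b | b \<in> B \<and> b \<noteq> z \<and> boundary_parent I r b = (u, c). s b)"
      by (rule sum.mono_neutral_cong_right) (use fB in auto)
    also have "(\<Sum>b\<in>B - {z}. s b * of_bool (b = (u, c))) = s (u, c)"
    proof -
      have "(\<Sum>b\<in>B - {z}. s b * of_bool (b = (u, c))) = (\<Sum>b\<in>B. s b * of_bool (b = (u, c)))"
        by (rule sum.mono_neutral_left) (use fB s0 in auto)
      also have "\<dots> = (\<Sum>b\<in>{(u, c)}. s b)"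
        by (rule sum.mono_neutral_cong_right) (use fB uc in \<open>auto simp: B_def\<close>)
      finally show ?thesis by simp
    qed
    finally have "f u c + \<delta> u c = boundary_value I r U (u, c)"
      unfolding boundary_value_def treeround_def s_def R_def B_def z_def U_def by simp
    moreover have "boundary_value I r U (u, c) \<in> \<int>"
      unfolding boundary_value_def B_def[symmetric] z_def[symmetric] R_def[symmetric]
      by (rule treeround_Ints[where rk = "boundary_rank I r", OF par R]) (use uc in \<open>auto simp: B_def\<close>)
    ultimately show ?thesis by blast
  qed
  ultimately show ?thesis unfolding U_def
    by (intro exI[of _ \<delta>] conjI allI) auto
qed

lemma treesum_measurable:
  assumes "\<And>b. b \<in> B \<Longrightarrow> (\<lambda>x. u x b) \<in> borel_measurable M" "b \<in> B"
  shows "(\<lambda>x. treesum B z p (u x) n b) \<in> borel_measurable M"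
  using assms(2)
proof (induction n arbitrary: b)
  case (Suc n)
  then show ?case using assms(1) unfolding treesum.simps frac_def
    by (intro borel_measurable_diff borel_measurable_add borel_measurable_sum
        measurable_compose[OF _ borel_measurable_real_floor]) auto
qed simp

lemma boundary_value_measurable:
  assumes "\<And>b. b \<in> boundary I r \<Longrightarrow> (\<lambda>x. u x b) \<in> borel_measurable M" "b \<in> boundary I r"
  shows "(\<lambda>x. boundary_value I r (u x) b) \<in> borel_measurable M"
  unfolding boundary_value_def treeround_def
  by (intro borel_measurable_diff borel_measurable_add borel_measurable_sum treesum_measurable)
     (use assms in auto)

section \<open>Tiles\<close>

lemma power_diff_le:
  fixes x y :: real
  assumes "0 \<le> y" "y \<le> x"
  shows "x ^ k - y ^ k \<le> real k * (x - y) * x ^ (k - 1)"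
proof (cases k)
  case (Suc n)
  have "x ^ k - y ^ k = (x - y) * (\<Sum>p<Suc n. x ^ p * y ^ (n - p))"
    unfolding Suc by (rule diff_power_eq_sum)
  also have "\<dots> \<le> (x - y) * (\<Sum>p<Suc n. x ^ n)"
  proof (intro mult_left_mono sum_mono)
    fix p assume "p \<in> {..<Suc n}"
    then have "x ^ p * y ^ (n - p) \<le> x ^ p * x ^ (n - p)"
      using assms by (intro mult_left_mono power_mono) auto
    then show "x ^ p * y ^ (n - p) \<le> x ^ n"
      using \<open>p \<in> {..<Suc n}\<close> by (simp flip: power_add)
  qed (use assms in auto)
  finally show ?thesis by (simp add: Suc algebra_simps)
qed simp

lemma card_gbox:
  assumes "0 \<le> r"
  shows "real (card (gbox I r :: (int ^ 'n) set)) = (2 * of_int r + 1) ^ card I"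
proof -
  have "bij_betw (\<lambda>v. \<lambda>i\<in>I. v $ i) (gbox I r :: (int ^ 'n) set) (I \<rightarrow>\<^sub>E {-r..r})"
  proof (rule bij_betw_byWitness[where f' = "\<lambda>g. \<chi> i. if i \<in> I then g i else 0"])
    show "\<forall>v\<in>gbox I r. (\<chi> i. if i \<in> I then (\<lambda>i\<in>I. v $ i) i else 0) = v"
      by (auto simp: gbox_def vec_eq_iff)
    show "\<forall>g\<in>I \<rightarrow>\<^sub>E {-r..r}. (\<lambda>i\<in>I. (\<chi> i. if i \<in> I then g i else 0) $ i) = g"
      by (auto simp: PiE_def extensional_def fun_eq_iff)
    show "(\<lambda>v. \<lambda>i\<in>I. v $ i) ` gbox I r \<subseteq> I \<rightarrow>\<^sub>E {-r..r}"
      by (force simp: gbox_def)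
    show "(\<lambda>g. \<chi> i. if i \<in> I then g i else 0) ` (I \<rightarrow>\<^sub>E {-r..r}) \<subseteq> gbox I r"
      by (force simp: gbox_def PiE_def Pi_def abs_le_iff)
  qed
  then have "card (gbox I r :: (int ^ 'n) set) = card (I \<rightarrow>\<^sub>E {-r..r})"
    by (rule bij_betw_same_card)
  also have "\<dots> = nat (2 * r + 1) ^ card I"
    by (simp add: card_PiE)
  finally show ?thesis using assms by simp
qed

lemma card_shell:
  assumes "0 \<le> s" "s \<le> t"
  shows "real (card (gbox I t - gbox I s :: (int ^ 'n) set)) \<le>
    real (card I) * (2 * (of_int t - of_int s)) * (2 * of_int t + 1) ^ (card I - 1)"
proof -
  have "card (gbox I t - gbox I s :: (int ^ 'n) set) = card (gbox I t :: (int ^ 'n) set) - card (gbox I s :: (int ^ 'n) set)"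
    using assms by (intro card_Diff_subset finite_gbox gbox_mono)
  moreover have "card (gbox I s :: (int ^ 'n) set) \<le> card (gbox I t :: (int ^ 'n) set)"
    using assms by (intro card_mono finite_gbox gbox_mono)
  ultimately have "real (card (gbox I t - gbox I s :: (int ^ 'n) set)) = (2 * of_int t + 1) ^ card I - (2 * of_int s + 1) ^ card I"
    using assms by (simp add: of_nat_diff card_gbox)
  also have "\<dots> \<le> real (card I) * ((2 * of_int t + 1) - (2 * of_int s + 1)) * (2 * of_int t + 1) ^ (card I - 1)"
    using assms by (intro power_diff_le) auto
  finally show ?thesis by (simp add: algebra_simps)
qed

definition is_tile :: "(real ^ 'n) set \<Rightarrow> (real ^ 'n) set \<Rightarrow> bool" where
  "is_tile G A \<longleftrightarrow> A \<in> sets borel \<and> (AE x in lborel. \<exists>!l. l \<in> G \<and> x - l \<in> A)"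

definition subgrp :: "(real ^ 'n) set \<Rightarrow> bool" where
  "subgrp G \<longleftrightarrow> 0 \<in> G \<and> (\<forall>x\<in>G. \<forall>y\<in>G. x - y \<in> G)"

lemma subgrp_uminus: "subgrp G \<Longrightarrow> x \<in> G \<Longrightarrow> - x \<in> G"
  unfolding subgrp_def by (metis diff_0)

lemma subgrp_add: "subgrp G \<Longrightarrow> x \<in> G \<Longrightarrow> y \<in> G \<Longrightarrow> x + y \<in> G"
  using subgrp_uminus[of G y] unfolding subgrp_def by (metis diff_minus_eq_add)

lemma subgrp_diff: "subgrp G \<Longrightarrow> x \<in> G \<Longrightarrow> y \<in> G \<Longrightarrow> x - y \<in> G"
  unfolding subgrp_def by blast

lemma nn_integral_lborel_shift:
  fixes f :: "real ^ 'n \<Rightarrow> ennreal"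
  assumes "f \<in> borel_measurable borel"
  shows "(\<integral>\<^sup>+x. f (x + t) \<partial>lborel) = (\<integral>\<^sup>+x. f x \<partial>lborel)"
proof -
  have "(\<integral>\<^sup>+x. f x \<partial>lborel) = (\<integral>\<^sup>+x. f x \<partial>distr lborel borel ((+) t))"
    by (simp add: lborel_distr_plus)
  also have "\<dots> = (\<integral>\<^sup>+x. f (t + x) \<partial>lborel)"
    using assms by (intro nn_integral_distr) auto
  finally show ?thesis by (simp add: add.commute)
qed

lemma nn_integral_count_unique:
  assumes "\<exists>!l. l \<in> G \<and> Q l"
  shows "(\<integral>\<^sup>+l. indicator {l. Q l} l \<partial>count_space G) = (1 :: ennreal)"
proof -
  obtain l0 where l0: "l0 \<in> G" "Q l0" "\<And>l. l \<in> G \<Longrightarrow> Q l \<Longrightarrow> l = l0"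
    using assms by blast
  have "(\<integral>\<^sup>+l. indicator {l. Q l} l \<partial>count_space G) = (\<integral>\<^sup>+l. indicator {l0} l \<partial>count_space G)"
  proof (rule nn_integral_cong)
    fix l assume "l \<in> space (count_space G)"
    then have "Q l \<longleftrightarrow> l = l0" using l0 by (metis space_count_space)
    then show "indicator {l. Q l} l = (indicator {l0} l :: ennreal)" by (simp add: indicator_def)
  qed
  also have "\<dots> = emeasure (count_space G) {l0}" using l0(1) by (intro nn_integral_indicator) auto
  finally show ?thesis using l0(1) by simp
qed

text \<open>Unfolding: A is cut along the translates of B by G, each piece is moved back into B, and
  g does not notice the move. The pieces so moved make up B, since A is a tile as well.\<close>

lemma tile_nn_integral_eq:
  fixes g :: "real ^ 'n \<Rightarrow> ennreal"
  assumes G: "subgrp G" "countable G" and A: "is_tile G A" and B: "is_tile G B"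
    and g: "g \<in> borel_measurable borel" and per: "\<And>x l. l \<in> G \<Longrightarrow> g (x + l) = g x"
  shows "(\<integral>\<^sup>+x. g x * indicator A x \<partial>lborel) = (\<integral>\<^sup>+x. g x * indicator B x \<partial>lborel)"
proof -
  have mA[measurable]: "A \<in> sets borel" and mB[measurable]: "B \<in> sets borel"
    using A B by (auto simp: is_tile_def)
  have tA: "AE x in lborel. \<exists>!l. l \<in> G \<and> x - l \<in> A" and tB: "AE x in lborel. \<exists>!l. l \<in> G \<and> x - l \<in> B"
    using A B by (auto simp: is_tile_def)
  note g[measurable]
  have AE1: "AE x in lborel. g x * indicator A x = (\<integral>\<^sup>+l. g x * indicator A x * indicator B (x - l) \<partial>count_space G)"
    using tB
  proof eventually_elim
    fix x assume "\<exists>!l. l \<in> G \<and> x - l \<in> B"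
    from nn_integral_count_unique[OF this]
    have "(\<integral>\<^sup>+l. indicator B (x - l) \<partial>count_space G) = (1 :: ennreal)"
      by (simp add: indicator_def)
    then show "g x * indicator A x = (\<integral>\<^sup>+l. g x * indicator A x * indicator B (x - l) \<partial>count_space G)"
      by (simp add: nn_integral_cmult)
  qed
  have AE2: "AE x in lborel. g x * indicator B x = (\<integral>\<^sup>+l. g x * indicator B x * indicator A (x + l) \<partial>count_space G)"
    using tA
  proof eventually_elim
    fix x assume *: "\<exists>!l. l \<in> G \<and> x - l \<in> A"
    then obtain l where "l \<in> G" "x - l \<in> A" "\<And>k. k \<in> G \<Longrightarrow> x - k \<in> A \<Longrightarrow> k = l" by blast
    then have "\<exists>!l. l \<in> G \<and> x + l \<in> A"
    proof (intro ex1I[of _ "- l"])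
      show "- l \<in> G \<and> x + - l \<in> A" using \<open>l \<in> G\<close> \<open>x - l \<in> A\<close> subgrp_uminus[OF G(1)] by simp
      fix k assume "k \<in> G \<and> x + k \<in> A"
      then have "- k = l" using \<open>\<And>k. k \<in> G \<Longrightarrow> x - k \<in> A \<Longrightarrow> k = l\<close>[of "- k"] subgrp_uminus[OF G(1)] by simp
      then show "k = - l" by auto
    qed
    from nn_integral_count_unique[OF this]
    have "(\<integral>\<^sup>+l. indicator A (x + l) \<partial>count_space G) = (1 :: ennreal)"
      by (simp add: indicator_def)
    then show "g x * indicator B x = (\<integral>\<^sup>+l. g x * indicator B x * indicator A (x + l) \<partial>count_space G)"
      by (simp add: nn_integral_cmult)
  qed
  have "(\<integral>\<^sup>+x. g x * indicator A x \<partial>lborel) =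
      (\<integral>\<^sup>+x. \<integral>\<^sup>+l. g x * indicator A x * indicator B (x - l) \<partial>count_space G \<partial>lborel)"
    by (rule nn_integral_cong_AE[OF AE1])
  also have "\<dots> = (\<integral>\<^sup>+l. \<integral>\<^sup>+x. g x * indicator A x * indicator B (x - l) \<partial>lborel \<partial>count_space G)"
    by (rule nn_integral_count_space_nn_integral) (use G in auto)
  also have "\<dots> = (\<integral>\<^sup>+l. \<integral>\<^sup>+x. g x * indicator B x * indicator A (x + l) \<partial>lborel \<partial>count_space G)"
  proof (rule nn_integral_cong)
    fix l assume "l \<in> space (count_space G)"
    then have l: "l \<in> G" by simp
    have "(\<integral>\<^sup>+x. g x * indicator A x * indicator B (x - l) \<partial>lborel) =
        (\<integral>\<^sup>+x. g (x + l) * indicator A (x + l) * indicator B (x + l - l) \<partial>lborel)"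
      by (rule nn_integral_lborel_shift[symmetric]) measurable
    also have "\<dots> = (\<integral>\<^sup>+x. g x * indicator B x * indicator A (x + l) \<partial>lborel)"
      by (intro nn_integral_cong) (simp add: per[OF l] ac_simps)
    finally show "(\<integral>\<^sup>+x. g x * indicator A x * indicator B (x - l) \<partial>lborel) =
      (\<integral>\<^sup>+x. g x * indicator B x * indicator A (x + l) \<partial>lborel)" .
  qed
  also have "\<dots> = (\<integral>\<^sup>+x. \<integral>\<^sup>+l. g x * indicator B x * indicator A (x + l) \<partial>count_space G \<partial>lborel)"
    by (rule nn_integral_count_space_nn_integral[symmetric]) (use G in auto)
  also have "\<dots> = (\<integral>\<^sup>+x. g x * indicator B x \<partial>lborel)"
    by (rule nn_integral_cong_AE[symmetric, OF AE2])
  finally show ?thesis .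
qed

lemma AE_lborel_shift:
  fixes t :: "real ^ 'n"
  assumes "AE x in lborel. Q x"
  shows "AE x in lborel. Q (x + t)"
proof -
  obtain N where N: "{x \<in> space lborel. \<not> Q x} \<subseteq> N" "emeasure lborel N = 0" "N \<in> sets lborel"
    using assms by (rule AE_E)
  have [measurable]: "N \<in> sets borel" using N(3) by simp
  have "emeasure lborel {x. x + t \<in> N} = (\<integral>\<^sup>+x. indicator {x. x + t \<in> N} x \<partial>lborel)"
    by (rule nn_integral_indicator[symmetric]) measurable
  also have "\<dots> = (\<integral>\<^sup>+x. indicator N (x + t) \<partial>lborel)"
    by (intro nn_integral_cong) (auto simp: indicator_def)
  also have "\<dots> = (\<integral>\<^sup>+x. indicator N x \<partial>lborel)"
    by (rule nn_integral_lborel_shift) measurable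
  also have "\<dots> = 0" using N by simp
  finally have "{x. x + t \<in> N} \<in> null_sets lborel"
    by (intro null_setsI) (auto, measurable)
  then show ?thesis by (rule AE_I') (use N(1) in auto)
qed

lemma is_tile_shift:
  assumes "is_tile G A"
  shows "is_tile G {x. x + t \<in> A}"
proof -
  have m[measurable]: "A \<in> sets borel" using assms by (simp add: is_tile_def)
  have "AE x in lborel. \<exists>!l. l \<in> G \<and> x - l \<in> A" using assms by (simp add: is_tile_def)
  then have "AE x in lborel. \<exists>!l. l \<in> G \<and> (x + t) - l \<in> A" by (rule AE_lborel_shift)
  moreover have "{x. x + t \<in> A} \<in> sets borel" by measurable
  ultimately show ?thesis by (simp add: is_tile_def algebra_simps)
qed

section \<open>Markers for a lattice action\<close>

text \<open>The group Z^I acting by the translations w on the torus R^n / La. The torus is not a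
  type: its points are classes modulo La, its subsets are the periodic sets and its measure is that
  of the part in the bounded domain P. \<open>free\<close> says that no non-zero element of Z^I
  fixes a point of the torus.\<close>

locale lattice_shift =
  fixes La :: "(real ^ 'n) set" and w :: "'n \<Rightarrow> real ^ 'n" and I :: "'n set" and P :: "(real ^ 'n) set"
  assumes La_subgrp: "subgrp La"
    and La_finite: "\<And>B. bounded B \<Longrightarrow> finite (La \<inter> B)"
    and P_borel [measurable]: "P \<in> sets borel" and P_bounded: "bounded P"
    and P_dom: "\<And>x. \<exists>!l. l \<in> La \<and> x - l \<in> P"
    and free: "\<And>v. (\<forall>i. i \<notin> I \<longrightarrow> v $ i = 0) \<Longrightarrow> (\<Sum>i\<in>UNIV. of_int (v $ i) *\<^sub>R w i) \<in> La \<Longrightarrow> v = 0"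
begin

definition act :: "int ^ 'n \<Rightarrow> real ^ 'n" where
  "act v = (\<Sum>i\<in>UNIV. of_int (v $ i) *\<^sub>R w i)"

lemma act_0 [simp]: "act 0 = 0" by (simp add: act_def)

lemma act_add: "act (u + v) = act u + act v"
  by (simp add: act_def scaleR_left_distrib sum.distrib)

lemma act_uminus: "act (- v) = - act v"
  by (simp add: act_def sum_negf)

lemma act_diff: "act (u - v) = act u - act v"
  using act_add[of u "- v"] act_uminus[of v] by simp

lemma free_gbox: "v \<in> gbox I r \<Longrightarrow> act v \<in> La \<Longrightarrow> v = 0"
  using free[of v] by (auto simp: gbox_def act_def)

lemma La_countable: "countable La"
proof -
  have "La \<subseteq> (\<Union>n. La \<inter> ball 0 (real n))"
  proof
    fix x assume "x \<in> La"
    obtain n where "norm x < real n" using reals_Archimedean2 by blast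
    then have "x \<in> La \<inter> ball 0 (real n)" using \<open>x \<in> La\<close> by simp
    then show "x \<in> (\<Union>n. La \<inter> ball 0 (real n))" by blast
  qed
  moreover have "countable (\<Union>n. La \<inter> ball 0 (real n))"
    by (rule countable_UN) (auto intro!: countable_finite La_finite)
  ultimately show ?thesis by (rule countable_subset)
qed

definition periodic :: "(real ^ 'n) set \<Rightarrow> bool" where
  "periodic S \<longleftrightarrow> (\<forall>x. \<forall>l\<in>La. x + l \<in> S \<longleftrightarrow> x \<in> S)"

definition pmeas :: "(real ^ 'n) set \<Rightarrow> real" where
  "pmeas S = measure lborel (S \<inter> P)"

lemma P_tile: "is_tile La P"
  using P_dom by (auto simp: is_tile_def)

lemma fmeasurable_P: "S \<in> sets borel \<Longrightarrow> S \<inter> P \<in> fmeasurable lborel"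
proof (rule fmeasurableI)
  assume S: "S \<in> sets borel"
  show "S \<inter> P \<in> sets lborel" using S by simp
  have "emeasure lborel (S \<inter> P) \<le> emeasure lborel P" by (rule emeasure_mono) auto
  also have "\<dots> < \<infinity>" using P_bounded by (rule emeasure_bounded_finite)
  finally show "emeasure lborel (S \<inter> P) < \<infinity>" .
qed

text \<open>A translation replaces P by a translate of P, and the integral of a periodic function is
  the same over all tiles of La.\<close>

lemma pmeas_shift:
  assumes S: "S \<in> sets borel" "periodic S"
  shows "pmeas {x. x + t \<in> S} = pmeas S"
proof -
  note S(1)[measurable]
  have "emeasure lborel ({x. x + t \<in> S} \<inter> P) = (\<integral>\<^sup>+x. indicator ({x. x + t \<in> S} \<inter> P) x \<partial>lborel)"
    by (rule nn_integral_indicator[symmetric]) measurable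
  also have "\<dots> = (\<integral>\<^sup>+x. indicator S (x + t) * indicator {x. x + (- t) \<in> P} (x + t) \<partial>lborel)"
    by (intro nn_integral_cong) (auto simp: indicator_def)
  also have "\<dots> = (\<integral>\<^sup>+x. indicator S x * indicator {x. x + (- t) \<in> P} x \<partial>lborel)"
    by (rule nn_integral_lborel_shift[of "\<lambda>x. indicator S x * indicator {x. x + (- t) \<in> P} x"]) measurable
  also have "\<dots> = (\<integral>\<^sup>+x. indicator S x * indicator P x \<partial>lborel)"
  proof (rule tile_nn_integral_eq[OF La_subgrp La_countable _ P_tile])
    show "is_tile La {x. x + (- t) \<in> P}" by (rule is_tile_shift[OF P_tile])
    show "indicator S (x + l) = (indicator S x :: ennreal)" if "l \<in> La" for x l
      using S(2) that by (auto simp: periodic_def indicator_def)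
  qed measurable
  also have "\<dots> = (\<integral>\<^sup>+x. indicator (S \<inter> P) x \<partial>lborel)"
    by (intro nn_integral_cong) (auto simp: indicator_def)
  also have "\<dots> = emeasure lborel (S \<inter> P)" by (rule nn_integral_indicator) measurable
  finally show ?thesis by (simp add: pmeas_def measure_def)
qed

lemma pmeas_mono: "S \<subseteq> T \<Longrightarrow> S \<in> sets borel \<Longrightarrow> T \<in> sets borel \<Longrightarrow> pmeas S \<le> pmeas T"
  unfolding pmeas_def by (intro measure_mono_fmeasurable fmeasurable_P) auto

lemma pmeas_nonneg [simp]: "0 \<le> pmeas S" by (simp add: pmeas_def)

lemma pmeas_UN_le:
  assumes "finite A" "\<And>a. a \<in> A \<Longrightarrow> S a \<in> sets borel"
  shows "pmeas (\<Union>a\<in>A. S a) \<le> (\<Sum>a\<in>A. pmeas (S a))"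
proof -
  have "(\<Union>a\<in>A. S a) \<inter> P = (\<Union>a\<in>A. S a \<inter> P)" by auto
  then show ?thesis unfolding pmeas_def
    using measure_UNION_le[OF assms(1), of "\<lambda>a. S a \<inter> P" lborel] assms(2) by auto
qed

lemma pmeas_UN_disj:
  assumes "finite A" "\<And>a. a \<in> A \<Longrightarrow> S a \<in> sets borel" "disjoint_family_on S A"
  shows "pmeas (\<Union>a\<in>A. S a) = (\<Sum>a\<in>A. pmeas (S a))"
proof -
  have "(\<Union>a\<in>A. S a) \<inter> P = (\<Union>a\<in>A. S a \<inter> P)" by auto
  then show ?thesis unfolding pmeas_def
    using measure_UNION'[of A "\<lambda>a. S a \<inter> P" lborel] assms fmeasurable_P
    by (auto simp: disjoint_family_on_def pairwise_def disjnt_def)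
qed

text \<open>S is covered by countably many translates, by elements of La, of its null part in
  P.\<close>

lemma pmeas_0_null:
  assumes S: "S \<in> sets borel" "periodic S" "pmeas S = 0"
  shows "AE x in lborel. x \<notin> S"
proof -
  have "AE x in lborel. x + l \<notin> S \<inter> P" if "l \<in> La" for l
  proof (rule AE_lborel_shift)
    have "emeasure lborel (S \<inter> P) = 0"
      using S(3) fmeasurable_P[OF S(1)] by (simp add: pmeas_def measure_eq_0_null_sets fmeasurableD2 emeasure_eq_measure2)
    then have "S \<inter> P \<in> null_sets lborel" using S(1) by (intro null_setsI) auto
    then show "AE x in lborel. x \<notin> S \<inter> P" by (rule AE_not_in)
  qed
  then have "AE x in lborel. \<forall>l\<in>La. x + l \<notin> S \<inter> P"
    using La_countable by (simp add: AE_ball_countable)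
  then show ?thesis
  proof eventually_elim
    fix x assume *: "\<forall>l\<in>La. x + l \<notin> S \<inter> P"
    obtain l where l: "l \<in> La" "x - l \<in> P" using P_dom[of x] by blast
    have "- l \<in> La" by (rule subgrp_uminus[OF La_subgrp l(1)])
    then have "x + - l \<notin> S \<inter> P" using * by blast
    then have "x + - l \<notin> S" using l by simp
    then show "x \<notin> S" using S(2) \<open>- l \<in> La\<close> unfolding periodic_def by blast
  qed
qed

lemma periodic_shift: "periodic S \<Longrightarrow> periodic {x. x + t \<in> S}"
proof -
  assume S: "periodic S"
  have "x + l + t \<in> S \<longleftrightarrow> x + t \<in> S" if "l \<in> La" for x l
  proof -
    have "x + l + t = (x + t) + l" by simp
    then show ?thesis using S that unfolding periodic_def by metis
  qed
  then show ?thesis by (simp add: periodic_def)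
qed

text \<open>Freeness made quantitative: only the finitely many elements of La within distance 1 of
  some \<open>act v\<close> matter, and none of them is equal to it. The 1 inserted into the minimum
  takes care of the others.\<close>

lemma separation:
  obtains e where "e > 0" "\<And>v l. v \<in> gbox I m \<Longrightarrow> v \<noteq> 0 \<Longrightarrow> l \<in> La \<Longrightarrow> e \<le> dist (act v) l"
proof -
  define D where "D = (\<Union>v\<in>gbox I m - {0}. dist (act v) ` (La \<inter> cball (act v) 1))"
  have fD: "finite D" unfolding D_def
    by (intro finite_UN_I finite_Diff finite_gbox finite_imageI La_finite bounded_cball)
  have pos: "d > 0" if "d \<in> D" for d
    using that free_gbox unfolding D_def by auto
  define e where "e = Min (insert 1 D)"
  have "e > 0" using fD pos by (simp add: e_def)
  moreover have "e \<le> dist (act v) l" if "v \<in> gbox I m" "v \<noteq> 0" "l \<in> La" for v l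
  proof (cases "dist (act v) l \<le> 1")
    case True
    then have "dist (act v) l \<in> D" using that by (auto simp: D_def intro!: bexI[of _ v])
    then show ?thesis using fD by (simp add: e_def)
  next
    case False
    have "e \<le> 1" using fD by (simp add: e_def)
    then show ?thesis using False by simp
  qed
  ultimately show ?thesis using that by blast
qed

text \<open>A greedy choice: cover space by finitely many small periodic open sets and keep from each of
  them the points that are not close, along the action, to points kept before.\<close>

lemma markers:
  assumes "0 \<le> m" "m \<le> m'"
  obtains n :: nat and Z where
    "\<And>j. Z j \<in> sets borel" "\<And>j. periodic (Z j)"
    "\<And>i j x v. i \<noteq> j \<Longrightarrow> x \<in> Z i \<Longrightarrow> v \<in> gbox I m \<Longrightarrow> x + act v \<notin> Z j"
    "\<And>j x v. x \<in> Z j \<Longrightarrow> v \<in> gbox I m' \<Longrightarrow> v \<noteq> 0 \<Longrightarrow> x + act v \<notin> Z j"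
    "\<And>x. \<exists>j<n. \<exists>v\<in>gbox I m. x + act v \<in> Z j"
proof -
  obtain e where e: "e > 0" "\<And>v l. v \<in> gbox I m' \<Longrightarrow> v \<noteq> 0 \<Longrightarrow> l \<in> La \<Longrightarrow> e \<le> dist (act v) l"
    using separation by blast
  have "compact (closure P)" using P_bounded by (simp add: compact_closure)
  \<comment> \<open>The radius is half the separation, so no union of balls shifted by La contains
    two points that differ by \<open>act v\<close> with a non-zero v in
    \<open>gbox I m'\<close>.\<close>
  then obtain K where K: "finite K" "closure P \<subseteq> (\<Union>p\<in>K. ball p (e / 2))"
    using e(1) unfolding compact_eq_totally_bounded by (meson half_gt_zero)
  obtain n p where p: "K = p ` {i::nat. i < n}"
    using finite_imp_nat_seg_image_inj_on[OF K(1)] by blast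
  define U where "U j = (\<Union>l\<in>La. ball (p j + l) (e / 2))" for j
  have U_open: "open (U j)" for j by (auto simp: U_def)
  have U_per: "periodic (U j)" for j
  proof -
    have imp: "x + l \<in> U j" if l: "l \<in> La" "x \<in> U j" for x l
    proof -
      obtain k where k: "k \<in> La" "dist (p j + k) x < e / 2" using l(2) by (auto simp: U_def)
      then have "k + l \<in> La" "dist (p j + (k + l)) (x + l) < e / 2"
        using subgrp_add[OF La_subgrp k(1) l(1)] by (auto simp: dist_norm algebra_simps)
      then show ?thesis by (auto simp: U_def intro!: bexI[of _ "k + l"])
    qed
    have "x + l \<in> U j \<longleftrightarrow> x \<in> U j" if "l \<in> La" for x l
      using imp[OF that, of x] imp[OF subgrp_uminus[OF La_subgrp that], of "x + l"] by auto
    then show ?thesis by (simp add: periodic_def)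
  qed
  have U_sep: "x + act v \<notin> U j" if "x \<in> U j" "v \<in> gbox I m'" "v \<noteq> 0" for x v j
  proof
    assume "x + act v \<in> U j"
    with \<open>x \<in> U j\<close> obtain k l where kl: "k \<in> La" "l \<in> La" "dist (p j + k) x < e / 2" "dist (p j + l) (x + act v) < e / 2"
      by (auto simp: U_def)
    have "dist (act v) (l - k) = norm ((p j + k - x) - (p j + l - (x + act v)))"
      by (simp add: dist_norm algebra_simps)
    also have "\<dots> \<le> norm (p j + k - x) + norm (p j + l - (x + act v))" by (rule norm_triangle_ineq4)
    also have "\<dots> < e" using kl by (simp add: dist_norm)
    finally show False using e(2)[OF that(2,3) subgrp_diff[OF La_subgrp kl(2,1)]] by simp
  qed
  have U_cover: "\<exists>j<n. x \<in> U j" for x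
  proof -
    obtain l where l: "l \<in> La" "x - l \<in> P" using P_dom[of x] by blast
    then obtain q where "q \<in> K" "x - l \<in> ball q (e / 2)" using K(2) closure_subset by blast
    then obtain j where j: "j < n" "dist (p j) (x - l) < e / 2" using p by auto
    then have "dist (p j + l) x < e / 2" by (simp add: dist_norm algebra_simps)
    then show ?thesis using j l by (auto simp: U_def)
  qed
  define W where "W = rec_nat {} (\<lambda>j W. W \<union> (U j \<inter> {x. \<forall>v\<in>gbox I m. x + act v \<notin> W}))"
  have W0: "W 0 = {}" and WS: "W (Suc j) = W j \<union> (U j \<inter> {x. \<forall>v\<in>gbox I m. x + act v \<notin> W j})" for j
    by (simp_all add: W_def)
  define Z where "Z j = U j \<inter> {x. \<forall>v\<in>gbox I m. x + act v \<notin> W j}" for j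
  have WS': "W (Suc j) = W j \<union> Z j" for j by (simp add: WS Z_def)
  have W_Z: "W j = (\<Union>i<j. Z i)" for j
    by (induction j) (auto simp: W0 WS' lessThan_Suc)
  have W_borel: "W j \<in> sets borel" for j
  proof (induction j)
    case (Suc j)
    note Suc[measurable]
    have "{x. x + act v \<notin> W j} \<in> sets borel" for v by measurable
    moreover have "0 \<in> gbox I m" using assms by auto
    then have "gbox I m \<noteq> {}" by blast
    ultimately have "(\<Inter>v\<in>gbox I m. {x. x + act v \<notin> W j}) \<in> sets borel"
      by (intro sets.finite_INT finite_gbox) auto
    moreover have "{x. \<forall>v\<in>gbox I m. x + act v \<notin> W j} = (\<Inter>v\<in>gbox I m. {x. x + act v \<notin> W j})" by auto
    ultimately have "{x. \<forall>v\<in>gbox I m. x + act v \<notin> W j} \<in> sets borel" by auto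
    then show ?case using Suc U_open[of j] unfolding WS by (intro sets.Un sets.Int) auto
  qed (simp add: W0)
  have Z_diff: "Z j = W (Suc j) - W j" for j
  proof -
    have "x \<notin> W j" if "x \<in> Z j" for x
      using that assms by (auto simp: Z_def dest!: bspec[of _ _ 0])
    then show ?thesis by (auto simp: WS')
  qed
  have W_per: "periodic (W j)" for j
  proof (induction j)
    case (Suc j)
    have "x + l + act v \<in> W j \<longleftrightarrow> x + act v \<in> W j" if "l \<in> La" for x l v
      using Suc that unfolding periodic_def by (metis add.assoc add.commute)
    then show ?case using Suc U_per[of j] unfolding WS periodic_def by auto
  qed (simp add: W0 periodic_def)
  have far: "x + act v \<notin> Z i" if "x \<in> Z j" "i < j" "v \<in> gbox I m" for x v i j
    using that unfolding Z_def[of j] W_Z[of j] by auto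
  show ?thesis
  proof (rule that[of Z n])
    show "Z j \<in> sets borel" for j unfolding Z_diff using W_borel by auto
    show "periodic (Z j)" for j using W_per[of j] W_per[of "Suc j"] unfolding Z_diff periodic_def by simp
    show "x + act v \<notin> Z j" if "i \<noteq> j" "x \<in> Z i" "v \<in> gbox I m" for i j x v
    proof (cases "j < i")
      case False
      show ?thesis
      proof
        assume "x + act v \<in> Z j"
        moreover have "i < j" using False that by simp
        ultimately have "x + act v + act (- v) \<notin> Z i" using that by (intro far) auto
        then show False using that by (simp add: act_uminus)
      qed
    qed (use far that in blast)
    show "x + act v \<notin> Z j" if "x \<in> Z j" "v \<in> gbox I m'" "v \<noteq> 0" for x v j
      using U_sep[of x j v] that by (auto simp: Z_def)
    show "\<exists>j<n. \<exists>v\<in>gbox I m. x + act v \<in> Z j" for x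
    proof -
      obtain j where j: "j < n" "x \<in> U j" using U_cover by blast
      show ?thesis
      proof (cases "x \<in> Z j")
        case True
        moreover have "0 \<in> gbox I m" using assms by auto
        ultimately show ?thesis using j by (intro exI[of _ j] conjI bexI[of _ 0]) auto
      next
        case False
        then obtain v where "v \<in> gbox I m" "x + act v \<in> W j" using j by (auto simp: Z_def)
        then show ?thesis using j unfolding W_Z by (meson UN_E lessThan_iff order.strict_trans)
      qed
    qed
  qed
qed

end

section \<open>Radii, and the density of shells around markers\<close>

text \<open>The quadratic exponent gives rad i / rad j at most 2^-(i + j) for i < j. Shells of
  thickness comparable to rad i around cubes of radius rad j are therefore summable over j and again
  over i. The shift by 3 makes the least radius 512, which absorbs the additive constants of the
  estimates below.\<close>

definition rad :: "nat \<Rightarrow> int" where "rad i = 2 ^ ((i + 3)\<^sup>2)"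

lemma rad_ge: "2 ^ i * 512 \<le> rad i"
proof -
  have "i + 9 \<le> (i + 3)\<^sup>2" by (simp add: power2_eq_square algebra_simps)
  then have "(2::int) ^ (i + 9) \<le> 2 ^ ((i + 3)\<^sup>2)" by (rule power_increasing) simp
  then show ?thesis by (simp add: rad_def power_add)
qed

lemma rad_ge_512: "512 \<le> rad i"
  using rad_ge[of i] one_le_power[of "2::int" i] by linarith

lemma rad_ratio:
  assumes "i < j"
  shows "rad i * (2 ^ i * 2 ^ j) \<le> rad j"
proof -
  have "(i + 3)\<^sup>2 + (i + j) \<le> (i + 3)\<^sup>2 + (j - i) * (i + j)"
    using assms by simp
  also have "\<dots> \<le> (j + 3)\<^sup>2"
  proof -
    obtain k where "j = i + k" using assms less_imp_add_positive by blast
    then show ?thesis by (simp add: power2_eq_square algebra_simps)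
  qed
  finally have "(2::int) ^ ((i + 3)\<^sup>2 + (i + j)) \<le> 2 ^ ((j + 3)\<^sup>2)"
    by (rule power_increasing) simp
  then show ?thesis by (simp add: rad_def power_add)
qed

lemma rad_less:
  assumes "i < j"
  shows "8 * rad i \<le> rad j"
proof -
  obtain k where "j = i + k" "k > 0" using assms less_imp_add_positive by blast
  then have "(i + 3)\<^sup>2 + 3 \<le> (j + 3)\<^sup>2" by (simp add: power2_eq_square algebra_simps)
  then have "(2::int) ^ ((i + 3)\<^sup>2 + 3) \<le> 2 ^ ((j + 3)\<^sup>2)" by (rule power_increasing) simp
  then show ?thesis by (simp add: rad_def power_add)
qed

context lattice_shift
begin

definition gvecs :: "(int ^ 'n) set" where "gvecs = {v. \<forall>i. i \<notin> I \<longrightarrow> v $ i = 0}"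

lemma gvecs_eq: "gvecs = (\<Union>n. gbox I (int n))"
proof
  show "gvecs \<subseteq> (\<Union>n. gbox I (int n))"
  proof
    fix v assume v: "v \<in> gvecs"
    have "v \<in> gbox I (int (\<Sum>i\<in>UNIV. nat \<bar>v $ i\<bar>))"
    proof -
      have "\<bar>v $ i\<bar> \<le> int (\<Sum>i\<in>UNIV. nat \<bar>v $ i\<bar>)" for i
      proof -
        have "nat \<bar>v $ i\<bar> \<le> (\<Sum>i\<in>UNIV. nat \<bar>v $ i\<bar>)" by (rule member_le_sum) auto
        then have "int (nat \<bar>v $ i\<bar>) \<le> int (\<Sum>i\<in>UNIV. nat \<bar>v $ i\<bar>)" by (rule of_nat_mono)
        moreover have "int (nat \<bar>v $ i\<bar>) = \<bar>v $ i\<bar>" by simp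
        ultimately show ?thesis by (simp only:)
      qed
      then show ?thesis using v by (simp add: gvecs_def gbox_def)
    qed
    then show "v \<in> (\<Union>n. gbox I (int n))" by blast
  qed
qed (auto simp: gvecs_def gbox_def)

lemma countable_gvecs: "countable gvecs"
  unfolding gvecs_eq by (rule countable_UN) (auto intro: countable_finite finite_gbox)

lemma gvecs_add: "u \<in> gvecs \<Longrightarrow> v \<in> gvecs \<Longrightarrow> u + v \<in> gvecs"
  and gvecs_uminus: "u \<in> gvecs \<Longrightarrow> - u \<in> gvecs"
  and gvecs_0 [simp]: "0 \<in> gvecs"
  by (auto simp: gvecs_def)

lemma gbox_gvecs: "v \<in> gbox I r \<Longrightarrow> v \<in> gvecs"
  by (auto simp: gbox_def gvecs_def)

definition shifts :: "(int ^ 'n) set \<Rightarrow> (real ^ 'n) set \<Rightarrow> (real ^ 'n) set" where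
  "shifts A S = {x. \<exists>v\<in>A. x + act v \<in> S}"

lemma shifts_UN: "shifts A S = (\<Union>v\<in>A. {x. x + act v \<in> S})"
  by (auto simp: shifts_def)

lemma shift_borel: "S \<in> sets borel \<Longrightarrow> {x. x + t \<in> S} \<in> sets borel" for t :: "real ^ 'n"
proof -
  assume [measurable]: "S \<in> sets borel"
  show ?thesis by measurable
qed

lemma shifts_borel: "A \<subseteq> gvecs \<Longrightarrow> S \<in> sets borel \<Longrightarrow> shifts A S \<in> sets borel"
  unfolding shifts_UN
  by (intro sets.countable_UN'' countable_subset[OF _ countable_gvecs] shift_borel)

lemma shifts_periodic: "periodic S \<Longrightarrow> periodic (shifts A S)"
  using periodic_shift[of S] unfolding shifts_def periodic_def by auto

lemma pmeas_shifts_le: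
  assumes "finite A" "A \<subseteq> gvecs" "S \<in> sets borel" "periodic S"
  shows "pmeas (shifts A S) \<le> real (card A) * pmeas S"
proof -
  have "pmeas (shifts A S) \<le> (\<Sum>v\<in>A. pmeas {x. x + act v \<in> S})"
    unfolding shifts_UN using assms by (intro pmeas_UN_le shift_borel)
  also have "\<dots> = real (card A) * pmeas S" using assms by (simp add: pmeas_shift)
  finally show ?thesis .
qed

text \<open>The same number 3 * r separates and covers. Cubes of radius r around the markers are
  disjoint, cubes of radius 3 * r cover, and so the former fill at least the fraction 3^(- card I)
  of any invariant set.\<close>

definition marker_set :: "int \<Rightarrow> (real ^ 'n) set \<Rightarrow> bool" where
  "marker_set r Y \<longleftrightarrow> Y \<in> sets borel \<and> periodic Y \<and>
     (\<forall>y\<in>Y. \<forall>v\<in>gbox I (3 * r). v \<noteq> 0 \<longrightarrow> y + act v \<notin> Y) \<and> shifts (gbox I (3 * r)) Y = UNIV"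

lemma marker_set_exists:
  assumes "0 \<le> r"
  shows "\<exists>Y. marker_set r Y"
proof -
  have r: "0 \<le> 3 * r" "3 * r \<le> 3 * r" using assms by auto
  obtain Z and n :: nat where Z:
    "\<And>j. Z j \<in> sets borel" "\<And>j. periodic (Z j)"
    "\<And>i j x v. i \<noteq> j \<Longrightarrow> x \<in> Z i \<Longrightarrow> v \<in> gbox I (3 * r) \<Longrightarrow> x + act v \<notin> Z j"
    "\<And>j x v. x \<in> Z j \<Longrightarrow> v \<in> gbox I (3 * r) \<Longrightarrow> v \<noteq> 0 \<Longrightarrow> x + act v \<notin> Z j"
    "\<And>x. \<exists>j<n. \<exists>v\<in>gbox I (3 * r). x + act v \<in> Z j"
  proof (rule markers[OF r], goal_cases)
    case (1 n Z)
    show ?case by (rule 1(1)[OF 1(2-)])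
  qed
  have "marker_set r (\<Union>j<n. Z j)"
    unfolding marker_set_def
  proof (intro conjI ballI impI)
    show "(\<Union>j<n. Z j) \<in> sets borel" using Z(1) by auto
    show "periodic (\<Union>j<n. Z j)" using Z(2) by (auto simp: periodic_def)
    show "y + act v \<notin> (\<Union>j<n. Z j)" if yv: "y \<in> (\<Union>j<n. Z j)" "v \<in> gbox I (3 * r)" "v \<noteq> 0" for y v
    proof -
      obtain i where i: "y \<in> Z i" using yv(1) by blast
      have "y + act v \<notin> Z j" for j
        using Z(3)[OF _ i yv(2), of j] Z(4)[OF i yv(2,3)] by (cases "i = j") simp_all
      then show ?thesis by blast
    qed
    have "x \<in> shifts (gbox I (3 * r)) (\<Union>j<n. Z j)" for x
    proof -
      obtain j v where "j < n" "v \<in> gbox I (3 * r)" "x + act v \<in> Z j" using Z(5)[of x] by blast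
      then show ?thesis unfolding shifts_def by blast
    qed
    then show "shifts (gbox I (3 * r)) (\<Union>j<n. Z j) = UNIV" by blast
  qed
  then show ?thesis by blast
qed

lemma pmeas_shifts_disj:
  assumes Y: "marker_set r Y" "0 \<le> r" and S: "S \<in> sets borel" "periodic S" "S \<subseteq> Y"
  shows "pmeas (shifts (gbox I r) S) = real (card (gbox I r)) * pmeas S"
proof -
  have "disjoint_family_on (\<lambda>v. {x. x + act v \<in> S}) (gbox I r)"
    unfolding disjoint_family_on_def
  proof (intro ballI impI, rule ccontr)
    fix u v assume uv: "u \<in> gbox I r" "v \<in> gbox I r" "u \<noteq> v"
      "{x. x + act u \<in> S} \<inter> {x. x + act v \<in> S} \<noteq> {}"
    then obtain x where x: "x + act u \<in> Y" "x + act v \<in> Y" using S by auto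
    have "v - u \<in> gbox I (3 * r)" using gbox_diff[OF uv(2,1)] gbox_mono[of "r + r" "3 * r" I] Y(2) by auto
    moreover have "x + act v = (x + act u) + act (v - u)" by (simp add: act_diff)
    ultimately show False using x uv(3) Y(1) unfolding marker_set_def by (metis right_minus_eq)
  qed
  then have "pmeas (shifts (gbox I r) S) = (\<Sum>v\<in>gbox I r. pmeas {x. x + act v \<in> S})"
    unfolding shifts_UN using S by (intro pmeas_UN_disj finite_gbox shift_borel)
  then show ?thesis using S by (simp add: pmeas_shift)
qed

definition shell_const :: real where
  "shell_const = pmeas UNIV * real (card I) * 2 ^ card I"

lemma shell_const_nonneg: "0 \<le> shell_const" by (simp add: shell_const_def)

text \<open>Disjointness of the cubes of radius r bounds the measure of the markers by that of the
  torus over (2 r + 1)^card I, and the shell contributes the number of its lattice points. In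
  \<open>shell_const\<close> one factor 2 comes from the thickness, as both faces of a direction
  count, and the other factors 2 come from t \<le> 2 * r.\<close>

lemma shell_pmeas:
  assumes Y: "marker_set r Y" "1 \<le> r" and st: "0 \<le> s" "s \<le> t" "t \<le> 2 * r"
  shows "pmeas (shifts (gbox I t - gbox I s) Y) \<le> shell_const * (of_int t - of_int s) / of_int r"
proof (cases "card I")
  case 0
  then have "gbox I t = (gbox I s :: (int ^ 'n) set)" by (auto simp: gbox_def)
  moreover have "shell_const = 0" using 0 by (simp only: shell_const_def)
  ultimately show ?thesis by (simp add: shifts_def pmeas_def)
next
  case (Suc k)
  let ?r = "of_int r :: real" and ?s = "of_int s :: real" and ?t = "of_int t :: real"
  have Yb: "Y \<in> sets borel" "periodic Y" using Y by (auto simp: marker_set_def)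
  have "(2 * ?r + 1) ^ card I * pmeas Y = pmeas (shifts (gbox I r) Y)"
    using pmeas_shifts_disj[OF Y(1) _ Yb order_refl] Y(2) by (simp add: card_gbox)
  also have "\<dots> \<le> pmeas UNIV"
    by (intro pmeas_mono shifts_borel Yb) (auto intro: gbox_gvecs)
  finally have Yle: "pmeas Y \<le> pmeas UNIV / (2 * ?r + 1) ^ card I"
    using Y(2) by (simp add: field_simps)
  have "pmeas (shifts (gbox I t - gbox I s) Y) \<le> real (card (gbox I t - gbox I s :: (int ^ 'n) set)) * pmeas Y"
    by (intro pmeas_shifts_le Yb) (auto simp: finite_gbox intro: gbox_gvecs)
  also have "\<dots> \<le> (real (card I) * (2 * (?t - ?s)) * (2 * ?t + 1) ^ k) *
      (pmeas UNIV / (2 * ?r + 1) ^ card I)"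
    using card_shell[OF st(1,2), where I = I] Suc by (intro mult_mono Yle) auto
  also have "\<dots> \<le> (real (card I) * (2 * (?t - ?s)) * (2 * (2 * ?r + 1)) ^ k) *
      (pmeas UNIV / (2 * ?r + 1) ^ card I)"
    using st Y(2) by (intro mult_right_mono mult_left_mono power_mono) auto
  also have "\<dots> = shell_const * (?t - ?s) / (2 * ?r + 1)"
  proof -
    define a where "a = 2 * ?r + 1"
    have "a > 0" using Y(2) by (simp add: a_def)
    then show ?thesis unfolding a_def[symmetric] shell_const_def Suc power_mult_distrib by simp
  qed
  also have "\<dots> \<le> shell_const * (?t - ?s) / ?r"
    using st Y(2) shell_const_nonneg by (intro divide_left_mono mult_nonneg_nonneg) auto
  finally show ?thesis .
qed

text \<open>The Borel-Cantelli lemma is applied inside P; the limit superior of periodic sets is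
  periodic, so it is null if its part in P is null.\<close>

lemma periodic_borel_cantelli:
  assumes A: "\<And>n. A n \<in> sets borel" "\<And>n. periodic (A n)" and "\<And>n. pmeas (A n) \<le> c n" "summable c"
  shows "AE x in lborel. eventually (\<lambda>n. x \<notin> A n) sequentially"
proof -
  define S where "S = (\<Inter>m. \<Union>n\<in>{m..}. A n)"
  have S: "S \<in> sets borel" using A(1) by (auto simp: S_def)
  have "periodic S" using A(2) by (auto simp: S_def periodic_def)
  moreover have "pmeas S = 0"
  proof -
    have "AE x in lborel. eventually (\<lambda>n. x \<in> space lborel - A n \<inter> P) sequentially"
    proof (rule borel_cantelli_AE1)
      show "A n \<inter> P \<in> sets lborel" for n using A by simp
      show "emeasure lborel (A n \<inter> P) < \<infinity>" for n using fmeasurable_P[OF A(1)] by (simp add: fmeasurable_def)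
      show "summable (\<lambda>n. measure lborel (A n \<inter> P))"
        using assms(3) by (intro summable_comparison_test[OF _ assms(4)]) (auto simp: pmeas_def)
    qed
    then have "AE x in lborel. x \<notin> S \<inter> P"
    proof eventually_elim
      fix x assume "eventually (\<lambda>n. x \<in> space lborel - A n \<inter> P) sequentially"
      then obtain N where N: "\<And>n. n \<ge> N \<Longrightarrow> x \<notin> A n \<inter> P" unfolding eventually_sequentially by blast
      show "x \<notin> S \<inter> P"
      proof
        assume x: "x \<in> S \<inter> P"
        then have "x \<in> (\<Union>n\<in>{N..}. A n)" unfolding S_def by blast
        then show False using N x by blast
      qed
    qed
    then have "S \<inter> P \<in> null_sets lborel"
      using S by (subst AE_iff_null_sets) auto
    then have "measure lborel (S \<inter> P) = 0"
      by (simp add: measure_eq_0_null_sets)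
    then show ?thesis by (simp add: pmeas_def)
  qed
  ultimately have "AE x in lborel. x \<notin> S" by (intro pmeas_0_null S)
  then show ?thesis
  proof eventually_elim
    fix x assume "x \<notin> S"
    then show "eventually (\<lambda>n. x \<notin> A n) sequentially"
      unfolding S_def eventually_sequentially by blast
  qed
qed

end

section \<open>Nested cubes exhausting almost every orbit\<close>

lemma sum_nbrs:
  "(\<Sum>a\<in>nbrs I. \<phi> a) = (\<Sum>j\<in>I. \<phi> (axis j 1)) + (\<Sum>j\<in>I. \<phi> (axis j (-1)))"
  for \<phi> :: "int ^ 'n \<Rightarrow> 'b::comm_monoid_add"
proof -
  have "axis i (1::int) \<noteq> axis j (-1)" for i j :: 'n by (simp add: axis_eq_axis)
  then have "(\<Sum>a\<in>nbrs I. \<phi> a) = (\<Sum>a\<in>(\<lambda>i. axis i 1) ` I. \<phi> a) + (\<Sum>a\<in>(\<lambda>i. axis i (-1)) ` I. \<phi> a)"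
    unfolding nbrs_def by (intro sum.union_disjoint) auto
  then show ?thesis
    by (simp add: sum.reindex inj_on_def axis_eq_axis)
qed

lemma axis_minus_one: "axis j (- 1 :: int) = - axis j 1"
  by (auto simp: axis_def vec_eq_iff)

text \<open>The integrality of flows for antisymmetric functions of a vertex and a direction. Each
  edge is represented by its orientation along a positive axis. \<open>Fr\<close> selects the edges
  to be rounded; they stay in V and are selected from both ends, so V with these edges is a finite
  graph of its own.\<close>

lemma lattice_flow_rounding:
  fixes h :: "int ^ 'n \<Rightarrow> int ^ 'n \<Rightarrow> real"
  assumes V: "finite V"
    and Fr: "\<And>u a. u \<in> V \<Longrightarrow> a \<in> nbrs I \<Longrightarrow> Fr u a \<Longrightarrow> u + a \<in> V \<and> Fr (u + a) (- a)"
    and anti: "\<And>u a. u \<in> V \<Longrightarrow> a \<in> nbrs I \<Longrightarrow> Fr u a \<Longrightarrow> h (u + a) (- a) = - h u a"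
    and int: "\<And>u. u \<in> V \<Longrightarrow> (\<Sum>a | a \<in> nbrs I \<and> Fr u a. h u a) \<in> \<int>"
  shows "\<exists>H :: int ^ 'n \<Rightarrow> int ^ 'n \<Rightarrow> int. \<forall>u\<in>V.
    real_of_int (\<Sum>a | a \<in> nbrs I \<and> Fr u a. H u a) = (\<Sum>a | a \<in> nbrs I \<and> Fr u a. h u a) \<and>
    (\<forall>a\<in>nbrs I. Fr u a \<longrightarrow> H (u + a) (- a) = - H u a \<and> \<bar>of_int (H u a) - h u a\<bar> \<le> 1)"
proof -
  define Ed where "Ed = {(u, j). u \<in> V \<and> j \<in> I \<and> Fr u (axis j 1)}"
  define s where "s = (\<lambda>(u :: int ^ 'n, j :: 'n). u)"
  define d where "d = (\<lambda>(u :: int ^ 'n, j :: 'n). u + axis j 1)"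
  define x where "x = (\<lambda>(u, j). h u (axis j 1))"
  have fEd: "finite Ed" using V by (intro finite_subset[of Ed "V \<times> I"]) (auto simp: Ed_def)
  have nb: "axis j 1 \<in> nbrs I" "axis j (-1) \<in> nbrs I" if "j \<in> I" for j
    using that by (auto simp: nbrs_def)
  have fromE: "(u - axis j 1, j) \<in> Ed \<longleftrightarrow> j \<in> I \<and> Fr u (axis j (-1))" if "u \<in> V" for u j
  proof
    assume "(u - axis j 1, j) \<in> Ed"
    then have "u - axis j 1 \<in> V" "j \<in> I" "Fr (u - axis j 1) (axis j 1)" by (auto simp: Ed_def)
    then show "j \<in> I \<and> Fr u (axis j (-1))" using Fr[of "u - axis j 1" "axis j 1"] nb by (simp add: axis_minus_one)
  next
    assume j: "j \<in> I \<and> Fr u (axis j (-1))"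
    then have "u + axis j (-1) \<in> V \<and> Fr (u + axis j (-1)) (- axis j (-1))"
      by (intro Fr that nb) auto
    then show "(u - axis j 1, j) \<in> Ed" using j unfolding axis_minus_one by (simp add: Ed_def)
  qed
  have net: "netflow Ed s d z u = (\<Sum>j | j \<in> I \<and> Fr u (axis j 1). z (u, j)) -
      (\<Sum>j | j \<in> I \<and> Fr u (axis j (-1)). z (u - axis j 1, j))" if u: "u \<in> V" for z u
  proof -
    have "{e. e \<in> Ed \<and> s e = u} = (\<lambda>j. (u, j)) ` {j. j \<in> I \<and> Fr u (axis j 1)}"
      using u unfolding Ed_def s_def by (auto split: prod.splits)
    then have "(\<Sum>e | e \<in> Ed \<and> s e = u. z e) = (\<Sum>j | j \<in> I \<and> Fr u (axis j 1). z (u, j))"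
      by (simp only:) (subst sum.reindex; simp add: inj_on_def)
    moreover have "{e. e \<in> Ed \<and> d e = u} = (\<lambda>j. (u - axis j 1, j)) ` {j. j \<in> I \<and> Fr u (axis j (-1))}"
    proof (intro subset_antisym subsetI)
      fix e assume e: "e \<in> {e. e \<in> Ed \<and> d e = u}"
      obtain v j where vj: "e = (v, j)" by (cases e)
      with e have "v = u - axis j 1" by (auto simp: d_def)
      with e vj have "(u - axis j 1, j) \<in> Ed" by simp
      then have "j \<in> I \<and> Fr u (axis j (-1))" using fromE[OF u] by blast
      then show "e \<in> (\<lambda>j. (u - axis j 1, j)) ` {j. j \<in> I \<and> Fr u (axis j (-1))}"
        using vj \<open>v = u - axis j 1\<close> by blast
    next
      fix e assume "e \<in> (\<lambda>j. (u - axis j 1, j)) ` {j. j \<in> I \<and> Fr u (axis j (-1))}"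
      then show "e \<in> {e. e \<in> Ed \<and> d e = u}" using fromE[OF u] unfolding d_def by auto
    qed
    then have "(\<Sum>e | e \<in> Ed \<and> d e = u. z e) = (\<Sum>j | j \<in> I \<and> Fr u (axis j (-1)). z (u - axis j 1, j))"
      by (simp only:) (subst sum.reindex; simp add: inj_on_def)
    ultimately show ?thesis by (simp add: netflow_def)
  qed
  have split: "(\<Sum>a | a \<in> nbrs I \<and> Fr u a. \<phi> a) =
      (\<Sum>j | j \<in> I \<and> Fr u (axis j 1). \<phi> (axis j 1)) + (\<Sum>j | j \<in> I \<and> Fr u (axis j (-1)). \<phi> (axis j (-1)))"
    for u and \<phi> :: "int ^ 'n \<Rightarrow> real"
  proof -
    have "(\<Sum>a | a \<in> nbrs I \<and> Fr u a. \<phi> a) = (\<Sum>a\<in>nbrs I. if Fr u a then \<phi> a else 0)"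
      by (rule sum.inter_filter[OF finite_nbrs])
    then show ?thesis
      unfolding sum_nbrs by (simp add: sum.inter_filter)
  qed
  have nethh: "netflow Ed s d x u = (\<Sum>a | a \<in> nbrs I \<and> Fr u a. h u a)" if u: "u \<in> V" for u
  proof -
    have "(\<Sum>j | j \<in> I \<and> Fr u (axis j (-1)). h u (axis j (-1))) =
        (\<Sum>j | j \<in> I \<and> Fr u (axis j (-1)). - x (u - axis j 1, j))"
    proof (rule sum.cong[OF refl])
      fix j assume "j \<in> {j. j \<in> I \<and> Fr u (axis j (-1))}"
      then show "h u (axis j (-1)) = - x (u - axis j 1, j)"
        using anti[OF u, of "axis j (-1)"] nb by (simp add: x_def axis_minus_one)
    qed
    then show ?thesis unfolding net[OF u] split by (simp add: x_def sum_negf)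
  qed
  have "netflow Ed s d x u \<in> \<int>" for u
  proof (cases "u \<in> V")
    case False
    have "{e \<in> Ed. s e = u} = {}" using False by (auto simp: Ed_def s_def)
    moreover have "{e \<in> Ed. d e = u} = {}"
    proof -
      have "d e \<in> V" if "e \<in> Ed" for e using that Fr nb by (auto simp: Ed_def d_def)
      then show ?thesis using False by blast
    qed
    ultimately show ?thesis unfolding netflow_def by (simp only:) simp
  qed (simp add: nethh int)
  moreover have "s e \<noteq> d e" if "e \<in> Ed" for e by (auto simp: s_def d_def axis_eq_0_iff split: prod.splits)
  ultimately obtain y where y: "\<forall>e\<in>Ed. y e \<in> \<int> \<and> of_int \<lfloor>x e\<rfloor> \<le> y e \<and> y e \<le> of_int \<lceil>x e\<rceil>"
      "\<forall>v. netflow Ed s d y v = netflow Ed s d x v"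
    using flow_rounding[OF fEd, of s d x] by blast
  define H where "H u a = (if \<exists>j\<in>I. a = axis j 1 then \<lfloor>y (u, SOME j. a = axis j 1)\<rfloor>
    else - \<lfloor>y (u + a, SOME j. a = axis j (-1))\<rfloor>)" for u a
  have Hp: "H u (axis j 1) = \<lfloor>y (u, j)\<rfloor>" if "j \<in> I" for u j
  proof -
    have "(SOME k. axis j (1::int) = axis k 1) = j" by (rule some_equality) (auto simp: axis_eq_axis)
    then show ?thesis unfolding H_def using that by auto
  qed
  have Hm: "H u (axis j (-1)) = - \<lfloor>y (u - axis j 1, j)\<rfloor>" for u j
  proof -
    have "(SOME k. axis j (-1::int) = axis k (-1)) = j" by (rule some_equality) (auto simp: axis_eq_axis)
    moreover have "\<not> (\<exists>k\<in>I. axis j (-1::int) = axis k 1)" by (auto simp: axis_eq_axis)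
    ultimately show ?thesis unfolding H_def by (simp add: axis_minus_one)
  qed
  have yint: "real_of_int \<lfloor>y e\<rfloor> = y e" if "e \<in> Ed" for e
    using y(1) that by (auto elim!: Ints_cases dest!: bspec)
  show ?thesis
  proof (intro exI[of _ H] ballI conjI impI)
    fix u assume u: "u \<in> V"
    have "real_of_int (\<Sum>a | a \<in> nbrs I \<and> Fr u a. H u a) = (\<Sum>a | a \<in> nbrs I \<and> Fr u a. real_of_int (H u a))"
      by simp
    also have "\<dots> = (\<Sum>j | j \<in> I \<and> Fr u (axis j 1). y (u, j)) + (\<Sum>j | j \<in> I \<and> Fr u (axis j (-1)). - y (u - axis j 1, j))"
      unfolding split
    proof (intro arg_cong2[where f = "(+)"] sum.cong refl)
      fix j assume j: "j \<in> {j. j \<in> I \<and> Fr u (axis j 1)}"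
      then have "(u, j) \<in> Ed" using u by (auto simp: Ed_def)
      then show "real_of_int (H u (axis j 1)) = y (u, j)" using j yint by (simp add: Hp)
    next
      fix j assume j: "j \<in> {j. j \<in> I \<and> Fr u (axis j (-1))}"
      then have "(u - axis j 1, j) \<in> Ed" using fromE[OF u] by auto
      then show "real_of_int (H u (axis j (-1))) = - y (u - axis j 1, j)" using yint by (simp add: Hm)
    qed
    also have "\<dots> = netflow Ed s d y u" unfolding net[OF u] by (simp add: sum_negf)
    also have "\<dots> = (\<Sum>a | a \<in> nbrs I \<and> Fr u a. h u a)" using y(2) nethh[OF u] by simp
    finally show "real_of_int (\<Sum>a | a \<in> nbrs I \<and> Fr u a. H u a) = (\<Sum>a | a \<in> nbrs I \<and> Fr u a. h u a)" .
    fix a assume a: "a \<in> nbrs I" "Fr u a"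
    have near: "\<bar>real_of_int \<lfloor>y e\<rfloor> - x e\<bar> \<le> 1" if "e \<in> Ed" for e
    proof -
      have "of_int \<lfloor>x e\<rfloor> \<le> y e" "y e \<le> of_int \<lceil>x e\<rceil>" using y(1) that by auto
      moreover have "of_int \<lceil>x e\<rceil> \<le> x e + 1" "x e - 1 \<le> of_int \<lfloor>x e\<rfloor>"
        by linarith+
      ultimately show ?thesis unfolding yint[OF that] by linarith
    qed
    obtain j where j: "j \<in> I" "a = axis j 1 \<or> a = axis j (-1)" using a(1) by (auto simp: nbrs_def)
    have "H (u + a) (- a) = - H u a \<and> \<bar>of_int (H u a) - h u a\<bar> \<le> 1"
      using j(2)
    proof
      assume aj: "a = axis j 1"
      have "(u, j) \<in> Ed" using u j a aj by (auto simp: Ed_def)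
      then show ?thesis using near[of "(u, j)"] j unfolding aj by (simp add: Hp Hm[unfolded axis_minus_one] x_def)
    next
      assume aj: "a = axis j (-1)"
      then have e: "(u - axis j 1, j) \<in> Ed" using fromE[OF u] a j by auto
      have "h (u - axis j 1) (axis j 1) = - h u a"
        using anti[OF u a] unfolding aj axis_minus_one by simp
      then show ?thesis using near[OF e] j unfolding aj by (simp add: Hp Hm[unfolded axis_minus_one] x_def axis_minus_one)
    qed
    then show "H (u + a) (- a) = - H u a" "\<bar>of_int (H u a) - h u a\<bar> \<le> 1" by auto
  qed
qed

context lattice_shift
begin

definition marked :: "nat \<Rightarrow> (real ^ 'n) set" where
  "marked i = (SOME Y. marker_set (rad i) Y)"

lemma marked: "marker_set (rad i) (marked i)"
  unfolding marked_def by (rule someI_ex, rule marker_set_exists) (use rad_ge_512[of i] in linarith)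

lemma marked_borel: "marked i \<in> sets borel" and marked_periodic: "periodic (marked i)"
  using marked[of i] by (auto simp: marker_set_def)

lemma marked_sep: "y \<in> marked i \<Longrightarrow> v \<in> gbox I (3 * rad i) \<Longrightarrow> y + act v \<in> marked i \<Longrightarrow> v = 0"
  using marked[of i] unfolding marker_set_def by blast

text \<open>The cubes of radius \<open>rad i\<close> around the markers \<open>marked i\<close> are kept if they stay away from the
  boundary of every larger marked cube.\<close>

definition good_cube :: "nat \<Rightarrow> (real ^ 'n) set" where
  "good_cube i = marked i - (\<Union>j\<in>{i<..}. shifts (gbox I (rad j + rad i + 3) - gbox I (rad j - rad i - 4)) (marked j))"

text \<open>If the cube of a marker near x is discarded, the marker is within about rad i of the
  boundary of a larger cube, hence x within about 2 * rad i. Outside this set no cube of level i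
  containing x is discarded.\<close>

definition bad_covered :: "nat \<Rightarrow> (real ^ 'n) set" where
  "bad_covered i = (\<Union>j\<in>{i<..}. shifts (gbox I (rad j + 2 * rad i + 3) - gbox I (rad j - 2 * rad i - 4)) (marked j))"

definition covered :: "nat \<Rightarrow> (real ^ 'n) set" where
  "covered i = shifts (gbox I (rad i)) (marked i)"

lemma gbox_sub_gvecs: "gbox I r - A \<subseteq> gvecs" "gbox I r \<subseteq> gvecs"
  by (auto intro: gbox_gvecs)

lemma good_cube_borel: "good_cube i \<in> sets borel"
  unfolding good_cube_def by (intro sets.Diff sets.countable_UN'' shifts_borel marked_borel gbox_sub_gvecs) auto

lemma good_cube_periodic: "periodic (good_cube i)"
  using marked_periodic shifts_periodic[OF marked_periodic] unfolding good_cube_def periodic_def by simp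

lemma good_cube_mk: "y \<in> good_cube i \<Longrightarrow> y \<in> marked i" by (simp add: good_cube_def)

lemma good_cube_sep: "y \<in> good_cube i \<Longrightarrow> v \<in> gbox I (3 * rad i) \<Longrightarrow> y + act v \<in> good_cube i \<Longrightarrow> v = 0"
  by (auto intro: marked_sep good_cube_mk)

text \<open>A smaller kept cube that comes near a larger one lies deep inside it. The margins 3 and
  4 leave room for the layers of corrections, which reach one step out of each cube.\<close>

lemma good_cube_nested:
  assumes "i < j" "y \<in> good_cube i" "y + act v \<in> good_cube j" "v \<in> gbox I (rad j + rad i + 3)"
  shows "v \<in> gbox I (rad j - rad i - 4)"
  using assms good_cube_mk[OF assms(3)] unfolding good_cube_def[of i] shifts_def by blast

lemma bad_covered_borel: "bad_covered i \<in> sets borel" and bad_covered_periodic: "periodic (bad_covered i)"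
proof -
  show "bad_covered i \<in> sets borel"
    unfolding bad_covered_def by (intro sets.countable_UN'' shifts_borel marked_borel gbox_sub_gvecs) auto
  show "periodic (bad_covered i)"
    using shifts_periodic[OF marked_periodic] unfolding bad_covered_def periodic_def by simp
qed

lemma covered_borel: "covered i \<in> sets borel" and covered_periodic: "periodic (covered i)"
  unfolding covered_def by (auto intro!: shifts_borel shifts_periodic marked_borel marked_periodic gbox_sub_gvecs)

lemma covered_good:
  assumes "x \<in> covered i" "x \<notin> bad_covered i"
  shows "\<exists>v\<in>gbox I (rad i). x + act v \<in> good_cube i"
proof -
  obtain v where v: "v \<in> gbox I (rad i)" "x + act v \<in> marked i"
    using assms(1) by (auto simp: covered_def shifts_def)
  have "x + act v \<notin> shifts (gbox I (rad j + rad i + 3) - gbox I (rad j - rad i - 4)) (marked j)" if "i < j" for j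
  proof
    assume "x + act v \<in> shifts (gbox I (rad j + rad i + 3) - gbox I (rad j - rad i - 4)) (marked j)"
    then obtain u where u: "u \<in> gbox I (rad j + rad i + 3)" "u \<notin> gbox I (rad j - rad i - 4)" "x + act v + act u \<in> marked j"
      by (auto simp: shifts_def)
    have "v + u \<in> gbox I (rad j + 2 * rad i + 3)" using gbox_add[OF v(1) u(1)] by (simp add: algebra_simps)
    moreover have "v + u \<notin> gbox I (rad j - 2 * rad i - 4)"
    proof
      assume "v + u \<in> gbox I (rad j - 2 * rad i - 4)"
      from gbox_diff[OF this v(1)] have "u \<in> gbox I (rad j - 2 * rad i - 4 + rad i)" by simp
      then show False using u(2) by (simp add: algebra_simps)
    qed
    moreover have "x + act (v + u) \<in> marked j" using u(3) by (simp add: act_add add.assoc)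
    ultimately have "x \<in> shifts (gbox I (rad j + 2 * rad i + 3) - gbox I (rad j - 2 * rad i - 4)) (marked j)"
      unfolding shifts_def by blast
    then have "x \<in> bad_covered i" using \<open>i < j\<close> unfolding bad_covered_def by blast
    then show False using assms(2) by simp
  qed
  then have "x + act v \<in> good_cube i" using v(2) unfolding good_cube_def by blast
  then show ?thesis using v by blast
qed

text \<open>The shells have thickness 4 * rad i + 7, at most 11 * rad i, which relative to rad j is
  at most 11 * 2^-(i + j). Summing 2^-j over j gives the factor 2 in 22.\<close>

lemma bad_covered_pmeas: "pmeas (bad_covered i) \<le> 22 * shell_const * (1/2) ^ i"
proof -
  define B where "B j = shifts (gbox I (rad j + 2 * rad i + 3) - gbox I (rad j - 2 * rad i - 4)) (marked j)" for j
  define c where "c j = 11 * shell_const * (1/2) ^ i * (1/2) ^ j" for j :: nat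
  have B_borel: "B j \<in> sets borel" for j unfolding B_def by (intro shifts_borel marked_borel gbox_sub_gvecs)
  have c0: "c j \<ge> 0" for j using shell_const_nonneg by (simp add: c_def)
  have Bc: "pmeas (B j) \<le> c j" if ij: "i < j" for j
  proof -
    have r: "rad i \<ge> 512" "rad j \<ge> 512" by (rule rad_ge_512)+
    have "8 * rad i \<le> rad j" by (rule rad_less[OF ij])
    have "pmeas (B j) \<le> shell_const * (of_int (rad j + 2 * rad i + 3) - of_int (rad j - 2 * rad i - 4)) / of_int (rad j)"
      unfolding B_def by (rule shell_pmeas[OF marked]) (use r \<open>8 * rad i \<le> rad j\<close> in linarith)+
    also have "\<dots> \<le> shell_const * (11 * of_int (rad i)) / of_int (rad j)"
    proof (intro divide_right_mono mult_left_mono shell_const_nonneg)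
      have "(rad j + 2 * rad i + 3) - (rad j - 2 * rad i - 4) \<le> 11 * rad i" using r by linarith
      then show "of_int (rad j + 2 * rad i + 3) - of_int (rad j - 2 * rad i - 4) \<le> (11 * of_int (rad i) :: real)"
        by linarith
      show "0 \<le> (of_int (rad j) :: real)" using r by linarith
    qed
    also have "\<dots> \<le> c j"
    proof -
      have "of_int (rad i) * (2 ^ i * 2 ^ j) \<le> (of_int (rad j) :: real)"
      proof -
        have "real_of_int (rad i * (2 ^ i * 2 ^ j)) \<le> real_of_int (rad j)"
          using rad_ratio[OF ij] by (simp only: of_int_le_iff)
        then show ?thesis by simp
      qed
      then have "of_int (rad i) / of_int (rad j) \<le> (1 / 2) ^ i * (1 / 2 :: real) ^ j"
        using r by (simp add: field_simps power_divide)
      then have "11 * shell_const * (of_int (rad i) / of_int (rad j)) \<le> 11 * shell_const * ((1 / 2) ^ i * (1 / 2) ^ j)"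
        using shell_const_nonneg by (intro mult_left_mono) auto
      then show ?thesis by (simp add: c_def mult_ac)
    qed
    finally show ?thesis .
  qed
  have sums: "c sums (11 * shell_const * (1/2) ^ i * 2)"
    unfolding c_def by (intro sums_mult) (use geometric_sums[of "1/2 :: real"] in simp)
  have eq: "bad_covered i \<inter> P = (\<Union>j. (if i < j then B j \<inter> P else {}))"
    by (auto simp: bad_covered_def B_def)
  have "emeasure lborel (bad_covered i \<inter> P) \<le> (\<Sum>j. emeasure lborel (if i < j then B j \<inter> P else {}))"
    unfolding eq by (rule emeasure_subadditive_countably) (use B_borel in auto)
  also have "\<dots> \<le> (\<Sum>j. ennreal (c j))"
  proof (rule suminf_le)
    fix j
    show "emeasure lborel (if i < j then B j \<inter> P else {}) \<le> ennreal (c j)"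
      using Bc[of j] fmeasurable_P[OF B_borel[of j]]
      by (auto simp: pmeas_def emeasure_eq_measure2 ennreal_leI)
  qed auto
  also have "\<dots> = ennreal (11 * shell_const * (1/2) ^ i * 2)"
    using sums c0 by (intro suminf_ennreal_eq) auto
  finally have "ennreal (pmeas (bad_covered i)) \<le> ennreal (11 * shell_const * (1/2) ^ i * 2)"
    using fmeasurable_P[OF bad_covered_borel] by (simp add: pmeas_def emeasure_eq_measure2)
  then show ?thesis using shell_const_nonneg by (subst (asm) ennreal_le_iff) auto
qed

text \<open>If x + act v is covered at level i and x is not, then x lies in a shell of fixed width n
  just outside a cube of radius rad i. The measures of these shells are summable, so almost every x
  meets only finitely many of them. In the limit being covered is thus a property of the
  orbit.\<close>

lemma AE_cov_invariant:
  "AE x in lborel. \<forall>v\<in>gvecs. eventually (\<lambda>i. x + act v \<in> covered i \<longrightarrow> x \<in> covered i) sequentially"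
proof -
  have "AE x in lborel. eventually (\<lambda>i. x + act v \<in> covered i \<longrightarrow> x \<in> covered i) sequentially" if v: "v \<in> gvecs" for v
  proof -
    obtain n where n: "v \<in> gbox I (int n)" using v unfolding gvecs_eq by blast
    define A where "A i = (if int n \<le> rad i then shifts (gbox I (rad i + int n) - gbox I (rad i)) (marked i) else {})" for i
    have "AE x in lborel. eventually (\<lambda>i. x \<notin> A i) sequentially"
    proof (rule periodic_borel_cantelli)
      show "A i \<in> sets borel" for i unfolding A_def by (auto intro!: shifts_borel marked_borel gbox_sub_gvecs)
      show "periodic (A i)" for i
        using shifts_periodic[OF marked_periodic] by (auto simp: A_def periodic_def)
      show "summable (\<lambda>i. shell_const * real n * (1/2) ^ i)"
        by (intro summable_mult summable_geometric) simp
      show "pmeas (A i) \<le> shell_const * real n * (1/2) ^ i" for i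
      proof (cases "int n \<le> rad i")
        case True
        have r: "rad i \<ge> 512" by (rule rad_ge_512)
        have "pmeas (A i) \<le> shell_const * (of_int (rad i + int n) - of_int (rad i)) / of_int (rad i)"
          using True r shell_pmeas[OF marked, of i "rad i" "rad i + int n"] by (simp add: A_def)
        also have "\<dots> = shell_const * real n * (1 / of_int (rad i))" by simp
        also have "\<dots> \<le> shell_const * real n * (1/2) ^ i"
        proof (intro mult_left_mono)
          have "(2::int) ^ i \<le> rad i" using rad_ge[of i] zero_le_power[of "2::int" i] by linarith
          then have "real_of_int (2 ^ i) \<le> of_int (rad i)" by (simp only: of_int_le_iff)
          then have "(2::real) ^ i \<le> of_int (rad i)" by simp
          then show "1 / of_int (rad i) \<le> (1/2 :: real) ^ i"
            by (simp add: power_divide frac_le)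
        qed (use shell_const_nonneg in auto)
        finally show ?thesis .
      next
        case False
        then show ?thesis using shell_const_nonneg by (simp add: A_def pmeas_def)
      qed
    qed
    then show ?thesis
    proof eventually_elim
      fix x assume "eventually (\<lambda>i. x \<notin> A i) sequentially"
      moreover have "eventually (\<lambda>i. int n \<le> rad i) sequentially"
      proof (rule eventually_sequentiallyI[of n])
        fix i assume "n \<le> i"
        have "int i < int (2 ^ i)" by (simp only: of_nat_less_iff less_exp)
        then have "int i \<le> 2 ^ i" by simp
        then show "int n \<le> rad i" using \<open>n \<le> i\<close> rad_ge[of i] by linarith
      qed
      ultimately show "eventually (\<lambda>i. x + act v \<in> covered i \<longrightarrow> x \<in> covered i) sequentially"
      proof eventually_elim
        fix i assume A: "x \<notin> A i" and i: "int n \<le> rad i"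
        show "x + act v \<in> covered i \<longrightarrow> x \<in> covered i"
        proof (rule impI, rule ccontr)
          assume "x + act v \<in> covered i" and no: "x \<notin> covered i"
          then obtain u where u: "u \<in> gbox I (rad i)" "x + act v + act u \<in> marked i"
            by (auto simp: covered_def shifts_def)
          then have 1: "x + act (u + v) \<in> marked i" by (simp add: act_add ac_simps)
          have 2: "u + v \<in> gbox I (rad i + int n)" by (rule gbox_add[OF u(1) n])
          have 3: "u + v \<notin> gbox I (rad i)" using no 1 by (auto simp: covered_def shifts_def)
          show False using A i 1 2 3 unfolding A_def shifts_def by auto
        qed
      qed
    qed
  qed
  then show ?thesis using countable_gvecs by (simp add: AE_ball_countable)
qed

text \<open>\<open>Z'\<close> consists of the points whose translates are all covered at finitely
  many levels only. At each level the cubes fill at least the fraction \<open>\<kappa>\<close> of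
  \<open>Z'\<close>, so the part not covered from level i on has at most 1 - \<open>\<kappa>\<close>
  times its measure. But these parts increase to \<open>Z'\<close>, which forces measure 0.
  Invariance is what allows the density of the cubes to be computed inside the set.\<close>

lemma AE_cov_frequently: "AE x in lborel. frequently (\<lambda>i. x \<in> covered i) sequentially"
proof -
  define T where "T m = (\<Inter>i\<in>{m..}. - covered i)" for m
  define Z where "Z = (\<Union>m. T m)"
  define Z' where "Z' = (\<Inter>v\<in>gvecs. {x. x + act v \<in> Z})"
  have T_borel: "T m \<in> sets borel" for m unfolding T_def using covered_borel by (intro sets.countable_INT'') auto
  have Z_borel: "Z \<in> sets borel" unfolding Z_def using T_borel by auto
  have "gvecs \<noteq> {}" using gvecs_0 by blast
  then have Z'_borel: "Z' \<in> sets borel" unfolding Z'_def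
    using shift_borel[OF Z_borel] by (intro sets.countable_INT' countable_gvecs) auto
  have T_per: "periodic (T m)" for m using covered_periodic by (auto simp: T_def periodic_def)
  have Z_per: "periodic Z" using T_per by (auto simp: Z_def periodic_def)
  have Z'_per: "periodic Z'"
    using periodic_shift[OF Z_per] by (auto simp: Z'_def periodic_def)
  have Z'_inv: "x + act v \<in> Z' \<longleftrightarrow> x \<in> Z'" if "v \<in> gvecs" for x v
  proof -
    have imp: "x + act v \<in> Z'" if v: "v \<in> gvecs" and x: "x \<in> Z'" for x v
    proof -
      have "x + act v + act u \<in> Z" if "u \<in> gvecs" for u
        using x gvecs_add[OF v that] unfolding Z'_def by (auto simp: act_add add.assoc)
      then show ?thesis by (simp add: Z'_def)
    qed
    show ?thesis
      using imp[OF that, of x] imp[OF gvecs_uminus[OF that], of "x + act v"] by (auto simp: act_uminus)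
  qed
  have Z'Z: "Z' \<subseteq> Z"
  proof
    fix x assume "x \<in> Z'"
    then have "x + act 0 \<in> Z" unfolding Z'_def using gvecs_0 by blast
    then show "x \<in> Z" by simp
  qed
  define \<kappa> where "\<kappa> = (1/3 :: real) ^ card I"
  have \<kappa>: "\<kappa> > 0" by (simp add: \<kappa>_def)
  have key: "\<kappa> * pmeas Z' \<le> pmeas Z' - pmeas (T i \<inter> Z')" for i
  proof -
    have r: "rad i \<ge> 512" by (rule rad_ge_512)
    define S where "S = marked i \<inter> Z'"
    have S: "S \<in> sets borel" "periodic S" "S \<subseteq> marked i"
      using marked_borel marked_periodic Z'_borel Z'_per by (auto simp: S_def periodic_def)
    have "Z' \<subseteq> shifts (gbox I (3 * rad i)) S"
    proof
      fix x assume x: "x \<in> Z'"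
      have "x \<in> shifts (gbox I (3 * rad i)) (marked i)" using marked[of i] by (auto simp: marker_set_def)
      then obtain v where v: "v \<in> gbox I (3 * rad i)" "x + act v \<in> marked i" by (auto simp: shifts_def)
      then have "x + act v \<in> S" using Z'_inv[OF gbox_gvecs[OF v(1)]] x by (simp add: S_def)
      then show "x \<in> shifts (gbox I (3 * rad i)) S" using v by (auto simp: shifts_def)
    qed
    then have "pmeas Z' \<le> pmeas (shifts (gbox I (3 * rad i)) S)"
      by (intro pmeas_mono shifts_borel S Z'_borel gbox_sub_gvecs)
    also have "\<dots> \<le> real (card (gbox I (3 * rad i) :: (int ^ 'n) set)) * pmeas S"
      by (intro pmeas_shifts_le finite_gbox gbox_sub_gvecs S)
    also have "real (card (gbox I (3 * rad i) :: (int ^ 'n) set)) = (2 * of_int (3 * rad i) + 1) ^ card I"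
      using r by (intro card_gbox) auto
    also have "\<dots> \<le> (3 * (2 * of_int (rad i) + 1)) ^ card I"
      using r by (intro power_mono) auto
    finally have "pmeas Z' \<le> (3 * (2 * of_int (rad i) + 1)) ^ card I * pmeas S"
      by (simp add: mult_right_mono)
    moreover have "shifts (gbox I (rad i)) S = covered i \<inter> Z'"
      using Z'_inv[OF gbox_gvecs] by (auto simp: shifts_def S_def covered_def)
    then have "pmeas (covered i \<inter> Z') = (2 * of_int (rad i) + 1) ^ card I * pmeas S"
      using pmeas_shifts_disj[OF marked _ S] r by (simp add: card_gbox)
    ultimately have "\<kappa> * pmeas Z' \<le> pmeas (covered i \<inter> Z')"
      unfolding \<kappa>_def power_mult_distrib by (simp add: power_divide field_simps)
    moreover have "pmeas (covered i \<inter> Z') + pmeas (T i \<inter> Z') \<le> pmeas Z'"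
    proof -
      define f where "f b = (if b then covered i \<inter> Z' else T i \<inter> Z')" for b
      have "pmeas (\<Union>b\<in>{True, False}. f b) = (\<Sum>b\<in>{True, False}. pmeas (f b))"
        by (rule pmeas_UN_disj)
           (use covered_borel T_borel Z'_borel in \<open>auto simp: f_def T_def disjoint_family_on_def\<close>)
      moreover have "pmeas (\<Union>b\<in>{True, False}. f b) \<le> pmeas Z'"
        by (rule pmeas_mono) (use covered_borel T_borel Z'_borel in \<open>auto simp: f_def\<close>)
      ultimately show ?thesis by (simp add: f_def)
    qed
    ultimately show ?thesis by linarith
  qed
  have "(\<lambda>i. measure lborel (T i \<inter> Z' \<inter> P)) \<longlonglongrightarrow> measure lborel (\<Union>i. T i \<inter> Z' \<inter> P)"
  proof (rule Lim_measure_incseq)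
    show "range (\<lambda>i. T i \<inter> Z' \<inter> P) \<subseteq> sets lborel" using T_borel Z'_borel by auto
    show "incseq (\<lambda>i. T i \<inter> Z' \<inter> P)" by (auto simp: incseq_def T_def)
    have "(\<Union>i. T i \<inter> Z' \<inter> P) = Z' \<inter> P" using Z'Z by (auto simp: Z_def)
    then show "emeasure lborel (\<Union>i. T i \<inter> Z' \<inter> P) \<noteq> \<infinity>"
      using fmeasurable_P[OF Z'_borel] by (simp add: fmeasurable_def less_top)
  qed
  moreover have "(\<Union>i. T i \<inter> Z' \<inter> P) = Z' \<inter> P" using Z'Z by (auto simp: Z_def)
  ultimately have "(\<lambda>i. pmeas Z' - pmeas (T i \<inter> Z')) \<longlonglongrightarrow> pmeas Z' - pmeas Z'"
    unfolding pmeas_def by (intro tendsto_diff tendsto_const) simp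
  then have "\<kappa> * pmeas Z' \<le> pmeas Z' - pmeas Z'"
    by (rule LIMSEQ_le_const) (use key in blast)
  then have "pmeas Z' = 0" using \<kappa> pmeas_nonneg[of Z'] by (simp add: mult_le_0_iff)
  then have "AE x in lborel. x \<notin> Z'" by (rule pmeas_0_null[OF Z'_borel Z'_per])
  moreover have "AE x in lborel. \<forall>u\<in>gvecs. \<forall>v\<in>gvecs.
      eventually (\<lambda>i. x + act u + act v \<in> covered i \<longrightarrow> x + act u \<in> covered i) sequentially"
    using AE_cov_invariant countable_gvecs AE_lborel_shift by (subst AE_ball_countable) blast+
  ultimately show ?thesis
  proof eventually_elim
    fix x assume x: "x \<notin> Z'"
      and inv: "\<forall>u\<in>gvecs. \<forall>v\<in>gvecs. eventually (\<lambda>i. x + act u + act v \<in> covered i \<longrightarrow> x + act u \<in> covered i) sequentially"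
    obtain u where u: "u \<in> gvecs" "x + act u \<notin> Z" using x unfolding Z'_def by blast
    have "frequently (\<lambda>i. x + act u \<in> covered i) sequentially"
      using u(2) unfolding Z_def T_def frequently_def eventually_sequentially by blast
    moreover have "eventually (\<lambda>i. x + act 0 + act u \<in> covered i \<longrightarrow> x + act 0 \<in> covered i) sequentially"
      using inv u(1) gvecs_0 by blast
    ultimately show "frequently (\<lambda>i. x \<in> covered i) sequentially"
      by (auto elim: frequently_rev_mp eventually_mono)
  qed
qed

text \<open>Almost every point is covered at infinitely many levels, and at all but finitely many of
  these its cube is kept.\<close>

lemma AE_good_cube: "AE x in lborel. \<exists>i. \<exists>v\<in>gbox I (rad i). x + act v \<in> good_cube i"
proof -
  have "summable (\<lambda>i. 22 * shell_const * (1/2) ^ i)"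
    by (intro summable_mult summable_geometric) simp
  then have "AE x in lborel. eventually (\<lambda>i. x \<notin> bad_covered i) sequentially"
    by (rule periodic_borel_cantelli[OF bad_covered_borel bad_covered_periodic bad_covered_pmeas])
  then show ?thesis using AE_cov_frequently
  proof eventually_elim
    fix x assume "eventually (\<lambda>i. x \<notin> bad_covered i) sequentially" "frequently (\<lambda>i. x \<in> covered i) sequentially"
    then have "frequently (\<lambda>i. x \<in> covered i \<and> x \<notin> bad_covered i) sequentially"
      using frequently_eventually_frequently by fastforce
    then obtain i where "x \<in> covered i" "x \<notin> bad_covered i" using frequently_ex by blast
    then show "\<exists>i. \<exists>v\<in>gbox I (rad i). x + act v \<in> good_cube i" using covered_good by blast
  qed
qed

end

section \<open>Integral flows\<close>

lemma map_list_measurable: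
  fixes d :: "'u \<Rightarrow> 'x \<Rightarrow> 'c"
  assumes "\<And>u c. u \<in> set us \<Longrightarrow> {x. d u x = c} \<in> sets M" "space M = UNIV"
  shows "{x. map (\<lambda>u. d u x) us = L} \<in> sets M"
  using assms(1)
proof (induction us arbitrary: L)
  case Nil
  have "{x. map (\<lambda>u. d u x) [] = L} = (if L = [] then space M else {})" using assms(2) by auto
  then show ?case by simp
next
  case (Cons u us)
  show ?case
  proof (cases L)
    case Nil
    then have "{x. map (\<lambda>u. d u x) (u # us) = L} = {}" by auto
    then show ?thesis by simp
  next
    case (Cons c L')
    then have "{x. map (\<lambda>u. d u x) (u # us) = L} = {x. d u x = c} \<inter> {x. map (\<lambda>u. d u x) us = L'}" by auto
    then show ?thesis using Cons.IH[of L'] Cons.prems by auto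
  qed
qed

text \<open>\<open>f x a\<close> is the flow from x to x + act a; both orientations of an edge are
  recorded and tied by \<open>f_anti\<close>. Only the divergences are integral at this
  point.\<close>

locale lattice_flow = lattice_shift La w I P
  for La :: "(real ^ 'n) set" and w I P +
  fixes f :: "real ^ 'n \<Rightarrow> int ^ 'n \<Rightarrow> real" and B :: real
  assumes f_meas: "\<And>a. a \<in> nbrs I \<Longrightarrow> (\<lambda>x. f x a) \<in> borel_measurable borel"
    and f_per: "\<And>x l a. l \<in> La \<Longrightarrow> f (x + l) a = f x a"
    and f_anti: "\<And>x a. a \<in> nbrs I \<Longrightarrow> f (x + act a) (- a) = - f x a"
    and f_bound: "\<And>x a. a \<in> nbrs I \<Longrightarrow> \<bar>f x a\<bar> \<le> B"
    and f_int: "\<And>x. (\<Sum>a\<in>nbrs I. f x a) \<in> \<int>"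
begin

section \<open>Corrections around the kept cubes\<close>

definition orbit_flow :: "real ^ 'n \<Rightarrow> int ^ 'n \<Rightarrow> int ^ 'n \<Rightarrow> real" where
  "orbit_flow y v a = f (y + act v) a"

definition edge_values :: "nat \<Rightarrow> real ^ 'n \<Rightarrow> (int ^ 'n) \<times> (int ^ 'n) \<Rightarrow> real" where
  "edge_values i y = boundary_value I (rad i) (\<lambda>(v, a). orbit_flow y v a)"

definition is_corr :: "nat \<Rightarrow> real ^ 'n \<Rightarrow> (int ^ 'n \<Rightarrow> int ^ 'n \<Rightarrow> real) \<Rightarrow> bool" where
  "is_corr i y \<delta> \<longleftrightarrow> (\<forall>u c. \<delta> (u + c) (- c) = - \<delta> u c) \<and> (\<forall>u. (\<Sum>c\<in>nbrs I. \<delta> u c) = 0) \<and>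
    (\<forall>u c. \<delta> u c \<noteq> 0 \<longrightarrow> u \<in> gbox I (rad i + 1) \<and> u \<notin> gbox I (rad i - 1)) \<and>
    (\<forall>u c. \<bar>\<delta> u c\<bar> \<le> 8 * real (card (gbox I 2 \<times> nbrs I))) \<and>
    (\<forall>(u, c)\<in>boundary I (rad i). orbit_flow y u c + \<delta> u c = edge_values i y (u, c) \<and> edge_values i y (u, c) \<in> \<int>)"

lemma corr_exists:
  assumes "card I \<ge> 2"
  shows "\<exists>\<delta>. is_corr i y \<delta>"
  unfolding is_corr_def edge_values_def
proof (rule cube_correction[OF assms])
  show "1 \<le> rad i" using rad_ge_512[of i] by linarith
  show "orbit_flow y (v + a) (- a) = - orbit_flow y v a" if "a \<in> nbrs I" for v a
    using f_anti[OF that, of "y + act v"] by (simp add: orbit_flow_def act_add add.assoc)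
  show "(\<Sum>a\<in>nbrs I. orbit_flow y v a) \<in> \<int>" for v
    using f_int by (simp add: orbit_flow_def)
qed

text \<open>A correction chosen without regard to measurability. Only its values on the edges
  leaving the cube enter Borel data later, and there the corrected flow is
  \<open>edge_values\<close>, an explicit Borel function.\<close>

definition cube_corr :: "nat \<Rightarrow> real ^ 'n \<Rightarrow> int ^ 'n \<Rightarrow> int ^ 'n \<Rightarrow> real" where
  "cube_corr i y = (SOME \<delta>. is_corr i y \<delta>)"

definition near_cube :: "real ^ 'n \<Rightarrow> nat \<times> (int ^ 'n) \<Rightarrow> bool" where
  "near_cube x = (\<lambda>(i, v). x + act v \<in> good_cube i \<and> v \<in> gbox I (rad i + 1) \<and> v \<notin> gbox I (rad i - 1))"

text \<open>Layers of one level are disjoint because markers are separated by 3 * rad i; at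
  different levels the smaller cube with its layer lies strictly inside the larger cube, away from
  its boundary.\<close>

lemma near_cube_unique:
  assumes "near_cube x (i, v)" "near_cube x (j, u)"
  shows "(i, v) = (j, u)"
proof -
  have *: "(i, v) = (j, u)" if "near_cube x (i, v)" "near_cube x (j, u)" "i \<le> j" for i j u v
  proof -
    have v: "x + act v \<in> good_cube i" "v \<in> gbox I (rad i + 1)" "v \<notin> gbox I (rad i - 1)"
      and u: "x + act u \<in> good_cube j" "u \<in> gbox I (rad j + 1)" "u \<notin> gbox I (rad j - 1)"
      using that by (auto simp: near_cube_def)
    have uv: "u - v \<in> gbox I (rad j + 1 + (rad i + 1))" by (rule gbox_diff[OF u(2) v(2)])
    have y: "x + act v + act (u - v) \<in> good_cube j" using u(1) by (simp add: act_diff)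
    show ?thesis
    proof (cases "i = j")
      case True
      have "u - v \<in> gbox I (3 * rad i)"
        using uv True rad_ge_512[of i] gbox_mono[of "rad j + 1 + (rad i + 1)" "3 * rad i" I] by auto
      then have "u - v = 0" using good_cube_sep[OF v(1)] y True by blast
      then show ?thesis using True by simp
    next
      case False
      then have ij: "i < j" using that by simp
      have "u - v \<in> gbox I (rad j + rad i + 3)"
        using uv gbox_mono[of "rad j + 1 + (rad i + 1)" "rad j + rad i + 3" I] by auto
      then have "u - v \<in> gbox I (rad j - rad i - 4)" by (rule good_cube_nested[OF ij v(1) y])
      from gbox_add[OF this v(2)] have "u \<in> gbox I (rad j - rad i - 4 + (rad i + 1))" by simp
      then have "u \<in> gbox I (rad j - 1)"
        using gbox_mono[of "rad j - rad i - 4 + (rad i + 1)" "rad j - 1" I] by auto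
      then show ?thesis using u by simp
    qed
  qed
  show ?thesis using *[OF assms] *[OF assms(2,1)] by (cases "i \<le> j") auto
qed

definition corr :: "real ^ 'n \<Rightarrow> int ^ 'n \<Rightarrow> real" where
  "corr x a = (if \<exists>p. near_cube x p then (\<lambda>(i, v). cube_corr i (x + act v) (- v) a) (SOME p. near_cube x p) else 0)"

definition real_rounded :: "real ^ 'n \<Rightarrow> int ^ 'n \<Rightarrow> real" where
  "real_rounded x a = f x a + corr x a"

lemma corr_eq:
  assumes "near_cube x (i, v)"
  shows "corr x a = cube_corr i (x + act v) (- v) a"
proof -
  have "(SOME p. near_cube x p) = (i, v)"
  proof (rule some_equality)
    show "p = (i, v)" if "near_cube x p" for p using near_cube_unique[OF _ assms] that by (cases p) auto
  qed fact
  then show ?thesis unfolding corr_def using assms by auto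
qed

text \<open>The centre is x + act v, so x and x + act a sit in the cube at - v and a - v. As cubes
  are symmetric, v and v - a tell the same.\<close>

definition crossing :: "real ^ 'n \<Rightarrow> int ^ 'n \<Rightarrow> bool" where
  "crossing x a \<longleftrightarrow> (\<exists>i v. x + act v \<in> good_cube i \<and> (v \<in> gbox I (rad i) \<longleftrightarrow> v - a \<notin> gbox I (rad i)))"

lemma crossing_rev: "crossing (x + act a) (- a) \<longleftrightarrow> crossing x a"
proof -
  have imp: "crossing (x + act a) (- a)" if c: "crossing x a" for x a
  proof -
    obtain i v where iv: "x + act v \<in> good_cube i" "v \<in> gbox I (rad i) \<longleftrightarrow> v - a \<notin> gbox I (rad i)"
      using c by (auto simp: crossing_def)
    have "x + act a + act (v - a) \<in> good_cube i" using iv by (simp add: act_diff)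
    then show ?thesis unfolding crossing_def using iv(2)
      by (intro exI[of _ i] exI[of _ "v - a"]) auto
  qed
  show ?thesis using imp[of x a] imp[of "x + act a" "- a"] by (auto simp: act_uminus)
qed

definition home :: "nat \<Rightarrow> int ^ 'n \<Rightarrow> real ^ 'n \<Rightarrow> bool" where
  "home i v x \<longleftrightarrow> v \<in> gbox I (rad i) \<and> x + act v \<in> good_cube i \<and>
     (\<forall>j<i. \<forall>u\<in>gbox I (rad j). x + act u \<notin> good_cube j)"

lemma home_unique:
  assumes "home i v x" "home j u x"
  shows "i = j \<and> v = u"
proof -
  have ij: "i = j" using assms unfolding home_def by (metis linorder_neqE_nat)
  have "u - v \<in> gbox I (3 * rad i)"
    using assms ij gbox_diff[of u I "rad i" v "rad i"] gbox_mono[of "rad i + rad i" "3 * rad i" I] rad_ge_512[of i]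
    by (auto simp: home_def)
  moreover have "x + act v + act (u - v) \<in> good_cube i" using assms ij by (simp add: home_def act_diff)
  ultimately have "u - v = 0" using assms by (intro good_cube_sep[of "x + act v" i]) (auto simp: home_def)
  then show ?thesis using ij by simp
qed

lemma home_exists:
  assumes "\<exists>i. \<exists>v\<in>gbox I (rad i). x + act v \<in> good_cube i"
  shows "\<exists>i v. home i v x"
proof -
  define i where "i = (LEAST i. \<exists>v\<in>gbox I (rad i). x + act v \<in> good_cube i)"
  have "\<exists>v\<in>gbox I (rad i). x + act v \<in> good_cube i" unfolding i_def using assms by (rule LeastI_ex)
  moreover have "\<forall>j<i. \<forall>u\<in>gbox I (rad j). x + act u \<notin> good_cube j"
    unfolding i_def using not_less_Least by blast
  ultimately show ?thesis unfolding home_def by blast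
qed

text \<open>An edge that crosses no boundary has both ends in the same cubes, hence the same
  smallest cube. The points with a given home thus form a finite piece closed under such edges, and
  this is where the integrality theorem is used.\<close>

lemma home_step:
  assumes "home i v x" "\<not> crossing x a"
  shows "home i (v - a) (x + act a)"
proof -
  have nc: "v \<in> gbox I (rad i) \<longleftrightarrow> v - a \<in> gbox I (rad i)" if "x + act v \<in> good_cube i" for i v
    using assms(2) that unfolding crossing_def by blast
  have "x + act a + act u \<notin> good_cube j" if "j < i" "u \<in> gbox I (rad j)" for u j
  proof
    assume "x + act a + act u \<in> good_cube j"
    then have "x + act (u + a) \<in> good_cube j" by (simp add: act_add ac_simps)
    with nc[OF this] that have "u + a \<in> gbox I (rad j)" by simp
    then show False using \<open>x + act (u + a) \<in> good_cube j\<close> assms(1) that by (auto simp: home_def)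
  qed
  moreover have "x + act a + act (v - a) \<in> good_cube i" using assms by (simp add: home_def act_diff)
  moreover have "v - a \<in> gbox I (rad i)" using assms nc[of v i] by (simp add: home_def)
  ultimately show ?thesis by (simp add: home_def)
qed

text \<open>Almost every point has a home, but a flow also visits its translates. Asking it of the
  whole orbit gives an invariant, periodic Borel set of full measure, inside which no exceptional
  sets occur.\<close>

definition dom :: "(real ^ 'n) set" where
  "dom = {x. \<forall>u\<in>gvecs. \<exists>i. \<exists>v\<in>gbox I (rad i). x + act u + act v \<in> good_cube i}"

lemma dom_borel: "dom \<in> sets borel"
proof -
  have "dom = (\<Inter>u\<in>gvecs. {x. x + act u \<in> (\<Union>i. shifts (gbox I (rad i)) (good_cube i))})"
    by (auto simp: dom_def shifts_def)
  also have "\<dots> \<in> sets borel"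
  proof (intro sets.countable_INT' countable_gvecs)
    show "gvecs \<noteq> {}" using gvecs_0 by blast
    have "(\<Union>i. shifts (gbox I (rad i)) (good_cube i)) \<in> sets borel"
      by (intro sets.countable_UN'' shifts_borel good_cube_borel gbox_sub_gvecs) auto
    then show "(\<lambda>u. {x. x + act u \<in> (\<Union>i. shifts (gbox I (rad i)) (good_cube i))}) ` gvecs \<subseteq> sets borel"
      using shift_borel by blast
  qed
  finally show ?thesis .
qed

lemma dom_periodic: "periodic dom"
proof -
  have "x + l + act u + act v \<in> good_cube i \<longleftrightarrow> x + act u + act v \<in> good_cube i" if "l \<in> La" for x l u v i
  proof -
    have "x + l + act u + act v = (x + act u + act v) + l" by (simp add: algebra_simps)
    then show ?thesis using good_cube_periodic[of i] that unfolding periodic_def by metis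
  qed
  then show ?thesis unfolding periodic_def dom_def by simp
qed

lemma dom_act: "x \<in> dom \<Longrightarrow> v \<in> gvecs \<Longrightarrow> x + act v \<in> dom"
proof -
  assume x: "x \<in> dom" and v: "v \<in> gvecs"
  have "\<exists>i. \<exists>k\<in>gbox I (rad i). x + act v + act u + act k \<in> good_cube i" if "u \<in> gvecs" for u
  proof -
    have "\<exists>i. \<exists>k\<in>gbox I (rad i). x + act (v + u) + act k \<in> good_cube i"
      using x gvecs_add[OF v that] unfolding dom_def by blast
    then show ?thesis by (simp add: act_add add.assoc)
  qed
  then show ?thesis by (simp add: dom_def)
qed

lemma dom_AE: "AE x in lborel. x \<in> dom"
proof -
  have "AE x in lborel. \<forall>u\<in>gvecs. \<exists>i. \<exists>v\<in>gbox I (rad i). x + act u + act v \<in> good_cube i"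
    using AE_lborel_shift[OF AE_good_cube] countable_gvecs by (subst AE_ball_countable) auto
  then show ?thesis by (simp add: dom_def)
qed

end

context lattice_flow
begin

lemma act_add_nbr: "x + act u + act v = x + act (u + v)"
  by (simp add: act_add add.assoc)

definition surplus :: "real ^ 'n \<Rightarrow> int" where "surplus x = \<lfloor>\<Sum>a\<in>nbrs I. f x a\<rfloor>"

lemma surplus_eq: "real_of_int (surplus x) = (\<Sum>a\<in>nbrs I. f x a)"
  unfolding surplus_def using f_int[of x] by (auto elim: Ints_cases)

lemma shift_La: "x + l + act v = x + act v + l"
  by (simp add: algebra_simps)

section \<open>Rounding in rank at least two\<close>

context
  assumes I2: "card I \<ge> 2"
begin

lemma cube_corr: "is_corr i y (cube_corr i y)"
  unfolding cube_corr_def by (rule someI_ex[OF corr_exists[OF I2]])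

lemma cube_corr_near_cube:
  assumes "x + act v \<in> good_cube i" "cube_corr i (x + act v) (- v) a \<noteq> 0"
  shows "near_cube x (i, v)"
proof -
  have "- v \<in> gbox I (rad i + 1)" "- v \<notin> gbox I (rad i - 1)"
    using cube_corr[of i "x + act v"] assms(2) unfolding is_corr_def by blast+
  then show ?thesis using assms(1) by (simp add: near_cube_def)
qed

text \<open>A non-zero correction at one end of an edge is, by antisymmetry in the coordinates of
  the cube, non-zero at the other end; this puts the other end into the layer of the same cube, and
  near cubes are unique. The case of a zero correction follows by exchanging the ends.\<close>

lemma corr_anti: "corr (x + act a) (- a) = - corr x a"
proof -
  have nz: "corr (x + act a) (- a) = - corr x a" if c: "corr x a \<noteq> 0" for x a
  proof -
    obtain i v where near: "near_cube x (i, v)" using c unfolding corr_def by (auto split: if_splits)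
    have d: "corr x a = cube_corr i (x + act v) (- v) a" by (rule corr_eq[OF near])
    have y: "x + act v \<in> good_cube i" using near by (simp add: near_cube_def)
    have y': "x + act a + act (v - a) = x + act v" by (simp add: act_diff)
    have "cube_corr i (x + act v) (- v + a) (- a) = - cube_corr i (x + act v) (- v) a"
      using cube_corr[of i "x + act v"] unfolding is_corr_def by blast
    then have e: "cube_corr i (x + act a + act (v - a)) (- (v - a)) (- a) = - corr x a"
      unfolding y' d by simp
    have "near_cube (x + act a) (i, v - a)"
    proof (rule cube_corr_near_cube[of _ _ _ "- a"])
      show "x + act a + act (v - a) \<in> good_cube i" unfolding y' by (rule y)
      show "cube_corr i (x + act a + act (v - a)) (- (v - a)) (- a) \<noteq> 0" unfolding e using c by simp
    qed
    from corr_eq[OF this, of "- a"] show ?thesis unfolding e .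
  qed
  show ?thesis
  proof (cases "corr x a = 0")
    case True
    show ?thesis
    proof (rule ccontr)
      assume "corr (x + act a) (- a) \<noteq> - corr x a"
      with True have "corr (x + act a) (- a) \<noteq> 0" by simp
      from nz[OF this] this True show False by (simp add: act_uminus)
    qed
  qed (rule nz)
qed

lemma corr_sum: "(\<Sum>a\<in>nbrs I. corr x a) = 0"
proof (cases "\<exists>p. near_cube x p")
  case True
  then obtain i v where near: "near_cube x (i, v)" by auto
  show ?thesis
    unfolding corr_eq[OF near] using cube_corr[of i "x + act v"] unfolding is_corr_def by blast
qed (simp add: corr_def)

definition corr_max :: real where "corr_max = 8 * real (card (gbox I 2 \<times> nbrs I :: ((int ^ 'n) \<times> (int ^ 'n)) set))"

lemma corr_bound: "\<bar>corr x a\<bar> \<le> corr_max"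
proof (cases "\<exists>p. near_cube x p")
  case True
  then obtain i v where near: "near_cube x (i, v)" by auto
  show ?thesis
    unfolding corr_eq[OF near] corr_max_def using cube_corr[of i "x + act v"] unfolding is_corr_def by blast
qed (simp add: corr_def corr_max_def)

lemma real_rounded_anti: "a \<in> nbrs I \<Longrightarrow> real_rounded (x + act a) (- a) = - real_rounded x a"
  by (simp add: real_rounded_def f_anti corr_anti)

lemma real_rounded_sum: "(\<Sum>a\<in>nbrs I. real_rounded x a) = (\<Sum>a\<in>nbrs I. f x a)"
  by (simp add: real_rounded_def sum.distrib corr_sum)

lemma real_rounded_bound: "a \<in> nbrs I \<Longrightarrow> \<bar>real_rounded x a\<bar> \<le> B + corr_max"
  using f_bound[of a x] corr_bound[of x a] unfolding real_rounded_def by linarith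

lemma real_rounded_out:
  assumes "x + act v \<in> good_cube i" "v \<in> gbox I (rad i)" "v - a \<notin> gbox I (rad i)" "a \<in> nbrs I"
  shows "real_rounded x a = edge_values i (x + act v) (- v, a)" "edge_values i (x + act v) (- v, a) \<in> \<int>"
proof -
  have "v \<notin> gbox I (rad i - 1)"
    using assms(3) gbox_diff[of v I "rad i - 1" a 1] nbrs_gbox[OF assms(4)] by auto
  then have near: "near_cube x (i, v)"
    using assms gbox_mono[of "rad i" "rad i + 1" I] by (auto simp: near_cube_def)
  have "- v + a \<notin> gbox I (rad i)"
    using assms(3) gbox_uminus[of "v - a" I "rad i"] by (simp add: minus_diff_eq)
  then have b: "(- v, a) \<in> boundary I (rad i)" using assms by (simp add: boundary_def)
  have o: "orbit_flow (x + act v) (- v) a = f x a" by (simp add: orbit_flow_def act_uminus)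
  have "\<forall>(u, c)\<in>boundary I (rad i). orbit_flow (x + act v) u c + cube_corr i (x + act v) u c = edge_values i (x + act v) (u, c) \<and>
      edge_values i (x + act v) (u, c) \<in> \<int>"
    using cube_corr[of i "x + act v"] unfolding is_corr_def by blast
  from bspec[OF this b] o corr_eq[OF near, of a]
  show "real_rounded x a = edge_values i (x + act v) (- v, a)" "edge_values i (x + act v) (- v, a) \<in> \<int>"
    by (auto simp: real_rounded_def)
qed

lemma real_rounded_in:
  assumes "x + act v \<in> good_cube i" "v \<notin> gbox I (rad i)" "v - a \<in> gbox I (rad i)" "a \<in> nbrs I"
  shows "real_rounded x a = - edge_values i (x + act v) (- v + a, - a)" "edge_values i (x + act v) (- v + a, - a) \<in> \<int>"
proof -
  have y: "x + act a + act (v - a) = x + act v" by (simp add: act_diff)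
  have *: "x + act a + act (v - a) \<in> good_cube i" "v - a - - a \<notin> gbox I (rad i)" unfolding y using assms by auto
  from real_rounded_out[OF *(1) assms(3) *(2)] assms(4) real_rounded_anti[OF assms(4), of x]
  show "real_rounded x a = - edge_values i (x + act v) (- v + a, - a)" "edge_values i (x + act v) (- v + a, - a) \<in> \<int>"
    unfolding y by auto
qed

lemma real_rounded_crossing_int:
  assumes "crossing x a" "a \<in> nbrs I"
  shows "real_rounded x a \<in> \<int>"
proof -
  obtain i v where iv: "x + act v \<in> good_cube i" "v \<in> gbox I (rad i) \<longleftrightarrow> v - a \<notin> gbox I (rad i)"
    using assms(1) by (auto simp: crossing_def)
  show ?thesis
    using real_rounded_out[OF iv(1) _ _ assms(2)] real_rounded_in[OF iv(1) _ _ assms(2)] iv(2)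
    by (cases "v \<in> gbox I (rad i)") auto
qed

text \<open>\<open>None\<close> marks the edges still to be rounded. On crossing edges the flow is
  already integral, so the floor loses nothing; it turns the value into one of a countable
  type.\<close>

definition crossing_value :: "real ^ 'n \<Rightarrow> int ^ 'n \<Rightarrow> int option" where
  "crossing_value x a = (if crossing x a then Some \<lfloor>real_rounded x a\<rfloor> else None)"

lemma edge_values_meas:
  assumes "b \<in> boundary I (rad i)"
  shows "(\<lambda>y. edge_values i y b) \<in> borel_measurable borel"
  unfolding edge_values_def
proof (rule boundary_value_measurable[OF _ assms])
  fix b assume "b \<in> boundary I (rad i)"
  then have "snd b \<in> nbrs I" by (auto simp: boundary_def)
  then have [measurable]: "(\<lambda>x. f x (snd b)) \<in> borel_measurable borel" by (rule f_meas)
  show "(\<lambda>x. case b of (v, a) \<Rightarrow> orbit_flow x v a) \<in> borel_measurable borel"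
    unfolding orbit_flow_def case_prod_unfold
    by (rule measurable_compose[of "\<lambda>x. x + act (fst b)" borel borel "\<lambda>x. f x (snd b)"]) measurable
qed

lemma good_cube_shift_borel: "{x. x + act v \<in> good_cube i} \<in> sets borel"
  by (rule shift_borel[OF good_cube_borel])

lemma edge_values_set_borel:
  assumes "b \<in> boundary I (rad i)"
  shows "{x. edge_values i (x + act v) b = c} \<in> sets borel"
proof -
  have [measurable]: "(\<lambda>y. edge_values i y b) \<in> borel_measurable borel" by (rule edge_values_meas[OF assms])
  have "(\<lambda>x. edge_values i (x + act v) b) \<in> borel_measurable borel"
    by (rule measurable_compose[of "\<lambda>x. x + act v" borel borel "\<lambda>y. edge_values i y b"]) measurable
  then show ?thesis by (simp add: borel_measurable_eq)
qed

definition out_neighbours :: "nat \<Rightarrow> int ^ 'n \<Rightarrow> (int ^ 'n) set" where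
  "out_neighbours i a = {v \<in> gbox I (rad i). v - a \<notin> gbox I (rad i)}"

definition in_neighbours :: "nat \<Rightarrow> int ^ 'n \<Rightarrow> (int ^ 'n) set" where
  "in_neighbours i a = {v \<in> gbox I (rad i + 1). v \<notin> gbox I (rad i) \<and> v - a \<in> gbox I (rad i)}"

lemma finite_outs: "finite (out_neighbours i a)" and finite_ins: "finite (in_neighbours i a)"
  by (auto simp: out_neighbours_def in_neighbours_def finite_gbox)

lemma crossing_cases:
  assumes "a \<in> nbrs I"
  shows "crossing x a \<longleftrightarrow> (\<exists>i. \<exists>v\<in>out_neighbours i a. x + act v \<in> good_cube i) \<or> (\<exists>i. \<exists>v\<in>in_neighbours i a. x + act v \<in> good_cube i)"
proof -
  have "v \<in> gbox I (rad i + 1)" if "v - a \<in> gbox I (rad i)" for v i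
    using gbox_add[OF that nbrs_gbox[OF assms]] by simp
  then show ?thesis unfolding crossing_def out_neighbours_def in_neighbours_def by blast
qed

text \<open>The set is expressed by the kept markers and by \<open>edge_values\<close>, both Borel;
  the arbitrary correction behind \<open>real_rounded\<close> does not appear.\<close>

lemma crossing_value_Some:
  assumes a: "a \<in> nbrs I"
  shows "{x. crossing_value x a = Some z} =
    (\<Union>i. \<Union>v\<in>out_neighbours i a. {x. x + act v \<in> good_cube i} \<inter> {x. edge_values i (x + act v) (- v, a) = of_int z}) \<union>
    (\<Union>i. \<Union>v\<in>in_neighbours i a. {x. x + act v \<in> good_cube i} \<inter> {x. edge_values i (x + act v) (- v + a, - a) = - of_int z})"
    (is "?L = ?R1 \<union> ?R2")
proof (intro subset_antisym subsetI)
  fix x assume "x \<in> ?L"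
  then have c: "crossing x a" "\<lfloor>real_rounded x a\<rfloor> = z" by (auto simp: crossing_value_def split: if_splits)
  then have h: "real_rounded x a = of_int z" using real_rounded_crossing_int[OF c(1) a] by (auto elim: Ints_cases)
  from c(1)[unfolded crossing_cases[OF a]] show "x \<in> ?R1 \<union> ?R2"
  proof (elim disjE exE bexE)
    fix i v assume v: "v \<in> out_neighbours i a" "x + act v \<in> good_cube i"
    then have "edge_values i (x + act v) (- v, a) = of_int z"
      using real_rounded_out(1)[OF v(2) _ _ a] h by (simp add: out_neighbours_def)
    then show ?thesis using v by blast
  next
    fix i v assume v: "v \<in> in_neighbours i a" "x + act v \<in> good_cube i"
    then have "edge_values i (x + act v) (- v + a, - a) = - of_int z"
      using real_rounded_in(1)[OF v(2) _ _ a] h by (simp add: in_neighbours_def)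
    then show ?thesis using v by blast
  qed
next
  fix x assume "x \<in> ?R1 \<union> ?R2"
  then show "x \<in> ?L"
  proof (elim UnE UN_E IntE)
    fix i v assume v: "v \<in> out_neighbours i a" "x \<in> {x. x + act v \<in> good_cube i}" "x \<in> {x. edge_values i (x + act v) (- v, a) = of_int z}"
    then have "crossing x a" unfolding crossing_cases[OF a] by blast
    moreover have "real_rounded x a = of_int z" using real_rounded_out(1)[of x v i a] v a by (simp add: out_neighbours_def)
    ultimately show ?thesis by (simp add: crossing_value_def)
  next
    fix i v assume v: "v \<in> in_neighbours i a" "x \<in> {x. x + act v \<in> good_cube i}"
      "x \<in> {x. edge_values i (x + act v) (- v + a, - a) = - of_int z}"
    then have "crossing x a" unfolding crossing_cases[OF a] by blast
    moreover have "real_rounded x a = of_int z" using real_rounded_in(1)[of x v i a] v a by (simp add: in_neighbours_def)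
    ultimately show ?thesis by (simp add: crossing_value_def)
  qed
qed

lemma crossing_value_borel:
  assumes a: "a \<in> nbrs I"
  shows "{x. crossing_value x a = r} \<in> sets borel"
proof (cases r)
  case None
  have "{x. crossing_value x a = None} = - ((\<Union>i. \<Union>v\<in>out_neighbours i a. {x. x + act v \<in> good_cube i}) \<union> (\<Union>i. \<Union>v\<in>in_neighbours i a. {x. x + act v \<in> good_cube i}))"
    using crossing_cases[OF a] by (auto simp: crossing_value_def)
  also have "\<dots> \<in> sets borel"
    by (intro borel_comp sets.Un sets.countable_UN'' sets.finite_UN finite_outs finite_ins good_cube_shift_borel) auto
  finally show ?thesis using None by simp
next
  case (Some z)
  have b1: "(- v, a) \<in> boundary I (rad i)" if v: "v \<in> out_neighbours i a" for v i
  proof -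
    have "- (v - a) \<notin> gbox I (rad i)" using v unfolding gbox_uminus by (simp add: out_neighbours_def)
    then show ?thesis using v a by (simp add: boundary_def out_neighbours_def)
  qed
  have b2: "(- v + a, - a) \<in> boundary I (rad i)" if v: "v \<in> in_neighbours i a" for v i
  proof -
    have "- (v - a) \<in> gbox I (rad i)" using v unfolding gbox_uminus by (simp add: in_neighbours_def)
    then show ?thesis using v a by (simp add: boundary_def in_neighbours_def)
  qed
  show ?thesis unfolding Some crossing_value_Some[OF a]
    by (intro sets.Un sets.countable_UN'' sets.finite_UN finite_outs finite_ins sets.Int good_cube_shift_borel edge_values_set_borel b1 b2) auto
qed

lemma surplus_borel: "{x. surplus x = z} \<in> sets borel"
proof -
  have [measurable]: "(\<lambda>x. \<Sum>a\<in>nbrs I. f x a) \<in> borel_measurable borel"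
    using f_meas by (intro borel_measurable_sum) auto
  have "{x. surplus x = z} = {x. (\<Sum>a\<in>nbrs I. f x a) = of_int z}"
    using surplus_eq by (metis of_int_eq_iff)
  also have "\<dots> \<in> sets borel" by measurable
  finally show ?thesis .
qed

lemma home_borel: "{x. home i v x} \<in> sets borel"
proof -
  have "{x. home i v x} = (if v \<in> gbox I (rad i) then {x. x + act v \<in> good_cube i} - (\<Union>j\<in>{..<i}. \<Union>u\<in>gbox I (rad j). {x. x + act u \<in> good_cube j}) else {})"
    by (auto simp: home_def)
  also have "\<dots> \<in> sets borel"
    using finite_gbox[of I] good_cube_shift_borel by (auto intro!: sets.Diff sets.finite_UN)
  finally show ?thesis .
qed

text \<open>All that the choice inside a home cube depends on, as a value of a countable type.\<close>

definition nblist :: "(int ^ 'n) list" where "nblist = (SOME as. set as = nbrs I)"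

lemma set_nblist: "set nblist = nbrs I"
  unfolding nblist_def by (rule someI_ex) (rule finite_list[OF finite_nbrs])

definition gblist :: "nat \<Rightarrow> (int ^ 'n) list" where "gblist i = (SOME us. set us = gbox I (rad i))"

lemma set_gblist: "set (gblist i) = gbox I (rad i)"
  unfolding gblist_def by (rule someI_ex) (rule finite_list[OF finite_gbox])

definition cube_data :: "nat \<Rightarrow> real ^ 'n \<Rightarrow> (bool \<times> int option list \<times> int) list" where
  "cube_data i y = map (\<lambda>u. (home i (- u) (y + act u), map (\<lambda>a. crossing_value (y + act u) a) nblist, surplus (y + act u))) (gblist i)"

lemma cube_data_borel: "{y. cube_data i y = L} \<in> sets borel"
  unfolding cube_data_def
proof (rule map_list_measurable)
  fix u :: "int ^ 'n" and c :: "bool \<times> int option list \<times> int"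
  obtain h l z where c: "c = (h, l, z)" by (cases c)
  have "{x. (home i (- u) (x + act u), map (\<lambda>a. crossing_value (x + act u) a) nblist, surplus (x + act u)) = c} =
      (if h then {x. x + act u \<in> {x. home i (- u) x}} else - {x. x + act u \<in> {x. home i (- u) x}}) \<inter>
      {x. x + act u \<in> {x. map (\<lambda>a. crossing_value x a) nblist = l}} \<inter> {x. x + act u \<in> {x. surplus x = z}}"
    by (auto simp: c)
  also have "\<dots> \<in> sets borel"
  proof -
    have "{x. map (\<lambda>a. crossing_value x a) nblist = l} \<in> sets borel"
      by (rule map_list_measurable) (auto simp: set_nblist crossing_value_borel)
    then show ?thesis
      using shift_borel[OF home_borel[of i "- u"], of "act u"] borel_comp[OF shift_borel[OF home_borel[of i "- u"], of "act u"]]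
      by (intro sets.Int shift_borel surplus_borel) auto
  qed
  finally show "{x. (home i (- u) (x + act u), map (\<lambda>a. crossing_value (x + act u) a) nblist, surplus (x + act u)) = c} \<in> sets borel" .
qed simp

lemma cube_data_eqD:
  assumes "cube_data i y = cube_data i y'" "u \<in> gbox I (rad i)"
  shows "home i (- u) (y + act u) \<longleftrightarrow> home i (- u) (y' + act u)"
    "a \<in> nbrs I \<Longrightarrow> crossing_value (y + act u) a = crossing_value (y' + act u) a"
    "surplus (y + act u) = surplus (y' + act u)"
  using assms unfolding cube_data_def set_gblist[symmetric] set_nblist[symmetric] by auto

definition rounded_bound :: int where "rounded_bound = \<lceil>B + corr_max\<rceil> + 1"

text \<open>H is read only where the edge does not cross; together with the crossing values it forms
  an integral flow with the required surplus. The point y occurs only through quantities listed in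
  \<open>cube_data\<close>.\<close>

definition home_rule :: "nat \<Rightarrow> real ^ 'n \<Rightarrow> (int ^ 'n \<Rightarrow> int ^ 'n \<Rightarrow> int) \<Rightarrow> bool" where
  "home_rule i y H \<longleftrightarrow> (\<forall>u\<in>gbox I (rad i). home i (- u) (y + act u) \<longrightarrow>
     (\<Sum>a\<in>nbrs I. case crossing_value (y + act u) a of Some z \<Rightarrow> z | None \<Rightarrow> H u a) = surplus (y + act u) \<and>
     (\<forall>a\<in>nbrs I. crossing_value (y + act u) a = None \<longrightarrow> H (u + a) (- a) = - H u a \<and> \<bar>H u a\<bar> \<le> rounded_bound))"

lemma home_rule_cong:
  assumes "cube_data i y = cube_data i y'" "home_rule i y H"
  shows "home_rule i y' H"
  unfolding home_rule_def
proof (intro ballI impI)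
  fix u assume u: "u \<in> gbox I (rad i)" and h: "home i (- u) (y' + act u)"
  note D = cube_data_eqD[OF assms(1) u]
  have h': "home i (- u) (y + act u)" using h D(1) by simp
  have *: "(\<Sum>a\<in>nbrs I. case crossing_value (y + act u) a of Some z \<Rightarrow> z | None \<Rightarrow> H u a) = surplus (y + act u)"
    "\<forall>a\<in>nbrs I. crossing_value (y + act u) a = None \<longrightarrow> H (u + a) (- a) = - H u a \<and> \<bar>H u a\<bar> \<le> rounded_bound"
    using assms(2) u h' unfolding home_rule_def by blast+
  have "(\<Sum>a\<in>nbrs I. case crossing_value (y' + act u) a of Some z \<Rightarrow> z | None \<Rightarrow> H u a) =
      (\<Sum>a\<in>nbrs I. case crossing_value (y + act u) a of Some z \<Rightarrow> z | None \<Rightarrow> H u a)"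
    using D(2) by (intro sum.cong) auto
  then show "(\<Sum>a\<in>nbrs I. case crossing_value (y' + act u) a of Some z \<Rightarrow> z | None \<Rightarrow> H u a) = surplus (y' + act u) \<and>
     (\<forall>a\<in>nbrs I. crossing_value (y' + act u) a = None \<longrightarrow> H (u + a) (- a) = - H u a \<and> \<bar>H u a\<bar> \<le> rounded_bound)"
    using * D(2,3) by simp
qed

text \<open>The real flow \<open>real_rounded\<close> has integral divergence and integral values on
  crossing edges, so the divergence carried by the remaining edges of a home is integral as well.
  Rounding there changes each value by at most 1, whence the bound.\<close>

lemma home_rule_exists: "\<exists>H. home_rule i y H"
proof -
  define V where "V = {u \<in> gbox I (rad i). home i (- u) (y + act u)}"
  define Fr where "Fr u a \<longleftrightarrow> \<not> crossing (y + act u) a" for u a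
  define h where "h u a = real_rounded (y + act u) a" for u a
  have fV: "finite V" by (simp add: V_def finite_gbox)
  have stepV: "u + a \<in> V \<and> Fr (u + a) (- a)" if u: "u \<in> V" "a \<in> nbrs I" "Fr u a" for u a
  proof -
    have "home i (- u - a) (y + act u + act a)"
      using u by (intro home_step) (auto simp: V_def Fr_def)
    then have *: "home i (- (u + a)) (y + act (u + a))" unfolding act_add_nbr by simp
    then have "- (u + a) \<in> gbox I (rad i)" unfolding home_def by blast
    then have "u + a \<in> gbox I (rad i)" by (simp only: gbox_uminus)
    moreover have "Fr (u + a) (- a)"
      using u(3) crossing_rev[of "y + act u" a] unfolding Fr_def act_add_nbr by simp
    ultimately show ?thesis using * by (simp add: V_def)
  qed
  have anti: "h (u + a) (- a) = - h u a" if "u \<in> V" "a \<in> nbrs I" "Fr u a" for u a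
    using real_rounded_anti[OF that(2), of "y + act u"] unfolding h_def act_add_nbr .
  have split: "(\<Sum>a\<in>nbrs I. h u a) = (\<Sum>a | a \<in> nbrs I \<and> Fr u a. h u a) + (\<Sum>a | a \<in> nbrs I \<and> \<not> Fr u a. h u a)" for u
    using sum.union_disjoint[of "{a \<in> nbrs I. Fr u a}" "{a \<in> nbrs I. \<not> Fr u a}" "h u"] finite_nbrs[of I]
    by (simp add: Un_def Int_def) (metis (mono_tags, lifting) Collect_cong Collect_mem_eq)
  have cross: "of_int \<lfloor>h u a\<rfloor> = h u a" if "a \<in> nbrs I" "\<not> Fr u a" for u a
    using real_rounded_crossing_int[of "y + act u" a] that by (auto simp: Fr_def h_def elim!: Ints_cases)
  have tot: "(\<Sum>a\<in>nbrs I. h u a) = of_int (surplus (y + act u))" for u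
    by (simp add: h_def real_rounded_sum surplus_eq)
  have int: "(\<Sum>a | a \<in> nbrs I \<and> Fr u a. h u a) \<in> \<int>" for u
  proof -
    have "(\<Sum>a | a \<in> nbrs I \<and> \<not> Fr u a. h u a) \<in> \<int>"
    proof (rule Ints_sum)
      fix a assume "a \<in> {a. a \<in> nbrs I \<and> \<not> Fr u a}"
      then show "h u a \<in> \<int>" using cross[of a u] by (metis (no_types, lifting) Ints_of_int mem_Collect_eq)
    qed
    moreover have "(\<Sum>a | a \<in> nbrs I \<and> Fr u a. h u a) =
        of_int (surplus (y + act u)) - (\<Sum>a | a \<in> nbrs I \<and> \<not> Fr u a. h u a)"
      using split[of u] tot[of u] by linarith
    ultimately show ?thesis by simp
  qed
  obtain H :: "int ^ 'n \<Rightarrow> int ^ 'n \<Rightarrow> int" where H: "\<forall>u\<in>V.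
    real_of_int (\<Sum>a | a \<in> nbrs I \<and> Fr u a. H u a) = (\<Sum>a | a \<in> nbrs I \<and> Fr u a. h u a) \<and>
    (\<forall>a\<in>nbrs I. Fr u a \<longrightarrow> H (u + a) (- a) = - H u a \<and> \<bar>of_int (H u a) - h u a\<bar> \<le> 1)"
    using lattice_flow_rounding[OF fV stepV anti int] by blast
  have "home_rule i y H"
    unfolding home_rule_def
  proof (intro ballI impI conjI)
    fix u assume "u \<in> gbox I (rad i)" "home i (- u) (y + act u)"
    then have u: "u \<in> V" by (simp add: V_def)
    note Hu = bspec[OF H u]
    have "real_of_int (\<Sum>a\<in>nbrs I. case crossing_value (y + act u) a of Some z \<Rightarrow> z | None \<Rightarrow> H u a) =
        (\<Sum>a\<in>nbrs I. if Fr u a then real_of_int (H u a) else h u a)"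
      unfolding of_int_sum
      by (intro sum.cong) (use cross in \<open>auto simp: crossing_value_def Fr_def h_def\<close>)
    also have "\<dots> = (\<Sum>a | a \<in> nbrs I \<and> Fr u a. real_of_int (H u a)) + (\<Sum>a | a \<in> nbrs I \<and> \<not> Fr u a. h u a)"
      using finite_nbrs[of I] by (simp add: sum.If_cases Int_def Collect_neg_eq[symmetric])
    also have "(\<Sum>a | a \<in> nbrs I \<and> Fr u a. real_of_int (H u a)) = (\<Sum>a | a \<in> nbrs I \<and> Fr u a. h u a)"
      using Hu by simp
    also have "\<dots> + (\<Sum>a | a \<in> nbrs I \<and> \<not> Fr u a. h u a) = of_int (surplus (y + act u))"
      using split[of u] tot[of u] by simp
    finally show "(\<Sum>a\<in>nbrs I. case crossing_value (y + act u) a of Some z \<Rightarrow> z | None \<Rightarrow> H u a) = surplus (y + act u)"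
      by (simp only: of_int_eq_iff)
    fix a assume a: "a \<in> nbrs I" "crossing_value (y + act u) a = None"
    then have "Fr u a" by (auto simp: crossing_value_def Fr_def split: if_splits)
    then have Ha: "H (u + a) (- a) = - H u a" "\<bar>of_int (H u a) - h u a\<bar> \<le> 1" using Hu a(1) by auto
    show "H (u + a) (- a) = - H u a" by fact
    have "\<bar>h u a\<bar> \<le> B + corr_max" unfolding h_def by (rule real_rounded_bound[OF a(1)])
    with Ha(2) show "\<bar>H u a\<bar> \<le> rounded_bound" unfolding rounded_bound_def by linarith
  qed
  then show ?thesis by blast
qed

text \<open>One flow is chosen for every value of the data, not for every centre. There are
  countably many values, so the choice composed with \<open>cube_data\<close> is Borel.\<close>

definition home_choice :: "nat \<Rightarrow> (bool \<times> int option list \<times> int) list \<Rightarrow> int ^ 'n \<Rightarrow> int ^ 'n \<Rightarrow> int" where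
  "home_choice i L = (SOME H. \<exists>y. cube_data i y = L \<and> home_rule i y H)"

lemma home_choice: "home_rule i y (home_choice i (cube_data i y))"
proof -
  have "\<exists>H. \<exists>z. cube_data i z = cube_data i y \<and> home_rule i z H" using home_rule_exists[of i y] by blast
  from someI_ex[OF this] obtain z where "cube_data i z = cube_data i y" "home_rule i z (home_choice i (cube_data i y))"
    unfolding home_choice_def by blast
  then show ?thesis by (rule home_rule_cong)
qed

text \<open>Crossing edges take their value independently of homes, so the two ends agree even when
  their homes differ. The value 0 without a home only makes the function total.\<close>

definition rounded :: "real ^ 'n \<Rightarrow> int ^ 'n \<Rightarrow> int" where
  "rounded x a = (case crossing_value x a of Some z \<Rightarrow> z | None \<Rightarrow>
     (if \<exists>i v. home i v x then (\<lambda>(i, v). home_choice i (cube_data i (x + act v)) (- v) a) (SOME (i, v). home i v x) else 0))"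

lemma rounded_home:
  assumes "home i v x"
  shows "rounded x a = (case crossing_value x a of Some z \<Rightarrow> z | None \<Rightarrow> home_choice i (cube_data i (x + act v)) (- v) a)"
proof -
  have "(SOME (i, v). home i v x) = (i, v)"
  proof (rule some_equality)
    show "p = (i, v)" if "case p of (i, v) \<Rightarrow> home i v x" for p
    proof (cases p)
      case (Pair j u)
      then show ?thesis using that home_unique[OF _ assms] by blast
    qed
  qed (use assms in simp)
  moreover have "\<exists>i v. home i v x" using assms by blast
  ultimately show ?thesis unfolding rounded_def by (simp split: option.split)
qed

lemma home_rule_at:
  assumes h: "home i v x"
  shows "(\<Sum>a\<in>nbrs I. rounded x a) = surplus x"
    "a \<in> nbrs I \<Longrightarrow> crossing_value x a = None \<Longrightarrow> home_choice i (cube_data i (x + act v)) (- v + a) (- a) = - home_choice i (cube_data i (x + act v)) (- v) a"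
    "a \<in> nbrs I \<Longrightarrow> crossing_value x a = None \<Longrightarrow> \<bar>home_choice i (cube_data i (x + act v)) (- v) a\<bar> \<le> rounded_bound"
proof -
  have x: "x + act v + act (- v) = x" by (simp add: act_uminus)
  have v: "- v \<in> gbox I (rad i)" using h by (simp add: home_def)
  have "home i (- (- v)) (x + act v + act (- v))" unfolding x using h by simp
  with home_choice[of i "x + act v", unfolded home_rule_def, rule_format, OF v]
  have S: "(\<Sum>a\<in>nbrs I. case crossing_value x a of Some z \<Rightarrow> z | None \<Rightarrow> home_choice i (cube_data i (x + act v)) (- v) a) = surplus x \<and>
    (\<forall>a\<in>nbrs I. crossing_value x a = None \<longrightarrow> home_choice i (cube_data i (x + act v)) (- v + a) (- a) = - home_choice i (cube_data i (x + act v)) (- v) a \<and>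
      \<bar>home_choice i (cube_data i (x + act v)) (- v) a\<bar> \<le> rounded_bound)"
    unfolding x by blast
  show "(\<Sum>a\<in>nbrs I. rounded x a) = surplus x" unfolding rounded_home[OF h] using S by blast
  show "a \<in> nbrs I \<Longrightarrow> crossing_value x a = None \<Longrightarrow> home_choice i (cube_data i (x + act v)) (- v + a) (- a) = - home_choice i (cube_data i (x + act v)) (- v) a"
    "a \<in> nbrs I \<Longrightarrow> crossing_value x a = None \<Longrightarrow> \<bar>home_choice i (cube_data i (x + act v)) (- v) a\<bar> \<le> rounded_bound"
    using S by blast+
qed

text \<open>A crossing edge inherits antisymmetry from the real flow. Any other edge has both ends
  in one home, with the same centre and thus the same chosen H.\<close>

lemma rounded_anti:
  assumes h: "home i v x" and a: "a \<in> nbrs I"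
  shows "rounded (x + act a) (- a) = - rounded x a"
proof (cases "crossing x a")
  case True
  then have "crossing (x + act a) (- a)" by (simp add: crossing_rev)
  moreover obtain z where z: "real_rounded x a = of_int z" using real_rounded_crossing_int[OF True a] by (auto elim: Ints_cases)
  ultimately show ?thesis
    using True real_rounded_anti[OF a, of x] by (simp add: rounded_def crossing_value_def del: of_int_minus flip: of_int_minus)
next
  case False
  then have nc: "\<not> crossing (x + act a) (- a)" by (simp add: crossing_rev)
  have h': "home i (v - a) (x + act a)" by (rule home_step[OF h False])
  have y: "x + act a + act (v - a) = x + act v" by (simp add: act_diff)
  have c: "crossing_value x a = None" "crossing_value (x + act a) (- a) = None" using False nc by (auto simp: crossing_value_def)
  show ?thesis
    unfolding rounded_home[OF h] rounded_home[OF h'] y c using home_rule_at(2)[OF h a c(1)] by simp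
qed

lemma rounded_bound:
  assumes h: "home i v x" and a: "a \<in> nbrs I"
  shows "\<bar>rounded x a\<bar> \<le> rounded_bound"
proof (cases "crossing_value x a")
  case None
  then show ?thesis unfolding rounded_home[OF h] using home_rule_at(3)[OF h a] by simp
next
  case (Some z)
  then have "crossing x a" "z = \<lfloor>real_rounded x a\<rfloor>" by (auto simp: crossing_value_def split: if_splits)
  then show ?thesis using real_rounded_bound[OF a, of x] Some by (simp add: rounded_def rounded_bound_def) linarith
qed

lemma rounded_borel:
  assumes a: "a \<in> nbrs I"
  shows "{x. rounded x a = z} \<in> sets borel"
proof -
  have D: "{x. home_choice i (cube_data i (x + act v)) (- v) a = z} \<in> sets borel" for i v
  proof -
    have "{x. home_choice i (cube_data i (x + act v)) (- v) a = z} =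
        (\<Union>L\<in>{L. home_choice i L (- v) a = z}. {x. x + act v \<in> {y. cube_data i y = L}})" by auto
    also have "\<dots> \<in> sets borel"
      by (intro sets.countable_UN'' shift_borel cube_data_borel) auto
    finally show ?thesis .
  qed
  have nohome: "rounded x a = (case crossing_value x a of Some z \<Rightarrow> z | None \<Rightarrow> 0)" if "\<not> (\<exists>i v. home i v x)" for x
    using that unfolding rounded_def by (simp split: option.split)
  define N where "N = - (\<Union>i. \<Union>v\<in>gbox I (rad i). {x. home i v x})"
  have N: "x \<in> N \<longleftrightarrow> \<not> (\<exists>i v. home i v x)" for x
    unfolding N_def by (auto simp: home_def)
  have N_borel: "N \<in> sets borel"
    unfolding N_def by (intro borel_comp sets.countable_UN'' sets.finite_UN finite_gbox home_borel) auto
  have "{x. rounded x a = z} = {x. crossing_value x a = Some z} \<union> ({x. crossing_value x a = None} \<inter>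
      ((\<Union>i. \<Union>v\<in>gbox I (rad i). {x. home i v x} \<inter> {x. home_choice i (cube_data i (x + act v)) (- v) a = z}) \<union>
       (if z = 0 then N else {})))" (is "_ = ?R")
  proof (rule set_eqI)
    fix x
    show "x \<in> {x. rounded x a = z} \<longleftrightarrow> x \<in> ?R"
    proof (cases "\<exists>i v. home i v x")
      case True
      then obtain i v where h: "home i v x" by blast
      have "(\<exists>j. \<exists>u\<in>gbox I (rad j). home j u x \<and> home_choice j (cube_data j (x + act u)) (- u) a = z) \<longleftrightarrow>
          home_choice i (cube_data i (x + act v)) (- v) a = z"
        using home_unique[OF h] h unfolding home_def by metis
      moreover have "x \<notin> N" using True N by blast
      ultimately show ?thesis using rounded_home[OF h, of a] by (cases "crossing_value x a") auto
    next
      case False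
      then have "x \<in> N" using N by blast
      then show ?thesis using nohome[OF False] False by (cases "crossing_value x a") auto
    qed
  qed
  also have "\<dots> \<in> sets borel"
  proof -
    have "(if z = 0 then N else {}) \<in> sets borel" using N_borel by simp
    then show ?thesis
      by (intro sets.Un sets.Int crossing_value_borel[OF a] sets.countable_UN'' sets.finite_UN finite_gbox home_borel D) auto
  qed
  finally show ?thesis .
qed

lemma good_cube_La: "l \<in> La \<Longrightarrow> x + l \<in> good_cube i \<longleftrightarrow> x \<in> good_cube i"
  using good_cube_periodic[of i] by (simp add: periodic_def)

lemma rounded_per:
  assumes l: "l \<in> La"
  shows "rounded (x + l) a = rounded x a"
proof -
  have orbit_flow: "orbit_flow (y + l) = orbit_flow y" for y
    by (intro ext) (simp add: orbit_flow_def shift_La f_per[OF l])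
  have edge_values: "edge_values i (y + l) = edge_values i y" for i y by (simp add: edge_values_def orbit_flow)
  have cube_corr: "cube_corr i (y + l) = cube_corr i y" for i y by (simp add: cube_corr_def is_corr_def edge_values orbit_flow)
  have near_cube: "near_cube (x + l) = near_cube x" for x by (simp add: near_cube_def shift_La good_cube_La[OF l])
  have corr: "corr (x + l) = corr x" for x
    by (intro ext) (simp add: corr_def near_cube shift_La cube_corr)
  have crossing_value: "crossing_value (x + l) = crossing_value x" for x
    by (intro ext) (simp add: crossing_value_def real_rounded_def crossing_def f_per[OF l] corr shift_La good_cube_La[OF l])
  have home: "home i v (x + l) \<longleftrightarrow> home i v x" for i v x
    unfolding home_def by (simp add: shift_La good_cube_La[OF l])
  have surplus: "surplus (x + l) = surplus x" for x by (simp add: surplus_def f_per[OF l])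
  have cube_data: "cube_data i (y + l) = cube_data i y" for i y
    by (simp add: cube_data_def shift_La home crossing_value surplus)
  have "home i v (x + l) = home i v x" "cube_data i (x + l + act v) = cube_data i (x + act v)" for i v
    by (simp_all add: home shift_La cube_data)
  then show ?thesis unfolding rounded_def case_prod_unfold crossing_value by (simp only:)
qed

lemma integer_flow_ge2:
  "\<exists>F K. (\<forall>a\<in>nbrs I. \<forall>z. {x. F x a = z} \<in> sets borel) \<and>
     (\<forall>x. \<forall>l\<in>La. \<forall>a. F (x + l) a = F x a) \<and>
     (\<forall>x\<in>dom. (\<Sum>a\<in>nbrs I. F x a) = surplus x \<and> (\<forall>a\<in>nbrs I. F (x + act a) (- a) = - F x a \<and> \<bar>F x a\<bar> \<le> K))"
proof (intro exI conjI ballI allI)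
  show "{x. rounded x a = z} \<in> sets borel" if "a \<in> nbrs I" for a z by (rule rounded_borel[OF that])
  show "rounded (x + l) a = rounded x a" if "l \<in> La" for x l a by (rule rounded_per[OF that])
  fix x assume "x \<in> dom"
  then have "\<exists>i. \<exists>v\<in>gbox I (rad i). x + act 0 + act v \<in> good_cube i" unfolding dom_def using gvecs_0 by blast
  then obtain i v where h: "home i v x" using home_exists[of x] by auto
  show "(\<Sum>a\<in>nbrs I. rounded x a) = surplus x" by (rule home_rule_at(1)[OF h])
  fix a assume "a \<in> nbrs I"
  then show "rounded (x + act a) (- a) = - rounded x a" "\<bar>rounded x a\<bar> \<le> rounded_bound"
    using rounded_anti[OF h] rounded_bound[OF h] by auto
qed

end

text \<open>On a line the divergence at x is the difference of the flows on the two edges at x. As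
  it is integral, taking floors on all positively oriented edges leaves it unchanged. In rank 0
  there are no edges at all.\<close>

lemma integer_flow_le1:
  assumes "card I \<le> 1"
  shows "\<exists>F K. (\<forall>a\<in>nbrs I. \<forall>z. {x. F x a = z} \<in> sets borel) \<and>
     (\<forall>x. \<forall>l\<in>La. \<forall>a. F (x + l) a = F x a) \<and>
     (\<forall>x\<in>dom. (\<Sum>a\<in>nbrs I. F x a) = surplus x \<and> (\<forall>a\<in>nbrs I. F (x + act a) (- a) = - F x a \<and> \<bar>F x a\<bar> \<le> K))"
proof -
  define pos where "pos a \<longleftrightarrow> (\<exists>j\<in>I. a = axis j (1::int))" for a :: "int ^ 'n"
  define F where "F x a = (if pos a then \<lfloor>f x a\<rfloor> else - \<lfloor>f (x + act a) (- a)\<rfloor>)" for x a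
  have pos_neg: "pos (- a) \<longleftrightarrow> \<not> pos a" if "a \<in> nbrs I" for a
  proof -
    have "\<not> pos (- axis j 1)" for j
    proof
      assume "pos (- axis j 1)"
      then obtain k where "- axis j 1 = axis k (1::int)" by (auto simp: pos_def)
      then have "(- axis j 1) $ k = axis k (1::int) $ k" by simp
      then show False by (simp add: axis_def split: if_splits)
    qed
    moreover have "pos (axis j 1)" if "j \<in> I" for j using that by (auto simp: pos_def)
    ultimately show ?thesis using that by (auto simp: nbrs_def axis_minus_one)
  qed
  have floor_meas: "{x. \<lfloor>\<phi> x\<rfloor> = z} \<in> sets borel" if "\<phi> \<in> borel_measurable borel" for \<phi> :: "real ^ 'n \<Rightarrow> real" and z
  proof -
    note that[measurable]
    have "{x. \<lfloor>\<phi> x\<rfloor> = z} = {x. of_int z \<le> \<phi> x \<and> \<phi> x < of_int z + 1}" by (auto simp: floor_eq_iff)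
    also have "\<dots> \<in> sets borel" by measurable
    finally show ?thesis .
  qed
  show ?thesis
  proof (intro exI[of _ F] exI[of _ "\<lceil>B\<rceil> + 1"] conjI ballI allI)
    fix a z assume a: "a \<in> nbrs I"
    show "{x. F x a = z} \<in> sets borel"
    proof (cases "pos a")
      case True
      then show ?thesis using floor_meas[OF f_meas[OF a]] by (simp add: F_def)
    next
      case False
      have [measurable]: "(\<lambda>x. f x (- a)) \<in> borel_measurable borel" using a by (intro f_meas) simp
      have "(\<lambda>x. f (x + act a) (- a)) \<in> borel_measurable borel"
        by (rule measurable_compose[of "\<lambda>x. x + act a" borel borel "\<lambda>x. f x (- a)"]) measurable
      from floor_meas[OF this, of "- z"] have "{x. - \<lfloor>f (x + act a) (- a)\<rfloor> = z} \<in> sets borel"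
        by (simp add: minus_equation_iff eq_commute)
      then show ?thesis using False by (simp add: F_def)
    qed
  next
    fix x l a assume "l \<in> La"
    then show "F (x + l) a = F x a" using f_per by (simp add: F_def shift_La)
  next
    fix x
    have F_axis: "F x (axis j 1) = \<lfloor>f x (axis j 1)\<rfloor>" "F x (axis j (-1)) = - \<lfloor>- f x (axis j (-1))\<rfloor>" if "j \<in> I" for j
    proof -
      have p: "pos (axis j 1)" using that by (auto simp: pos_def)
      then show "F x (axis j 1) = \<lfloor>f x (axis j 1)\<rfloor>" by (simp add: F_def)
      have nb: "axis j (-1) \<in> nbrs I" "axis j (1::int) \<in> nbrs I" using that by (auto simp: nbrs_def)
      have "\<not> pos (axis j (-1))" using pos_neg[OF nb(2)] p by (simp add: axis_minus_one)
      then show "F x (axis j (-1)) = - \<lfloor>- f x (axis j (-1))\<rfloor>"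
        using f_anti[OF nb(1), of x] by (simp add: F_def)
    qed
    show "(\<Sum>a\<in>nbrs I. F x a) = surplus x"
    proof (cases "card I = 0")
      case True
      then have "nbrs I = {}" by (simp add: nbrs_def)
      then show ?thesis unfolding surplus_def by (simp only:) simp
    next
      case False
      then have "card I = 1" using assms by linarith
      then obtain j where I: "I = {j}" by (rule card_1_singletonE)
      have s: "(\<Sum>a\<in>nbrs I. \<phi> a) = \<phi> (axis j 1) + \<phi> (axis j (-1))" for \<phi> :: "int ^ 'n \<Rightarrow> 'b::comm_monoid_add"
        unfolding sum_nbrs by (simp add: I)
      have "f x (axis j 1) = of_int (surplus x) + - f x (axis j (-1))" using surplus_eq[of x] unfolding s by simp
      then have "\<lfloor>f x (axis j 1)\<rfloor> = surplus x + \<lfloor>- f x (axis j (-1))\<rfloor>" by (simp only: int_add_floor)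
      moreover have "j \<in> I" using I by simp
      ultimately show ?thesis unfolding s using F_axis[of j] by linarith
    qed
    fix a assume a: "a \<in> nbrs I"
    show "F (x + act a) (- a) = - F x a"
      using pos_neg[OF a] by (simp add: F_def act_uminus)
    have "\<bar>f x a\<bar> \<le> B" "\<bar>f (x + act a) (- a)\<bar> \<le> B" using f_bound a by auto
    then show "\<bar>F x a\<bar> \<le> \<lceil>B\<rceil> + 1" unfolding F_def by (cases "pos a") (simp_all, linarith+)
  qed
qed

theorem integer_flow:
  "\<exists>F K. (\<forall>a\<in>nbrs I. \<forall>z. {x. F x a = z} \<in> sets borel) \<and>
     (\<forall>x. \<forall>l\<in>La. \<forall>a. F (x + l) a = F x a) \<and>
     (\<forall>x\<in>dom. of_int (\<Sum>a\<in>nbrs I. F x a) = (\<Sum>a\<in>nbrs I. f x a) \<and>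
       (\<forall>a\<in>nbrs I. F (x + act a) (- a) = - F x a \<and> \<bar>F x a\<bar> \<le> K))"
proof -
  show ?thesis unfolding surplus_eq[symmetric] of_int_eq_iff
    using integer_flow_le1 integer_flow_ge2 by (cases "card I \<le> 1") auto
qed

end

section \<open>Transports\<close>

text \<open>However g was chosen, its level sets are countable unions of sets on which finitely many
  functions with values in a countable type are prescribed. This makes choice operators compatible
  with measurability.\<close>

lemma finite_dependence_measurable:
  fixes d :: "'u \<Rightarrow> 'x \<Rightarrow> 'c::countable"
  assumes U: "finite U" and d: "\<And>u c. u \<in> U \<Longrightarrow> {x. d u x = c} \<in> sets M" and sp: "space M = UNIV"
    and g: "\<And>x y. (\<And>u. u \<in> U \<Longrightarrow> d u x = d u y) \<Longrightarrow> g x = g y"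
  shows "{x. g x = n} \<in> sets M"
proof -
  obtain us where us: "set us = U" using finite_list[OF U] by blast
  define h where "h x = map (\<lambda>u. d u x) us" for x
  have "{x. g x = n} = (\<Union>L\<in>h ` {x. g x = n}. {x. h x = L})"
  proof (intro subset_antisym subsetI)
    fix x assume "x \<in> (\<Union>L\<in>h ` {x. g x = n}. {x. h x = L})"
    then obtain y where y: "g y = n" "h x = h y" by auto
    have "d u x = d u y" if "u \<in> U" for u using y(2) that us by (auto simp: h_def)
    then have "g x = g y" by (rule g)
    then show "x \<in> {x. g x = n}" using y by simp
  qed auto
  also have "\<dots> \<in> sets M"
    unfolding h_def
    by (intro sets.countable_UN'' map_list_measurable sp d) (auto simp: us intro: countable_subset[OF subset_UNIV])
  finally show ?thesis .
qed

text \<open>A table with given margins, filled one unit at a time: as long as some row has units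
  left, so has some column.\<close>

lemma transport_matrix:
  fixes p q :: "'s \<Rightarrow> nat"
  assumes "finite S" "finite R" "(\<Sum>s\<in>S. p s) = (\<Sum>r\<in>R. q r)"
  shows "\<exists>m :: 's \<Rightarrow> 's \<Rightarrow> nat. (\<forall>s\<in>S. (\<Sum>r\<in>R. m s r) = p s) \<and> (\<forall>r\<in>R. (\<Sum>s\<in>S. m s r) = q r)"
  using assms(3)
proof (induction "\<Sum>s\<in>S. p s" arbitrary: p q)
  case 0
  then have "p s = 0" "q r = 0" if "s \<in> S" "r \<in> R" for s r
    using that assms(1,2) by auto
  moreover have "p s = 0" if "s \<in> S" for s using 0 that assms by auto
  moreover have "q s = 0" if "s \<in> R" for s using 0 that assms by auto
  ultimately show ?case by (intro exI[of _ "\<lambda>_ _. 0"]) auto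
next
  case (Suc n)
  have "\<exists>s\<in>S. p s \<noteq> 0"
  proof (rule ccontr)
    assume "\<not> (\<exists>s\<in>S. p s \<noteq> 0)"
    then have "(\<Sum>s\<in>S. p s) = 0" by simp
    then show False using Suc.hyps(2) by simp
  qed
  then obtain s where s: "s \<in> S" "p s \<noteq> 0" by blast
  have "\<exists>r\<in>R. q r \<noteq> 0"
  proof (rule ccontr)
    assume "\<not> (\<exists>r\<in>R. q r \<noteq> 0)"
    then have "(\<Sum>r\<in>R. q r) = 0" by simp
    then show False using Suc by simp
  qed
  then obtain r where r: "r \<in> R" "q r \<noteq> 0" by blast
  define p' where "p' = p(s := p s - 1)"
  define q' where "q' = q(r := q r - 1)"
  have p: "p x = p' x + of_bool (x = s)" for x using s by (simp add: p'_def)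
  have q: "q x = q' x + of_bool (x = r)" for x using r by (simp add: q'_def)
  have sp: "(\<Sum>x\<in>S. p x) = (\<Sum>x\<in>S. p' x) + 1"
    unfolding p sum.distrib using assms(1) s by (simp add: of_bool_def)
  have sq: "(\<Sum>x\<in>R. q x) = (\<Sum>x\<in>R. q' x) + 1"
    unfolding q sum.distrib using assms(2) r by (simp add: of_bool_def)
  have "n = (\<Sum>x\<in>S. p' x)" "(\<Sum>x\<in>S. p' x) = (\<Sum>x\<in>R. q' x)" using sp sq Suc by auto
  from Suc.hyps(1)[OF this] obtain m :: "'s \<Rightarrow> 's \<Rightarrow> nat"
    where m: "\<forall>s\<in>S. (\<Sum>r\<in>R. m s r) = p' s" "\<forall>r\<in>R. (\<Sum>s\<in>S. m s r) = q' r" by blast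
  define m' where "m' x y = m x y + of_bool (x = s) * of_bool (y = r)" for x y
  have "(\<Sum>y\<in>R. m' x y) = p x" if "x \<in> S" for x
    unfolding m'_def sum.distrib sum_distrib_left[symmetric] p using m(1) that assms(2) r
    by (simp add: of_bool_def)
  moreover have "(\<Sum>x\<in>S. m' x y) = q y" if "y \<in> R" for y
    unfolding m'_def sum.distrib sum_distrib_right[symmetric] q using m(2) that assms(1) s
    by (simp add: of_bool_def)
  ultimately show ?case by blast
qed

text \<open>\<open>t s x\<close> units travel from x to x + s; a counts what leaves each point and b
  what arrives. Finiteness of S keeps all displacements bounded.\<close>

definition transportable :: "(real ^ 'n) set \<Rightarrow> (real ^ 'n \<Rightarrow> nat) \<Rightarrow> (real ^ 'n \<Rightarrow> nat) \<Rightarrow> bool" where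
  "transportable D a b \<longleftrightarrow> (\<exists>S t. finite S \<and> S \<subseteq> D \<and> (\<forall>s\<in>S. \<forall>n. {x. t s x = n} \<in> sets borel) \<and>
     (\<forall>x. (\<Sum>s\<in>S. t s x) = a x) \<and> (\<forall>x. (\<Sum>s\<in>S. t s (x - s)) = b x))"

lemma transportableE:
  assumes "transportable D a b"
  obtains S t where "finite S" "S \<subseteq> D" "\<And>s n. s \<in> S \<Longrightarrow> {x. t s x = n} \<in> sets borel"
    "\<And>x. (\<Sum>s\<in>S. t s x) = a x" "\<And>x. (\<Sum>s\<in>S. t s (x - s)) = b x"
proof -
  from assms obtain S where "\<exists>t. finite S \<and> S \<subseteq> D \<and> (\<forall>s\<in>S. \<forall>n. {x. t s x = n} \<in> sets borel) \<and>
     (\<forall>x. (\<Sum>s\<in>S. t s x) = a x) \<and> (\<forall>x. (\<Sum>s\<in>S. t s (x - s)) = b x)"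
    unfolding transportable_def by (rule exE)
  then obtain t where *: "finite S \<and> S \<subseteq> D \<and> (\<forall>s\<in>S. \<forall>n. {x. t s x = n} \<in> sets borel) \<and>
     (\<forall>x. (\<Sum>s\<in>S. t s x) = a x) \<and> (\<forall>x. (\<Sum>s\<in>S. t s (x - s)) = b x)"
    by (rule exE)
  show ?thesis
    by (rule that[of S t]) (insert *, simp_all)
qed

lemma borel_shift_eq:
  fixes h :: "real ^ 'n \<Rightarrow> 'c"
  assumes "{x. h x = n} \<in> sets borel"
  shows "{x. h (x + t) = n} \<in> sets borel"
proof -
  define S where "S = {x. h x = n}"
  have [measurable]: "S \<in> sets borel" using assms by (simp add: S_def)
  have "{x. h (x + t) = n} = {x. x + t \<in> S}" by (simp add: S_def)
  also have "\<dots> \<in> sets borel" by measurable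
  finally show ?thesis .
qed

lemma transportable_sym:
  assumes D: "subgrp D" and "transportable D a b"
  shows "transportable D b a"
proof -
  obtain S t where t: "finite S" "S \<subseteq> D" "\<And>s n. s \<in> S \<Longrightarrow> {x. t s x = n} \<in> sets borel"
    "\<And>x. (\<Sum>s\<in>S. t s x) = a x" "\<And>x. (\<Sum>s\<in>S. t s (x - s)) = b x"
  proof (rule transportableE[OF assms(2)], goal_cases)
    case (1 S t)
    show ?case by (rule 1(1)[OF 1(2-)])
  qed
  define t' where "t' s x = t (- s) (x + s)" for s x
  have re: "(\<Sum>s\<in>uminus ` S. h s) = (\<Sum>s\<in>S. h (- s))" for h :: "real ^ 'a \<Rightarrow> nat"
    by (simp add: sum.reindex)
  show ?thesis unfolding transportable_def
  proof (intro exI[of _ "uminus ` S"] exI[of _ t'] conjI allI ballI)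
    show "uminus ` S \<subseteq> D" using t(2) subgrp_uminus[OF D] by auto
    show "{x. t' s x = n} \<in> sets borel" if "s \<in> uminus ` S" for s n
      using t(3) that unfolding t'_def by (intro borel_shift_eq) auto
    show "(\<Sum>s\<in>uminus ` S. t' s x) = b x" for x unfolding re t(5)[symmetric] by (simp add: t'_def)
    show "(\<Sum>s\<in>uminus ` S. t' s (x - s)) = a x" for x unfolding re t(4)[symmetric] by (simp add: t'_def)
  qed (use t(1) in simp)
qed

text \<open>At each intermediate point the units that arrive, sorted by their displacement s, must
  be matched with those that depart, sorted by r. A table with these margins does it; it is chosen
  as a function of the margins alone, hence measurably.\<close>

lemma transportable_trans:
  assumes D: "subgrp D" and ab: "transportable D a b" and bc: "transportable D b c"
  shows "transportable D a c"
proof -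
  obtain S t where t: "finite S" "S \<subseteq> D" "\<And>s n. s \<in> S \<Longrightarrow> {x. t s x = n} \<in> sets borel"
    "\<And>x. (\<Sum>s\<in>S. t s x) = a x" "\<And>x. (\<Sum>s\<in>S. t s (x - s)) = b x"
  proof (rule transportableE[OF ab], goal_cases)
    case (1 S t)
    show ?case by (rule 1(1)[OF 1(2-)])
  qed
  obtain R u where u: "finite R" "R \<subseteq> D" "\<And>s n. s \<in> R \<Longrightarrow> {x. u s x = n} \<in> sets borel"
    "\<And>x. (\<Sum>s\<in>R. u s x) = b x" "\<And>x. (\<Sum>s\<in>R. u s (x - s)) = c x"
  proof (rule transportableE[OF bc], goal_cases)
    case (1 S t)
    show ?case by (rule 1(1)[OF 1(2-)])
  qed
  \<comment> \<open>Zero off S and R: the functions p x and q x are then determined by finitely many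
    values.\<close>
  define p where "p x s = (if s \<in> S then t s (x - s) else 0)" for x s
  define q where "q x r = (if r \<in> R then u r x else 0)" for x r
  define ok where "ok p q m \<longleftrightarrow> (\<forall>s\<in>S. (\<Sum>r\<in>R. m s r) = p s) \<and> (\<forall>r\<in>R. (\<Sum>s\<in>S. m s r) = q r)"
    for p q :: "real ^ 'a \<Rightarrow> nat" and m :: "real ^ 'a \<Rightarrow> real ^ 'a \<Rightarrow> nat"
  define m where "m x = (SOME m. ok (p x) (q x) m)" for x
  have okm: "ok (p x) (q x) (m x)" for x
  proof -
    have "(\<Sum>s\<in>S. p x s) = (\<Sum>r\<in>R. q x r)" using t(5)[of x] u(4)[of x] by (simp add: p_def q_def)
    then have "\<exists>m. ok (p x) (q x) m" unfolding ok_def by (rule transport_matrix[OF t(1) u(1)])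
    then show ?thesis unfolding m_def by (rule someI_ex)
  qed
  have m1: "(\<Sum>r\<in>R. m x s r) = t s (x - s)" if "s \<in> S" for x s
    using okm[of x] that by (simp add: ok_def p_def)
  have m2: "(\<Sum>s\<in>S. m x s r) = u r x" if "r \<in> R" for x r
    using okm[of x] that by (simp add: ok_def q_def)
  have m_borel: "{x. m x s r = n} \<in> sets borel" for s r n
  proof (rule finite_dependence_measurable[of "S \<times> {True} \<union> R \<times> {False}" "\<lambda>(s, h) x. if h then p x s else q x s"])
    show "finite (S \<times> {True} \<union> R \<times> {False})" using t u by simp
    fix k n assume "k \<in> S \<times> {True} \<union> R \<times> {False}"
    then show "{x. (case k of (s, h) \<Rightarrow> \<lambda>x. if h then p x s else q x s) x = n} \<in> sets borel"
      using borel_shift_eq[where t = "- fst k", OF t(3)] u(3) by (auto simp: p_def q_def)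
  next
    fix x y assume *: "\<And>k. k \<in> S \<times> {True} \<union> R \<times> {False} \<Longrightarrow>
      (case k of (s, h) \<Rightarrow> \<lambda>x. if h then p x s else q x s) x = (case k of (s, h) \<Rightarrow> \<lambda>x. if h then p x s else q x s) y"
    have "p x s = p y s" for s using *[of "(s, True)"] by (cases "s \<in> S") (auto simp: p_def)
    moreover have "q x s = q y s" for s using *[of "(s, False)"] by (cases "s \<in> R") (auto simp: q_def)
    ultimately have "p x = p y" "q x = q y" by auto
    then show "m x s r = m y s r" by (simp add: m_def)
  qed simp
  \<comment> \<open>A unit that moves by s and then by r counts for the total displacement s + r;
    the table is that of the point x + s where it changes over.\<close>
  define z where "z v x = (\<Sum>(s, r)\<in>{(s, r). s \<in> S \<and> r \<in> R \<and> s + r = v}. m (x + s) s r)" for v x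
  define W where "W = (\<lambda>(s, r). s + r) ` (S \<times> R)"
  have fW: "finite W" using t u by (simp add: W_def)
  have fSR: "finite (S \<times> R)" using t u by simp
  have grp: "(\<Sum>v\<in>W. \<Sum>(s, r)\<in>{(s, r). s \<in> S \<and> r \<in> R \<and> s + r = v}. h v s r) = (\<Sum>(s, r)\<in>S \<times> R. h (s + r) s r)"
    for h :: "real ^ 'a \<Rightarrow> real ^ 'a \<Rightarrow> real ^ 'a \<Rightarrow> nat"
  proof -
    have "(\<Sum>v\<in>W. \<Sum>k\<in>{k \<in> S \<times> R. (\<lambda>(s, r). s + r) k = v}. (\<lambda>(s, r). h (s + r) s r) k) = (\<Sum>(s, r)\<in>S \<times> R. h (s + r) s r)"
      by (rule sum.group[OF fSR fW]) (auto simp: W_def)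
    moreover have "(\<Sum>(s, r)\<in>{(s, r). s \<in> S \<and> r \<in> R \<and> s + r = v}. h v s r) =
        (\<Sum>k\<in>{k \<in> S \<times> R. (\<lambda>(s, r). s + r) k = v}. (\<lambda>(s, r). h (s + r) s r) k)" for v
      by (rule sum.cong) auto
    ultimately show ?thesis by simp
  qed
  show ?thesis unfolding transportable_def
  proof (intro exI[of _ W] exI[of _ z] conjI allI ballI)
    show "finite W" by fact
    show "W \<subseteq> D" using t(2) u(2) subgrp_add[OF D] by (auto simp: W_def)
    show "{x. z v x = n} \<in> sets borel" for v n
      unfolding z_def
      by (rule finite_dependence_measurable[of "{(s, r). s \<in> S \<and> r \<in> R \<and> s + r = v}" "\<lambda>(s, r) x. m (x + s) s r"])
         (use fSR m_borel[THEN borel_shift_eq] in \<open>auto intro: finite_subset intro!: sum.cong\<close>)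
    show "(\<Sum>v\<in>W. z v x) = a x" for x
    proof -
      have "(\<Sum>v\<in>W. z v x) = (\<Sum>s\<in>S. \<Sum>r\<in>R. m (x + s) s r)"
        unfolding z_def grp[of "\<lambda>v s r. m (x + s) s r"] by (simp add: sum.cartesian_product)
      also have "\<dots> = a x" using m1 by (simp add: t(4)[symmetric])
      finally show ?thesis .
    qed
    show "(\<Sum>v\<in>W. z v (x - v)) = c x" for x
    proof -
      have "(\<Sum>v\<in>W. z v (x - v)) = (\<Sum>(s, r)\<in>S \<times> R. m (x - (s + r) + s) s r)"
        unfolding z_def grp[of "\<lambda>v s r. m (x - v + s) s r"] ..
      also have "\<dots> = (\<Sum>(s, r)\<in>S \<times> R. m (x - r) s r)"
        by (intro sum.cong) (auto simp: algebra_simps)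
      also have "\<dots> = (\<Sum>r\<in>R. \<Sum>s\<in>S. m (x - r) s r)"
        by (subst sum.swap) (simp add: sum.cartesian_product)
      also have "\<dots> = c x" using m2 by (simp add: u(5)[symmetric])
      finally show ?thesis .
    qed
  qed
qed

lemma transportable_gather:
  assumes S: "finite S" "S \<subseteq> D" and \<tau>: "\<And>x. x \<in> A \<Longrightarrow> \<tau> x - x \<in> S"
    and meas: "A \<in> sets borel" "\<And>s. s \<in> S \<Longrightarrow> {x. \<tau> x - x = s} \<in> sets borel"
  shows "transportable D (\<lambda>x. of_bool (x \<in> A)) (\<lambda>y. card {x \<in> A. \<tau> x = y})"
proof -
  define t where "t s x = (of_bool (x \<in> A \<and> \<tau> x - x = s) :: nat)" for s x
  show ?thesis unfolding transportable_def
  proof (intro exI[of _ S] exI[of _ t] conjI allI ballI)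
    fix s n assume s: "s \<in> S"
    have "{x. x \<in> A \<and> \<tau> x - x = s} \<in> sets borel" using meas(1) meas(2)[OF s] by (simp add: Collect_conj_eq)
    moreover from this have "- {x. x \<in> A \<and> \<tau> x - x = s} \<in> sets borel" by (rule borel_comp)
    moreover have "{x. t s x = n} = (if n = 1 then {x. x \<in> A \<and> \<tau> x - x = s} else if n = 0 then - {x. x \<in> A \<and> \<tau> x - x = s} else {})"
      by (auto simp: t_def)
    ultimately show "{x. t s x = n} \<in> sets borel" by simp
  next
    fix x
    show "(\<Sum>s\<in>S. t s x) = of_bool (x \<in> A)"
    proof (cases "x \<in> A")
      case True
      then have "(\<Sum>s\<in>S. t s x) = (\<Sum>s\<in>S. if s = \<tau> x - x then 1 else 0)"
        by (intro sum.cong) (auto simp: t_def)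
      then show ?thesis using True \<tau>[OF True] S by simp
    qed (simp add: t_def)
    have "(\<Sum>s\<in>S. t s (x - s)) = card {s \<in> S. x - s \<in> A \<and> \<tau> (x - s) = x}"
      using S(1) by (auto simp: t_def of_bool_def sum.If_cases Int_def intro!: arg_cong[where f = card])
    also have "\<dots> = card {z \<in> A. \<tau> z = x}"
    proof (rule bij_betw_same_card[of "\<lambda>s. x - s"])
      show "bij_betw (\<lambda>s. x - s) {s \<in> S. x - s \<in> A \<and> \<tau> (x - s) = x} {z \<in> A. \<tau> z = x}"
        by (rule bij_betw_byWitness[where f' = "\<lambda>z. x - z"]) (use \<tau> in auto)
    qed
    finally show "(\<Sum>s\<in>S. t s (x - s)) = card {z \<in> A. \<tau> z = x}" .
  qed (use S in auto)
qed

section \<open>Cells with small boundary\<close>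

lemma card_nbrs_le: "card (nbrs I) \<le> 2 * card I"
proof -
  have "card (nbrs I) \<le> card ((\<lambda>i. axis i (1::int)) ` I) + card ((\<lambda>i. axis i (-1::int)) ` I)"
    unfolding nbrs_def by (rule card_Un_le)
  also have "\<dots> \<le> card I + card I" by (intro add_mono card_image_le) auto
  finally show ?thesis by simp
qed

context lattice_shift
begin

text \<open>\<open>c x\<close> is the displacement from x to the centre of its cell, so the cell of
  y consists of the points y + act v whose displacement is - v. R bounds the size of the
  cells.\<close>

definition cell_vertices :: "(real ^ 'n \<Rightarrow> int ^ 'n) \<Rightarrow> int \<Rightarrow> real ^ 'n \<Rightarrow> (int ^ 'n) set" where
  "cell_vertices c R y = {v \<in> gbox I R. c (y + act v) = - v}"

definition cell_boundary :: "(real ^ 'n \<Rightarrow> int ^ 'n) \<Rightarrow> int \<Rightarrow> real ^ 'n \<Rightarrow> ((int ^ 'n) \<times> (int ^ 'n)) set" where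
  "cell_boundary c R y = {(v, a). v \<in> cell_vertices c R y \<and> a \<in> nbrs I \<and> v + a \<notin> cell_vertices c R y}"

lemma finite_cell_vertices: "finite (cell_vertices c R y)" by (simp add: cell_vertices_def finite_gbox)

lemma finite_cell_boundary: "finite (cell_boundary c R y)"
  by (rule finite_subset[of _ "gbox I R \<times> nbrs I"]) (auto simp: cell_boundary_def cell_vertices_def finite_gbox finite_nbrs)

text \<open>The cubes of radius s around these points are disjoint and lie in a cube of radius 7 * s
  + 1, which has at most 7^card I times as many points.\<close>

lemma packing:
  assumes s: "0 \<le> s" and sep: "\<And>y w. y \<in> Y \<Longrightarrow> w \<in> gbox I (3 * s) \<Longrightarrow> w \<noteq> 0 \<Longrightarrow> y + act w \<notin> Y"
  shows "real (card {w \<in> gbox I (6 * s + 1). y + act w \<in> Y}) \<le> 7 ^ card I"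
proof -
  define W where "W = {w \<in> gbox I (6 * s + 1). y + act w \<in> Y}"
  have fW: "finite W" by (simp add: W_def finite_gbox)
  have "inj_on (\<lambda>(w, p). w + p) (W \<times> gbox I s)"
  proof (rule inj_onI, clarify)
    fix w p w' p' assume a: "w \<in> W" "p \<in> gbox I s" "w' \<in> W" "p' \<in> gbox I s" "w + p = w' + p'"
    have "w' - w = p - p'" using a(5) by (simp add: algebra_simps)
    then have "w' - w \<in> gbox I (3 * s)"
      using gbox_diff[OF a(2,4)] gbox_mono[of "s + s" "3 * s" I] s by auto
    moreover have "y + act w + act (w' - w) \<in> Y" using a(3) by (simp add: W_def act_diff)
    ultimately have "w' - w = 0" using sep[of "y + act w" "w' - w"] a(1) by (auto simp: W_def)
    then show "w = w' \<and> p = p'" using a(5) by simp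
  qed
  moreover have "(\<lambda>(w, p). w + p) ` (W \<times> gbox I s) \<subseteq> gbox I (7 * s + 1)"
    using gbox_add[of _ I "6 * s + 1" _ s] by (force simp: W_def algebra_simps)
  ultimately have "card (W \<times> gbox I s) \<le> card (gbox I (7 * s + 1) :: (int ^ 'n) set)"
    by (intro card_inj_on_le finite_gbox)
  then have "real (card W) * real (card (gbox I s :: (int ^ 'n) set)) \<le> real (card (gbox I (7 * s + 1) :: (int ^ 'n) set))"
    unfolding card_cartesian_product by (simp flip: of_nat_mult)
  also have "\<dots> = (2 * of_int (7 * s + 1) + 1) ^ card I" using s by (intro card_gbox) auto
  also have "\<dots> \<le> (7 * (2 * of_int s + 1)) ^ card I" using s by (intro power_mono) auto
  also have "\<dots> = 7 ^ card I * (2 * of_int s + 1) ^ card I" by (rule power_mult_distrib)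
  finally have "real (card W) * (2 * of_int s + 1) ^ card I \<le> 7 ^ card I * (2 * of_int s + 1) ^ card I"
    unfolding card_gbox[OF s] .
  moreover have "(0::real) < (2 * of_int s + 1) ^ card I" using s by (intro zero_less_power) auto
  ultimately show ?thesis unfolding W_def[symmetric] by (simp only: mult_le_cancel_right_pos)
qed

text \<open>A cell contains the whole cube of radius s around its centre, and a step leaves the cell
  only if it crosses the boundary of a cube of radius s or 3 * s around one of the few nearby
  markers. With k = card I the volume grows like s^k and the boundary like s^(k - 1), so a large s
  gives any prescribed ratio K.\<close>

lemma cells:
  fixes K :: real
  assumes K: "0 \<le> K"
  obtains Y :: "(real ^ 'n) set" and c R where
    "Y \<in> sets borel" "periodic Y" "\<And>v. {x. c x = v} \<in> sets borel"
    "\<And>x l. l \<in> La \<Longrightarrow> c (x + l) = c x" "\<And>x. c x \<in> gbox I R" "\<And>x. x + act (c x) \<in> Y"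
    "\<And>y. y \<in> Y \<Longrightarrow> K * real (card (cell_boundary c R y)) \<le> real (card (cell_vertices c R y))"
proof -
  define k where "k = card I"
  \<comment> \<open>At most 7^k nearby markers, each with shells of at most 8 k 3^(k - 1) (2 s +
    1)^(k - 1) points, and 2 k directions at every point, give at most 16 k^2 7^k 3^(k - 1) (2 s +
    1)^(k - 1) boundary edges, against at least (2 s + 1)^k points.\<close>
  obtain s :: int where s: "1 \<le> s" "K * (16 * k * k * 7 ^ k * 3 ^ k) \<le> 2 * of_int s + 1"
  proof -
    define s where "s = max 1 \<lceil>K * (16 * k * k * 7 ^ k * 3 ^ k)\<rceil>"
    have "K * (16 * k * k * 7 ^ k * 3 ^ k) \<le> of_int \<lceil>K * (16 * k * k * 7 ^ k * 3 ^ k)\<rceil>" by simp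
    also have "\<dots> \<le> of_int s" by (simp add: s_def)
    finally have le: "K * (16 * k * k * 7 ^ k * 3 ^ k) \<le> of_int s" .
    moreover have s1: "1 \<le> s" by (simp add: s_def)
    ultimately have "K * (16 * k * k * 7 ^ k * 3 ^ k) \<le> 2 * of_int s + 1" by linarith
    with s1 have "1 \<le> s" "K * (16 * k * k * 7 ^ k * 3 ^ k) \<le> 2 * of_int s + 1" by auto
    then show ?thesis using that by blast
  qed
  have m: "0 \<le> 3 * s" "3 * s \<le> 6 * s" using s by auto
  obtain n :: nat and Z where Z:
    "\<And>j. Z j \<in> sets borel" "\<And>j. periodic (Z j)"
    "\<And>i j x v. i \<noteq> j \<Longrightarrow> x \<in> Z i \<Longrightarrow> v \<in> gbox I (3 * s) \<Longrightarrow> x + act v \<notin> Z j"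
    "\<And>j x v. x \<in> Z j \<Longrightarrow> v \<in> gbox I (6 * s) \<Longrightarrow> v \<noteq> 0 \<Longrightarrow> x + act v \<notin> Z j"
    "\<And>x. \<exists>j<n. \<exists>v\<in>gbox I (3 * s). x + act v \<in> Z j"
  proof (rule markers[OF m], goal_cases)
    case (1 n Z)
    show ?case by (rule 1(1)[OF 1(2-)])
  qed
  define Y where "Y = (\<Union>j. Z j)"
  have Y_sep: "y + act w \<notin> Y" if y: "y \<in> Y" and w: "w \<in> gbox I (3 * s)" "w \<noteq> 0" for y w
  proof -
    obtain i where i: "y \<in> Z i" using y by (auto simp: Y_def)
    have "w \<in> gbox I (6 * s)" using w(1) gbox_mono[OF m(2)] by blast
    then have "y + act w \<notin> Z j" for j
      using Z(3)[OF _ i w(1), of j] Z(4)[OF i _ w(2)] by (cases "i = j") auto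
    then show ?thesis by (simp add: Y_def)
  qed
  \<comment> \<open>A list of priorities: the cubes of radius s around all markers come before the
    cubes of radius 3 * s, and the latter are sorted by class. At each priority the cubes are
    disjoint, and a point joins the cube of the first priority that has one over it.\<close>
  define Q where "Q k x v = (case k of 0 \<Rightarrow> v \<in> gbox I s \<and> x + act v \<in> Y
    | Suc j \<Rightarrow> v \<in> gbox I (3 * s) \<and> x + act v \<in> Z j)" for k :: nat and x v
  have Q_Y: "x + act v \<in> Y" if "Q k x v" for k x v
    using that by (cases k) (auto simp: Q_def Y_def)
  have Q_gbox: "v \<in> gbox I (3 * s)" if "Q k x v" for k x v
    using that s gbox_mono[of s "3 * s" I] by (cases k) (auto simp: Q_def)
  have Q_uniq: "u = v" if Qv: "Q k x v" and Qu: "Q k x u" for k x u v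
  proof (rule ccontr)
    assume "u \<noteq> v"
    then have ne: "u - v \<noteq> 0" by simp
    have y: "x + act v + act (u - v) = x + act u" by (simp add: act_diff)
    show False
    proof (cases k)
      case 0
      then have "v \<in> gbox I s" "u \<in> gbox I s" using Qv Qu by (auto simp: Q_def)
      then have "u - v \<in> gbox I (3 * s)" using gbox_diff[of u I s v s] gbox_mono[of "s + s" "3 * s" I] s by auto
      from Y_sep[OF Q_Y[OF Qv] this ne] show False using Q_Y[OF Qu] unfolding y by simp
    next
      case (Suc j)
      then have v: "v \<in> gbox I (3 * s)" "x + act v \<in> Z j" and u: "u \<in> gbox I (3 * s)" "x + act u \<in> Z j"
        using Qv Qu by (auto simp: Q_def)
      have "u - v \<in> gbox I (6 * s)" using gbox_diff[OF u(1) v(1)] by simp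
      from Z(4)[OF v(2) this ne] show False using u(2) unfolding y by simp
    qed
  qed
  have Q_ex: "\<exists>k v. Q k x v" for x
  proof -
    obtain j v where "v \<in> gbox I (3 * s)" "x + act v \<in> Z j" using Z(5)[of x] by blast
    then have "Q (Suc j) x v" by (simp add: Q_def)
    then show ?thesis by blast
  qed
  define kk where "kk x = (LEAST k. \<exists>v. Q k x v)" for x
  define c where "c x = (THE v. Q (kk x) x v)" for x
  have Qc: "Q (kk x) x (c x)" for x
  proof -
    have "\<exists>v. Q (kk x) x v" unfolding kk_def using Q_ex[of x] by (rule LeastI_ex)
    then obtain v where v: "Q (kk x) x v" by blast
    then have "c x = v" unfolding c_def by (intro the_equality) (auto intro: Q_uniq)
    then show ?thesis using v by simp
  qed
  have c_iff: "c x = v \<longleftrightarrow> (\<exists>k. Q k x v \<and> (\<forall>j<k. \<forall>u. \<not> Q j x u))" for x v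
  proof
    assume "c x = v"
    then have "Q (kk x) x v" using Qc[of x] by simp
    moreover have "\<forall>j<kk x. \<forall>u. \<not> Q j x u" unfolding kk_def using not_less_Least by blast
    ultimately show "\<exists>k. Q k x v \<and> (\<forall>j<k. \<forall>u. \<not> Q j x u)" by blast
  next
    assume "\<exists>k. Q k x v \<and> (\<forall>j<k. \<forall>u. \<not> Q j x u)"
    then obtain k where k: "Q k x v" "\<forall>j<k. \<forall>u. \<not> Q j x u" by blast
    have "kk x = k" unfolding kk_def
    proof (rule Least_equality)
      show "\<exists>v. Q k x v" using k by blast
      show "k \<le> j" if "\<exists>v. Q j x v" for j using k(2) that not_less by blast
    qed
    then show "c x = v" using Qc[of x] k(1) Q_uniq by blast
  qed
  have c_step: "c (x + act a) = c x - a" if same: "\<And>k v. Q k (x + act a) (v - a) \<longleftrightarrow> Q k x v" for x a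
  proof -
    obtain k where k: "Q k x (c x)" "\<forall>j<k. \<forall>u. \<not> Q j x u" using c_iff[of x "c x"] by blast
    have "Q k (x + act a) (c x - a)" using k(1) same by simp
    moreover have "\<not> Q j (x + act a) u" if "j < k" for j u
      using k(2) that same[of j "u + a"] by simp
    ultimately show ?thesis using c_iff by blast
  qed
  define R where "R = 3 * s"
  have Zp: "x + l + act v \<in> Z j \<longleftrightarrow> x + act v \<in> Z j" if "l \<in> La" for x l v j
  proof -
    have "x + l + act v = (x + act v) + l" by (simp add: algebra_simps)
    then show ?thesis using Z(2)[of j] that unfolding periodic_def by metis
  qed
  have Y_borel: "Y \<in> sets borel" unfolding Y_def using Z(1) by auto
  have Q_borel: "{x. Q k x v} \<in> sets borel" for k v
  proof -
    have "{x. Q k x v} = (case k of 0 \<Rightarrow> if v \<in> gbox I s then {x. x + act v \<in> Y} else {}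
      | Suc j \<Rightarrow> if v \<in> gbox I (3 * s) then {x. x + act v \<in> Z j} else {})"
      by (auto simp: Q_def split: nat.split)
    also have "\<dots> \<in> sets borel" using shift_borel[OF Y_borel] shift_borel[OF Z(1)] by (auto split: nat.split)
    finally show ?thesis .
  qed
  show ?thesis
  proof (rule that[of Y c R])
    show "Y \<in> sets borel" by fact
    show "periodic Y" using Z(2) by (auto simp: Y_def periodic_def)
    show "{x. c x = v} \<in> sets borel" for v
    proof -
      have "{x. c x = v} = (\<Union>k. {x. Q k x v} - (\<Union>j\<in>{..<k}. \<Union>u\<in>gbox I (3 * s). {x. Q j x u}))"
      proof -
        have "(\<forall>u. \<not> Q j x u) \<longleftrightarrow> x \<notin> (\<Union>u\<in>gbox I (3 * s). {x. Q j x u})" for j x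
          using Q_gbox[of j x] by auto
        then show ?thesis unfolding c_iff by auto
      qed
      also have "\<dots> \<in> sets borel"
        by (intro sets.countable_UN'' sets.Diff sets.finite_UN finite_gbox Q_borel) auto
      finally show ?thesis .
    qed
    show "c (x + l) = c x" if "l \<in> La" for x l
    proof -
      have "Q k (x + l) v \<longleftrightarrow> Q k x v" for k v
        using Zp[OF that] by (simp add: Q_def Y_def split: nat.split)
      then show ?thesis by (simp add: c_def kk_def)
    qed
    show "c x \<in> gbox I R" for x unfolding R_def using Q_gbox[OF Qc] .
    show "x + act (c x) \<in> Y" for x using Q_Y[OF Qc] .
    fix y assume y: "y \<in> Y"
    define Sh where "Sh = (gbox I (s + 1) - gbox I (s - 1)) \<union> (gbox I (3 * s + 1) - gbox I (3 * s - 1) :: (int ^ 'n) set)"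
    define W where "W = {w \<in> gbox I (6 * s + 1). y + act w \<in> Y}"
    have fin: "finite Sh" "finite W" by (simp_all add: Sh_def W_def finite_gbox)
    \<comment> \<open>The centre is within 3 * s of the point, and the marker whose cube is left or
      entered is within 3 * s + 1 of it; hence the radius 6 * s + 1 in W.\<close>
    have rep: "\<exists>w\<in>W. \<exists>p\<in>Sh. v = w - p" if va: "(v, a) \<in> cell_boundary c R y" for v a
    proof -
      have v: "v \<in> gbox I R" "c (y + act v) = - v" and a: "a \<in> nbrs I" and out: "v + a \<notin> cell_vertices c R y"
        using va by (auto simp: cell_boundary_def cell_vertices_def)
      define x where "x = y + act v"
      have "c (x + act a) \<noteq> c x - a"
      proof
        assume "c (x + act a) = c x - a"
        then have *: "c (y + act (v + a)) = - (v + a)" using v(2) by (simp add: x_def act_add add.assoc)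
        have "c (y + act (v + a)) \<in> gbox I R" unfolding R_def using Q_gbox[OF Qc] .
        then have "v + a \<in> gbox I R" unfolding * by (simp only: gbox_uminus)
        then show False using out * by (simp add: cell_vertices_def)
      qed
      then obtain k p where kp: "Q k (x + act a) (p - a) \<noteq> Q k x p" using c_step by blast
      have xp: "x + act a + act (p - a) = x + act p" by (simp add: act_diff)
      have shell: "p \<in> gbox I (\<rho> + 1) - gbox I (\<rho> - 1)" if "(p \<in> gbox I \<rho>) \<noteq> (p - a \<in> gbox I \<rho>)" for \<rho>
      proof -
        have "p \<in> gbox I (\<rho> + 1)"
          using that gbox_mono[of \<rho> "\<rho> + 1" I] gbox_add[of "p - a" I \<rho> a 1] nbrs_gbox[OF a] by auto
        moreover have "p \<notin> gbox I (\<rho> - 1)"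
          using that gbox_mono[of "\<rho> - 1" \<rho> I] gbox_diff[of p I "\<rho> - 1" a 1] nbrs_gbox[OF a] by auto
        ultimately show ?thesis by blast
      qed
      have p: "p \<in> Sh" "x + act p \<in> Y"
        using kp shell[of s] shell[of "3 * s"] unfolding Q_def xp Sh_def by (auto simp: Y_def split: nat.splits)
      have "p \<in> gbox I (3 * s + 1)" using p(1) s gbox_mono[of "s + 1" "3 * s + 1" I] by (auto simp: Sh_def)
      from gbox_add[OF v(1) this] have "v + p \<in> gbox I (6 * s + 1)" by (simp add: R_def add.assoc[symmetric])
      moreover have "y + act (v + p) \<in> Y" using p(2) by (simp add: x_def act_add add.assoc)
      ultimately have "v + p \<in> W" by (simp add: W_def)
      then show ?thesis using p(1) by (intro bexI[of _ "v + p"] bexI[of _ p]) auto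
    qed
    have "cell_boundary c R y \<subseteq> (\<lambda>(w, p, a). (w - p, a)) ` (W \<times> Sh \<times> nbrs I)"
    proof
      fix b assume b: "b \<in> cell_boundary c R y"
      obtain v a where va: "b = (v, a)" by (cases b)
      obtain w p where "w \<in> W" "p \<in> Sh" "v = w - p" using rep[of v a] b va by blast
      moreover have "a \<in> nbrs I" using b va by (auto simp: cell_boundary_def)
      ultimately show "b \<in> (\<lambda>(w, p, a). (w - p, a)) ` (W \<times> Sh \<times> nbrs I)"
        using va by (intro image_eqI[of _ _ "(w, p, a)"]) auto
    qed
    then have "card (cell_boundary c R y) \<le> card (W \<times> Sh \<times> nbrs I)"
      using fin finite_nbrs by (intro surj_card_le) auto
    then have "real (card (cell_boundary c R y)) \<le> real (card W) * (real (card Sh) * real (card (nbrs I)))"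
      by (simp add: card_cartesian_product flip: of_nat_mult)
    also have "\<dots> \<le> (7::real) ^ k * ((8 * real k * 3 ^ (k - 1) * (2 * real_of_int s + 1) ^ (k - 1)) * (2 * real k))"
    proof (intro mult_mono)
      show "real (card W) \<le> (7::real) ^ k" unfolding W_def k_def by (rule packing) (use s Y_sep in auto)
      show "real (card (nbrs I)) \<le> 2 * real k" using card_nbrs_le[of I] by (simp add: k_def)
      have "real (card Sh) \<le> real (card (gbox I (s + 1) - gbox I (s - 1) :: (int ^ 'n) set)) +
          real (card (gbox I (3 * s + 1) - gbox I (3 * s - 1) :: (int ^ 'n) set))"
        unfolding Sh_def by (simp flip: of_nat_add add: card_Un_le)
      also have "\<dots> \<le> real k * 4 * (2 * real_of_int (s + 1) + 1) ^ (k - 1) + real k * 4 * (2 * real_of_int (3 * s + 1) + 1) ^ (k - 1)"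
        using card_shell[of "s - 1" "s + 1" I] card_shell[of "3 * s - 1" "3 * s + 1" I] s
        by (intro add_mono) (auto simp: k_def)
      also have "\<dots> \<le> real k * 4 * (3 * (2 * real_of_int s + 1)) ^ (k - 1) + real k * 4 * (3 * (2 * real_of_int s + 1)) ^ (k - 1)"
        using s by (intro add_mono mult_left_mono power_mono) auto
      also have "\<dots> = 8 * real k * 3 ^ (k - 1) * (2 * real_of_int s + 1) ^ (k - 1)" unfolding power_mult_distrib by simp
      finally show "real (card Sh) \<le> 8 * real k * 3 ^ (k - 1) * (2 * real_of_int s + 1) ^ (k - 1)" by simp
    qed (use s in auto)
    finally have cB: "real (card (cell_boundary c R y)) \<le> (7::real) ^ k * ((8 * real k * 3 ^ (k - 1) * (2 * real_of_int s + 1) ^ (k - 1)) * (2 * real k))" .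
    have "gbox I s \<subseteq> cell_vertices c R y"
    proof
      fix v assume v: "v \<in> gbox I s"
      have "Q 0 (y + act v) (- v)" using v y by (simp add: Q_def act_uminus)
      then have "c (y + act v) = - v" unfolding c_iff by blast
      then show "v \<in> cell_vertices c R y" using v gbox_mono[of s R I] s by (auto simp: cell_vertices_def R_def)
    qed
    then have "card (gbox I s :: (int ^ 'n) set) \<le> card (cell_vertices c R y)" by (intro card_mono finite_cell_vertices)
    then have cV: "(2 * real_of_int s + 1) ^ k \<le> real (card (cell_vertices c R y))"
      using s card_gbox[of s I] by (simp add: k_def)
    show "K * real (card (cell_boundary c R y)) \<le> real (card (cell_vertices c R y))"
    proof (cases k)
      case 0
      then show ?thesis using cB K cV by simp
    next
      case (Suc k')
      have "K * real (card (cell_boundary c R y)) \<le> K * ((7::real) ^ k * ((8 * real k * 3 ^ k' * (2 * real_of_int s + 1) ^ k') * (2 * real k)))"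
        using cB K Suc by (intro mult_left_mono) auto
      also have "\<dots> \<le> (K * (16 * real k * real k * (7::real) ^ k * 3 ^ k)) * (2 * real_of_int s + 1) ^ k'"
      proof -
        have "(3::real) ^ k' \<le> 3 ^ k" using Suc by (intro power_increasing) auto
        then have "K * ((7::real) ^ k * 16 * real k * real k * (2 * real_of_int s + 1) ^ k') * 3 ^ k' \<le> K * ((7::real) ^ k * 16 * real k * real k * (2 * real_of_int s + 1) ^ k') * 3 ^ k"
          using K s by (intro mult_left_mono) auto
        then show ?thesis by (simp add: mult_ac)
      qed
      also have "\<dots> \<le> (2 * real_of_int s + 1) * (2 * real_of_int s + 1) ^ k'"
        using s by (intro mult_right_mono) auto
      also have "\<dots> = (2 * real_of_int s + 1) ^ k" by (simp add: Suc)
      finally show ?thesis using cV by linarith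
    qed
  qed
qed

end

section \<open>From a flow to a transport\<close>

context lattice_shift
begin

definition red :: "real ^ 'n \<Rightarrow> real ^ 'n" where
  "red x = x - (THE l. l \<in> La \<and> x - l \<in> P)"

lemma red: "red x \<in> P" "x - red x \<in> La"
  using theI'[OF P_dom[of x]] by (auto simp: red_def)

lemma red_unique:
  assumes "p \<in> P" "x - p \<in> La"
  shows "red x = p"
proof -
  have "x - (x - p) \<in> P" using assms by simp
  then have "(THE l. l \<in> La \<and> x - l \<in> P) = x - p"
    using assms P_dom[of x] by (intro the1_equality) auto
  then show ?thesis by (simp add: red_def)
qed

definition moves :: "(int ^ 'n) set \<Rightarrow> real \<Rightarrow> (real ^ 'n) set" where
  "moves W \<rho> = (\<lambda>(v, l). act v - l) ` (W \<times> (La \<inter> cball 0 \<rho>))"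

lemma finite_moves: "finite W \<Longrightarrow> finite (moves W \<rho>)"
  unfolding moves_def by (intro finite_imageI finite_cartesian_product La_finite bounded_cball)

lemma movesI: "v \<in> W \<Longrightarrow> act v - s \<in> La \<Longrightarrow> norm (act v - s) \<le> \<rho> \<Longrightarrow> s \<in> moves W \<rho>"
  unfolding moves_def by (rule image_eqI[of _ _ "(v, act v - s)"]) auto

lemma moves_sub:
  assumes "subgrp D" "La \<subseteq> D" "act ` gvecs \<subseteq> D" "W \<subseteq> gvecs"
  shows "moves W \<rho> \<subseteq> D"
  unfolding moves_def using assms by (auto intro!: subgrp_diff[OF assms(1)])

lemma act_bounded:
  assumes "finite W"
  obtains \<rho> where "\<And>v. v \<in> W \<Longrightarrow> norm (act v) \<le> \<rho>"
proof -
  have "bounded (act ` W)" using assms by (intro finite_imp_bounded) simp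
  then show ?thesis using that by (auto simp: bounded_iff)
qed

text \<open>On the torus n w x units are sent from x to x + act w. In P every arrival is reduced
  modulo La; as P is bounded, finitely many elements of La suffice for all reductions.\<close>

lemma per_transportable:
  assumes D: "subgrp D" "La \<subseteq> D" "act ` gvecs \<subseteq> D"
    and W: "finite W" "W \<subseteq> gvecs"
    and n: "\<And>w k. w \<in> W \<Longrightarrow> {x. n w x = k} \<in> sets borel"
    and per: "\<And>w x l. w \<in> W \<Longrightarrow> l \<in> La \<Longrightarrow> n w (x + l) = (n w x :: nat)"
  shows "transportable D (\<lambda>x. if x \<in> P then \<Sum>w\<in>W. n w x else 0) (\<lambda>x. if x \<in> P then \<Sum>w\<in>W. n w (x - act w) else 0)"
proof -
  obtain \<rho>P where \<rho>P: "\<And>x. x \<in> P \<Longrightarrow> norm x \<le> \<rho>P" using P_bounded by (auto simp: bounded_iff)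
  obtain \<rho>a where \<rho>a: "\<And>v. v \<in> W \<Longrightarrow> norm (act v) \<le> \<rho>a" using act_bounded[OF W(1)] by blast
  define S where "S = moves W (\<rho>a + 2 * \<rho>P)"
  have S_in: "s \<in> S" if "w \<in> W" "act w - s \<in> La" "x \<in> P" "y \<in> P" "s = y - x" for w s x y
  proof -
    have "norm (act w - s) \<le> norm (act w) + norm s" by (rule norm_triangle_ineq4)
    also have "norm s \<le> norm y + norm x" unfolding that(5) by (rule norm_triangle_ineq4)
    finally have "norm (act w - s) \<le> \<rho>a + 2 * \<rho>P" using \<rho>a[OF that(1)] \<rho>P[OF that(3)] \<rho>P[OF that(4)] by linarith
    then show ?thesis unfolding S_def by (rule movesI[OF that(1,2)])
  qed
  have fS: "finite S" unfolding S_def by (rule finite_moves[OF W(1)])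
  define t where "t s x = (\<Sum>w\<in>W. of_bool (x \<in> P \<and> x + s \<in> P \<and> act w - s \<in> La) * n w x)" for s x
  have one: "(\<Sum>s\<in>S. of_bool (s = s0) * m) = m" if "s0 \<in> S" for s0 and m :: nat
  proof -
    have "(\<Sum>s\<in>S. of_bool (s = s0) * m) = (\<Sum>s\<in>S. if s = s0 then m else 0)" by (intro sum.cong) auto
    then show ?thesis using that fS by simp
  qed
  show ?thesis unfolding transportable_def
  proof (intro exI[of _ S] exI[of _ t] conjI allI ballI)
    show "finite S" by fact
    show "S \<subseteq> D" unfolding S_def by (rule moves_sub[OF D W(2)])
    show "{x. t s x = k} \<in> sets borel" for s k
    proof (rule finite_dependence_measurable[of W "\<lambda>w x. of_bool (x \<in> P \<and> x + s \<in> P \<and> act w - s \<in> La) * n w x"])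
      fix w k assume w: "w \<in> W"
      have 1: "{x. x \<in> P \<and> x + s \<in> P} \<in> sets borel" by measurable
      show "{x. of_bool (x \<in> P \<and> x + s \<in> P \<and> act w - s \<in> La) * n w x = k} \<in> sets borel"
      proof (cases "act w - s \<in> La")
        case True
        have "{x. of_bool (x \<in> P \<and> x + s \<in> P \<and> act w - s \<in> La) * n w x = k} =
            ({x. x \<in> P \<and> x + s \<in> P} \<inter> {x. n w x = k}) \<union> (if k = 0 then - {x. x \<in> P \<and> x + s \<in> P} else {})"
          using True by auto
        also have "\<dots> \<in> sets borel" using 1 n[OF w] borel_comp[OF 1] by auto
        finally show ?thesis .
      qed auto
    qed (use W in \<open>auto simp: t_def intro!: sum.cong\<close>)
    fix x
    show "(\<Sum>s\<in>S. t s x) = (if x \<in> P then \<Sum>w\<in>W. n w x else 0)"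
    proof (cases "x \<in> P")
      case True
      have "(\<Sum>s\<in>S. t s x) = (\<Sum>w\<in>W. \<Sum>s\<in>S. of_bool (x \<in> P \<and> x + s \<in> P \<and> act w - s \<in> La) * n w x)"
        unfolding t_def by (rule sum.swap)
      also have "\<dots> = (\<Sum>w\<in>W. n w x)"
      proof (rule sum.cong[OF refl])
        fix w assume w: "w \<in> W"
        define s0 where "s0 = red (x + act w) - x"
        have iff: "(x + s \<in> P \<and> act w - s \<in> La) = (s = s0)" for s
        proof
          assume "x + s \<in> P \<and> act w - s \<in> La"
          then have "red (x + act w) = x + s" by (intro red_unique) (auto simp: algebra_simps)
          then show "s = s0" by (simp add: s0_def)
        next
          assume s: "s = s0"
          have "act w - s0 = x + act w - red (x + act w)" by (simp add: s0_def)
          then have "act w - s0 \<in> La" using red(2)[of "x + act w"] by (simp only:)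
          then show "x + s \<in> P \<and> act w - s \<in> La" using red(1)[of "x + act w"] unfolding s by (simp add: s0_def)
        qed
        have "s0 \<in> S" using iff[of s0] w True by (intro S_in[of w s0 x "x + s0"]) auto
        then show "(\<Sum>s\<in>S. of_bool (x \<in> P \<and> x + s \<in> P \<and> act w - s \<in> La) * n w x) = n w x"
          unfolding iff using True one[of s0 "n w x"] by simp
      qed
      finally show ?thesis using True by simp
    qed (simp add: t_def)
    show "(\<Sum>s\<in>S. t s (x - s)) = (if x \<in> P then \<Sum>w\<in>W. n w (x - act w) else 0)"
    proof (cases "x \<in> P")
      case True
      have "(\<Sum>s\<in>S. t s (x - s)) = (\<Sum>w\<in>W. \<Sum>s\<in>S. of_bool (x - s \<in> P \<and> x - s + s \<in> P \<and> act w - s \<in> La) * n w (x - s))"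
        unfolding t_def by (rule sum.swap)
      also have "\<dots> = (\<Sum>w\<in>W. n w (x - act w))"
      proof (rule sum.cong[OF refl])
        fix w assume w: "w \<in> W"
        define s0 where "s0 = x - red (x - act w)"
        have iff: "(x - s \<in> P \<and> x - s + s \<in> P \<and> act w - s \<in> La) = (s = s0)" for s
        proof
          assume a: "x - s \<in> P \<and> x - s + s \<in> P \<and> act w - s \<in> La"
          then have "- (act w - s) \<in> La" using subgrp_uminus[OF La_subgrp] by blast
          then have "red (x - act w) = x - s" using a by (intro red_unique) (auto simp: algebra_simps)
          then show "s = s0" by (simp add: s0_def)
        next
          assume s: "s = s0"
          have "- (x - act w - red (x - act w)) \<in> La" by (rule subgrp_uminus[OF La_subgrp red(2)])
          moreover have "- (x - act w - red (x - act w)) = act w - s0" by (simp add: s0_def)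
          ultimately have "act w - s0 \<in> La" by (simp only:)
          then show "x - s \<in> P \<and> x - s + s \<in> P \<and> act w - s \<in> La"
            unfolding s using red(1)[of "x - act w"] True by (simp add: s0_def)
        qed
        have s0: "act w - s0 \<in> La" "x - s0 \<in> P" using iff[of s0] by auto
        have "s0 \<in> S" using w True s0 by (intro S_in[of w s0 "x - s0" x]) auto
        moreover have "n w (x - s0) = n w (x - act w)"
          using per[OF w s0(1), of "x - act w"] by (simp add: algebra_simps)
        moreover have "(\<Sum>s\<in>S. of_bool (x - s \<in> P \<and> x - s + s \<in> P \<and> act w - s \<in> La) * n w (x - s)) =
            (\<Sum>s\<in>S. of_bool (s = s0) * n w (x - s0))"
          unfolding iff by (intro sum.cong) auto
        ultimately show "(\<Sum>s\<in>S. of_bool (x - s \<in> P \<and> x - s + s \<in> P \<and> act w - s \<in> La) * n w (x - s)) = n w (x - act w)"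
          using one[of s0 "n w (x - s0)"] by simp
      qed
      finally show ?thesis using True by simp
    qed (simp add: t_def)
  qed
qed

text \<open>The multiplicity with which A covers the torus at the class of x.\<close>

definition fibre_count :: "(real ^ 'n) set \<Rightarrow> real ^ 'n \<Rightarrow> nat" where
  "fibre_count A x = card {z \<in> A. z - x \<in> La}"

lemma finite_fibre_count:
  assumes "bounded A"
  shows "finite {z \<in> A. z - x \<in> La}"
proof -
  have "bounded ((\<lambda>z. z - x) ` A)" using assms by (intro bounded_translation_minus)
  then have "finite (La \<inter> (\<lambda>z. z - x) ` A)" by (rule La_finite)
  then have "finite ((\<lambda>l. l + x) ` (La \<inter> (\<lambda>z. z - x) ` A))" by (rule finite_imageI)
  moreover have "{z \<in> A. z - x \<in> La} \<subseteq> (\<lambda>l. l + x) ` (La \<inter> (\<lambda>z. z - x) ` A)"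
    by (auto intro!: image_eqI[of _ _ "_ - x"])
  ultimately show ?thesis by (rule finite_subset[rotated])
qed

text \<open>Each point of A is sent to the representative in P of the centre of its cell. What
  arrives at a centre is the number of points of A over the cell.\<close>

lemma transportable_to_markers:
  assumes D: "subgrp D" "La \<subseteq> D" "act ` gvecs \<subseteq> D"
    and c: "\<And>v. {x. c x = v} \<in> sets borel" "\<And>x l. l \<in> La \<Longrightarrow> c (x + l) = c x" "\<And>x. c x \<in> gbox I R"
      "\<And>x. x + act (c x) \<in> Y"
    and Y: "periodic Y" and \<Omega>: "periodic \<Omega>" "\<And>x v. x \<in> \<Omega> \<Longrightarrow> v \<in> gvecs \<Longrightarrow> x + act v \<in> \<Omega>"
    and A: "A \<in> sets borel" "bounded A" "A \<subseteq> \<Omega>"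
  shows "transportable D (\<lambda>x. of_bool (x \<in> A))
    (\<lambda>y. if y \<in> P then (if y \<in> Y \<inter> \<Omega> then \<Sum>v\<in>cell_vertices c R y. fibre_count A (y + act v) else 0) else 0)"
proof -
  define \<tau> where "\<tau> z = red (z + act (c z))" for z
  obtain \<rho>P where \<rho>P: "\<And>x. x \<in> P \<Longrightarrow> norm x \<le> \<rho>P" using P_bounded by (auto simp: bounded_iff)
  obtain \<rho>A where \<rho>A: "\<And>x. x \<in> A \<Longrightarrow> norm x \<le> \<rho>A" using A(2) by (auto simp: bounded_iff)
  obtain \<rho>a where \<rho>a: "\<And>v. v \<in> gbox I R \<Longrightarrow> norm (act v) \<le> \<rho>a" using act_bounded[OF finite_gbox] by blast
  define S where "S = moves (gbox I R) (\<rho>A + \<rho>a + \<rho>P)"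
  have La_c: "c x = c y" if "x - y \<in> La" for x y
    using c(2)[OF that, of y] by simp
  have perD: "x \<in> Z \<longleftrightarrow> y \<in> Z" if "periodic Z" "x - y \<in> La" for Z x y
    using that unfolding periodic_def by (metis diff_add_cancel add.commute)
  have \<tau>_iff: "\<tau> z = y \<longleftrightarrow> y \<in> P \<and> z + act (c z) - y \<in> La" for z y
    unfolding \<tau>_def using red[of "z + act (c z)"] red_unique[of y "z + act (c z)"] by auto
  have "transportable D (\<lambda>x. of_bool (x \<in> A)) (\<lambda>y. card {x \<in> A. \<tau> x = y})"
  proof (rule transportable_gather)
    show "finite S" unfolding S_def by (rule finite_moves[OF finite_gbox])
    show "S \<subseteq> D" unfolding S_def by (rule moves_sub[OF D]) (auto intro: gbox_gvecs)
    show "\<tau> x - x \<in> S" if x: "x \<in> A" for x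
    proof -
      have t: "\<tau> x \<in> P" "x + act (c x) - \<tau> x \<in> La" using \<tau>_iff[of x "\<tau> x"] by auto
      have "norm (x + act (c x) - \<tau> x) \<le> norm (x + act (c x)) + norm (\<tau> x)" by (rule norm_triangle_ineq4)
      also have "norm (x + act (c x)) \<le> norm x + norm (act (c x))" by (rule norm_triangle_ineq)
      finally have "norm (x + act (c x) - \<tau> x) \<le> \<rho>A + \<rho>a + \<rho>P" using \<rho>A[OF x] \<rho>a[OF c(3)[of x]] \<rho>P[OF t(1)] by linarith
      then show ?thesis unfolding S_def using t(2) by (intro movesI[OF c(3)[of x]]) (auto simp: algebra_simps)
    qed
    show "A \<in> sets borel" by fact
    fix s assume "s \<in> S"
    have "\<tau> x - x = s \<longleftrightarrow> x + s \<in> P \<and> act (c x) - s \<in> La" for x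
      using \<tau>_iff[of x "x + s"] by (auto simp: algebra_simps)
    then have "{x. \<tau> x - x = s} = {x. x + s \<in> P} \<inter> (\<Union>v\<in>{v \<in> gbox I R. act v - s \<in> La}. {x. c x = v})"
      using c(3) by auto
    also have "\<dots> \<in> sets borel"
    proof (intro sets.Int sets.finite_UN c(1))
      show "{x. x + s \<in> P} \<in> sets borel" by measurable
    qed (simp add: finite_gbox)
    finally show "{x. \<tau> x - x = s} \<in> sets borel" .
  qed
  moreover have "card {x \<in> A. \<tau> x = y} =
      (if y \<in> P then (if y \<in> Y \<inter> \<Omega> then \<Sum>v\<in>cell_vertices c R y. fibre_count A (y + act v) else 0) else 0)" for y
  proof (cases "y \<in> P \<and> y \<in> Y \<inter> \<Omega>")
    case False
    have "{x \<in> A. \<tau> x = y} = {}"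
    proof (rule ccontr)
      assume "{x \<in> A. \<tau> x = y} \<noteq> {}"
      then obtain x where x: "x \<in> A" "y \<in> P" "x + act (c x) - y \<in> La" using \<tau>_iff by blast
      have "x + act (c x) \<in> Y \<inter> \<Omega>" using c(4) \<Omega>(2)[OF _ gbox_gvecs[OF c(3)]] A(3) x(1) by blast
      then show False using perD[OF Y x(3)] perD[OF \<Omega>(1) x(3)] False x(2) by blast
    qed
    then have "card {x \<in> A. \<tau> x = y} = 0" by (simp only: card.empty)
    then show ?thesis using False by auto
  next
    case True
    have "{x \<in> A. \<tau> x = y} = (\<Union>v\<in>cell_vertices c R y. {z \<in> A. z - (y + act v) \<in> La})"
    proof (intro subset_antisym subsetI)
      fix x assume "x \<in> {x \<in> A. \<tau> x = y}"
      then have x: "x \<in> A" "x + act (c x) - y \<in> La" using \<tau>_iff by auto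
      define v where "v = - c x"
      have d: "x - (y + act v) \<in> La" using x(2) by (simp add: v_def act_uminus algebra_simps)
      have "v \<in> gbox I R" unfolding v_def gbox_uminus by (rule c(3))
      moreover have "c (y + act v) = - v" using La_c[OF d] by (simp add: v_def)
      ultimately have "v \<in> cell_vertices c R y" by (simp add: cell_vertices_def)
      then show "x \<in> (\<Union>v\<in>cell_vertices c R y. {z \<in> A. z - (y + act v) \<in> La})" using x d by blast
    next
      fix x assume "x \<in> (\<Union>v\<in>cell_vertices c R y. {z \<in> A. z - (y + act v) \<in> La})"
      then obtain v where v: "v \<in> cell_vertices c R y" "x \<in> A" "x - (y + act v) \<in> La" by blast
      have "c x = - v" using La_c[OF v(3)] v(1) by (simp add: cell_vertices_def)
      then have "x + act (c x) - y \<in> La" using v(3) by (simp add: act_uminus algebra_simps)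
      then show "x \<in> {x \<in> A. \<tau> x = y}" using v(2) True \<tau>_iff by blast
    qed
    also have "card \<dots> = (\<Sum>v\<in>cell_vertices c R y. fibre_count A (y + act v))"
      unfolding fibre_count_def
    proof (rule card_UN_disjoint[OF finite_cell_vertices])
      show "\<forall>v\<in>cell_vertices c R y. finite {z \<in> A. z - (y + act v) \<in> La}" using finite_fibre_count[OF A(2)] by blast
      show "\<forall>u\<in>cell_vertices c R y. \<forall>v\<in>cell_vertices c R y. u \<noteq> v \<longrightarrow>
        {z \<in> A. z - (y + act u) \<in> La} \<inter> {z \<in> A. z - (y + act v) \<in> La} = {}"
      proof (intro ballI impI, rule ccontr)
        fix u v assume uv: "u \<in> cell_vertices c R y" "v \<in> cell_vertices c R y" "u \<noteq> v"
          "{z \<in> A. z - (y + act u) \<in> La} \<inter> {z \<in> A. z - (y + act v) \<in> La} \<noteq> {}"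
        then obtain z where z: "z - (y + act u) \<in> La" "z - (y + act v) \<in> La" by blast
        have "c z = - u" "c z = - v" using La_c[OF z(1)] La_c[OF z(2)] uv by (auto simp: cell_vertices_def)
        then show False using uv(3) by simp
      qed
    qed
    finally show ?thesis using True by simp
  qed
  ultimately show ?thesis by simp
qed

text \<open>Both sets are gathered at the centres of cells. There A delivers q units per point of
  the cell, and by the divergence theorem this differs from what B requires by the flow through the
  boundary of the cell. That flow is at most K per edge, hence at most the number of points, so
  every cell can send its outflow at once from its own stock, without waiting for arrivals.\<close>

theorem transport_of_flow:
  fixes F :: "real ^ 'n \<Rightarrow> int ^ 'n \<Rightarrow> int" and K :: int
  assumes D: "subgrp D" "La \<subseteq> D" "act ` gvecs \<subseteq> D"
    and \<Omega>: "\<Omega> \<in> sets borel" "periodic \<Omega>" "\<And>x v. x \<in> \<Omega> \<Longrightarrow> v \<in> gvecs \<Longrightarrow> x + act v \<in> \<Omega>"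
    and F: "\<And>a z. a \<in> nbrs I \<Longrightarrow> {x. F x a = z} \<in> sets borel"
      "\<And>x l a. l \<in> La \<Longrightarrow> F (x + l) a = F x a"
      "\<And>x a. x \<in> \<Omega> \<Longrightarrow> a \<in> nbrs I \<Longrightarrow> F (x + act a) (- a) = - F x a"
      "\<And>x a. x \<in> \<Omega> \<Longrightarrow> a \<in> nbrs I \<Longrightarrow> \<bar>F x a\<bar> \<le> K"
    and A: "A \<in> sets borel" "bounded A" "A \<subseteq> \<Omega>" and B: "B \<in> sets borel" "bounded B" "B \<subseteq> \<Omega>"
    and q: "q \<ge> 1" "\<And>x. x \<in> \<Omega> \<Longrightarrow> fibre_count A x = q"
      "\<And>x. x \<in> \<Omega> \<Longrightarrow> int (fibre_count B x) = int q - (\<Sum>a\<in>nbrs I. F x a)"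
  shows "transportable D (\<lambda>x. of_bool (x \<in> A)) (\<lambda>x. of_bool (x \<in> B))"
proof -
  define K' where "K' = max 0 K"
  have K': "0 \<le> real_of_int K'" by (simp add: K'_def)
  obtain Y :: "(real ^ 'n) set" and c R where Y: "Y \<in> sets borel" "periodic Y"
    and c: "\<And>v. {x. c x = v} \<in> sets borel" "\<And>x l. l \<in> La \<Longrightarrow> c (x + l) = c x"
      "\<And>x. c x \<in> gbox I R" "\<And>x. x + act (c x) \<in> Y"
    and cell: "\<And>y. y \<in> Y \<Longrightarrow> K' * real (card (cell_boundary c R y)) \<le> real (card (cell_vertices c R y))"
  proof (rule cells[OF K'], goal_cases)
    case (1 Y c R)
    show ?case by (rule 1(1)[OF 1(2-)])
  qed
  define YO where "YO = Y \<inter> \<Omega>"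
  define \<alpha> where "\<alpha> y = (\<Sum>v\<in>cell_vertices c R y. q)" for y
  define \<beta> where "\<beta> y = (\<Sum>v\<in>cell_vertices c R y. fibre_count B (y + act v))" for y
  \<comment> \<open>Displacement from y to the centre of the cell that the edge (v, a) leads
    into.\<close>
  define dst where "dst y = (\<lambda>(v, a). v + a + c (y + act (v + a)))" for y
  define out where "out y = (\<lambda>(v, a). nat (F (y + act v) a))" for y
  define W where "W = gbox I (2 * R + 1)"
  \<comment> \<open>The units with w = 0 stay. Their number is a difference of natural numbers,
    exact because of \<open>out_le\<close>.\<close>
  define n where "n w y = (if y \<in> YO then (\<Sum>b | b \<in> cell_boundary c R y \<and> dst y b = w. out y b) +
      (if w = 0 then \<alpha> y - (\<Sum>b\<in>cell_boundary c R y. out y b) else 0) else 0)" for w y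
  have fW: "finite W" by (simp add: W_def finite_gbox)
  have R0: "0 \<in> W"
  proof -
    have "c 0 - c 0 \<in> gbox I (R + R)" by (rule gbox_diff[OF c(3) c(3)])
    then show ?thesis unfolding W_def using gbox_mono[of "R + R" "2 * R + 1" I] by auto
  qed
  have inO: "y + act v \<in> \<Omega>" if "y \<in> \<Omega>" "v \<in> gbox I r" for y v r
    using \<Omega>(3)[OF that(1) gbox_gvecs[OF that(2)]] .
  have actO: "y - act w \<in> \<Omega> \<longleftrightarrow> y \<in> \<Omega>" if "w \<in> W" for y w
  proof -
    have w: "w \<in> gvecs" using that unfolding W_def by (rule gbox_gvecs)
    show ?thesis using \<Omega>(3)[of y "- w"] \<Omega>(3)[of "y - act w" w] w gvecs_uminus[OF w] by (auto simp: act_uminus)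
  qed
  have cV: "v \<in> cell_vertices c R y \<longleftrightarrow> c (y + act v) = - v" for v y
    using c(3)[of "y + act v"] gbox_uminus[of v I R] by (auto simp: cell_vertices_def)
  have dst_W: "dst y (v, a) \<in> W" if "(v, a) \<in> cell_boundary c R y" for y v a
  proof -
    have "v \<in> gbox I R" "a \<in> gbox I 1" using that nbrs_gbox by (auto simp: cell_boundary_def cell_vertices_def)
    from gbox_add[OF gbox_add[OF this] c(3)[of "y + act (v + a)"]]
    show ?thesis by (simp add: dst_def W_def algebra_simps)
  qed
  have dst_0: "dst y (v, a) \<noteq> 0" if "(v, a) \<in> cell_boundary c R y" for y v a
  proof
    assume "dst y (v, a) = 0"
    then have "v + a + c (y + act (v + a)) = 0" by (simp add: dst_def)
    then have "c (y + act (v + a)) = - (v + a)" by (rule minus_unique[symmetric])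
    then show False using that cV[of "v + a" y] by (simp add: cell_boundary_def)
  qed
  have dst_Y: "y + act (dst y b) \<in> Y" for y b
    using c(4)[of "y + act (fst b + snd b)"] by (simp add: dst_def case_prod_unfold act_add add.assoc)
  have out_le: "(\<Sum>b\<in>cell_boundary c R y. out y b) \<le> \<alpha> y" if y: "y \<in> YO" for y
  proof -
    have "real (\<Sum>b\<in>cell_boundary c R y. out y b) \<le> (\<Sum>b\<in>cell_boundary c R y. real_of_int K')"
      unfolding of_nat_sum
    proof (rule sum_mono)
      fix b assume b: "b \<in> cell_boundary c R y"
      obtain v a where va: "b = (v, a)" by (cases b)
      have "v \<in> gbox I R" "a \<in> nbrs I" using b va by (auto simp: cell_boundary_def cell_vertices_def)
      then have "\<bar>F (y + act v) a\<bar> \<le> K" using y by (intro F(4) inO) (auto simp: YO_def)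
      then show "real (out y b) \<le> real_of_int K'" unfolding va out_def K'_def by simp
    qed
    also have "\<dots> \<le> real (card (cell_vertices c R y))" using cell[of y] y by (simp add: YO_def mult.commute)
    also have "\<dots> \<le> real (card (cell_vertices c R y)) * real q" using q(1) mult_left_mono[of 1 "real q" "real (card (cell_vertices c R y))"] by simp
    also have "\<dots> = real (\<alpha> y)" by (simp add: \<alpha>_def)
    finally show ?thesis by (simp only: of_nat_le_iff)
  qed
  have n_sum: "(\<Sum>w\<in>W. n w y) = (if y \<in> YO then \<alpha> y else 0)" for y
  proof (cases "y \<in> YO")
    case True
    have "(\<Sum>w\<in>W. \<Sum>b | b \<in> cell_boundary c R y \<and> dst y b = w. out y b) = (\<Sum>b\<in>cell_boundary c R y. out y b)"
      by (rule sum.group[OF finite_cell_boundary fW]) (use dst_W in auto)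
    then show ?thesis using True out_le[OF True] fW R0 by (simp add: n_def sum.distrib sum.delta)
  qed (simp add: n_def)
  have n_in: "(\<Sum>w\<in>W. n w (y - act w)) = (if y \<in> YO then \<beta> y else 0)" for y
  proof (cases "y \<in> YO")
    case False
    have "n w (y - act w) = 0" if w: "w \<in> W" for w
    proof (cases "w = 0")
      case True
      then show ?thesis using False by (simp add: n_def)
    next
      case w0: False
      have "n w (y - act w) = 0"
      proof (cases "y - act w \<in> YO")
        case True
        then have "y \<in> \<Omega>" using actO[OF w] by (simp add: YO_def)
        then have "y \<notin> Y" using False by (simp add: YO_def)
        then have "dst (y - act w) b \<noteq> w" for b using dst_Y[of "y - act w" b] by auto
        then show ?thesis using w0 by (simp add: n_def)
      qed (simp add: n_def)
      then show ?thesis .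
    qed
    then show ?thesis using False by simp
  next
    case True
    then have yO: "y \<in> \<Omega>" and yY: "y \<in> Y" by (auto simp: YO_def)
    define inn where "inn = (\<lambda>(v, a). nat (- F (y + act v) a))"
    define X where "X = (SIGMA w:W. {b. y - act w \<in> YO \<and> b \<in> cell_boundary c R (y - act w) \<and> dst (y - act w) b = w})"
    have fX: "finite {b. y - act w \<in> YO \<and> b \<in> cell_boundary c R (y - act w) \<and> dst (y - act w) b = w}" for w
      by (rule finite_subset[OF _ finite_cell_boundary[of c R "y - act w"]]) auto
    have "(\<Sum>w\<in>W. n w (y - act w)) = (\<Sum>w\<in>W. (\<Sum>b | y - act w \<in> YO \<and> b \<in> cell_boundary c R (y - act w) \<and> dst (y - act w) b = w. out (y - act w) b) +
        (if w = 0 then \<alpha> y - (\<Sum>b\<in>cell_boundary c R y. out y b) else 0))"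
      using True by (intro sum.cong) (auto simp: n_def)
    also have "\<dots> = (\<Sum>(w, b)\<in>X. out (y - act w) b) + (\<alpha> y - (\<Sum>b\<in>cell_boundary c R y. out y b))"
      unfolding X_def using fW R0 fX by (simp add: sum.distrib sum.delta sum.Sigma)
    \<comment> \<open>An edge that leads from the cell of y - act w into the cell of y is, read
      backwards, a boundary edge of the cell of y; by antisymmetry its outflow is the inflow
      there.\<close>
    also have "(\<Sum>(w, b)\<in>X. out (y - act w) b) = (\<Sum>b\<in>cell_boundary c R y. inn b)"
    proof (rule sum.reindex_bij_witness[of _ "\<lambda>(v', a'). (- dst y (v', a'), (v' + a' - dst y (v', a'), - a'))"
          "\<lambda>(w, (v, a)). (v + a - w, - a)"])
      fix k assume k: "k \<in> X"
      obtain w v a where kw: "k = (w, (v, a))" by (cases k) auto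
      have w: "w \<in> W" "y - act w \<in> YO" "(v, a) \<in> cell_boundary c R (y - act w)" "dst (y - act w) (v, a) = w"
        using k unfolding kw X_def by auto
      have a: "a \<in> nbrs I" "c (y - act w + act v) = - v" using w(3) cV by (auto simp: cell_boundary_def)
      define v' where "v' = v + a - w"
      have p1: "y + act v' = y - act w + act (v + a)" by (simp add: v'_def act_add act_diff algebra_simps)
      have p2: "y + act (v' + - a) = y - act w + act v" by (simp add: v'_def act_add act_diff algebra_simps)
      have c1: "c (y + act v') = - v'" using w(4) unfolding p1 by (simp add: dst_def v'_def algebra_simps)
      have w0: "w \<noteq> 0" using dst_0[OF w(3)] w(4) by simp
      have c2: "c (y + act (v' + - a)) = - v" unfolding p2 by (rule a(2))
      have B': "(v', - a) \<in> cell_boundary c R y"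
      proof -
        have "v' + - a \<notin> cell_vertices c R y"
          unfolding cV c2 using w0 by (simp add: v'_def)
        then show ?thesis using c1 cV a(1) by (simp add: cell_boundary_def)
      qed
      have d': "dst y (v', - a) = - w" unfolding dst_def using c2 by (simp add: v'_def)
      show "(\<lambda>(v', a'). (- dst y (v', a'), (v' + a' - dst y (v', a'), - a'))) ((\<lambda>(w, (v, a)). (v + a - w, - a)) k) = k"
        unfolding kw split_conv v'_def[symmetric] d' by (simp add: v'_def)
      show "(\<lambda>(w, (v, a)). (v + a - w, - a)) k \<in> cell_boundary c R y" unfolding kw split_conv v'_def[symmetric] by (rule B')
      have vg: "v \<in> gbox I R" using w(3) by (auto simp: cell_boundary_def cell_vertices_def)
      have xO: "y - act w + act v \<in> \<Omega>" using w(2) vg by (intro inO[of _ _ R]) (auto simp: YO_def)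
      have "F (y + act v') (- a) = - F (y - act w + act v) a"
        using F(3)[OF xO a(1)] unfolding p1 act_add add.assoc .
      then show "inn ((\<lambda>(w, (v, a)). (v + a - w, - a)) k) = (case k of (w, b) \<Rightarrow> out (y - act w) b)"
        unfolding kw split_conv v'_def[symmetric] inn_def out_def by simp
    next
      fix b assume b: "b \<in> cell_boundary c R y"
      obtain v' a' where va: "b = (v', a')" by (cases b)
      have a': "a' \<in> nbrs I" "c (y + act v') = - v'" using b va cV by (auto simp: cell_boundary_def)
      define d where "d = dst y (v', a')"
      have dW: "- d \<in> W" using dst_W[of v' a' y] b va unfolding d_def W_def gbox_uminus by simp
      have c1: "c (y + act (v' + a')) = d - (v' + a')" by (simp add: d_def dst_def)
      have d0: "d \<noteq> 0" unfolding d_def using dst_0 b va by blast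
      have p1: "y - act (- d) + act (v' + a' - d) = y + act (v' + a')" by (simp add: act_uminus act_diff act_add)
      have p2: "y - act (- d) + act (v' + a' - d + - a') = y + act v'" by (simp add: act_uminus act_diff act_add)
      have "y + act d \<in> Y" unfolding d_def by (rule dst_Y)
      then have YO': "y - act (- d) \<in> YO" using actO[OF dW, of y] yO by (simp add: YO_def act_uminus)
      have in1: "v' + a' - d \<in> cell_vertices c R (y - act (- d))" unfolding cV p1 c1 by simp
      have in2: "v' + a' - d + - a' \<notin> cell_vertices c R (y - act (- d))" unfolding cV p2 a'(2) using d0 by simp
      have d': "dst (y - act (- d)) (v' + a' - d, - a') = - d" unfolding dst_def split_conv p2 a'(2) by simp
      show "(\<lambda>(v', a'). (- dst y (v', a'), (v' + a' - dst y (v', a'), - a'))) b \<in> X"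
        unfolding va split_conv d_def[symmetric] X_def using dW YO' in1 in2 d' a'(1) by (simp add: cell_boundary_def)
      show "(\<lambda>(w, (v, a)). (v + a - w, - a)) ((\<lambda>(v', a'). (- dst y (v', a'), (v' + a' - dst y (v', a'), - a'))) b) = b"
        unfolding va by simp
    qed
    also have "(\<Sum>b\<in>cell_boundary c R y. inn b) + (\<alpha> y - (\<Sum>b\<in>cell_boundary c R y. out y b)) = \<beta> y"
    proof -
      \<comment> \<open>The divergence theorem asks for antisymmetry at all vertices, while F has it
        on \<Omega>, which the translates of y by \<open>gvecs\<close> do not leave. Hence the
        cut-off outside \<open>gvecs\<close>.\<close>
      define f where "f v a = (if v \<in> gvecs then real_of_int (F (y + act v) a) else 0)" for v a
      have gv: "v + a \<in> gvecs \<longleftrightarrow> v \<in> gvecs" if "a \<in> nbrs I" for v a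
      proof -
        have "a \<in> gvecs" using nbrs_gbox[OF that] by (rule gbox_gvecs)
        then show ?thesis using gvecs_add[of v a] gvecs_add[of "v + a" "- a"] gvecs_uminus[of a] by auto
      qed
      have f_anti: "f (v + a) (- a) = - f v a" if "a \<in> nbrs I" for v a
        using F(3)[OF \<Omega>(3)[OF yO, of v] that] gv[OF that, of v] by (simp add: f_def act_add add.assoc)
      have vgv: "v \<in> gvecs" if "v \<in> cell_vertices c R y" for v using that gbox_gvecs by (auto simp: cell_vertices_def)
      have "real_of_int (int (\<alpha> y) - int (\<beta> y)) = (\<Sum>v\<in>cell_vertices c R y. real_of_int (int q - int (fibre_count B (y + act v))))"
        by (simp add: \<alpha>_def \<beta>_def sum_subtractf)
      also have "\<dots> = (\<Sum>v\<in>cell_vertices c R y. \<Sum>a\<in>nbrs I. f v a)"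
      proof (rule sum.cong[OF refl])
        fix v assume v: "v \<in> cell_vertices c R y"
        have "int q - int (fibre_count B (y + act v)) = (\<Sum>a\<in>nbrs I. F (y + act v) a)"
          using q(3)[OF \<Omega>(3)[OF yO vgv[OF v]]] by simp
        then show "real_of_int (int q - int (fibre_count B (y + act v))) = (\<Sum>a\<in>nbrs I. f v a)"
          using vgv[OF v] by (simp add: f_def)
      qed
      also have "\<dots> = (\<Sum>(v, a) | v \<in> cell_vertices c R y \<and> a \<in> nbrs I \<and> v + a \<notin> cell_vertices c R y. f v a)"
        by (rule sum_boundary[OF finite_cell_vertices finite_nbrs]) (auto simp: f_anti)
      also have "\<dots> = (\<Sum>b\<in>cell_boundary c R y. real_of_int (int (out y b) - int (inn b)))"
        unfolding cell_boundary_def using vgv by (intro sum.cong) (auto simp: f_def out_def inn_def)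
      also have "\<dots> = real_of_int (int (\<Sum>b\<in>cell_boundary c R y. out y b) - int (\<Sum>b\<in>cell_boundary c R y. inn b))"
        by (simp add: sum_subtractf)
      finally have "int (\<alpha> y) - int (\<beta> y) = int (\<Sum>b\<in>cell_boundary c R y. out y b) - int (\<Sum>b\<in>cell_boundary c R y. inn b)"
        by (simp only: of_int_eq_iff)
      then show ?thesis using out_le[OF True] by linarith
    qed
    finally show ?thesis using True by simp
  qed
  have n_borel: "{y. n w y = k} \<in> sets borel" for w k
  proof -
    \<comment> \<open>The direction 0 is a placeholder for probing only c or membership in
      YO.\<close>
    define U where "U = gbox I (R + 1) \<times> gbox I R \<times> insert 0 (nbrs I)"
    define d where "d = (\<lambda>(v, v', a) y. (y \<in> YO, c (y + act v) = v', if a \<in> nbrs I then F (y + act v) a else 0))"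
    show ?thesis
    proof (rule finite_dependence_measurable[of U d])
      show "finite U" by (simp add: U_def finite_gbox finite_nbrs)
      show "{y. d u y = r} \<in> sets borel" for u r
      proof -
        obtain v v' a where u: "u = (v, v', a)" by (cases u)
        obtain r1 r2 r3 where r: "r = (r1, r2, r3)" by (cases r)
        have YOb: "YO \<in> sets borel" using Y \<Omega> by (simp add: YO_def)
        have 1: "{y. (y \<in> YO) = r1} \<in> sets borel" using YOb borel_comp[OF YOb] by (cases r1) (auto simp: Compl_eq)
        have cb: "{y. c (y + act v) = v'} \<in> sets borel" by (rule borel_shift_eq[OF c(1)])
        have 2: "{y. (c (y + act v) = v') = r2} \<in> sets borel" using cb borel_comp[OF cb] by (cases r2) (auto simp: Compl_eq)
        have 3: "{y. (if a \<in> nbrs I then F (y + act v) a else 0) = r3} \<in> sets borel"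
          using borel_shift_eq[OF F(1)] by (cases "a \<in> nbrs I") auto
        have "{y. d u y = r} = {y. (y \<in> YO) = r1} \<inter> {y. (c (y + act v) = v') = r2} \<inter>
            {y. (if a \<in> nbrs I then F (y + act v) a else 0) = r3}"
          unfolding u r d_def by auto
        also have "\<dots> \<in> sets borel" using 1 2 3 by (intro sets.Int)
        finally show ?thesis .
      qed
      fix x y assume eq: "\<And>u. u \<in> U \<Longrightarrow> d u x = d u y"
      have z: "(0 :: int ^ 'n) \<notin> nbrs I" using nbrs_nonzero by blast
      have cc: "c (x + act v) = c (y + act v)" if "v \<in> gbox I (R + 1)" for v
        using eq[of "(v, c (x + act v), 0)"] that c(3) by (auto simp: U_def d_def)
      have rounded: "F (x + act v) a = F (y + act v) a" if "v \<in> gbox I (R + 1)" "a \<in> nbrs I" for v a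
        using eq[of "(v, c 0, a)"] that c(3) by (auto simp: U_def d_def)
      have YO': "x \<in> YO \<longleftrightarrow> y \<in> YO"
      proof -
        have "c 0 \<in> gbox I (R + 1)" using c(3)[of 0] gbox_mono[of R "R + 1" I] by auto
        then show ?thesis using eq[of "(c 0, c 0, 0)"] c(3) by (auto simp: U_def d_def)
      qed
      have mono: "v \<in> gbox I (R + 1)" if "v \<in> gbox I R" for v using that gbox_mono[of R "R + 1" I] by auto
      have V: "cell_vertices c R x = cell_vertices c R y" using cc mono by (auto simp: cell_vertices_def)
      then have B: "cell_boundary c R x = cell_boundary c R y" by (simp add: cell_boundary_def)
      have bd: "v \<in> gbox I (R + 1) \<and> v + a \<in> gbox I (R + 1) \<and> a \<in> nbrs I" if "(v, a) \<in> cell_boundary c R y" for v a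
        using that mono[of v] gbox_add[of v I R a 1] nbrs_gbox[of a I] by (auto simp: cell_boundary_def cell_vertices_def)
      have ds: "dst x b = dst y b" if "b \<in> cell_boundary c R y" for b
        using cc bd[of "fst b" "snd b"] that by (simp add: dst_def case_prod_unfold)
      have ou: "out x b = out y b" if "b \<in> cell_boundary c R y" for b
        using rounded bd[of "fst b" "snd b"] that by (simp add: out_def case_prod_unfold)
      have "(\<Sum>b | b \<in> cell_boundary c R x \<and> dst x b = w. out x b) = (\<Sum>b | b \<in> cell_boundary c R y \<and> dst y b = w. out y b)"
        unfolding B using ds ou by (intro sum.cong) auto
      moreover have "(\<Sum>b\<in>cell_boundary c R x. out x b) = (\<Sum>b\<in>cell_boundary c R y. out y b)"
        unfolding B using ou by (intro sum.cong) auto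
      moreover have "\<alpha> x = \<alpha> y" by (simp add: \<alpha>_def V)
      ultimately show "n w x = n w y" unfolding n_def YO' by simp
    qed simp
  qed
  have n_per: "n w (x + l) = n w x" if l: "l \<in> La" for w x l
  proof -
    have sh: "x + l + act v = x + act v + l" for v by (simp add: algebra_simps)
    have cl: "c (x + l + act v) = c (x + act v)" for v unfolding sh by (rule c(2)[OF l])
    have Fl: "F (x + l + act v) a = F (x + act v) a" for v a unfolding sh by (rule F(2)[OF l])
    have V: "cell_vertices c R (x + l) = cell_vertices c R x" by (simp add: cell_vertices_def cl)
    then have B: "cell_boundary c R (x + l) = cell_boundary c R x" by (simp add: cell_boundary_def)
    have "dst (x + l) = dst x" "out (x + l) = out x" by (auto simp: dst_def out_def cl Fl fun_eq_iff)
    moreover have "x + l \<in> YO \<longleftrightarrow> x \<in> YO" using Y(2) \<Omega>(2) l by (simp add: YO_def periodic_def)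
    moreover have "\<alpha> (x + l) = \<alpha> x" by (simp add: \<alpha>_def V)
    ultimately show ?thesis by (simp add: n_def B)
  qed
  have Wg: "W \<subseteq> gvecs" unfolding W_def by (auto intro: gbox_gvecs)
  have mid: "transportable D (\<lambda>x. if x \<in> P then if x \<in> YO then \<alpha> x else 0 else 0) (\<lambda>x. if x \<in> P then if x \<in> YO then \<beta> x else 0 else 0)"
    using per_transportable[where n = n, OF D fW Wg n_borel n_per] unfolding n_sum n_in .
  have tA: "transportable D (\<lambda>x. of_bool (x \<in> A)) (\<lambda>y. if y \<in> P then if y \<in> YO then \<alpha> y else 0 else 0)"
  proof -
    have "(\<Sum>v\<in>cell_vertices c R y. fibre_count A (y + act v)) = \<alpha> y" if "y \<in> YO" for y
      unfolding \<alpha>_def using that q(2) inO[of y _ R] by (intro sum.cong) (auto simp: cell_vertices_def YO_def)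
    then have "(\<lambda>y. if y \<in> P then (if y \<in> Y \<inter> \<Omega> then \<Sum>v\<in>cell_vertices c R y. fibre_count A (y + act v) else 0) else 0) =
        (\<lambda>y. if y \<in> P then if y \<in> YO then \<alpha> y else 0 else 0)"
      by (auto simp: fun_eq_iff YO_def)
    then show ?thesis using transportable_to_markers[OF D c Y(2) \<Omega>(2,3) A] by simp
  qed
  have tB: "transportable D (\<lambda>x. of_bool (x \<in> B)) (\<lambda>y. if y \<in> P then if y \<in> YO then \<beta> y else 0 else 0)"
    using transportable_to_markers[OF D c Y(2) \<Omega>(2,3) B] unfolding \<beta>_def YO_def .
  show ?thesis
    by (rule transportable_trans[OF D(1) tA transportable_trans[OF D(1) mid transportable_sym[OF D(1) tB]]])
qed

end

section \<open>Adapted bases and fundamental parallelepipeds\<close>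

lemma is_lattice_subgrp: "is_lattice L \<Longrightarrow> subgrp L"
  by (auto simp: is_lattice_def subgrp_def)

lemma is_lattice_uniform_discrete:
  assumes "is_lattice L"
  shows "uniform_discrete L"
proof -
  have L0: "0 \<in> L" and Ld: "\<And>x y. x \<in> L \<Longrightarrow> y \<in> L \<Longrightarrow> x - y \<in> L" and disc: "discrete L"
    using assms unfolding is_lattice_def by auto
  obtain e where e: "e > 0" "\<And>y. y \<in> L \<Longrightarrow> dist 0 y < e \<Longrightarrow> y = 0"
    using discreteD[OF disc L0] unfolding isolated_in_dist_Ex_iff by auto
  show ?thesis unfolding uniform_discrete_def
  proof (intro exI[of _ e] conjI ballI impI)
    fix x y assume "x \<in> L" "y \<in> L" "dist x y < e"
    then have "x - y = 0" using e(2)[OF Ld[of x y]] by (simp add: dist_norm norm_minus_commute)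
    then show "x = y" by simp
  qed (rule e)
qed

lemma is_lattice_finite:
  assumes "is_lattice L" "bounded B"
  shows "finite (L \<inter> B)"
  using is_lattice_uniform_discrete[OF assms(1)] assms(2)
  by (metis bounded_Int inf_le1 uniform_discrete_finite_iff uniform_discrete_subset)

lemma subgrp_scale:
  assumes "subgrp G" "x \<in> G"
  shows "of_int k *\<^sub>R x \<in> G"
proof -
  have nat: "of_nat n *\<^sub>R x \<in> G" for n
  proof (induction n)
    case 0
    show ?case using assms(1) by (simp add: subgrp_def)
  next
    case (Suc n)
    then show ?case using subgrp_add[OF assms(1) assms(2)] by (simp add: scaleR_left_distrib)
  qed
  show ?thesis
  proof (cases "k \<ge> 0")
    case True
    then show ?thesis using nat[of "nat k"] by simp
  next
    case False
    then show ?thesis using subgrp_uminus[OF assms(1) nat[of "nat (- k)"]] by simp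
  qed
qed

lemma subgrp_sum:
  assumes "subgrp G" "\<And>i. i \<in> S \<Longrightarrow> f i \<in> G"
  shows "(\<Sum>i\<in>S. f i) \<in> G"
proof (cases "finite S")
  case True
  then show ?thesis using assms(2)
    by (induction S rule: finite_induct) (use assms(1) subgrp_add[OF assms(1)] in \<open>auto simp: subgrp_def\<close>)
qed (use assms in \<open>simp add: subgrp_def\<close>)

definition zcomb :: "('n \<Rightarrow> real ^ 'n) \<Rightarrow> int ^ 'n \<Rightarrow> real ^ 'n" where
  "zcomb w v = (\<Sum>i\<in>UNIV. of_int (v $ i) *\<^sub>R w i)"

definition zbasis :: "(real ^ 'n) set \<Rightarrow> ('n \<Rightarrow> real ^ 'n) \<Rightarrow> bool" where
  "zbasis M w \<longleftrightarrow> M = range (zcomb w) \<and> (\<forall>r. (\<Sum>i\<in>UNIV. r i *\<^sub>R w i) = 0 \<longrightarrow> (\<forall>i. r i = 0))"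

lemma sum_two:
  fixes g :: "'n::finite \<Rightarrow> 'b::comm_monoid_add"
  assumes "i \<noteq> j"
  shows "(\<Sum>k\<in>UNIV. g k) = g i + g j + (\<Sum>k\<in>UNIV - {i, j}. g k)"
proof -
  have "(\<Sum>k\<in>UNIV. g k) = g i + (\<Sum>k\<in>UNIV - {i}. g k)" by (rule sum.remove) auto
  also have "(\<Sum>k\<in>UNIV - {i}. g k) = g j + (\<Sum>k\<in>UNIV - {i} - {j}. g k)"
    using assms by (intro sum.remove) auto
  also have "UNIV - {i} - {j} = UNIV - {i, j}" by auto
  finally show ?thesis by (simp add: add.assoc)
qed

lemma zcomb_elementary:
  fixes w :: "'n \<Rightarrow> real ^ 'n"
  assumes "i \<noteq> j"
  shows "(\<Sum>k\<in>UNIV. r k *\<^sub>R (w(j := w j + s *\<^sub>R w i)) k) = (\<Sum>k\<in>UNIV. (r(i := r i + s * r j)) k *\<^sub>R w k)"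
proof -
  have "(\<Sum>k\<in>UNIV - {i, j}. r k *\<^sub>R (w(j := w j + s *\<^sub>R w i)) k) = (\<Sum>k\<in>UNIV - {i, j}. (r(i := r i + s * r j)) k *\<^sub>R w k)"
    by (intro sum.cong) auto
  then show ?thesis
    unfolding sum_two[OF assms] using assms by (simp add: algebra_simps)
qed

lemma zbasis_elementary:
  assumes w: "zbasis M w" and ij: "i \<noteq> j"
  shows "zbasis M (w(j := w j + of_int s *\<^sub>R w i))"
proof -
  define w' where "w' = w(j := w j + of_int s *\<^sub>R w i)"
  have el: "(\<Sum>k\<in>UNIV. r k *\<^sub>R w' k) = (\<Sum>k\<in>UNIV. (r(i := r i + of_int s * r j)) k *\<^sub>R w k)" for r
    unfolding w'_def by (rule zcomb_elementary[OF ij])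
  have zc: "zcomb w' v = zcomb w (\<chi> k. if k = i then v $ i + s * v $ j else v $ k)" for v
    unfolding zcomb_def el by (intro sum.cong) auto
  have "range (zcomb w') = range (zcomb w)"
  proof (intro subset_antisym subsetI)
    fix x assume "x \<in> range (zcomb w)"
    then obtain v where "x = zcomb w v" by blast
    also have "v = (\<chi> k. if k = i then (\<chi> k. if k = i then v $ i - s * v $ j else v $ k) $ i + s * (\<chi> k. if k = i then v $ i - s * v $ j else v $ k) $ j
        else (\<chi> k. if k = i then v $ i - s * v $ j else v $ k) $ k)"
      using ij by (auto simp: vec_eq_iff)
    finally show "x \<in> range (zcomb w')" unfolding zc[symmetric] by blast
  qed (use zc in auto)
  moreover have "\<forall>k. r k = 0" if "(\<Sum>k\<in>UNIV. r k *\<^sub>R w' k) = 0" for r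
  proof -
    have "\<forall>k. (r(i := r i + of_int s * r j)) k = 0"
      using w that unfolding el zbasis_def by blast
    then have *: "(r(i := r i + of_int s * r j)) k = 0" for k by blast
    have "r k = 0" if "k \<noteq> i" for k using *[of k] that by simp
    moreover from this[of j] have "r i = 0" using *[of i] ij by simp
    ultimately show ?thesis by metis
  qed
  ultimately show ?thesis using w unfolding zbasis_def w'_def[symmetric] by simp
qed

text \<open>Take a basis with as many members as possible in the saturated subgroup \<open>N\<close>. A relation
  modulo \<open>N\<close> between the others could be shortened, by elementary changes of the basis, to one with
  a single coefficient.\<close>

lemma adapted_basis:
  fixes M N :: "(real ^ 'n) set"
  assumes w0: "zbasis M w0" and N: "\<And>k m. m \<in> M \<Longrightarrow> k \<noteq> 0 \<Longrightarrow> of_int k *\<^sub>R m \<in> N \<Longrightarrow> m \<in> N"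
  shows "\<exists>w. zbasis M w \<and> (\<forall>v. (\<forall>i. w i \<in> N \<longrightarrow> v $ i = 0) \<and> zcomb w v \<in> N \<longrightarrow> v = 0)"
proof -
  define cn where "cn w = card {i. w i \<in> N}" for w :: "'n \<Rightarrow> real ^ 'n"
  have "cn w \<le> CARD('n)" for w unfolding cn_def by (rule card_mono) auto
  then have "\<forall>w. zbasis M w \<longrightarrow> cn w < Suc CARD('n)" by (simp add: less_Suc_eq_le)
  from ex_has_greatest_nat[of "zbasis M" w0 cn, OF w0 this]
  obtain w1 where w1: "zbasis M w1" "\<And>w. zbasis M w \<Longrightarrow> cn w \<le> cn w1" by blast
  define bad where "bad w v \<longleftrightarrow> zbasis M w \<and> cn w = cn w1 \<and> (\<forall>i. w i \<in> N \<longrightarrow> v $ i = 0) \<and> zcomb w v \<in> N \<and> v \<noteq> 0" for w v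
  define sz where "sz v = (\<Sum>i\<in>UNIV. nat \<bar>v $ i\<bar>)" for v :: "int ^ 'n"
  have red: "\<exists>w' v'. bad w' v' \<and> sz v' < sz v" if b: "bad w v" for w v
  proof -
    have w: "zbasis M w" "cn w = cn w1" "\<And>i. w i \<in> N \<Longrightarrow> v $ i = 0" "zcomb w v \<in> N" "v \<noteq> 0"
      using b unfolding bad_def by blast+
    obtain i0 where i0: "v $ i0 \<noteq> 0" using w(5) by (auto simp: vec_eq_iff)
    have wM: "w i \<in> M" for i
    proof -
      have "w i = zcomb w (axis i 1)"
      proof -
        have "zcomb w (axis i 1) = (\<Sum>k\<in>UNIV. if k = i then w k else 0)"
          unfolding zcomb_def by (intro sum.cong) (auto simp: axis_def)
        then show ?thesis by simp
      qed
      then show ?thesis using w(1) unfolding zbasis_def by blast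
    qed
    have "\<exists>j. j \<noteq> i0 \<and> v $ j \<noteq> 0"
    proof (rule ccontr)
      assume "\<not> (\<exists>j. j \<noteq> i0 \<and> v $ j \<noteq> 0)"
      then have "zcomb w v = (\<Sum>k\<in>UNIV. if k = i0 then of_int (v $ k) *\<^sub>R w k else 0)"
        unfolding zcomb_def by (intro sum.cong) auto
      then have "of_int (v $ i0) *\<^sub>R w i0 \<in> N" using w(4) by simp
      then have "w i0 \<in> N" using N[OF wM i0] by blast
      then show False using w(3) i0 by blast
    qed
    then obtain j0 where j0: "j0 \<noteq> i0" "v $ j0 \<noteq> 0" by blast
    obtain i j where ij: "i \<noteq> j" "v $ i \<noteq> 0" "v $ j \<noteq> 0" "\<bar>v $ j\<bar> \<le> \<bar>v $ i\<bar>"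
      using i0 j0 by (cases "\<bar>v $ j0\<bar> \<le> \<bar>v $ i0\<bar>") (metis, metis linorder_le_cases)
    \<comment> \<open>A Euclidean step. With this sign the coefficient at i loses the absolute value
      of that at j. Since \<open>v $ j\<close> is non-zero, w j is outside N, so replacing it
      removes no member of N.\<close>
    define s where "s = sgn (v $ i) * sgn (v $ j)"
    have abs: "\<bar>v $ i - s * v $ j\<bar> = \<bar>v $ i\<bar> - \<bar>v $ j\<bar>"
      using ij by (auto simp: s_def sgn_if abs_if split: if_splits)
    define w' where "w' = w(j := w j + of_int s *\<^sub>R w i)"
    define v' where "v' = (\<chi> k. if k = i then v $ i - s * v $ j else v $ k)"
    have bas: "zbasis M w'" unfolding w'_def by (rule zbasis_elementary[OF w(1) ij(1)])
    have sub: "{k. w k \<in> N} \<subseteq> {k. w' k \<in> N}"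
    proof
      fix k assume k: "k \<in> {k. w k \<in> N}"
      then have "k \<noteq> j" using w(3) ij(3) by auto
      then show "k \<in> {k. w' k \<in> N}" using k by (simp add: w'_def)
    qed
    have "cn w' \<le> cn w" using w1(2)[OF bas] w(2) by simp
    then have eq: "{k. w k \<in> N} = {k. w' k \<in> N}"
      unfolding cn_def by (intro card_seteq sub) auto
    have zc: "zcomb w' v' = zcomb w v"
    proof -
      have "zcomb w' v' = (\<Sum>k\<in>UNIV. ((\<lambda>k. of_int (v' $ k))(i := of_int (v' $ i) + of_int s * of_int (v' $ j))) k *\<^sub>R w k)"
        unfolding zcomb_def w'_def by (rule zcomb_elementary[OF ij(1)])
      also have "\<dots> = zcomb w v"
        unfolding zcomb_def using ij(1) by (intro sum.cong) (auto simp: v'_def)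
      finally show ?thesis .
    qed
    have supp: "v' $ k = 0" if "w' k \<in> N" for k
    proof -
      have "v $ k = 0" using w(3)[of k] eq that by blast
      moreover from this have "k \<noteq> i" using ij(2) by auto
      ultimately show ?thesis by (simp add: v'_def)
    qed
    have "v' $ j = v $ j" using ij(1) by (simp add: v'_def)
    then have "v' \<noteq> 0" using ij(3) by auto
    then have "bad w' v'" unfolding bad_def using bas zc w(2,4) supp eq by (simp add: cn_def)
    moreover have "sz v' < sz v"
      unfolding sz_def
    proof (rule sum_strict_mono_ex1)
      show "\<forall>k\<in>UNIV. nat \<bar>v' $ k\<bar> \<le> nat \<bar>v $ k\<bar>" using abs by (auto simp: v'_def)
      have "nat \<bar>v' $ i\<bar> < nat \<bar>v $ i\<bar>" using abs ij by (simp add: v'_def)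
      then show "\<exists>k\<in>UNIV. nat \<bar>v' $ k\<bar> < nat \<bar>v $ k\<bar>" by blast
    qed simp
    ultimately show ?thesis by blast
  qed
  have nobad: "\<not> bad w v" for w v
  proof (induction "sz v" arbitrary: w v rule: less_induct)
    case less
    show ?case
    proof
      assume "bad w v"
      then obtain w' v' where "bad w' v'" "sz v' < sz v" using red by blast
      then show False using less by blast
    qed
  qed
  show ?thesis
  proof (intro exI[of _ w1] conjI allI impI w1(1))
    fix v assume "(\<forall>i. w1 i \<in> N \<longrightarrow> v $ i = 0) \<and> zcomb w1 v \<in> N"
    then show "v = 0" using nobad[of w1 v] w1(1) unfolding bad_def by blast
  qed
qed

section \<open>Half-open parallelepipeds and their volume\<close>

definition parallelepiped :: "real ^ 'n ^ 'n \<Rightarrow> (real ^ 'n) set" where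
  "parallelepiped A = {x. \<forall>i. 0 \<le> (matrix_inv A *v x) $ i \<and> (matrix_inv A *v x) $ i < 1}"

lemma matrix_inv_vec:
  fixes A :: "real ^ 'n ^ 'n"
  assumes "det A \<noteq> 0"
  shows "matrix_inv A *v (A *v x) = x" "A *v (matrix_inv A *v x) = x"
proof -
  have "invertible A" using assms by (simp add: invertible_det_nz)
  then show "matrix_inv A *v (A *v x) = x" "A *v (matrix_inv A *v x) = x"
    by (simp_all add: matrix_vector_mul_assoc matrix_inv_left matrix_inv_right)
qed

lemma parallelepiped_image:
  assumes "det A \<noteq> 0"
  shows "parallelepiped A = (\<lambda>y. A *v y) ` {y. \<forall>i. 0 \<le> y $ i \<and> y $ i < 1}"
proof (intro subset_antisym subsetI)
  fix x assume "x \<in> parallelepiped A"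
  then show "x \<in> (\<lambda>y. A *v y) ` {y. \<forall>i. 0 \<le> y $ i \<and> y $ i < 1}"
    using matrix_inv_vec(2)[OF assms, of x] unfolding parallelepiped_def
    by (intro image_eqI[of _ _ "matrix_inv A *v x"]) auto
qed (auto simp: parallelepiped_def matrix_inv_vec[OF assms])

lemma parallelepiped_borel: "parallelepiped A \<in> sets borel"
proof -
  have [measurable]: "(\<lambda>x. (matrix_inv A *v x) $ i) \<in> borel_measurable borel" for i
    by (intro borel_measurable_continuous_onI continuous_intros matrix_vector_mult_linear_continuous_on)
  show ?thesis unfolding parallelepiped_def by measurable
qed

lemma parallelepiped_bounded:
  assumes "det A \<noteq> 0"
  shows "bounded (parallelepiped A)"
proof -
  have "{y :: real ^ 'n. \<forall>i. 0 \<le> y $ i \<and> y $ i < 1} \<subseteq> cbox 0 1" by (auto simp: mem_box_cart less_imp_le)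
  then have "bounded {y :: real ^ 'n. \<forall>i. 0 \<le> y $ i \<and> y $ i < 1}" using bounded_cbox bounded_subset by blast
  then show ?thesis unfolding parallelepiped_image[OF assms]
    by (intro bounded_linear_image matrix_vector_mul_bounded_linear)
qed

lemma parallelepiped_dom:
  assumes "det A \<noteq> 0"
  shows "\<exists>!l. l \<in> lattice_of A \<and> x - l \<in> parallelepiped A"
proof -
  define y where "y = matrix_inv A *v x"
  have iff: "l \<in> lattice_of A \<and> x - l \<in> parallelepiped A \<longleftrightarrow> l = A *v (\<chi> i. of_int \<lfloor>y $ i\<rfloor>)" for l
  proof
    assume l: "l \<in> lattice_of A \<and> x - l \<in> parallelepiped A"
    then obtain z where z: "z \<in> int_vecs" "l = A *v z" by (auto simp: lattice_of_def)
    have "matrix_inv A *v (x - l) = y - z"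
      by (simp add: matrix_vector_mult_diff_distrib z(2) matrix_inv_vec[OF assms] y_def)
    then have "0 \<le> y $ i - z $ i \<and> y $ i - z $ i < 1" for i using l by (auto simp: parallelepiped_def)
    moreover have "z $ i \<in> \<int>" for i using z(1) by (simp add: int_vecs_def)
    ultimately have "z $ i = of_int \<lfloor>y $ i\<rfloor>" for i
    proof -
      obtain k where k: "z $ i = of_int k" using \<open>z $ i \<in> \<int>\<close> by (auto elim: Ints_cases)
      then have "\<lfloor>y $ i\<rfloor> = k"
        using \<open>0 \<le> y $ i - z $ i \<and> y $ i - z $ i < 1\<close> by (simp add: floor_eq_iff)
      then show ?thesis using k by simp
    qed
    then have "z = (\<chi> i. of_int \<lfloor>y $ i\<rfloor>)" by (simp add: vec_eq_iff)
    then show "l = A *v (\<chi> i. of_int \<lfloor>y $ i\<rfloor>)" using z by simp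
  next
    assume l: "l = A *v (\<chi> i. of_int \<lfloor>y $ i\<rfloor>)"
    have "matrix_inv A *v (x - l) = y - (\<chi> i. of_int \<lfloor>y $ i\<rfloor>)"
      by (simp add: matrix_vector_mult_diff_distrib l matrix_inv_vec[OF assms] y_def)
    then have "x - l \<in> parallelepiped A" by (simp add: parallelepiped_def) linarith
    moreover have "l \<in> lattice_of A" unfolding l lattice_of_def by (auto simp: int_vecs_def)
    ultimately show "l \<in> lattice_of A \<and> x - l \<in> parallelepiped A" by blast
  qed
  show ?thesis unfolding iff by blast
qed

lemma int_vecs_range: "int_vecs = range (\<lambda>v :: int ^ 'n. \<chi> i. real_of_int (v $ i))"
proof (intro subset_antisym subsetI)
  fix z :: "real ^ 'n" assume "z \<in> int_vecs"
  then have "z = (\<chi> i. real_of_int ((\<chi> i. \<lfloor>z $ i\<rfloor>) $ i))" by (simp add: int_vecs_def vec_eq_iff)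
  then show "z \<in> range (\<lambda>v :: int ^ 'n. \<chi> i. real_of_int (v $ i))" by blast
qed (auto simp: int_vecs_def)

lemma lattice_of_countable: "countable (lattice_of A)"
  unfolding lattice_of_def int_vecs_range by (intro countable_image) simp

lemma is_tile_measure_eq:
  assumes "subgrp G" "countable G" "is_tile G A" "is_tile G B"
  shows "measure lborel A = measure lborel B"
  using tile_nn_integral_eq[OF assms, of "\<lambda>_. 1"] assms(3,4)
  by (simp add: is_tile_def measure_def)

lemma is_tile_parallelepiped: "det A \<noteq> 0 \<Longrightarrow> is_tile (lattice_of A) (parallelepiped A)"
  by (simp add: is_tile_def parallelepiped_borel parallelepiped_dom)

lemma emeasure_parallelepiped:
  assumes "det A \<noteq> 0"
  shows "emeasure lborel (parallelepiped A) = measure lborel (parallelepiped A)"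
  using emeasure_bounded_finite[OF parallelepiped_bounded[OF assms]] by (simp add: emeasure_eq_ennreal_measure)

text \<open>In the coordinates of A' the lattice of A is sheared: the integral parts of the other
  coordinates are determined on their own, and that of coordinate n afterwards, shifted by c times
  the one at m. So the new parallelepiped tiles with the old lattice though c is any real, which is
  how a shear is seen to preserve volume.\<close>

lemma is_tile_shear:
  fixes A :: "real ^ 'n ^ 'n"
  assumes A: "det A \<noteq> 0" and A': "det A' \<noteq> 0" and mn: "m \<noteq> n"
    and co: "\<And>j. column j A' = (if j = m then column m A + c *\<^sub>R column n A else column j A)"
  shows "is_tile (lattice_of A) (parallelepiped A')"
proof -
  define sh where "sh y = (\<chi> j. if j = n then y $ n + c * y $ m else y $ j)" for y :: "real ^ 'n"
  have A'v: "A' *v y = A *v sh y" for y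
  proof -
    have "(\<Sum>j\<in>UNIV - {m, n}. y $ j *\<^sub>R column j A') = (\<Sum>j\<in>UNIV - {m, n}. sh y $ j *\<^sub>R column j A)"
      by (intro sum.cong) (auto simp: co sh_def)
    then show ?thesis
      unfolding matrix_mult_sum scalar_mult_eq_scaleR sum_two[OF mn] using mn
      by (simp add: co sh_def algebra_simps)
  qed
  have "\<exists>!l. l \<in> lattice_of A \<and> x - l \<in> parallelepiped A'" for x
  proof -
    define y where "y = matrix_inv A' *v x"
    have x: "x = A' *v y" using matrix_inv_vec(2)[OF A'] by (simp add: y_def)
    define us where "us z = (\<chi> j. if j = n then z $ n - c * z $ m else z $ j)" for z :: "real ^ 'n"
    have us: "A *v z = A' *v us z" for z
    proof -
      have "sh (us z) = z" using mn by (simp add: sh_def us_def vec_eq_iff)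
      then show ?thesis by (simp add: A'v)
    qed
    have mem: "x - A *v z \<in> parallelepiped A' \<longleftrightarrow> (\<forall>j. 0 \<le> (y - us z) $ j \<and> (y - us z) $ j < 1)" for z
      unfolding parallelepiped_def us x by (simp add: matrix_inv_vec[OF A'] flip: matrix_vector_mult_diff_distrib)
    define z0 :: "real ^ 'n" where "z0 = (\<chi> j. if j = n then of_int \<lfloor>y $ n + c * of_int \<lfloor>y $ m\<rfloor>\<rfloor> else of_int \<lfloor>y $ j\<rfloor>)"
    have z0: "z0 \<in> int_vecs" by (simp add: z0_def int_vecs_def)
    have z0in: "x - A *v z0 \<in> parallelepiped A'"
      unfolding mem using mn by (auto simp: us_def z0_def) linarith+
    have uniq: "z = z0" if z: "z \<in> int_vecs" "x - A *v z \<in> parallelepiped A'" for z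
    proof -
      have fl: "z $ j = of_int \<lfloor>r\<rfloor>" if "0 \<le> r - z $ j" "r - z $ j < 1" for j r
      proof -
        obtain k where k: "z $ j = of_int k" using z(1) by (auto simp: int_vecs_def elim: Ints_cases)
        then have "\<lfloor>r\<rfloor> = k" using that by (simp add: floor_eq_iff)
        then show ?thesis using k by simp
      qed
      have b: "0 \<le> (y - us z) $ j" "(y - us z) $ j < 1" for j using z(2) unfolding mem by blast+
      have o: "z $ j = of_int \<lfloor>y $ j\<rfloor>" if "j \<noteq> n" for j
        using b[of j] that by (intro fl) (auto simp: us_def)
      have "z $ n = of_int \<lfloor>y $ n + c * z $ m\<rfloor>"
        using b[of n] by (intro fl) (auto simp: us_def)
      then show ?thesis using o mn by (auto simp: z0_def vec_eq_iff)
    qed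
    show ?thesis
    proof (intro ex1I[of _ "A *v z0"] conjI z0in)
      show "A *v z0 \<in> lattice_of A" using z0 by (auto simp: lattice_of_def)
      fix l assume "l \<in> lattice_of A \<and> x - l \<in> parallelepiped A'"
      then show "l = A *v z0" using uniq by (auto simp: lattice_of_def)
    qed
  qed
  then show ?thesis by (simp add: is_tile_def parallelepiped_borel)
qed

lemma lborel_transpose_coordinates:
  fixes m n :: "'n::finite"
  defines "T \<equiv> \<lambda>x :: real ^ 'n. \<chi> i. x $ Transposition.transpose m n i"
  shows "distr lborel borel T = lborel"
proof (rule lborel_eqI[symmetric])
  have [measurable]: "T \<in> borel_measurable borel"
    unfolding T_def by (intro borel_measurable_continuous_onI continuous_intros)
  fix l u :: "real ^ 'n" assume le: "\<And>b. b \<in> Basis \<Longrightarrow> l \<bullet> b \<le> u \<bullet> b"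
  have le': "l $ i \<le> u $ i" for i using le[of "axis i 1"] by (simp add: axis_in_Basis_iff cart_eq_inner_axis)
  have "T -` box l u = box (T l) (T u)"
  proof -
    have "(\<forall>i. l $ i < x $ Transposition.transpose m n i \<and> x $ Transposition.transpose m n i < u $ i) \<longleftrightarrow>
        (\<forall>i. l $ Transposition.transpose m n i < x $ i \<and> x $ i < u $ Transposition.transpose m n i)" for x :: "real ^ 'n"
      by (metis transpose_involutory)
    then show ?thesis by (auto simp: T_def mem_box_cart)
  qed
  moreover have "emeasure lborel (box (T l) (T u)) = (\<Prod>b\<in>Basis. (T u - T l) \<bullet> b)"
    using le' by (subst emeasure_lborel_box_eq) (auto simp: T_def Basis_vec_def cart_eq_inner_axis[symmetric])
  moreover have prodB: "(\<Prod>b\<in>Basis. x \<bullet> b) = (\<Prod>i\<in>UNIV. x $ i)" for x :: "real ^ 'n"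
  proof -
    have B: "Basis = range (\<lambda>i :: 'n. axis i (1::real))" by (auto simp: Basis_vec_def)
    have "inj (\<lambda>i :: 'n. axis i (1::real))" by (auto simp: inj_on_def axis_eq_axis)
    then show ?thesis unfolding B by (simp add: prod.reindex cart_eq_inner_axis)
  qed
  moreover have "(\<Prod>i\<in>UNIV. (T u - T l) $ i) = (\<Prod>i\<in>UNIV. (u - l) $ i)"
    by (rule prod.reindex_bij_witness[of _ "Transposition.transpose m n" "Transposition.transpose m n"])
      (auto simp: T_def)
  ultimately show "emeasure (distr lborel borel T) (box l u) = (\<Prod>b\<in>Basis. (u - l) \<bullet> b)"
    by (simp add: emeasure_distr)
qed simp

text \<open>Volume and determinant are compared along elementary operations on A, whose rows are the
  edges of the parallelepiped: a diagonal matrix gives a box, a swap of columns permutes the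
  coordinates of the space, and a row shear yields another tile of the same lattice, hence the same
  volume.\<close>

lemma measure_parallelepiped_transpose:
  fixes A :: "real ^ 'n ^ 'n"
  assumes "det (transpose A) \<noteq> 0"
  shows "measure lborel (parallelepiped (transpose A)) = \<bar>det A\<bar>"
  using assms
proof (induction A rule: induct_matrix_row_operations)
  case (1 A i)
  then show ?case by (simp add: det_zero_row(1) det_transpose)
next
  case (2 A)
  have d: "det A = (\<Prod>i\<in>UNIV. A $ i $ i)" by (rule det_diagonal) (use 2 in blast)
  have nz: "A $ i $ i \<noteq> 0" for i using 2(2) d by (auto simp: det_transpose)
  have tA: "transpose A *v y = (\<chi> i. A $ i $ i * y $ i)" for y
  proof -
    have "(\<Sum>j\<in>UNIV. A $ j $ i * y $ j) = (\<Sum>j\<in>UNIV. if j = i then A $ i $ i * y $ i else 0)" for i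
      by (rule sum.cong) (use 2 in auto)
    then show ?thesis by (simp add: matrix_vector_mult_def transpose_def vec_eq_iff)
  qed
  \<comment> \<open>A negative diagonal entry reverses the half-open interval, so the set is only
    squeezed between the open and the closed box, which have the same volume.\<close>
  define lo hi where "lo = (\<chi> i. min 0 (A $ i $ i))" and "hi = (\<chi> i. max 0 (A $ i $ i))"
  have iff: "x \<in> parallelepiped (transpose A) \<longleftrightarrow> (\<forall>i. 0 \<le> x $ i / A $ i $ i \<and> x $ i / A $ i $ i < 1)" for x
  proof -
    have "transpose A *v (\<chi> i. x $ i / A $ i $ i) = x" unfolding tA using nz by (simp add: vec_eq_iff)
    then have "matrix_inv (transpose A) *v x = (\<chi> i. x $ i / A $ i $ i)"
      using matrix_inv_vec(1)[OF 2(2)] by metis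
    then show ?thesis by (simp add: parallelepiped_def)
  qed
  have b: "(lo $ i < r \<and> r < hi $ i \<longrightarrow> 0 \<le> r / A $ i $ i \<and> r / A $ i $ i < 1)
      \<and> (0 \<le> r / A $ i $ i \<and> r / A $ i $ i < 1 \<longrightarrow> lo $ i \<le> r \<and> r \<le> hi $ i)" for i r
    using nz[of i] by (cases "A $ i $ i > 0") (auto simp: lo_def hi_def field_simps)
  have sub: "box lo hi \<subseteq> parallelepiped (transpose A)" "parallelepiped (transpose A) \<subseteq> cbox lo hi"
    using b by (auto simp: iff mem_box_cart)
  have le: "lo $ i \<le> hi $ i" for i by (simp add: lo_def hi_def)
  have c: "measure lborel (cbox lo hi) = \<bar>det A\<bar>"
  proof -
    have "measure lborel (cbox lo hi) = (\<Prod>i\<in>UNIV. hi $ i - lo $ i)"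
      using le by (intro content_cbox_cart) (auto simp: interval_ne_empty_cart)
    also have "\<dots> = (\<Prod>i\<in>UNIV. \<bar>A $ i $ i\<bar>)" by (rule prod.cong) (auto simp: lo_def hi_def)
    finally show ?thesis by (simp add: d abs_prod)
  qed
  have bo: "measure lborel (box lo hi) = \<bar>det A\<bar>"
    using c by (simp add: measure_lborel_box_eq measure_lborel_cbox_eq)
  have "measure lborel (box lo hi) \<le> measure lborel (parallelepiped (transpose A))"
    by (intro measure_mono_fmeasurable sub(1))
      (use emeasure_parallelepiped[OF 2(2)] parallelepiped_borel in \<open>auto simp: fmeasurable_def\<close>)
  moreover have "measure lborel (parallelepiped (transpose A)) \<le> measure lborel (cbox lo hi)"
    by (intro measure_mono_fmeasurable sub(2)) (use parallelepiped_borel in auto)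
  ultimately show ?case using c bo by linarith
next
  case (3 A m n)
  define A' where "A' = (\<chi> i j. A $ i $ Transposition.transpose m n j)"
  define T where "T = (\<lambda>x :: real ^ 'n. \<chi> i. x $ Transposition.transpose m n i)"
  have TT: "T (T x) = x" for x by (simp add: T_def vec_eq_iff)
  have dA: "\<bar>det A'\<bar> = \<bar>det A\<bar>"
    using det_permute_columns[of "Transposition.transpose m n" A]
    by (simp add: A'_def permutes_swap_id sign_swap_id abs_mult)
  have nz': "det (transpose A') \<noteq> 0" using 3 by (simp add: A'_def)
  have nz: "det (transpose A) \<noteq> 0" using nz' dA by (simp add: det_transpose)
  have tv: "transpose A' *v y = T (transpose A *v y)" for y
    by (simp add: A'_def T_def matrix_vector_mult_def transpose_def vec_eq_iff)
  have "parallelepiped (transpose A') = T -` parallelepiped (transpose A)"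
  proof -
    have "matrix_inv (transpose A') *v x = matrix_inv (transpose A) *v T x" for x
    proof -
      have "transpose A' *v (matrix_inv (transpose A) *v T x) = x"
        unfolding tv matrix_inv_vec(2)[OF nz] TT ..
      then show ?thesis using matrix_inv_vec(1)[OF nz'] by metis
    qed
    then show ?thesis by (auto simp: parallelepiped_def)
  qed
  moreover have "measure lborel (T -` parallelepiped (transpose A)) = measure lborel (parallelepiped (transpose A))"
  proof -
    have [measurable]: "T \<in> borel_measurable borel"
      unfolding T_def by (intro borel_measurable_continuous_onI continuous_intros)
    have "measure lborel (parallelepiped (transpose A)) = measure (distr lborel borel T) (parallelepiped (transpose A))"
      unfolding T_def lborel_transpose_coordinates ..
    also have "\<dots> = measure lborel (T -` parallelepiped (transpose A))"
      by (subst measure_distr) (auto simp: parallelepiped_borel)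
    finally show ?thesis by simp
  qed
  ultimately show ?case using 3(1)[OF nz] dA unfolding A'_def by simp
next
  case (4 A m n c)
  define A' where "A' = (\<chi> i. if i = m then row m A + c *\<^sub>R row n A else row i A)"
  have dA: "det A' = det A"
    unfolding A'_def scalar_mult_eq_scaleR[symmetric] by (rule det_row_operation[OF 4(2)])
  have nz': "det (transpose A') \<noteq> 0" using 4 by (simp add: A'_def)
  have nz: "det (transpose A) \<noteq> 0" using nz' dA by (simp add: det_transpose)
  have co: "column j (transpose A') = (if j = m then column m (transpose A) + c *\<^sub>R column n (transpose A) else column j (transpose A))" for j
    by (simp add: A'_def column_transpose row_def vec_eq_iff)
  have "measure lborel (parallelepiped (transpose A)) = measure lborel (parallelepiped (transpose A'))"
    by (intro is_tile_measure_eq[OF is_lattice_subgrp[OF is_lattice_lattice_of[OF nz]] lattice_of_countable]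
        is_tile_parallelepiped nz is_tile_shear[OF nz nz' 4(2) co])
  then show ?case using 4(1)[OF nz] dA unfolding A'_def by simp
qed

lemma parallelepiped_measure:
  fixes A :: "real ^ 'n ^ 'n"
  assumes "det A \<noteq> 0"
  shows "measure lborel (parallelepiped A) = \<bar>det A\<bar>"
  using measure_parallelepiped_transpose[of "transpose A"] assms by (simp add: det_transpose)

section \<open>The real flow\<close>

text \<open>The box is moved one coordinate at a time. In one coordinate ch s = H s - H (s - 1) for
  the step function H, so ch s - ch (s - t) is the difference of H s - H (s - t) and its shift by 1.
  That function takes only the values 0, 1 and - 1, whatever t is: this is the origin of the uniform
  bound.\<close>

lemma telescoping_box:
  fixes J :: "'n::finite set"
  defines "ch \<equiv> \<lambda>s::real. (of_bool (0 \<le> s \<and> s < 1) :: real)"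
  shows "\<exists>h :: 'n \<Rightarrow> real ^ 'n \<Rightarrow> real ^ 'n \<Rightarrow> real.
    (\<forall>j. (\<lambda>(x, t). h j x t) \<in> borel_measurable borel) \<and> (\<forall>j x t. \<bar>h j x t\<bar> \<le> 1) \<and>
    (\<forall>j x t. h j x t \<noteq> 0 \<longrightarrow> (\<forall>l. \<bar>x $ l\<bar> \<le> 1 + \<bar>t $ l\<bar>)) \<and>
    (\<forall>x t. (\<Prod>l\<in>UNIV. ch (x $ l)) - (\<Prod>l\<in>UNIV. ch (x $ l - (if l \<in> J then t $ l else 0)))
       = (\<Sum>j\<in>J. h j x t - h j (x - axis j 1) t))"
proof -
  have "finite J" by simp
  then show ?thesis
  proof (induction J rule: finite_induct)
    case empty
    show ?case by (rule exI[of _ "\<lambda>_ _ _. 0"]) simp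
  next
    case (insert k J)
    then obtain h :: "'n \<Rightarrow> real ^ 'n \<Rightarrow> real ^ 'n \<Rightarrow> real" where
      meas: "\<And>j. (\<lambda>(x, t). h j x t) \<in> borel_measurable borel" and bd: "\<And>j x t. \<bar>h j x t\<bar> \<le> 1"
      and supp: "\<And>j x t l. h j x t \<noteq> 0 \<Longrightarrow> \<bar>x $ l\<bar> \<le> 1 + \<bar>t $ l\<bar>"
      and tel: "\<And>x t. (\<Prod>l\<in>UNIV. ch (x $ l)) - (\<Prod>l\<in>UNIV. ch (x $ l - (if l \<in> J then t $ l else 0)))
       = (\<Sum>j\<in>J. h j x t - h j (x - axis j 1) t)"
      by blast
    define H where "H s = (of_bool (0 \<le> s) :: real)" for s :: real
    define y where "y x t l = x $ l - (if l \<in> J then t $ l else 0)" for x t :: "real ^ 'n" and l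
    define g where "g x t = (H (x $ k) - H (x $ k - t $ k)) * (\<Prod>l\<in>UNIV - {k}. ch (y x t l))" for x t
    define h' where "h' = h(k := g)"
    have pr: "\<bar>\<Prod>l\<in>S. ch (r l)\<bar> \<le> 1" for S :: "'n set" and r
      unfolding abs_prod by (rule prod_le_1) (auto simp: ch_def)
    have [measurable]: "ch \<in> borel_measurable borel" "H \<in> borel_measurable borel"
      unfolding ch_def H_def by measurable
    have [measurable]: "(\<lambda>p :: (real ^ 'n) \<times> (real ^ 'n). fst p $ l) \<in> borel_measurable borel"
      "(\<lambda>p :: (real ^ 'n) \<times> (real ^ 'n). snd p $ l) \<in> borel_measurable borel" for l
      by (intro borel_measurable_continuous_onI continuous_intros)+
    have "(\<lambda>(x, t). h' j x t) \<in> borel_measurable borel" for j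
    proof (cases "j = k")
      case True
      have "(\<lambda>p. g (fst p) (snd p)) \<in> borel_measurable borel" unfolding g_def y_def by measurable
      then show ?thesis by (simp add: h'_def True split_beta')
    qed (use meas in \<open>simp add: h'_def\<close>)
    moreover have "\<bar>h' j x t\<bar> \<le> 1" for j x t
    proof (cases "j = k")
      case True
      have "\<bar>g x t\<bar> \<le> 1 * 1"
        unfolding g_def abs_mult by (intro mult_mono pr) (auto simp: H_def)
      then show ?thesis by (simp add: h'_def True)
    qed (use bd in \<open>simp add: h'_def\<close>)
    moreover have "\<bar>x $ l\<bar> \<le> 1 + \<bar>t $ l\<bar>" if "h' j x t \<noteq> 0" for j x t l
    proof (cases "j = k")
      case True
      then have g: "g x t \<noteq> 0" using that by (simp add: h'_def)
      show ?thesis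
      proof (cases "l = k")
        case True
        have "H (x $ k) - H (x $ k - t $ k) \<noteq> 0" using g by (simp add: g_def)
        then show ?thesis unfolding True H_def by (auto split: if_splits simp: of_bool_def)
      next
        case False
        have "ch (y x t l) \<noteq> 0" using g False by (simp add: g_def)
        then show ?thesis by (auto simp: ch_def y_def of_bool_def split: if_splits)
      qed
    qed (use supp that in \<open>simp add: h'_def\<close>)
    moreover have "(\<Prod>l\<in>UNIV. ch (x $ l)) - (\<Prod>l\<in>UNIV. ch (x $ l - (if l \<in> insert k J then t $ l else 0)))
       = (\<Sum>j\<in>insert k J. h' j x t - h' j (x - axis j 1) t)" for x t
    proof -
      have cH: "ch s = H s - H (s - 1)" for s by (auto simp: ch_def H_def)
      have a: "(\<Prod>l\<in>UNIV. ch (y x t l)) = ch (x $ k) * (\<Prod>l\<in>UNIV - {k}. ch (y x t l))"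
        using insert.hyps(2) by (subst prod.remove[of _ k]) (auto simp: y_def)
      have b: "(\<Prod>l\<in>UNIV. ch (x $ l - (if l \<in> insert k J then t $ l else 0))) = ch (x $ k - t $ k) * (\<Prod>l\<in>UNIV - {k}. ch (y x t l))"
        by (subst prod.remove[of _ k]) (auto simp: y_def intro!: prod.cong)
      have c: "(\<Prod>l\<in>UNIV - {k}. ch (y (x - axis k 1) t l)) = (\<Prod>l\<in>UNIV - {k}. ch (y x t l))"
        by (rule prod.cong) (auto simp: y_def axis_def)
      have "g x t - g (x - axis k 1) t = (H (x $ k) - H (x $ k - t $ k) - (H (x $ k - 1) - H (x $ k - 1 - t $ k))) * (\<Prod>l\<in>UNIV - {k}. ch (y x t l))"
        unfolding g_def c by (simp add: algebra_simps axis_def)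
      also have "\<dots> = (ch (x $ k) - ch (x $ k - t $ k)) * (\<Prod>l\<in>UNIV - {k}. ch (y x t l))"
        by (simp add: cH algebra_simps)
      also have "\<dots> = (\<Prod>l\<in>UNIV. ch (y x t l)) - (\<Prod>l\<in>UNIV. ch (x $ l - (if l \<in> insert k J then t $ l else 0)))"
        unfolding a b by (simp add: algebra_simps)
      finally have 1: "g x t - g (x - axis k 1) t = \<dots>" .
      have 2: "(\<Sum>j\<in>J. h' j x t - h' j (x - axis j 1) t) = (\<Sum>j\<in>J. h j x t - h j (x - axis j 1) t)"
        using insert.hyps(2) by (intro sum.cong) (auto simp: h'_def)
      have "(\<Sum>j\<in>insert k J. h' j x t - h' j (x - axis j 1) t) = (g x t - g (x - axis k 1) t) + (\<Sum>j\<in>J. h' j x t - h' j (x - axis j 1) t)"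
        using insert.hyps by (simp add: h'_def)
      then show ?thesis using 1 2 tel[of x t] by (simp add: y_def)
    qed
    ultimately show ?case by (intro exI[of _ h']) blast
  qed
qed

context lattice_shift
begin

text \<open>Truncation of the class of x modulo La to a ball, which turns sums over the class of
  boundedly supported functions into finite sums.\<close>

definition fibre_ball :: "real \<Rightarrow> real ^ 'n \<Rightarrow> (real ^ 'n) set" where
  "fibre_ball R x = {z. norm z \<le> R \<and> z - x \<in> La}"

lemma finite_fibre_ball: "finite (fibre_ball R x)"
proof -
  have "finite (La \<inter> cball (- x) R)" by (rule La_finite) simp
  moreover have "(\<lambda>z. z - x) ` fibre_ball R x \<subseteq> La \<inter> cball (- x) R"
    by (auto simp: fibre_ball_def dist_norm norm_minus_commute)
  ultimately have "finite ((\<lambda>z. z - x) ` fibre_ball R x)" by (rule rev_finite_subset)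
  then show ?thesis by (rule finite_imageD) simp
qed

lemma fibre_ball_periodic:
  assumes "l \<in> La"
  shows "fibre_ball R (x + l) = fibre_ball R x"
proof -
  have "z - (x + l) \<in> La \<longleftrightarrow> z - x \<in> La" for z
    using subgrp_add[OF La_subgrp assms, of "z - (x + l)"] subgrp_diff[OF La_subgrp _ assms, of "z - x"]
    by (auto simp: algebra_simps)
  then show ?thesis by (simp add: fibre_ball_def)
qed

lemma red_measurable [measurable]: "red \<in> borel_measurable borel"
proof (rule measurableI)
  fix S :: "(real ^ 'n) set" assume S[measurable]: "S \<in> sets borel"
  have "red -` S \<inter> space borel = (\<Union>l\<in>La. {x. x - l \<in> P \<inter> S})"
  proof (intro subset_antisym subsetI)
    fix x assume "x \<in> red -` S \<inter> space borel"
    then have "x - (x - red x) \<in> P \<inter> S" using red(1)[of x] by simp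
    then show "x \<in> (\<Union>l\<in>La. {x. x - l \<in> P \<inter> S})" using red(2)[of x] by blast
  next
    fix x assume "x \<in> (\<Union>l\<in>La. {x. x - l \<in> P \<inter> S})"
    then obtain l where l: "l \<in> La" "x - l \<in> P" "x - l \<in> S" by auto
    then have "red x = x - l" by (intro red_unique) auto
    then show "x \<in> red -` S \<inter> space borel" using l by simp
  qed
  also have "\<dots> \<in> sets borel"
  proof (intro sets.countable_UN' La_countable image_subsetI)
    fix l :: "real ^ 'n"
    show "{x. x - l \<in> P \<inter> S} \<in> sets borel" by measurable
  qed
  finally show "red -` S \<inter> space borel \<in> sets borel" .
qed simp

text \<open>One finite set of translations serves all x once x is reduced into P; measurability in x
  and uniform bounds both follow from this form.\<close>

lemma fibre_ball_red:
  "\<exists>Z. finite Z \<and> (\<forall>x. fibre_ball R x = (\<lambda>l. red x + l) ` {l \<in> Z. norm (red x + l) \<le> R})"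
proof -
  obtain p where p: "\<And>x. x \<in> P \<Longrightarrow> norm x \<le> p" using P_bounded by (auto simp: bounded_iff)
  define Z where "Z = La \<inter> cball 0 (R + p)"
  have "finite Z" unfolding Z_def by (rule La_finite) simp
  moreover have "fibre_ball R x = (\<lambda>l. red x + l) ` {l \<in> Z. norm (red x + l) \<le> R}" for x
  proof (intro subset_antisym subsetI)
    fix z assume "z \<in> fibre_ball R x"
    then have z: "norm z \<le> R" "z - x \<in> La" by (auto simp: fibre_ball_def)
    have "z - red x \<in> La" using subgrp_add[OF La_subgrp z(2) red(2)[of x]] by simp
    moreover have "norm (z - red x) \<le> R + p"
      using norm_triangle_ineq4[of z "red x"] z(1) p[OF red(1)[of x]] by linarith
    ultimately show "z \<in> (\<lambda>l. red x + l) ` {l \<in> Z. norm (red x + l) \<le> R}"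
      using z(1) by (intro image_eqI[of _ _ "z - red x"]) (auto simp: Z_def)
  next
    fix z assume "z \<in> (\<lambda>l. red x + l) ` {l \<in> Z. norm (red x + l) \<le> R}"
    then obtain l where l: "l \<in> La" "norm (red x + l) \<le> R" "z = red x + l" by (auto simp: Z_def)
    have "l - (x - red x) \<in> La" by (rule subgrp_diff[OF La_subgrp l(1) red(2)])
    then show "z \<in> fibre_ball R x" using l by (simp add: fibre_ball_def algebra_simps)
  qed
  ultimately show ?thesis by blast
qed

lemma sum_fibre_ball_measurable:
  fixes \<phi> :: "real ^ 'n \<Rightarrow> real"
  assumes [measurable]: "\<phi> \<in> borel_measurable borel"
  shows "(\<lambda>x. \<Sum>z\<in>fibre_ball R x. \<phi> z) \<in> borel_measurable borel"
proof -
  obtain Z where Z: "finite Z" "\<And>x. fibre_ball R x = (\<lambda>l. red x + l) ` {l \<in> Z. norm (red x + l) \<le> R}"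
    using fibre_ball_red by blast
  have "(\<Sum>z\<in>fibre_ball R x. \<phi> z) = (\<Sum>l\<in>Z. if norm (red x + l) \<le> R then \<phi> (red x + l) else 0)" for x
    unfolding Z(2) using Z(1) by (subst sum.reindex) (auto simp: sum.inter_filter inj_on_def)
  then show ?thesis by simp
qed

lemma sum_fibre_ball_bounded:
  "\<exists>C. \<forall>\<phi> x. (\<forall>z. \<bar>\<phi> z :: real\<bar> \<le> 1) \<longrightarrow> \<bar>\<Sum>z\<in>fibre_ball R x. \<phi> z\<bar> \<le> C"
proof -
  obtain Z where Z: "finite Z" "\<And>x. fibre_ball R x = (\<lambda>l. red x + l) ` {l \<in> Z. norm (red x + l) \<le> R}"
    using fibre_ball_red by blast
  have "\<bar>\<Sum>z\<in>fibre_ball R x. \<phi> z\<bar> \<le> real (card Z)" if b: "\<forall>z. \<bar>\<phi> z :: real\<bar> \<le> 1" for \<phi> x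
  proof -
    have "\<bar>\<Sum>z\<in>fibre_ball R x. \<phi> z\<bar> \<le> (\<Sum>z\<in>fibre_ball R x. 1)"
      using b by (intro order_trans[OF sum_abs] sum_mono) auto
    also have "\<dots> = real (card (fibre_ball R x))" by simp
    also have "card (fibre_ball R x) \<le> card {l \<in> Z. norm (red x + l) \<le> R}"
      unfolding Z(2) using Z(1) by (intro card_image_le) auto
    also have "\<dots> \<le> card Z" using Z(1) by (intro card_mono) auto
    finally show ?thesis by simp
  qed
  then show ?thesis by blast
qed

text \<open>The hypothesis on the support ensures that the ball cuts off neither sum.\<close>

lemma sum_fibre_ball_shift:
  fixes \<phi> :: "real ^ 'n \<Rightarrow> real"
  assumes "\<And>z. \<phi> z \<noteq> 0 \<Longrightarrow> norm z + norm u \<le> R"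
  shows "(\<Sum>z\<in>fibre_ball R x. \<phi> (z - u)) = (\<Sum>z\<in>fibre_ball R (x - u). \<phi> z)"
proof -
  have n: "norm (z - u) \<le> R" "norm z \<le> R" if "\<phi> (z - u) \<noteq> 0" for z
  proof -
    have *: "norm (z - u) + norm u \<le> R" by (rule assms[OF that])
    then show "norm (z - u) \<le> R" using norm_ge_zero[of u] by linarith
    show "norm z \<le> R" using norm_triangle_ineq[of "z - u" u] * by simp
  qed
  have n': "norm (y + u) \<le> R" if "\<phi> y \<noteq> 0" for y
    using n(2)[of "y + u"] that by simp
  have "(\<Sum>z\<in>fibre_ball R x. \<phi> (z - u)) = (\<Sum>z\<in>{z \<in> fibre_ball R x. \<phi> (z - u) \<noteq> 0}. \<phi> (z - u))"
    by (rule sum.mono_neutral_right) (auto simp: finite_fibre_ball)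
  also have "\<dots> = (\<Sum>y\<in>{y \<in> fibre_ball R (x - u). \<phi> y \<noteq> 0}. \<phi> y)"
    by (rule sum.reindex_bij_witness[of _ "\<lambda>y. y + u" "\<lambda>z. z - u"]) (auto simp: fibre_ball_def n n' algebra_simps)
  also have "\<dots> = (\<Sum>z\<in>fibre_ball R (x - u). \<phi> z)"
    by (rule sum.mono_neutral_left) (auto simp: finite_fibre_ball)
  finally show ?thesis .
qed

lemma sum_fibre_ball_indicator:
  assumes "\<And>z. z \<in> A \<Longrightarrow> norm z \<le> R"
  shows "(\<Sum>z\<in>fibre_ball R x. of_bool (z \<in> A)) = real (fibre_count A x)"
proof -
  have "(\<Sum>z\<in>fibre_ball R x. of_bool (z \<in> A) :: real) = (\<Sum>z\<in>{z \<in> fibre_ball R x. z \<in> A}. 1)"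
    unfolding of_bool_def by (rule sum.inter_filter[OF finite_fibre_ball, symmetric])
  also have "{z \<in> fibre_ball R x. z \<in> A} = {z \<in> A. z - x \<in> La}" using assms by (auto simp: fibre_ball_def)
  finally show ?thesis by (simp add: fibre_count_def)
qed

text \<open>Sum and integral are exchanged. For s in FB the points z of the class with s - z in FA
  correspond to the points of FA in the class of s - x, and there are q of these.\<close>

lemma average_over_box:
  fixes FA FB :: "(real ^ 'n) set" and x :: "real ^ 'n"
  assumes FA: "FA \<in> sets borel" "bounded FA" and FB: "FB \<in> sets borel" "bounded FB"
    and q: "\<And>x. fibre_count FA x = q" and R: "\<And>z t. t \<in> FA \<Longrightarrow> z + t \<in> FB \<Longrightarrow> norm z \<le> R"
  shows "(\<Sum>z\<in>fibre_ball R x. \<integral>t. of_bool (z + t \<in> FB) * indicator FA t \<partial>lborel) = real q * measure lborel FB"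
proof -
  have [measurable]: "FA \<in> sets borel" "FB \<in> sets borel" by (fact FA FB)+
  have fB: "emeasure lborel FB < \<infinity>" by (rule emeasure_bounded_finite[OF FB(2)])
  have tr: "(\<integral>t. of_bool (z + t \<in> FB) * indicator FA t \<partial>lborel :: real) = (\<integral>s. indicator FB s * of_bool (s - z \<in> FA) \<partial>lborel)" for z
  proof -
    have "(\<integral>s. indicator FB s * of_bool (s - z \<in> FA) \<partial>lborel :: real) = (\<integral>s. indicator FB s * of_bool (s - z \<in> FA) \<partial>distr lborel borel ((+) z))"
      by (simp add: lborel_distr_plus)
    also have "\<dots> = (\<integral>t. indicator FB (z + t) * of_bool (z + t - z \<in> FA) \<partial>lborel)"
      by (rule integral_distr) auto
    also have "\<dots> = (\<integral>t. of_bool (z + t \<in> FB) * indicator FA t \<partial>lborel)"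
      by (rule Bochner_Integration.integral_cong) (auto simp: indicator_def)
    finally show ?thesis by simp
  qed
  have int: "integrable lborel (\<lambda>s. indicator FB s * of_bool (s - z \<in> FA) :: real)" for z
  proof (rule Bochner_Integration.integrable_bound)
    show "integrable lborel (indicator FB :: _ \<Rightarrow> real)" using fB by (simp add: integrable_indicator_iff)
  qed (auto simp: indicator_def)
  have sum: "(\<Sum>z\<in>fibre_ball R x. indicator FB s * of_bool (s - z \<in> FA)) = real q * indicator FB s" for s
  proof (cases "s \<in> FB")
    case True
    have "(\<Sum>z\<in>fibre_ball R x. of_bool (s - z \<in> FA) :: real) = (\<Sum>z\<in>{z \<in> fibre_ball R x. s - z \<in> FA}. 1)"
      unfolding of_bool_def by (rule sum.inter_filter[OF finite_fibre_ball, symmetric])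
    also have "\<dots> = real (card {z \<in> fibre_ball R x. s - z \<in> FA})" by simp
    also have "card {z \<in> fibre_ball R x. s - z \<in> FA} = card {y \<in> FA. y - (s - x) \<in> La}"
    proof (rule bij_betw_same_card[of "\<lambda>z. s - z"], rule bij_betw_byWitness[of _ "\<lambda>y. s - y"])
      have neg: "z - x \<in> La \<longleftrightarrow> s - z - (s - x) \<in> La" for z
        using subgrp_uminus[OF La_subgrp, of "z - x"] subgrp_uminus[OF La_subgrp, of "x - z"] by auto
      show "(\<lambda>z. s - z) ` {z \<in> fibre_ball R x. s - z \<in> FA} \<subseteq> {y \<in> FA. y - (s - x) \<in> La}"
        using neg by (auto simp: fibre_ball_def)
      show "(\<lambda>y. s - y) ` {y \<in> FA. y - (s - x) \<in> La} \<subseteq> {z \<in> fibre_ball R x. s - z \<in> FA}"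
      proof (intro image_subsetI)
        fix y assume y: "y \<in> {y \<in> FA. y - (s - x) \<in> La}"
        then have "norm (s - y) \<le> R" using R[of y "s - y"] True by simp
        then show "s - y \<in> {z \<in> fibre_ball R x. s - z \<in> FA}" using y neg[of "s - y"] by (simp add: fibre_ball_def)
      qed
    qed auto
    also have "\<dots> = q" using q[of "s - x"] by (simp add: fibre_count_def)
    finally show ?thesis using True by simp
  qed simp
  have "(\<Sum>z\<in>fibre_ball R x. \<integral>t. of_bool (z + t \<in> FB) * indicator FA t \<partial>lborel :: real) = (\<integral>s. (\<Sum>z\<in>fibre_ball R x. indicator FB s * of_bool (s - z \<in> FA)) \<partial>lborel)"
    unfolding tr by (rule Bochner_Integration.integral_sum[OF int, symmetric])
  then show ?thesis unfolding sum by simp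
qed

text \<open>For each t the box minus its translate by - t is a coboundary with a bounded potential;
  \<open>g\<close> averages these potentials over t in FA. Summed over a class modulo La, the
  averaged translates give q times the volume of the box divided by that of FA, that is q: this is
  where the equality of volumes enters.\<close>

theorem real_flow:
  fixes W :: "real ^ 'n ^ 'n" and FA :: "(real ^ 'n) set"
  assumes W: "det W \<noteq> 0" "\<And>i. column i W = w i"
    and FA: "FA \<in> sets borel" "bounded FA" "measure lborel FA = \<bar>det W\<bar>"
    and q: "\<And>x. fibre_count FA x = q"
  shows "\<exists>f :: 'n \<Rightarrow> real ^ 'n \<Rightarrow> real. (\<forall>j. f j \<in> borel_measurable borel) \<and> (\<forall>j x. \<forall>l\<in>La. f j (x + l) = f j x) \<and>
    (\<exists>C. \<forall>j x. \<bar>f j x\<bar> \<le> C) \<and> (\<forall>x. real (fibre_count (parallelepiped W) x) - real q = (\<Sum>j\<in>UNIV. f j x - f j (x - w j)))"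
proof -
  define V where "V = \<bar>det W\<bar>"
  have V: "V > 0" using W by (simp add: V_def)
  define c where "c x = matrix_inv W *v x" for x
  have Wc: "W *v c x = x" for x using matrix_inv_vec(2)[OF W(1)] by (simp add: c_def)
  have c_add: "c (x + y) = c x + c y" and c_diff: "c (x - y) = c x - c y" for x y
    by (simp_all add: c_def matrix_vector_right_distrib matrix_vector_mult_diff_distrib)
  have c_neg: "c (- x) = - c x" for x
    using c_diff[of 0 x] by (simp add: c_def)
  have c_w: "c (w j) = axis j 1" for j
  proof -
    have "w j = W *v axis j 1" by (simp add: matrix_vector_mult_basis W(2))
    then show ?thesis using matrix_inv_vec(1)[OF W(1)] by (simp add: c_def)
  qed
  obtain h :: "'n \<Rightarrow> real ^ 'n \<Rightarrow> real ^ 'n \<Rightarrow> real" where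
    h_meas: "\<And>j. (\<lambda>(x, t). h j x t) \<in> borel_measurable borel" and h_bd: "\<And>j x t. \<bar>h j x t\<bar> \<le> 1"
    and h_supp: "\<And>j x t l. h j x t \<noteq> 0 \<Longrightarrow> \<bar>x $ l\<bar> \<le> 1 + \<bar>t $ l\<bar>"
    and h_tel: "\<And>x t. (\<Prod>l\<in>UNIV. of_bool (0 \<le> x $ l \<and> x $ l < 1)) -
        (\<Prod>l\<in>UNIV. of_bool (0 \<le> x $ l - (if l \<in> UNIV then t $ l else 0) \<and> x $ l - (if l \<in> UNIV then t $ l else 0) < 1))
       = (\<Sum>j\<in>UNIV. h j x t - h j (x - axis j 1) t)"
    using telescoping_box[of "UNIV :: 'n set"] by blast
  define FB where "FB = parallelepiped W"
  have FB: "FB \<in> sets borel" "bounded FB" "measure lborel FB = V"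
    unfolding FB_def V_def using W(1) by (auto intro: parallelepiped_borel parallelepiped_bounded parallelepiped_measure)
  have [measurable]: "FA \<in> sets borel" "FB \<in> sets borel" by (fact FA FB)+
  have prod_FB: "(\<Prod>l\<in>UNIV. of_bool (0 \<le> c x $ l \<and> c x $ l < 1)) = (of_bool (x \<in> FB) :: real)" for x
    by (auto simp: FB_def parallelepiped_def c_def)
  \<comment> \<open>The telescoping lemma subtracts its shift, and z + t in FB means that c z minus
    c (- t) is in the unit cube; hence c (- t).\<close>
  define H where "H j z t = h j (c z) (c (- t)) * indicator FA t" for j z t
  have tel: "of_bool (z \<in> FB) * indicator FA t - of_bool (z + t \<in> FB) * indicator FA t = (\<Sum>j\<in>UNIV. H j z t - H j (z - w j) t)" for z t
  proof -
    have e: "c (z + t) $ l = c z $ l - (if l \<in> UNIV then c (- t) $ l else 0)" for l by (simp add: c_add c_neg)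
    have "of_bool (z \<in> FB) - (of_bool (z + t \<in> FB) :: real) = (\<Sum>j\<in>UNIV. h j (c z) (c (- t)) - h j (c z - axis j 1) (c (- t)))"
      unfolding prod_FB[symmetric] e by (rule h_tel)
    then show ?thesis
      by (simp add: H_def c_diff c_w sum_distrib_right flip: left_diff_distrib)
  qed
  have c_meas: "c \<in> borel_measurable borel"
    unfolding c_def by (intro borel_measurable_continuous_onI matrix_vector_mult_linear_continuous_on)
  have hm: "(\<lambda>p. h j (c (fst p)) (c (- snd p))) \<in> borel_measurable (borel \<Otimes>\<^sub>M lborel)" for j
  proof -
    have "(\<lambda>p :: (real ^ 'n) \<times> (real ^ 'n). (c (fst p), c (- snd p))) \<in> borel \<Otimes>\<^sub>M lborel \<rightarrow>\<^sub>M borel"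
      unfolding borel_prod[symmetric]
      by (intro measurable_Pair measurable_compose[OF _ c_meas]) auto
    from measurable_compose[OF this h_meas[of j]] show ?thesis by simp
  qed
  have H_meas: "(\<lambda>(z, t). H j z t) \<in> borel_measurable (borel \<Otimes>\<^sub>M lborel)" for j
    unfolding H_def split_beta' using hm[of j] by measurable
  have H_int: "integrable lborel (H j z)" for j z
  proof (rule Bochner_Integration.integrable_bound)
    show "integrable lborel (indicator FA :: _ \<Rightarrow> real)"
      using emeasure_bounded_finite[OF FA(2)] by (simp add: integrable_indicator_iff)
    show "H j z \<in> borel_measurable lborel"
      using measurable_compose[OF measurable_Pair1' H_meas[of j], of z] by simp
    show "AE t in lborel. norm (H j z t) \<le> norm (indicator FA t :: real)"
      using h_bd by (auto simp: H_def indicator_def)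
  qed
  have iFA: "integrable lborel (indicator FA :: _ \<Rightarrow> real)"
    using emeasure_bounded_finite[OF FA(2)] by (simp add: integrable_indicator_iff)
  define g where "g j z = (\<integral>t. H j z t \<partial>lborel) / V" for j z
  have g_meas: "g j \<in> borel_measurable borel" for j
    unfolding g_def by (intro borel_measurable_divide lborel.borel_measurable_lebesgue_integral H_meas) simp
  have g_bd: "\<bar>g j z\<bar> \<le> 1" for j z
  proof -
    have "\<bar>\<integral>t. H j z t \<partial>lborel\<bar> \<le> (\<integral>t. indicator FA t \<partial>lborel)"
      using h_bd
      by (intro order_trans[OF integral_abs_bound] integral_mono integrable_abs H_int iFA)
        (auto simp: H_def indicator_def)
    also have "\<dots> = V" by (simp add: FA(3) V_def)
    finally show ?thesis using V by (simp add: g_def field_simps)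
  qed
  have g_tel: "of_bool (z \<in> FB) - (\<integral>t. of_bool (z + t \<in> FB) * indicator FA t \<partial>lborel) / V = (\<Sum>j\<in>UNIV. g j z - g j (z - w j))" for z
  proof -
    have i1: "integrable lborel (\<lambda>t. of_bool (z \<in> FB) * indicator FA t :: real)"
      and i2: "integrable lborel (\<lambda>t. of_bool (z + t \<in> FB) * indicator FA t :: real)"
      by (rule Bochner_Integration.integrable_bound[where f="indicator FA :: _ \<Rightarrow> real"];
        use emeasure_bounded_finite[OF FA(2)] in \<open>auto simp: integrable_indicator_iff indicator_def\<close>)+
    have "(\<integral>t. of_bool (z \<in> FB) * indicator FA t - of_bool (z + t \<in> FB) * indicator FA t \<partial>lborel) = (\<Sum>j\<in>UNIV. (\<integral>t. H j z t \<partial>lborel) - (\<integral>t. H j (z - w j) t \<partial>lborel))"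
      unfolding tel by (simp add: H_int)
    moreover have "(\<integral>t. of_bool (z \<in> FB) * indicator FA t - of_bool (z + t \<in> FB) * indicator FA t \<partial>lborel)
       = of_bool (z \<in> FB) * V - (\<integral>t. of_bool (z + t \<in> FB) * indicator FA t \<partial>lborel)"
      using Bochner_Integration.integral_diff[OF i1 i2] by (simp add: FA(3) V_def)
    ultimately show ?thesis using V by (simp add: g_def field_simps flip: sum_divide_distrib diff_divide_distrib)
  qed
  obtain rA where rA: "\<And>t. t \<in> FA \<Longrightarrow> norm t \<le> rA" using FA(2) by (auto simp: bounded_iff)
  obtain rB where rB: "\<And>t. t \<in> FB \<Longrightarrow> norm t \<le> rB" using FB(2) by (auto simp: bounded_iff)
  have "\<exists>C. \<forall>j z. g j z \<noteq> 0 \<longrightarrow> norm z \<le> C"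
  proof -
    obtain K1 where K1: "K1 > 0" "\<And>x. norm (c x) \<le> norm x * K1"
      unfolding c_def using bounded_linear.pos_bounded[OF matrix_vector_mul_bounded_linear] by blast
    obtain K2 where K2: "K2 > 0" "\<And>x. norm (W *v x) \<le> norm x * K2"
      using bounded_linear.pos_bounded[OF matrix_vector_mul_bounded_linear] by blast
    have "norm z \<le> real CARD('n) * (1 + rA * K1) * K2" if nz: "g j z \<noteq> 0" for j z
    proof -
      have "\<exists>t. H j z t \<noteq> 0"
      proof (rule ccontr)
        assume "\<not> (\<exists>t. H j z t \<noteq> 0)"
        then show False using nz by (simp add: g_def)
      qed
      then obtain t where t: "t \<in> FA" "h j (c z) (c (- t)) \<noteq> 0" by (auto simp: H_def indicator_def split: if_splits)
      have "\<bar>c z $ l\<bar> \<le> 1 + rA * K1" for l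
      proof -
        have "\<bar>c z $ l\<bar> \<le> 1 + \<bar>c (- t) $ l\<bar>" by (rule h_supp[OF t(2)])
        also have "\<bar>c (- t) $ l\<bar> \<le> norm (- t) * K1" using component_le_norm_cart[of "c (- t)" l] K1(2)[of "- t"] by linarith
        also have "\<dots> \<le> rA * K1" using rA[OF t(1)] K1(1) by simp
        finally show ?thesis by simp
      qed
      then have "norm (c z) \<le> (\<Sum>l\<in>(UNIV :: 'n set). 1 + rA * K1)"
        by (intro order_trans[OF norm_le_l1_cart] sum_mono)
      then have "norm (c z) * K2 \<le> real CARD('n) * (1 + rA * K1) * K2" using K2(1) by simp
      then show ?thesis using K2(2)[of "c z"] by (simp add: Wc)
    qed
    then show ?thesis by blast
  qed
  then obtain C where C: "\<And>j z. g j z \<noteq> 0 \<Longrightarrow> norm z \<le> C" by blast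
  \<comment> \<open>Large enough for the truncation to be invisible: it covers the box, the supports
    of all g j with their translates by w j, and the differences of points of FB and FA.\<close>
  define R where "R = max (rA + rB) (max rB (C + (\<Sum>j\<in>UNIV. norm (w j))))"
  define f where "f j x = (\<Sum>z\<in>fibre_ball R x. g j z)" for j x
  have "f j \<in> borel_measurable borel" for j
    unfolding f_def by (rule sum_fibre_ball_measurable[OF g_meas])
  moreover have "f j (x + l) = f j x" if "l \<in> La" for j x l
    unfolding f_def fibre_ball_periodic[OF that] ..
  moreover have "\<exists>C. \<forall>j x. \<bar>f j x\<bar> \<le> C"
    using sum_fibre_ball_bounded[of R] g_bd unfolding f_def by meson
  moreover have "real (fibre_count (parallelepiped W) x) - real q = (\<Sum>j\<in>UNIV. f j x - f j (x - w j))" for x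
  proof -
    have sh: "(\<Sum>z\<in>fibre_ball R x. g j (z - w j)) = f j (x - w j)" for j
      unfolding f_def
    proof (rule sum_fibre_ball_shift)
      fix z assume "g j z \<noteq> 0"
      moreover have "norm (w j) \<le> (\<Sum>j\<in>UNIV. norm (w j))" by (rule member_le_sum) auto
      ultimately show "norm z + norm (w j) \<le> R" using C[of j z] by (auto simp: R_def)
    qed
    have "(\<Sum>j\<in>UNIV. f j x - f j (x - w j)) = (\<Sum>j\<in>UNIV. \<Sum>z\<in>fibre_ball R x. g j z - g j (z - w j))"
      unfolding sum_subtractf sh by (simp add: f_def)
    also have "\<dots> = (\<Sum>z\<in>fibre_ball R x. \<Sum>j\<in>UNIV. g j z - g j (z - w j))" by (rule sum.swap)
    also have "\<dots> = (\<Sum>z\<in>fibre_ball R x. of_bool (z \<in> FB)) - (\<Sum>z\<in>fibre_ball R x. \<integral>t. of_bool (z + t \<in> FB) * indicator FA t \<partial>lborel) / V"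
      unfolding g_tel[symmetric] by (simp only: sum_subtractf sum_divide_distrib)
    also have "(\<Sum>z\<in>fibre_ball R x. \<integral>t. of_bool (z + t \<in> FB) * indicator FA t \<partial>lborel) = real q * V"
      unfolding FB(3)[symmetric]
    proof (rule average_over_box[OF FA(1,2) FB(1,2) q])
      fix z t assume "t \<in> FA" "z + t \<in> FB"
      then show "norm z \<le> R" using norm_triangle_ineq4[of "z + t" t] rA[of t] rB[of "z + t"] by (auto simp: R_def)
    qed
    also have "(\<Sum>z\<in>fibre_ball R x. of_bool (z \<in> FB)) = real (fibre_count FB x)"
      by (rule sum_fibre_ball_indicator) (use rB in \<open>force simp: R_def\<close>)
    finally show ?thesis using V by (simp add: FB_def)
  qed
  ultimately show ?thesis by blast
qed

end

section \<open>The common fundamental domain\<close>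

definition saturation :: "(real ^ 'n) set \<Rightarrow> (real ^ 'n) set \<Rightarrow> (real ^ 'n) set" where
  "saturation L M = {m \<in> M. \<exists>k::int. k \<noteq> 0 \<and> of_int k *\<^sub>R m \<in> L}"

lemma subgrp_saturation:
  assumes L: "subgrp L" and M: "subgrp M"
  shows "subgrp (saturation L M)"
  unfolding subgrp_def
proof (intro conjI ballI)
  show "0 \<in> saturation L M" using L M by (auto simp: saturation_def subgrp_def intro: exI[of _ 1])
  fix x y assume x: "x \<in> saturation L M" and y: "y \<in> saturation L M"
  obtain k j :: int where k: "k \<noteq> 0" "of_int k *\<^sub>R x \<in> L" and j: "j \<noteq> 0" "of_int j *\<^sub>R y \<in> L"
    using x y by (auto simp: saturation_def)
  have "of_int (k * j) *\<^sub>R (x - y) = of_int j *\<^sub>R (of_int k *\<^sub>R x) - of_int k *\<^sub>R (of_int j *\<^sub>R y)"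
    by (simp add: scaleR_diff_right mult.commute)
  also have "\<dots> \<in> L" by (intro subgrp_diff[OF L] subgrp_scale[OF L] k j)
  finally show "x - y \<in> saturation L M"
    using x y k(1) j(1) subgrp_diff[OF M, of x y] unfolding saturation_def
    by (auto intro!: exI[of _ "k * j"])
qed

lemma subgrp_sum_sets:
  assumes L: "subgrp L" and M: "subgrp M"
  shows "subgrp {l + m | l m. l \<in> L \<and> m \<in> M}"
  unfolding subgrp_def
proof (intro conjI ballI)
  show "0 \<in> {l + m | l m. l \<in> L \<and> m \<in> M}" using L M by (force simp: subgrp_def)
  fix x y assume "x \<in> {l + m | l m. l \<in> L \<and> m \<in> M}" "y \<in> {l + m | l m. l \<in> L \<and> m \<in> M}"
  then obtain l m l' m' where *: "x = l + m" "y = l' + m'" "l \<in> L" "m \<in> M" "l' \<in> L" "m' \<in> M" by blast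
  have "x - y = (l - l') + (m - m')" by (simp add: *)
  then show "x - y \<in> {l + m | l m. l \<in> L \<and> m \<in> M}"
    using subgrp_diff[OF L *(3,5)] subgrp_diff[OF M *(4,6)] by blast
qed

lemma subset_sum_sets:
  assumes "subgrp L" "subgrp M"
  shows "L \<subseteq> {l + m | l m. l \<in> L \<and> m \<in> M}" "M \<subseteq> {l + m | l m. l \<in> L \<and> m \<in> M}"
proof -
  have "0 \<in> L" "0 \<in> M" using assms by (auto simp: subgrp_def)
  moreover have "x = x + 0" "x = 0 + x" for x :: "real ^ 'a" by simp_all
  ultimately show "L \<subseteq> {l + m | l m. l \<in> L \<and> m \<in> M}" "M \<subseteq> {l + m | l m. l \<in> L \<and> m \<in> M}" by blast+
qed

text \<open>Multiplication by Q maps G injectively into the uniformly discrete L and scales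
  distances by a constant.\<close>

lemma is_lattice_multiple:
  assumes L: "is_lattice L" and G: "subgrp G" "L \<subseteq> G" and Q: "Q \<noteq> 0" "\<And>x. x \<in> G \<Longrightarrow> of_int Q *\<^sub>R x \<in> L"
  shows "is_lattice G"
proof -
  obtain e where e: "e > 0" "\<And>x y. x \<in> L \<Longrightarrow> y \<in> L \<Longrightarrow> dist x y < e \<Longrightarrow> x = y"
    using is_lattice_uniform_discrete[OF L] unfolding uniform_discrete_def by blast
  define r where "r = \<bar>real_of_int Q\<bar>"
  have r: "r > 0" using Q(1) by (simp add: r_def)
  have "uniform_discrete G" unfolding uniform_discrete_def
  proof (intro exI[of _ "e / r"] conjI ballI impI)
    fix x y assume xy: "x \<in> G" "y \<in> G" "dist x y < e / r"
    have "dist (of_int Q *\<^sub>R x) (of_int Q *\<^sub>R y) = r * dist x y"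
      by (simp add: r_def dist_norm flip: scaleR_diff_right)
    also have "\<dots> < e" using xy(3) r by (simp add: field_simps)
    finally have "of_int Q *\<^sub>R x = of_int Q *\<^sub>R y" by (rule e(2)[OF Q(2)[OF xy(1)] Q(2)[OF xy(2)]])
    then show "x = y" using Q(1) by simp
  qed (use e r in simp)
  then have "discrete G" by (rule uniform_discrete_imp_discrete)
  moreover have "span G = UNIV"
    using span_mono[OF G(2)] L by (auto simp: is_lattice_def)
  ultimately show ?thesis using G(1) by (simp add: is_lattice_def subgrp_def)
qed

text \<open>By adaptedness an element of the saturation is an integral combination of those basis
  members that lie in it: subtracting their part leaves an element with no such coefficients, which
  must vanish. Each of these members has a multiple in L, so the product Q of the multipliers
  carries the whole sum into L.\<close>

lemma saturation_sum_lattice: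
  fixes L M :: "(real ^ 'n) set"
  assumes L: "is_lattice L" and M: "subgrp M" and w: "zbasis M w"
    and ad: "\<And>v. (\<forall>i. w i \<in> saturation L M \<longrightarrow> v $ i = 0) \<Longrightarrow> zcomb w v \<in> saturation L M \<Longrightarrow> v = 0"
  shows "is_lattice {l + m | l m. l \<in> L \<and> m \<in> saturation L M}"
proof -
  let ?N = "saturation L M"
  note Ls = is_lattice_subgrp[OF L]
  note N = subgrp_saturation[OF Ls M]
  have "\<forall>i. \<exists>k::int. k \<noteq> 0 \<and> (w i \<in> ?N \<longrightarrow> of_int k *\<^sub>R w i \<in> L)"
  proof
    fix i
    show "\<exists>k::int. k \<noteq> 0 \<and> (w i \<in> ?N \<longrightarrow> of_int k *\<^sub>R w i \<in> L)"
      by (cases "w i \<in> ?N") (auto simp: saturation_def intro: exI[of _ 1])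
  qed
  from choice[OF this] obtain k :: "'n \<Rightarrow> int" where k: "\<And>i. k i \<noteq> 0" "\<And>i. w i \<in> ?N \<Longrightarrow> of_int (k i) *\<^sub>R w i \<in> L" by blast
  define Q where "Q = (\<Prod>i\<in>UNIV. k i)"
  have QL: "of_int Q *\<^sub>R x \<in> L" if "x \<in> {l + m | l m. l \<in> L \<and> m \<in> ?N}" for x
  proof -
    from that obtain l m where x: "x = l + m" "l \<in> L" "m \<in> ?N" by blast
    obtain v where v: "m = zcomb w v" using x(3) w by (auto simp: saturation_def zbasis_def)
    define v' where "v' = (\<chi> i. if w i \<in> ?N then 0 else v $ i)"
    have "zcomb w v - zcomb w v' = (\<Sum>i\<in>UNIV. of_int (v $ i - v' $ i) *\<^sub>R w i)"
      by (simp add: zcomb_def sum_subtractf scaleR_left_diff_distrib)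
    also have "\<dots> \<in> ?N"
    proof (rule subgrp_sum[OF N])
      fix i
      show "of_int (v $ i - v' $ i) *\<^sub>R w i \<in> ?N"
      proof (cases "w i \<in> ?N")
        case True
        then show ?thesis by (rule subgrp_scale[OF N])
      qed (use N in \<open>simp add: v'_def subgrp_def\<close>)
    qed
    finally have "zcomb w v - (zcomb w v - zcomb w v') \<in> ?N" using subgrp_diff[OF N x(3)] v by blast
    then have "zcomb w v' \<in> ?N" by simp
    moreover have "\<forall>i. w i \<in> ?N \<longrightarrow> v' $ i = 0" by (simp add: v'_def)
    ultimately have "v' = 0" using ad by blast
    have v0: "v $ i = 0" if "w i \<notin> ?N" for i
    proof -
      have "v' $ i = 0" using \<open>v' = 0\<close> by simp
      then show ?thesis using that by (simp add: v'_def)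
    qed
    have "of_int Q *\<^sub>R m = (\<Sum>i\<in>UNIV. of_int (Q * v $ i) *\<^sub>R w i)"
      by (simp add: v zcomb_def scaleR_sum_right)
    also have "\<dots> \<in> L"
    proof (rule subgrp_sum[OF Ls])
      fix i
      show "of_int (Q * v $ i) *\<^sub>R w i \<in> L"
      proof (cases "w i \<in> ?N")
        case True
        have "Q = k i * (\<Prod>j\<in>UNIV - {i}. k j)" unfolding Q_def by (rule prod.remove) auto
        then have "of_int (Q * v $ i) *\<^sub>R w i = of_int ((\<Prod>j\<in>UNIV - {i}. k j) * v $ i) *\<^sub>R (of_int (k i) *\<^sub>R w i)"
          by (simp add: mult_ac)
        also have "\<dots> \<in> L" by (rule subgrp_scale[OF Ls k(2)[OF True]])
        finally show ?thesis .
      qed (use v0 Ls in \<open>simp add: subgrp_def\<close>)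
    qed
    finally have "of_int Q *\<^sub>R m \<in> L" .
    then show ?thesis
      using subgrp_add[OF Ls subgrp_scale[OF Ls x(2)]] by (simp add: x(1) scaleR_add_right)
  qed
  show ?thesis
  proof (rule is_lattice_multiple[OF L subgrp_sum_sets[OF Ls N] _ _ QL])
    show "L \<subseteq> {l + m | l m. l \<in> L \<and> m \<in> ?N}" by (rule subset_sum_sets(1)[OF Ls N])
    show "Q \<noteq> 0" using k(1) by (simp add: Q_def)
  qed
qed

text \<open>\<open>t s x = 1\<close> says that the point x bears the label s; the sum condition
  gives each point of F inside \<Omega> exactly one label. Moving the points of label s by
  \<open>g s\<close> in G keeps every point in its class, so the moved set still meets the class of
  y exactly once.\<close>

lemma regroup_domain:
  fixes t :: "'a::ab_group_add \<Rightarrow> 'a \<Rightarrow> nat"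
  assumes G: "0 \<in> G" "\<And>x y. x \<in> G \<Longrightarrow> y \<in> G \<Longrightarrow> x - y \<in> G" and S: "finite S" "g ` S \<subseteq> G"
    and t: "\<And>x. (\<Sum>s\<in>S. t s x) = of_bool (x \<in> F \<inter> \<Omega>)"
    and F: "\<exists>!l. l \<in> G \<and> y - l \<in> F" and \<Omega>: "\<And>l. l \<in> G \<Longrightarrow> y - l \<in> \<Omega>"
  shows "\<exists>!l. l \<in> G \<and> (\<exists>s\<in>S. t s (y - l - g s) = 1)"
proof -
  obtain l0 where l0: "l0 \<in> G" "y - l0 \<in> F" "\<And>l. l \<in> G \<Longrightarrow> y - l \<in> F \<Longrightarrow> l = l0" using F by blast
  have G_add: "x + y \<in> G" if "x \<in> G" "y \<in> G" for x y
    using G(2)[OF that(1) G(2)[OF G(1) that(2)]] by simp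
  have one: "(\<Sum>s\<in>S. t s (y - l0)) = 1" using t[of "y - l0"] l0(2) \<Omega>[OF l0(1)] by simp
  then obtain s0 where s0: "s0 \<in> S" "t s0 (y - l0) \<noteq> 0" by (metis sum.neutral zero_neq_one)
  have rest: "t s0 (y - l0) + (\<Sum>s\<in>S - {s0}. t s (y - l0)) = 1"
    using one sum.remove[OF S(1) s0(1), of "\<lambda>s. t s (y - l0)"] by simp
  then have s01: "t s0 (y - l0) = 1" and "(\<Sum>s\<in>S - {s0}. t s (y - l0)) = 0" using s0(2) by linarith+
  then have s0u: "s = s0" if "s \<in> S" "t s (y - l0) = 1" for s
    using that S(1) by (metis Diff_iff empty_iff finite_Diff insert_iff sum_eq_0_iff zero_neq_one)
  show ?thesis
  proof (intro ex1I[of _ "l0 - g s0"] conjI)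
    show "l0 - g s0 \<in> G" using G(2)[OF l0(1)] S(2) s0(1) by blast
    show "\<exists>s\<in>S. t s (y - (l0 - g s0) - g s) = 1" using s0(1) s01 by (intro bexI[of _ s0]) simp_all
    fix l assume "l \<in> G \<and> (\<exists>s\<in>S. t s (y - l - g s) = 1)"
    then obtain s where s: "l \<in> G" "s \<in> S" "t s (y - l - g s) = 1" by blast
    have "y - l - g s \<in> F"
    proof -
      have "t s (y - l - g s) \<le> (\<Sum>s'\<in>S. t s' (y - l - g s))" using S(1) s(2) by (intro member_le_sum) auto
      then show ?thesis using t[of "y - l - g s"] s(3) by (auto split: if_splits simp: of_bool_def)
    qed
    moreover have "l + g s \<in> G" using G_add s(1,2) S(2) by blast
    ultimately have eq: "l + g s = l0" using l0(3)[of "l + g s"] by (simp add: diff_diff_eq)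
    then have "y - l - g s = y - l0" by (simp add: diff_diff_eq flip: eq)
    then have "s = s0" using s0u[OF s(2)] s(3) by (simp only:)
    then show "l = l0 - g s0" using eq by (simp add: algebra_simps flip: eq)
  qed
qed

context lattice_shift
begin

text \<open>Moving the points over x by y - x and reducing them into F modulo L is injective into
  the points over y; exchange x and y. The constant is the index of L in La.\<close>

lemma fibre_count_const:
  assumes L: "subgrp L" "L \<subseteq> La" and F: "bounded F" "\<And>x. \<exists>!l. l \<in> L \<and> x - l \<in> F"
  shows "\<exists>q\<ge>1. \<forall>x. fibre_count F x = q"
proof -
  have uniq: "p = p'" if "p \<in> F" "p' \<in> F" "p - p' \<in> L" for p p'
  proof -
    have "p - p' \<in> L \<and> p - (p - p') \<in> F" "0 \<in> L \<and> p - 0 \<in> F" using that L(1) by (auto simp: subgrp_def)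
    then have "p - p' = 0" using F(2)[of p] by blast
    then show ?thesis by simp
  qed
  have le: "fibre_count F x \<le> fibre_count F y" for x y
  proof -
    define r where "r z = (SOME p. p \<in> F \<and> z - p \<in> L)" for z
    have r: "r z \<in> F" "z - r z \<in> L" for z
    proof -
      obtain l where "l \<in> L" "z - l \<in> F" using F(2)[of z] by blast
      then have "\<exists>p. p \<in> F \<and> z - p \<in> L" by (intro exI[of _ "z - l"]) simp
      from someI_ex[OF this] show "r z \<in> F" "z - r z \<in> L" by (simp_all add: r_def)
    qed
    show ?thesis unfolding fibre_count_def
    proof (rule card_inj_on_le[of "\<lambda>z. r (z + (y - x))"])
      show "inj_on (\<lambda>z. r (z + (y - x))) {z \<in> F. z - x \<in> La}"
      proof (rule inj_onI)
        fix z z' assume z: "z \<in> {z \<in> F. z - x \<in> La}" "z' \<in> {z \<in> F. z - x \<in> La}" and eq: "r (z + (y - x)) = r (z' + (y - x))"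
        have "(z + (y - x) - r (z + (y - x))) - (z' + (y - x) - r (z' + (y - x))) \<in> L"
          by (rule subgrp_diff[OF L(1) r(2) r(2)])
        then have "z - z' \<in> L" by (simp add: eq)
        then show "z = z'" using uniq z by blast
      qed
      show "(\<lambda>z. r (z + (y - x))) ` {z \<in> F. z - x \<in> La} \<subseteq> {z \<in> F. z - y \<in> La}"
      proof (intro image_subsetI CollectI conjI r(1))
        fix z assume "z \<in> {z \<in> F. z - x \<in> La}"
        then have "(z - x) - (z + (y - x) - r (z + (y - x))) \<in> La"
          using subgrp_diff[OF La_subgrp, of "z - x"] r(2)[of "z + (y - x)"] L(2) by blast
        then show "r (z + (y - x)) - y \<in> La" by (simp add: algebra_simps)
      qed
      show "finite {z \<in> F. z - y \<in> La}" by (rule finite_fibre_count[OF F(1)])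
    qed
  qed
  obtain l where "l \<in> L" "0 - l \<in> F" using F(2)[of 0] by blast
  then have "- l \<in> {z \<in> F. z - 0 \<in> La}" using subgrp_uminus[OF L(1)] L(2) by auto
  then have "fibre_count F 0 \<ge> 1"
    unfolding fibre_count_def using finite_fibre_count[OF F(1), of 0] by (metis Suc_leI card_gt_0_iff empty_iff One_nat_def)
  moreover have "fibre_count F x = fibre_count F 0" for x using le[of x 0] le[of 0 x] by simp
  ultimately show ?thesis by blast
qed

lemma act_axis: "act (axis j 1) = w j"
proof -
  have "act (axis j 1) = (\<Sum>i\<in>UNIV. if i = j then w i else 0)"
    unfolding act_def by (intro sum.cong) (auto simp: axis_def)
  then show ?thesis by simp
qed

text \<open>The potentials f j become a flow on oriented edges with divergence q - b x. Directions
  outside I translate by elements of La, so their terms cancel by periodicity and only edges of the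
  free action remain.\<close>

lemma flow_edges:
  fixes f :: "'n \<Rightarrow> real ^ 'n \<Rightarrow> real" and b :: "real ^ 'n \<Rightarrow> nat"
  assumes meas: "\<And>j. f j \<in> borel_measurable borel" and per: "\<And>j x l. l \<in> La \<Longrightarrow> f j (x + l) = f j x"
    and bd: "\<And>j x. \<bar>f j x\<bar> \<le> C" and off: "\<And>i. i \<notin> I \<Longrightarrow> w i \<in> La"
    and eq: "\<And>x. real (b x) - real q = (\<Sum>j\<in>UNIV. f j x - f j (x - w j))"
  shows "\<exists>\<phi> C. lattice_flow La w I P \<phi> C \<and> (\<forall>x. (\<Sum>a\<in>nbrs I. \<phi> x a) = real q - real (b x))"
proof -
  define \<phi> where "\<phi> x a = (\<Sum>i\<in>I. of_bool (a = axis i (-1)) * f i (x - w i) - of_bool (a = axis i 1) * f i x)"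
    for x and a :: "int ^ 'n"
  have ne: "axis i (1::int) \<noteq> axis j (-1)" for i j :: 'n by (simp add: axis_eq_axis)
  have pos: "\<phi> x (axis j 1) = - f j x" if "j \<in> I" for x j
  proof -
    have "\<phi> x (axis j 1) = (\<Sum>i\<in>I. if i = j then - f j x else 0)"
      unfolding \<phi>_def by (rule sum.cong) (auto simp: ne axis_eq_axis)
    then show ?thesis using that by simp
  qed
  have neg: "\<phi> x (axis j (-1)) = f j (x - w j)" if "j \<in> I" for x j
  proof -
    have "\<phi> x (axis j (-1)) = (\<Sum>i\<in>I. if i = j then f j (x - w j) else 0)"
      unfolding \<phi>_def by (rule sum.cong) (auto simp: ne[symmetric] axis_eq_axis)
    then show ?thesis using that by simp
  qed
  have sum: "(\<Sum>a\<in>nbrs I. \<phi> x a) = real q - real (b x)" for x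
  proof -
    have "f j x - f j (x - w j) = 0" if "j \<notin> I" for j
      using per[OF off[OF that], of j "x - w j"] by simp
    then have "(\<Sum>j\<in>UNIV. f j x - f j (x - w j)) = (\<Sum>j\<in>I. f j x - f j (x - w j))"
      by (intro sum.mono_neutral_right) auto
    moreover have "(\<Sum>a\<in>nbrs I. \<phi> x a) = (\<Sum>j\<in>I. - f j x) + (\<Sum>j\<in>I. f j (x - w j))"
      unfolding sum_nbrs by (intro arg_cong2[where f="(+)"] sum.cong) (auto simp: pos neg)
    ultimately show ?thesis using eq[of x] by (simp add: sum_subtractf sum_negf)
  qed
  have "lattice_flow La w I P \<phi> C"
  proof
    fix a assume "a \<in> nbrs I"
    show "(\<lambda>x. \<phi> x a) \<in> borel_measurable borel"
    proof -
      have [measurable]: "f j \<in> borel_measurable borel" for j by (rule meas)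
      show ?thesis unfolding \<phi>_def by measurable
    qed
  next
    fix x l a assume l: "l \<in> La"
    have "f j (x + l - w j) = f j (x - w j)" for j
      using per[OF l, of j "x - w j"] by (simp add: algebra_simps)
    then show "\<phi> (x + l) a = \<phi> x a" by (simp add: \<phi>_def per[OF l])
  next
    fix x a assume "a \<in> nbrs I"
    then obtain j where j: "j \<in> I" "a = axis j 1 \<or> a = axis j (-1)" by (auto simp: nbrs_def)
    have m: "- axis j (1::int) = axis j (-1)" "- axis j (- 1 :: int) = axis j 1" by (simp_all add: axis_minus_one)
    have "act (axis j (-1)) = - w j" by (simp add: act_uminus act_axis flip: m(1))
    then show "\<phi> (x + act a) (- a) = - \<phi> x a"
      using j(2) by (auto simp: m pos[OF j(1)] neg[OF j(1)] act_axis)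
  next
    fix x a assume "a \<in> nbrs I"
    then show "\<bar>\<phi> x a\<bar> \<le> C" using bd by (auto simp: nbrs_def pos neg)
  next
    fix x
    show "(\<Sum>a\<in>nbrs I. \<phi> x a) \<in> \<int>" unfolding sum by auto
  qed
  then show ?thesis using sum by blast
qed

end

theorem common_fundamental_domain:
  fixes L M :: "(real ^ 'n) set"
  assumes L: "is_lattice L" and M: "is_lattice M" and vol: "lattice_volume L = lattice_volume M"
  shows "\<exists>E \<in> sets borel. bounded E \<and> (AE x in lborel. \<exists>!l. l \<in> L \<and> x - l \<in> E) \<and> (AE x in lborel. \<exists>!m. m \<in> M \<and> x - m \<in> E)"
proof -
  note Ls = is_lattice_subgrp[OF L] and Ms = is_lattice_subgrp[OF M]
  obtain AL where AL: "det AL \<noteq> 0" "L = lattice_of AL" using is_lattice_imp_lattice_of[OF L] by blast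
  obtain AM where AM: "det AM \<noteq> 0" "M = lattice_of AM" using is_lattice_imp_lattice_of[OF M] by blast
  have comb: "A *v y = (\<Sum>i\<in>UNIV. y $ i *\<^sub>R column i A)" for A :: "real ^ 'n ^ 'n" and y
    by (simp add: matrix_mult_sum scalar_mult_eq_scaleR)
  have zc: "range (zcomb (\<lambda>i. column i A)) = lattice_of A" for A :: "real ^ 'n ^ 'n"
    by (simp add: lattice_of_def int_vecs_range image_image comb zcomb_def)
  have zb: "zbasis M (\<lambda>i. column i AM)"
    unfolding zbasis_def
  proof (intro conjI allI impI)
    show "M = range (zcomb (\<lambda>i. column i AM))" by (simp add: zc AM(2))
    fix r i assume "(\<Sum>i\<in>UNIV. r i *\<^sub>R column i AM) = 0"
    then have "AM *v (\<chi> i. r i) = 0" by (simp add: comb)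
    then have "(\<chi> i. r i) = 0" using matrix_inv_vec(1)[OF AM(1), of "\<chi> i. r i"] by simp
    then show "r i = 0" by (simp add: vec_eq_iff)
  qed
  have sat: "m \<in> saturation L M" if m: "m \<in> M" "k \<noteq> 0" "of_int k *\<^sub>R m \<in> saturation L M" for k m
  proof -
    obtain j :: int where j: "j \<noteq> 0" "of_int j *\<^sub>R (of_int k *\<^sub>R m) \<in> L" using m(3) by (auto simp: saturation_def)
    then have "of_int (j * k) *\<^sub>R m \<in> L" by simp
    moreover have "j * k \<noteq> 0" using m(2) j(1) by simp
    ultimately show ?thesis using m(1) unfolding saturation_def by blast
  qed
  have "\<exists>w. zbasis M w \<and> (\<forall>v. (\<forall>i. w i \<in> saturation L M \<longrightarrow> v $ i = 0) \<and> zcomb w v \<in> saturation L M \<longrightarrow> v = 0)"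
    by (rule adapted_basis[OF zb]) (rule sat)
  then obtain w where w: "zbasis M w"
    and ad0: "\<forall>v. (\<forall>i. w i \<in> saturation L M \<longrightarrow> v $ i = 0) \<and> zcomb w v \<in> saturation L M \<longrightarrow> v = 0"
    by (elim exE conjE)
  have ad: "v = 0" if "\<forall>i. w i \<in> saturation L M \<longrightarrow> v $ i = 0" "zcomb w v \<in> saturation L M" for v
    by (rule ad0[THEN spec, THEN mp, OF conjI[OF that]])
  define W :: "real ^ 'n ^ 'n" where "W = (\<chi> i j. w j $ i)"
  have colW: "column j W = w j" for j by (simp add: W_def column_def vec_eq_iff)
  have "det W \<noteq> 0"
  proof -
    have "x = 0" if "W *v x = 0" for x
    proof -
      have "\<forall>i. x $ i = 0" using w that unfolding comb zbasis_def colW by blast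
      then show ?thesis by (simp add: vec_eq_iff)
    qed
    then have "\<exists>B. B ** W = mat 1" unfolding matrix_left_invertible_ker by blast
    then show ?thesis by (simp add: invertible_left_inverse flip: invertible_det_nz)
  qed
  have MW: "M = lattice_of W" using w zc[of W] by (simp add: zbasis_def colW)
  have volW: "\<bar>det AL\<bar> = \<bar>det W\<bar>"
    using vol lattice_volume_eq[OF AL(1)] lattice_volume_eq[OF \<open>det W \<noteq> 0\<close>] AL(2) MW by simp
  define I where "I = {i. w i \<notin> saturation L M}"
  define La where "La = {l + m | l m. l \<in> L \<and> m \<in> saturation L M}"
  have La: "is_lattice La" unfolding La_def by (rule saturation_sum_lattice[OF L Ms w ad])
  note Las = is_lattice_subgrp[OF La]
  note N = subgrp_saturation[OF Ls Ms]
  have L_La: "L \<subseteq> La" and N_La: "saturation L M \<subseteq> La"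
    unfolding La_def by (fact subset_sum_sets[OF Ls N])+
  obtain B where B: "det B \<noteq> 0" "La = lattice_of B" using is_lattice_imp_lattice_of[OF La] by blast
  have wM: "zcomb w v \<in> M" for v using w by (auto simp: zbasis_def)
  interpret lattice_shift La w I "parallelepiped B"
  proof
    show "subgrp La" "parallelepiped B \<in> sets borel" "bounded (parallelepiped B)" by (fact Las parallelepiped_borel parallelepiped_bounded[OF B(1)])+
    show "finite (La \<inter> B)" if "bounded B" for B using is_lattice_finite[OF La that] .
    show "\<exists>!l. l \<in> La \<and> x - l \<in> parallelepiped B" for x unfolding B(2) by (rule parallelepiped_dom[OF B(1)])
    fix v assume v: "\<forall>i. i \<notin> I \<longrightarrow> v $ i = 0" "(\<Sum>i\<in>UNIV. of_int (v $ i) *\<^sub>R w i) \<in> La"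
    then obtain l m where lm: "zcomb w v = l + m" "l \<in> L" "m \<in> saturation L M" by (auto simp: La_def zcomb_def)
    \<comment> \<open>l lies in L and, as a difference of elements of M, in M as well, so it is in
      the saturation with multiplier 1; then so is \<open>zcomb w v\<close>, and adaptedness
      applies.\<close>
    have "zcomb w v - m \<in> M" using subgrp_diff[OF Ms wM] lm(3) by (simp add: saturation_def)
    then have "l \<in> saturation L M" using lm(1,2) by (auto simp: saturation_def intro!: exI[of _ 1])
    then have "zcomb w v \<in> saturation L M" using lm subgrp_add[OF N] by simp
    then show "v = 0" using ad v(1) by (auto simp: I_def)
  qed
  define FL where "FL = parallelepiped AL"
  define FM where "FM = parallelepiped W"
  have FL: "FL \<in> sets borel" "bounded FL" "\<And>x. \<exists>!l. l \<in> L \<and> x - l \<in> FL" "measure lborel FL = \<bar>det W\<bar>"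
    unfolding FL_def AL(2) by (fact parallelepiped_borel parallelepiped_bounded[OF AL(1)] parallelepiped_dom[OF AL(1)] parallelepiped_measure[OF AL(1), unfolded volW])+
  have FM: "FM \<in> sets borel" "bounded FM" "\<And>x. \<exists>!l. l \<in> M \<and> x - l \<in> FM"
    unfolding FM_def MW by (fact parallelepiped_borel parallelepiped_bounded[OF \<open>det W \<noteq> 0\<close>] parallelepiped_dom[OF \<open>det W \<noteq> 0\<close>])+
  obtain q where q: "q \<ge> 1" "\<And>x. fibre_count FL x = q" using fibre_count_const[OF Ls L_La FL(2,3)] by blast
  obtain f C where f: "\<And>j. f j \<in> borel_measurable borel" "\<And>j x l. l \<in> La \<Longrightarrow> f j (x + l) = f j x"
    "\<And>j x. \<bar>f j x\<bar> \<le> C" "\<And>x. real (fibre_count FM x) - real q = (\<Sum>j\<in>UNIV. f j x - f j (x - w j))"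
    using real_flow[OF \<open>det W \<noteq> 0\<close> colW FL(1,2,4) q(2)] unfolding FM_def by blast
  have off: "w i \<in> La" if "i \<notin> I" for i using that N_La by (auto simp: I_def)
  obtain \<phi> C' where "lattice_flow La w I (parallelepiped B) \<phi> C'" and \<phi>: "\<And>x. (\<Sum>a\<in>nbrs I. \<phi> x a) = real q - real (fibre_count FM x)"
    using flow_edges[OF f(1-3) off f(4)] by blast
  then interpret lattice_flow La w I "parallelepiped B" \<phi> C' by blast
  obtain F K where F0: "(\<forall>a\<in>nbrs I. \<forall>z. {x. F x a = z} \<in> sets borel) \<and>
     (\<forall>x. \<forall>l\<in>La. \<forall>a. F (x + l) a = F x a) \<and>
     (\<forall>x\<in>dom. of_int (\<Sum>a\<in>nbrs I. F x a) = (\<Sum>a\<in>nbrs I. \<phi> x a) \<and>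
       (\<forall>a\<in>nbrs I. F (x + act a) (- a) = - F x a \<and> \<bar>F x a\<bar> \<le> K))"
    using integer_flow by (elim exE)
  have F_borel: "{x. F x a = z} \<in> sets borel" if "a \<in> nbrs I" for a z
    by (rule F0[THEN conjunct1, THEN bspec, OF that, THEN spec])
  have F_per: "F (x + l) a = F x a" if "l \<in> La" for x l a
    by (rule F0[THEN conjunct2, THEN conjunct1, THEN spec, THEN bspec, OF that, THEN spec])
  have F_dom: "of_int (\<Sum>a\<in>nbrs I. F x a) = (\<Sum>a\<in>nbrs I. \<phi> x a) \<and>
       (\<forall>a\<in>nbrs I. F (x + act a) (- a) = - F x a \<and> \<bar>F x a\<bar> \<le> K)" if "x \<in> dom" for x
    by (rule F0[THEN conjunct2, THEN conjunct2, THEN bspec, OF that])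
  have F_anti: "F (x + act a) (- a) = - F x a" and F_bound: "\<bar>F x a\<bar> \<le> K" if "x \<in> dom" "a \<in> nbrs I" for x a
    by (rule F_dom[OF that(1), THEN conjunct2, THEN bspec, OF that(2), THEN conjunct1],
        rule F_dom[OF that(1), THEN conjunct2, THEN bspec, OF that(2), THEN conjunct2])
  define D where "D = {l + m | l m. l \<in> L \<and> m \<in> M}"
  have D: "subgrp D" unfolding D_def by (rule subgrp_sum_sets[OF Ls Ms])
  have L_D: "L \<subseteq> D" and M_D: "M \<subseteq> D" unfolding D_def by (fact subset_sum_sets[OF Ls Ms])+
  have La_D: "La \<subseteq> D" by (auto simp: La_def D_def saturation_def)
  have act_D: "act ` gvecs \<subseteq> D" using wM M_D by (auto simp: act_def zcomb_def)
  have dom_La: "x + l \<in> dom \<longleftrightarrow> x \<in> dom" if "l \<in> La" for x l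
    using dom_periodic that by (auto simp: periodic_def)
  \<comment> \<open>\<open>dom\<close> is invariant under La and under the directions in I. The
    remaining directions of M lie in La, so it is invariant under all of D.\<close>
  have dom_D: "x + d \<in> dom" if x: "x \<in> dom" and d: "d \<in> D" for x d
  proof -
    obtain l v where l: "l \<in> L" "d = l + zcomb w v" using d w by (auto simp: D_def zbasis_def)
    define v' where "v' = (\<chi> i. if i \<in> I then v $ i else 0)"
    have "zcomb w v - act v' = (\<Sum>i\<in>UNIV. of_int (v $ i - v' $ i) *\<^sub>R w i)"
      by (simp add: zcomb_def act_def sum_subtractf scaleR_left_diff_distrib)
    also have "\<dots> \<in> La"
    proof (rule subgrp_sum[OF Las])
      fix i
      show "of_int (v $ i - v' $ i) *\<^sub>R w i \<in> La"
      proof (cases "i \<in> I")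
        case False
        then show ?thesis by (intro subgrp_scale[OF Las] off)
      qed (use Las in \<open>simp add: v'_def subgrp_def\<close>)
    qed
    finally have "l + (zcomb w v - act v') \<in> La" using subgrp_add[OF Las] L_La l(1) by blast
    moreover have "x + act v' \<in> dom" by (rule dom_act[OF x]) (simp add: gvecs_def v'_def)
    ultimately have "x + act v' + (l + (zcomb w v - act v')) \<in> dom" using dom_La by blast
    then show ?thesis by (simp add: l(2) algebra_simps)
  qed
  have fibre_count_dom: "fibre_count (X \<inter> dom) x = fibre_count X x" if "x \<in> dom" for X x
  proof -
    have "z \<in> dom" if "z - x \<in> La" for z
      using dom_La[OF that, of x] \<open>x \<in> dom\<close> by simp
    then have "{z \<in> X \<inter> dom. z - x \<in> La} = {z \<in> X. z - x \<in> La}" by blast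
    then show ?thesis by (simp add: fibre_count_def)
  qed
  have "transportable D (\<lambda>x. of_bool (x \<in> FL \<inter> dom)) (\<lambda>x. of_bool (x \<in> FM \<inter> dom))"
  proof (rule transport_of_flow[OF D La_D act_D dom_borel dom_periodic dom_act F_borel F_per F_anti F_bound _ _ _ _ _ _ q(1)])
    show "FL \<inter> dom \<in> sets borel" "FM \<inter> dom \<in> sets borel" using FL(1) FM(1) dom_borel by auto
    show "bounded (FL \<inter> dom)" "bounded (FM \<inter> dom)" using FL(2) FM(2) by (auto intro: bounded_Int)
    fix x assume x: "x \<in> dom"
    show "fibre_count (FL \<inter> dom) x = q" by (simp add: fibre_count_dom[OF x] q(2))
    have "of_int (\<Sum>a\<in>nbrs I. F x a) = real q - real (fibre_count FM x)" by (simp only: F_dom[OF x, THEN conjunct1] \<phi>)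
    then have "real_of_int (int (fibre_count FM x)) = of_int (int q - (\<Sum>a\<in>nbrs I. F x a))" by simp
    then show "int (fibre_count (FM \<inter> dom) x) = int q - (\<Sum>a\<in>nbrs I. F x a)"
      unfolding fibre_count_dom[OF x] of_int_eq_iff .
  qed auto
  then obtain S and t :: "real ^ 'n \<Rightarrow> real ^ 'n \<Rightarrow> nat" where S: "finite S" "S \<subseteq> D"
    and t: "\<And>s n. s \<in> S \<Longrightarrow> {x. t s x = n} \<in> sets borel" "\<And>x. (\<Sum>s\<in>S. t s x) = of_bool (x \<in> FL \<inter> dom)"
      "\<And>x. (\<Sum>s\<in>S. t s (x - s)) = of_bool (x \<in> FM \<inter> dom)"
  proof (rule transportableE, goal_cases)
    case (1 S t)
    show ?case by (rule 1(1)[OF 1(2-)])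
  qed
  have "\<forall>s\<in>S. \<exists>l. l \<in> L \<and> s - l \<in> M"
  proof
    fix s assume "s \<in> S"
    then obtain l m where "s = l + m" "l \<in> L" "m \<in> M" using S(2) by (auto simp: D_def)
    then show "\<exists>l. l \<in> L \<and> s - l \<in> M" by (intro exI[of _ l]) simp
  qed
  from bchoice[OF this] obtain g where g: "\<And>s. s \<in> S \<Longrightarrow> g s \<in> L" "\<And>s. s \<in> S \<Longrightarrow> s - g s \<in> M" by blast
  \<comment> \<open>The piece of FL with displacement s ends up in FM. Stopping it after its part g
    s in L gives the piece of E; the rest s - g s lies in M.\<close>
  define E where "E = {y. \<exists>s\<in>S. t s (y - g s) = 1}"
  have E_borel: "E \<in> sets borel"
  proof -
    have "E = (\<Union>s\<in>S. {y. t s (y + (- g s)) = 1})" by (auto simp: E_def)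
    also have "\<dots> \<in> sets borel"
      by (intro sets.finite_UN S(1) borel_shift_eq t(1))
    finally show ?thesis .
  qed
  have E_bounded: "bounded E"
  proof -
    have "E \<subseteq> (\<Union>s\<in>S. (\<lambda>x. g s + x) ` FL)"
    proof
      fix y assume "y \<in> E"
      then obtain s where s: "s \<in> S" "t s (y - g s) = 1" by (auto simp: E_def)
      have "t s (y - g s) \<le> (\<Sum>s'\<in>S. t s' (y - g s))" using S(1) s(1) by (intro member_le_sum) auto
      then have "y - g s \<in> FL" using t(2)[of "y - g s"] s(2) by (auto split: if_splits simp: of_bool_def)
      then show "y \<in> (\<Union>s\<in>S. (\<lambda>x. g s + x) ` FL)" using s(1) by (intro UN_I[of s] image_eqI[of _ _ "y - g s"]) auto
    qed
    moreover have "bounded (\<Union>s\<in>S. (\<lambda>x. g s + x) ` FL)"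
      using S(1) FL(2) by (intro bounded_UN ballI bounded_translation)
    ultimately show ?thesis by (rule bounded_subset[rotated])
  qed
  have dom_minus: "y - d \<in> dom" if "y \<in> dom" "d \<in> D" for y d
    using dom_D[OF that(1) subgrp_uminus[OF D that(2)]] by simp
  have EL: "\<exists>!l. l \<in> L \<and> y - l \<in> E" if "y \<in> dom" for y
    unfolding E_def mem_Collect_eq
  proof (rule regroup_domain[OF _ _ S(1) _ t(2) FL(3)])
    show "g ` S \<subseteq> L" using g(1) by blast
    show "y - l \<in> dom" if "l \<in> L" for l using dom_minus \<open>y \<in> dom\<close> that L_D by blast
  qed (use Ls in \<open>auto simp: subgrp_def\<close>)
  \<comment> \<open>Seen from FM, the same piece is shifted by g s - s, an element of M.\<close>
  have EM: "\<exists>!m. m \<in> M \<and> y - m \<in> E" if "y \<in> dom" for y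
  proof -
    have "y - m - (g s - s) - s = y - m - g s" for m s by simp
    then have e: "y - m \<in> E \<longleftrightarrow> (\<exists>s\<in>S. t s (y - m - (g s - s) - s) = 1)" for m by (simp only: E_def mem_Collect_eq)
    show ?thesis unfolding e
    proof (rule regroup_domain[OF _ _ S(1) _ t(3) FM(3)])
      show "(\<lambda>s. g s - s) ` S \<subseteq> M"
        using g(2) subgrp_uminus[OF Ms, of "s - g s" for s] by fastforce
      show "y - l \<in> dom" if "l \<in> M" for l using dom_minus \<open>y \<in> dom\<close> that M_D by blast
    qed (use Ms in \<open>auto simp: subgrp_def\<close>)
  qed
  have "AE x in lborel. \<exists>!l. l \<in> L \<and> x - l \<in> E"
    using dom_AE by eventually_elim (rule EL)
  moreover have "AE x in lborel. \<exists>!m. m \<in> M \<and> x - m \<in> E"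
    using dom_AE by eventually_elim (rule EM)
  ultimately show ?thesis using E_borel E_bounded by blast
qed

section \<open>Approximation in the mean square\<close>

text \<open>The complex linear span, generated by adding one scaled member at a time. This gives
  induction over the span; \<open>cspan_image\<close> returns to finite sums with distinct
  indices.\<close>

inductive_set cspan :: "('a \<Rightarrow> complex) set \<Rightarrow> ('a \<Rightarrow> complex) set" for B where
  cspan_zero: "(\<lambda>_. 0) \<in> cspan B"
| cspan_step: "v \<in> cspan B \<Longrightarrow> b \<in> B \<Longrightarrow> (\<lambda>x. v x + c * b x) \<in> cspan B"

lemma cspan_base: "b \<in> B \<Longrightarrow> (\<lambda>x. c * b x) \<in> cspan B"
  using cspan_step[OF cspan_zero, of b B c] by simp

lemma cspan_add:
  assumes "v \<in> cspan B" "w \<in> cspan B"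
  shows "(\<lambda>x. v x + w x) \<in> cspan B"
  using assms(2)
proof (induction rule: cspan.induct)
  case (cspan_step w b c)
  then show ?case using cspan.cspan_step[of "\<lambda>x. v x + w x" B b c] by (simp add: add.assoc)
qed (simp add: assms(1))

lemma cspan_scale:
  assumes "v \<in> cspan B"
  shows "(\<lambda>x. k * v x) \<in> cspan B"
  using assms
proof (induction rule: cspan.induct)
  case (cspan_step v b c)
  then show ?case using cspan.cspan_step[of "\<lambda>x. k * v x" B b "k * c"] by (simp add: algebra_simps)
qed (simp add: cspan_zero)

lemma cspan_mult:
  assumes v: "v \<in> cspan B" and w: "w \<in> cspan B'" and BB: "\<And>b b'. b \<in> B \<Longrightarrow> b' \<in> B' \<Longrightarrow> (\<lambda>x. b x * b' x) \<in> cspan B''"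
  shows "(\<lambda>x. v x * w x) \<in> cspan B''"
  using v
proof (induction rule: cspan.induct)
  case (cspan_step v b c)
  have "(\<lambda>x. b x * w x) \<in> cspan B''"
    using w
  proof (induction rule: cspan.induct)
    case (cspan_step w b' c')
    then show ?case using cspan_add[OF cspan_step.IH cspan_scale[OF BB[OF \<open>b \<in> B\<close> cspan_step(2)], of c']] by (simp add: algebra_simps)
  qed (simp add: cspan_zero)
  then show ?case using cspan_add[OF cspan_step.IH cspan_scale, of "\<lambda>x. b x * w x" c] by (simp add: algebra_simps)
qed (simp add: cspan_zero)

lemma cspan_image:
  assumes "v \<in> cspan (f ` I)"
  shows "\<exists>S c. finite S \<and> S \<subseteq> I \<and> v = (\<lambda>x. \<Sum>i\<in>S. c i * f i x)"
  using assms
proof (induction rule: cspan.induct)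
  case cspan_zero
  show ?case by (rule exI[of _ "{}"]) simp
next
  case (cspan_step v b c)
  then obtain S a i where S: "finite S" "S \<subseteq> I" "v = (\<lambda>x. \<Sum>i\<in>S. a i * f i x)" and i: "i \<in> I" "b = f i" by blast
  define a' where "a' j = (if j \<in> S then a j else 0) + (if j = i then c else 0)" for j
  have "(\<Sum>j\<in>insert i S. a' j * f j x) = v x + c * b x" for x
  proof -
    have "(\<Sum>j\<in>insert i S. a' j * f j x) = (\<Sum>j\<in>insert i S. (if j \<in> S then a j else 0) * f j x) + (\<Sum>j\<in>insert i S. (if j = i then c else 0) * f j x)"
      by (simp add: a'_def distrib_right sum.distrib del: sum.insert)
    also have "(\<Sum>j\<in>insert i S. (if j \<in> S then a j else 0) * f j x) = (\<Sum>j\<in>S. a j * f j x)"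
      using S(1) by (intro sum.mono_neutral_cong_right) auto
    also have "(\<Sum>j\<in>insert i S. (if j = i then c else 0) * f j x) = (\<Sum>j\<in>{i}. c * f j x)"
      using S(1) by (intro sum.mono_neutral_cong_right) auto
    finally show ?thesis by (simp add: S(3) i(2))
  qed
  then show ?case using S(1,2) i(1)
    by (intro exI[of _ "insert i S"] exI[of _ a']) simp
qed

lemma norm_sum_squared_le: "(norm (a + b))\<^sup>2 \<le> 2 * (norm a)\<^sup>2 + 2 * (norm b)\<^sup>2"
  for a b :: "'a::real_normed_vector"
proof -
  have "(norm (a + b))\<^sup>2 \<le> (norm a + norm b)\<^sup>2" by (rule power_mono[OF norm_triangle_ineq]) simp
  also have "\<dots> \<le> 2 * (norm a)\<^sup>2 + 2 * (norm b)\<^sup>2"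
    using zero_le_power2[of "norm a - norm b"] by (simp add: power2_eq_square algebra_simps)
  finally show ?thesis .
qed

lemma square_integrable_bound:
  assumes f: "f \<in> borel_measurable M" and h: "integrable M h" and le: "AE x in M. (cmod (f x))\<^sup>2 \<le> h x"
  shows "square_integrable M f"
  unfolding square_integrable_def
proof (intro conjI f Bochner_Integration.integrable_bound[OF h])
  show "(\<lambda>x. (cmod (f x))\<^sup>2) \<in> borel_measurable M" using f by simp
  show "AE x in M. norm ((cmod (f x))\<^sup>2) \<le> norm (h x)" using le by eventually_elim simp
qed

lemma square_integrable_add:
  assumes "square_integrable M f" "square_integrable M g"
  shows "square_integrable M (\<lambda>x. f x + g x)"
proof (rule square_integrable_bound)
  show "integrable M (\<lambda>x. 2 * (cmod (f x))\<^sup>2 + 2 * (cmod (g x))\<^sup>2)"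
    using assms by (auto simp: square_integrable_def)
qed (use assms in \<open>auto simp: square_integrable_def norm_sum_squared_le\<close>)

lemma square_integrable_scale: "square_integrable M f \<Longrightarrow> square_integrable M (\<lambda>x. c * f x)"
  by (auto simp: square_integrable_def norm_mult power_mult_distrib)

lemma square_integrable_diff:
  assumes "square_integrable M f" "square_integrable M g"
  shows "square_integrable M (\<lambda>x. f x - g x)"
  using square_integrable_add[OF assms(1) square_integrable_scale[OF assms(2), of "-1"]] by simp

lemma integral_sum_squared_le:
  assumes "square_integrable M f" "square_integrable M g"
  shows "(LINT x|M. (cmod (f x + g x))\<^sup>2) \<le> 2 * (LINT x|M. (cmod (f x))\<^sup>2) + 2 * (LINT x|M. (cmod (g x))\<^sup>2)"
proof -
  have i: "integrable M (\<lambda>x. (cmod (f x))\<^sup>2)" "integrable M (\<lambda>x. (cmod (g x))\<^sup>2)"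
    using assms by (auto simp: square_integrable_def)
  have "(LINT x|M. (cmod (f x + g x))\<^sup>2) \<le> (LINT x|M. 2 * (cmod (f x))\<^sup>2 + 2 * (cmod (g x))\<^sup>2)"
    using square_integrable_add[OF assms] i
    by (intro integral_mono) (auto simp: square_integrable_def norm_sum_squared_le)
  then show ?thesis using i by simp
qed

definition approximable :: "'a measure \<Rightarrow> ('a \<Rightarrow> complex) set \<Rightarrow> ('a \<Rightarrow> complex) \<Rightarrow> bool" where
  "approximable M V f \<longleftrightarrow> square_integrable M f \<and> (\<forall>e>0. \<exists>v\<in>V. (LINT x|M. (cmod (f x - v x))\<^sup>2) < e)"

lemma square_integrable_cspan:
  assumes "v \<in> cspan B" "\<And>b. b \<in> B \<Longrightarrow> square_integrable M b"
  shows "square_integrable M v"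
  using assms(1)
proof (induction rule: cspan.induct)
  case cspan_zero
  show ?case by (simp add: square_integrable_def)
next
  case (cspan_step v b c)
  then show ?case using assms(2) by (intro square_integrable_add square_integrable_scale) auto
qed

context
  fixes M :: "'a measure" and B
  assumes B: "\<And>b. b \<in> B \<Longrightarrow> square_integrable M b"
begin

lemma approximable_cspan: "v \<in> cspan B \<Longrightarrow> approximable M (cspan B) v"
  using square_integrable_cspan[OF _ B]
  by (auto simp: approximable_def intro!: bexI[of _ v])

lemma approximable_add:
  assumes f: "approximable M (cspan B) f" and g: "approximable M (cspan B) g"
  shows "approximable M (cspan B) (\<lambda>x. f x + g x)"
  unfolding approximable_def
proof (intro conjI allI impI)
  show "square_integrable M (\<lambda>x. f x + g x)" using f g by (auto simp: approximable_def square_integrable_add)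
  fix e :: real assume "e > 0"
  then have "e / 4 > 0" by simp
  then obtain v w where v: "v \<in> cspan B" "(LINT x|M. (cmod (f x - v x))\<^sup>2) < e / 4"
    and w: "w \<in> cspan B" "(LINT x|M. (cmod (g x - w x))\<^sup>2) < e / 4"
    using f g unfolding approximable_def by meson
  have "(LINT x|M. (cmod ((f x - v x) + (g x - w x)))\<^sup>2) \<le> 2 * (LINT x|M. (cmod (f x - v x))\<^sup>2) + 2 * (LINT x|M. (cmod (g x - w x))\<^sup>2)"
    using f g square_integrable_cspan[OF v(1) B] square_integrable_cspan[OF w(1) B]
    by (intro integral_sum_squared_le square_integrable_diff) (auto simp: approximable_def)
  also have "\<dots> < e" using v(2) w(2) by linarith
  finally have "(LINT x|M. (cmod ((f x + g x) - (v x + w x)))\<^sup>2) < e" by (simp add: algebra_simps)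
  then show "\<exists>u\<in>cspan B. (LINT x|M. (cmod ((f x + g x) - u x))\<^sup>2) < e"
    using cspan_add[OF v(1) w(1)] by (intro bexI[of _ "\<lambda>x. v x + w x"])
qed

lemma approximable_scale:
  assumes f: "approximable M (cspan B) f"
  shows "approximable M (cspan B) (\<lambda>x. c * f x)"
proof (cases "c = 0")
  case True
  then show ?thesis using approximable_cspan[OF cspan_zero] by simp
next
  case False
  show ?thesis
    unfolding approximable_def
  proof (intro conjI allI impI)
    show "square_integrable M (\<lambda>x. c * f x)" using f by (auto simp: approximable_def square_integrable_scale)
    fix e :: real assume "e > 0"
    then have "e / (cmod c)\<^sup>2 > 0" using False by simp
    then obtain v where v: "v \<in> cspan B" "(LINT x|M. (cmod (f x - v x))\<^sup>2) < e / (cmod c)\<^sup>2"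
      using f unfolding approximable_def by meson
    have "(LINT x|M. (cmod (c * f x - c * v x))\<^sup>2) = (cmod c)\<^sup>2 * (LINT x|M. (cmod (f x - v x))\<^sup>2)"
      by (simp add: norm_mult power_mult_distrib flip: right_diff_distrib)
    also have "\<dots> < e" using v(2) False by (simp add: field_simps)
    finally show "\<exists>u\<in>cspan B. (LINT x|M. (cmod (c * f x - u x))\<^sup>2) < e"
      using cspan_scale[OF v(1), of c] by (intro bexI[of _ "\<lambda>x. c * v x"])
  qed
qed

lemma approximable_sum:
  assumes "\<And>i. i \<in> S \<Longrightarrow> approximable M (cspan B) (f i)"
  shows "approximable M (cspan B) (\<lambda>x. \<Sum>i\<in>S. f i x)"
proof (cases "finite S")
  case True
  then show ?thesis using assms
  proof (induction S rule: finite_induct)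
    case empty
    show ?case using approximable_cspan[OF cspan_zero] by simp
  next
    case (insert i S)
    then show ?case using approximable_add[of "f i" "\<lambda>x. \<Sum>i\<in>S. f i x"] by simp
  qed
qed (use approximable_cspan[OF cspan_zero] in simp)

text \<open>Mean square convergence by dominated convergence, the bound 4 * h coming from the
  squared norms of f and of s k, both at most h; a good s k is then approximated in turn.\<close>

lemma approximable_limit:
  assumes f: "f \<in> borel_measurable M" and s: "\<And>k::nat. approximable M (cspan B) (s k)"
    and lim: "AE x in M. (\<lambda>k. s k x) \<longlonglongrightarrow> f x" and h: "integrable M h" "\<And>k. AE x in M. (cmod (s k x))\<^sup>2 \<le> h x"
  shows "approximable M (cspan B) f"
proof -
  have s': "square_integrable M (s k)" for k using s by (auto simp: approximable_def)
  have all: "AE x in M. \<forall>k. (cmod (s k x))\<^sup>2 \<le> h x" using h(2) by (simp add: AE_all_countable)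
  have fh: "AE x in M. (cmod (f x))\<^sup>2 \<le> h x"
    using lim all
  proof eventually_elim
    case (elim x)
    have "(\<lambda>k. (cmod (s k x))\<^sup>2) \<longlonglongrightarrow> (cmod (f x))\<^sup>2" by (intro tendsto_intros elim)
    then show ?case by (rule LIMSEQ_le_const2) (use elim in auto)
  qed
  have f': "square_integrable M f" by (rule square_integrable_bound[OF f h(1) fh])
  have sm: "s k \<in> borel_measurable M" for k using s' by (simp add: square_integrable_def)
  have "(\<lambda>k. LINT x|M. (cmod (f x - s k x))\<^sup>2) \<longlonglongrightarrow> (LINT x|M. 0)"
  proof (rule integral_dominated_convergence)
    show "(\<lambda>x. 0) \<in> borel_measurable M" by simp
    show "(\<lambda>x. (cmod (f x - s k x))\<^sup>2) \<in> borel_measurable M" for k using f sm by measurable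
    show "integrable M (\<lambda>x. 4 * h x)" using h(1) by simp
    show "AE x in M. (\<lambda>k. (cmod (f x - s k x))\<^sup>2) \<longlonglongrightarrow> 0"
      using lim
    proof eventually_elim
      case (elim x)
      have "(\<lambda>k. (cmod (f x - s k x))\<^sup>2) \<longlonglongrightarrow> (cmod (f x - f x))\<^sup>2" by (intro tendsto_intros elim)
      then show ?case by simp
    qed
    show "AE x in M. norm ((cmod (f x - s k x))\<^sup>2) \<le> 4 * h x" for k
      using fh all
    proof eventually_elim
      case (elim x)
      have "(cmod (s k x))\<^sup>2 \<le> h x" using elim by blast
      moreover have "(cmod (f x - s k x))\<^sup>2 \<le> 2 * (cmod (f x))\<^sup>2 + 2 * (cmod (s k x))\<^sup>2"
        using norm_sum_squared_le[of "f x" "- s k x"] by simp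
      ultimately have "(cmod (f x - s k x))\<^sup>2 \<le> 4 * h x" using elim(1) by linarith
      then show ?case by simp
    qed
  qed
  then have l0: "(\<lambda>k. LINT x|M. (cmod (f x - s k x))\<^sup>2) \<longlonglongrightarrow> 0" by simp
  show ?thesis unfolding approximable_def
  proof (intro conjI f' allI impI)
    fix e :: real assume "e > 0"
    then have e: "e / 4 > 0" by simp
    obtain k where k: "(LINT x|M. (cmod (f x - s k x))\<^sup>2) < e / 4"
      using order_tendstoD(2)[OF l0 e] by (auto simp: eventually_sequentially)
    obtain v where v: "v \<in> cspan B" "(LINT x|M. (cmod (s k x - v x))\<^sup>2) < e / 4"
      using s[of k] e unfolding approximable_def by meson
    have "(LINT x|M. (cmod ((f x - s k x) + (s k x - v x)))\<^sup>2) \<le> 2 * (LINT x|M. (cmod (f x - s k x))\<^sup>2) + 2 * (LINT x|M. (cmod (s k x - v x))\<^sup>2)"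
      by (intro integral_sum_squared_le square_integrable_diff f' s' square_integrable_cspan[OF v(1) B])
    also have "\<dots> < e" using k v(2) by linarith
    finally show "\<exists>u\<in>cspan B. (LINT x|M. (cmod (f x - u x))\<^sup>2) < e" using v(1) by auto
  qed
qed

lemma approximable_AE_eq:
  assumes "approximable M (cspan B) f" "g \<in> borel_measurable M" "AE x in M. f x = g x"
  shows "approximable M (cspan B) g"
proof (rule approximable_limit[of g "\<lambda>_. f" "\<lambda>x. (cmod (f x))\<^sup>2"])
  show "AE x in M. (\<lambda>k. f x) \<longlonglongrightarrow> g x" using assms(3) by eventually_elim simp
qed (use assms in \<open>auto simp: approximable_def square_integrable_def\<close>)

text \<open>Non-negative functions are reached by sums, multiples and increasing limits; the square
  of the limit dominates those of the approximants, so square integrability descends to them. The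
  rest is positive and negative, real and imaginary parts.\<close>

lemma approximable_from_indicators:
  assumes ind: "\<And>A. A \<in> sets M \<Longrightarrow> emeasure M A < \<infinity> \<Longrightarrow> approximable M (cspan B) (\<lambda>x. of_real (indicator A x))"
    and g: "square_integrable M g"
  shows "approximable M (cspan B) g"
proof -
  have nonneg: "approximable M (cspan B) (\<lambda>x. of_real (u x))"
    if u: "u \<in> borel_measurable M" "\<And>x. 0 \<le> u x" "integrable M (\<lambda>x. (u x)\<^sup>2)" for u :: "'a \<Rightarrow> real"
    using u
  proof (induction u rule: borel_measurable_induct_real)
    case (set A)
    have "(indicator A x :: real)\<^sup>2 = indicator A x" for x by (simp add: indicator_def)
    then have "emeasure M A < \<infinity>" using set by (simp add: integrable_indicator_iff Int_absorb2 sets.sets_into_space)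
    then show ?case by (rule ind[OF set(1)])
  next
    case (mult u c)
    show ?case
    proof (cases "c = 0")
      case True
      then show ?thesis using approximable_cspan[OF cspan_zero] by simp
    next
      case False
      have "integrable M (\<lambda>x. (u x)\<^sup>2)" using mult.prems False by (simp add: power_mult_distrib)
      then show ?thesis using approximable_scale[OF mult.IH, of "of_real c"] by simp
    qed
  next
    case (add u v)
    have "integrable M (\<lambda>x. (u x)\<^sup>2)" "integrable M (\<lambda>x. (v x)\<^sup>2)"
      by (rule Bochner_Integration.integrable_bound[OF add.prems]; use add in \<open>auto intro!: power_mono\<close>)+
    then show ?case using approximable_add[OF add.IH(2) add.IH(1)] by simp
  next
    case (seq U)
    have Ule: "U i x \<le> u x" if "x \<in> space M" for i x
      using seq.hyps(3) by (intro incseq_le[OF _ seq.hyps(4)[OF that]]) (auto simp: incseq_def le_fun_def)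
    have Usq: "AE x in M. (U i x)\<^sup>2 \<le> (u x)\<^sup>2" for i
      using Ule seq.hyps(2) by (intro AE_I2 power_mono) auto
    have "integrable M (\<lambda>x. (U i x)\<^sup>2)" for i
      by (rule Bochner_Integration.integrable_bound[OF seq.prems]) (use seq.hyps(1) Usq[of i] in auto)
    then have ap: "approximable M (cspan B) (\<lambda>x. of_real (U i x))" for i by (rule seq.IH)
    show ?case
    proof (rule approximable_limit[OF _ ap _ seq.prems])
      show "(\<lambda>x. complex_of_real (u x)) \<in> borel_measurable M" using u(1) by measurable
      show "AE x in M. (\<lambda>k. complex_of_real (U k x)) \<longlonglongrightarrow> complex_of_real (u x)"
        using seq.hyps(4) by (intro AE_I2 tendsto_of_real) auto
      show "AE x in M. (cmod (complex_of_real (U k x)))\<^sup>2 \<le> (u x)\<^sup>2" for k using Usq[of k] by simp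
    qed
  qed
  have real: "approximable M (cspan B) (\<lambda>x. of_real (r x))"
    if r: "r \<in> borel_measurable M" "integrable M (\<lambda>x. (r x)\<^sup>2)" for r :: "'a \<Rightarrow> real"
  proof -
    have "integrable M (\<lambda>x. (max 0 (r x))\<^sup>2)" "integrable M (\<lambda>x. (max 0 (- r x))\<^sup>2)"
      by (rule Bochner_Integration.integrable_bound[OF r(2)]; use r(1) in \<open>auto simp: max_def\<close>)+
    then have "approximable M (cspan B) (\<lambda>x. of_real (max 0 (r x)) + (-1) * of_real (max 0 (- r x)))"
      using r(1) by (intro approximable_add approximable_scale nonneg) auto
    moreover have "complex_of_real (max 0 (r x)) + (-1) * of_real (max 0 (- r x)) = of_real (r x)" for x by (auto simp: max_def)
    ultimately show ?thesis by simp
  qed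
  have gm: "g \<in> borel_measurable M" and gi: "integrable M (\<lambda>x. (cmod (g x))\<^sup>2)" using g by (auto simp: square_integrable_def)
  have "integrable M (\<lambda>x. (Re (g x))\<^sup>2)" "integrable M (\<lambda>x. (Im (g x))\<^sup>2)"
    by (rule Bochner_Integration.integrable_bound[OF gi]; use gm in \<open>auto simp: cmod_power2\<close>)+
  then have "approximable M (cspan B) (\<lambda>x. of_real (Re (g x)) + \<i> * of_real (Im (g x)))"
    using gm by (intro approximable_add approximable_scale real) auto
  then show ?thesis by (simp flip: complex_eq)
qed

end

section \<open>Completeness of plane waves on a tile\<close>

definition wave :: "real ^ 'n \<Rightarrow> real ^ 'n \<Rightarrow> complex" where
  "wave \<mu> x = exp (complex_of_real (2 * pi) * \<i> * complex_of_real (\<mu> \<bullet> x))"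

lemma wave_cis: "wave \<mu> x = cis (2 * pi * (\<mu> \<bullet> x))"
  by (simp add: wave_def cis_conv_exp algebra_simps)

lemma wave_add: "wave (\<mu> + \<nu>) x = wave \<mu> x * wave \<nu> x"
  by (simp add: wave_cis cis_mult inner_add_left distrib_left)

lemma wave_add_right: "wave \<mu> (x + y) = wave \<mu> x * wave \<mu> y"
  by (simp add: wave_cis cis_mult inner_add_right distrib_left)

lemma wave_0 [simp]: "wave 0 x = 1" by (simp add: wave_def)

lemma cnj_wave: "cnj (wave \<mu> x) = wave (- \<mu>) x"
  by (simp add: wave_cis cis_cnj)

lemma norm_wave [simp]: "cmod (wave \<mu> x) = 1"
  by (simp add: wave_cis)

lemma wave_borel [measurable]: "wave \<mu> \<in> borel_measurable borel"
  unfolding wave_def by (intro borel_measurable_continuous_onI continuous_intros)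

lemma wave_int: "\<mu> \<bullet> m \<in> \<int> \<Longrightarrow> wave \<mu> m = 1"
  by (simp add: wave_cis)

lemma dual_add: "\<mu> \<in> dual_lattice M \<Longrightarrow> \<nu> \<in> dual_lattice M \<Longrightarrow> \<mu> + \<nu> \<in> dual_lattice M"
  by (auto simp: dual_lattice_def inner_add_left)

lemma dual_uminus: "\<mu> \<in> dual_lattice M \<Longrightarrow> - \<mu> \<in> dual_lattice M"
  by (auto simp: dual_lattice_def)

lemma dual_0: "0 \<in> dual_lattice M"
  by (auto simp: dual_lattice_def)

text \<open>A branch of the argument written with arccos, so that it is Borel by inspection. The
  clamping to [-1, 1] keeps arccos in its domain off the unit circle.\<close>

definition angle :: "complex \<Rightarrow> real" where
  "angle z = (let a = arccos (max (- 1) (min 1 (Re z))) in if 0 \<le> Im z then a else - a)"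

lemma angle_borel [measurable]: "angle \<in> borel_measurable borel"
proof -
  have "(\<lambda>z. arccos (max (- 1) (min 1 (Re z)))) \<in> borel_measurable borel"
    by (intro borel_measurable_continuous_onI continuous_intros) auto
  moreover have "Im \<in> borel_measurable borel" by (intro borel_measurable_continuous_onI continuous_intros)
  ultimately show ?thesis unfolding angle_def Let_def by measurable
qed

lemma cis_angle:
  assumes "cmod z = 1"
  shows "cis (angle z) = z"
proof -
  have r: "\<bar>Re z\<bar> \<le> 1" using abs_Re_le_cmod[of z] assms by simp
  then have m: "max (- 1) (min 1 (Re z)) = Re z" by (auto simp: max_def min_def)
  have "(Re z)\<^sup>2 + (Im z)\<^sup>2 = 1" using cmod_power2[of z] assms by simp
  then have s: "sqrt (1 - (Re z)\<^sup>2) = \<bar>Im z\<bar>" by (metis add_diff_cancel_left' real_sqrt_abs)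
  show ?thesis
    unfolding angle_def Let_def m using r s by (auto simp: complex_eq_iff cos_arccos_abs sin_arccos_abs)
qed

definition torus :: "(complex ^ 'n) set" where
  "torus = {z. \<forall>i. cmod (z $ i) = 1}"

lemma compact_torus: "compact (torus :: (complex ^ 'n) set)"
proof -
  have "closed (torus :: (complex ^ 'n) set)"
    unfolding torus_def by (intro closed_Collect_all closed_Collect_eq continuous_intros)
  moreover have "bounded (torus :: (complex ^ 'n) set)"
    unfolding bounded_iff
  proof (intro exI ballI)
    fix z :: "complex ^ 'n" assume "z \<in> torus"
    have "norm z \<le> (\<Sum>i\<in>UNIV. cmod (z $ i))" unfolding norm_vec_def by (rule L2_set_le_sum) simp
    also have "\<dots> = real CARD('n)" using \<open>z \<in> torus\<close> by (simp add: torus_def)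
    finally show "norm z \<le> real CARD('n)" .
  qed
  ultimately show ?thesis by (simp add: compact_eq_bounded_closed)
qed

section \<open>Density of the waves on a single tile\<close>

context
  fixes W :: "real ^ 'n ^ 'n" and E M :: "(real ^ 'n) set"
  assumes W: "det W \<noteq> 0" and M: "M = lattice_of W"
    and E [measurable]: "E \<in> sets borel" and E_bounded: "bounded E" and E_tile: "AE x in lborel. \<exists>!m. m \<in> M \<and> x - m \<in> E"
begin

text \<open>The coordinates of x in the basis W, wrapped round circles: this identifies R^n / M with
  the torus. The rows of the inverse matrix belong to the dual lattice, so the components are
  waves.\<close>

definition phase :: "real ^ 'n \<Rightarrow> complex ^ 'n" where
  "phase x = (\<chi> i. wave (matrix_inv W $ i) x)"

definition trig :: "(real ^ 'n \<Rightarrow> complex) set" where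
  "trig = cspan (wave ` dual_lattice M)"

definition waves :: "(real ^ 'n \<Rightarrow> complex) set" where
  "waves = (\<lambda>\<mu> x. wave \<mu> x * indicator E x) ` dual_lattice M"

lemma phase_torus: "phase x \<in> torus"
  by (simp add: phase_def torus_def)

lemma phase_borel [measurable]: "phase \<in> borel_measurable borel"
  unfolding phase_def wave_def
  by (intro borel_measurable_continuous_onI continuous_intros)

lemma row_dual: "matrix_inv W $ i \<in> dual_lattice M"
proof -
  have "(matrix_inv W $ i) \<bullet> (W *v z) = z $ i" for z
    using matrix_inv_vec(1)[OF W, of z] by (metis matrix_vector_mul_component)
  then show ?thesis by (auto simp: dual_lattice_def M lattice_of_def int_vecs_def)
qed

lemma trig_mult: "p \<in> trig \<Longrightarrow> q \<in> trig \<Longrightarrow> (\<lambda>x. p x * q x) \<in> trig"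
  unfolding trig_def
proof (rule cspan_mult)
  fix b b' assume "b \<in> wave ` dual_lattice M" "b' \<in> wave ` dual_lattice M"
  then obtain \<mu> \<nu> where "\<mu> \<in> dual_lattice M" "\<nu> \<in> dual_lattice M" "b = wave \<mu>" "b' = wave \<nu>" by blast
  then have "(\<lambda>x. b x * b' x) = wave (\<mu> + \<nu>)" "wave (\<mu> + \<nu>) \<in> wave ` dual_lattice M"
    by (auto simp: wave_add dual_add)
  then show "(\<lambda>x. b x * b' x) \<in> cspan (wave ` dual_lattice M)"
    using cspan_base[of "wave (\<mu> + \<nu>)" "wave ` dual_lattice M" 1] by simp
qed

lemma trig_wave: "\<mu> \<in> dual_lattice M \<Longrightarrow> (\<lambda>x. c * wave \<mu> x) \<in> trig"
  unfolding trig_def by (rule cspan_base) simp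

lemma trig_waves:
  assumes "p \<in> trig"
  shows "(\<lambda>x. p x * indicator E x) \<in> cspan waves"
proof -
  have "(indicator E :: _ \<Rightarrow> complex) \<in> cspan {indicator E}" using cspan_base[of "indicator E" "{indicator E}" 1] by simp
  from cspan_mult[OF assms[unfolded trig_def] this, of waves] show ?thesis
    using cspan_base[of _ waves 1] by (force simp: waves_def)
qed

lemma emeasure_E: "emeasure lborel E < \<infinity>"
  by (rule emeasure_bounded_finite[OF E_bounded])

lemma integrable_E: "integrable lebesgue (indicator E :: _ \<Rightarrow> real)"
  using emeasure_E by (simp add: integrable_indicator_iff)

lemma borel_lebesgue: "f \<in> borel_measurable borel \<Longrightarrow> f \<in> borel_measurable lebesgue"
  by (simp add: measurable_completion)

lemma square_integrable_waves: "b \<in> waves \<Longrightarrow> square_integrable lebesgue b"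
proof (rule square_integrable_bound[OF _ integrable_E])
  assume "b \<in> waves"
  then obtain \<mu> where b: "b = (\<lambda>x. wave \<mu> x * indicator E x)" by (auto simp: waves_def)
  show "b \<in> borel_measurable lebesgue" unfolding b by (rule borel_lebesgue) measurable
  show "AE x in lebesgue. (cmod (b x))\<^sup>2 \<le> indicator E x"
    unfolding b by (intro AE_I2) (simp add: norm_mult indicator_def)
qed

text \<open>Stone-Weierstrass on the torus. R consists of the continuous functions that become
  trigonometric polynomials along \<open>phase\<close>; the real and imaginary parts of the
  coordinates belong to it, being combinations of a wave and its conjugate, and they separate
  points.\<close>

lemma approximable_continuous:
  assumes F: "continuous_on torus F" and Fb: "F \<in> borel_measurable borel"
  shows "approximable lebesgue (cspan waves) (\<lambda>x. of_real (F (phase x)) * indicator E x)"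
proof -
  define R where "R = {f :: complex ^ 'n \<Rightarrow> real. continuous_on torus f \<and> (\<lambda>x. of_real (f (phase x))) \<in> trig}"
  interpret function_ring_on R torus
  proof
    show "compact (torus :: (complex ^ 'n) set)" by (rule compact_torus)
    show "continuous_on torus f" if "f \<in> R" for f using that by (simp add: R_def)
    show "(\<lambda>x. f x + g x) \<in> R" if "f \<in> R" "g \<in> R" for f g
      using that by (auto simp: R_def trig_def intro!: continuous_intros cspan_add)
    show "(\<lambda>x. f x * g x) \<in> R" if "f \<in> R" "g \<in> R" for f g
      using that by (auto simp: R_def intro!: continuous_intros trig_mult)
    show "(\<lambda>_. c) \<in> R" for c
      using trig_wave[OF dual_0, of "of_real c"] by (simp add: R_def)
    fix x y :: "complex ^ 'n" assume "x \<noteq> y"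
    then obtain i where i: "x $ i \<noteq> y $ i" by (auto simp: vec_eq_iff)
    have w: "phase x $ i = wave (matrix_inv W $ i) x" for x by (simp add: phase_def)
    have re: "complex_of_real (Re u) = (1/2) * u + (1/2) * cnj u" for u by (simp add: complex_eq_iff)
    have im: "complex_of_real (Im u) = (- \<i>/2) * u + (\<i>/2) * cnj u" for u by (simp add: complex_eq_iff)
    have lin: "(\<lambda>x. c * wave (matrix_inv W $ i) x + d * wave (- (matrix_inv W $ i)) x) \<in> trig" for c d
      using cspan_add trig_wave[OF row_dual] trig_wave[OF dual_uminus[OF row_dual]] unfolding trig_def by blast
    have "(\<lambda>x. complex_of_real (Re (phase x $ i))) \<in> trig" "(\<lambda>x. complex_of_real (Im (phase x $ i))) \<in> trig"
      unfolding re im w cnj_wave by (rule lin)+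
    then have RI: "(\<lambda>z. Re (z $ i)) \<in> R" "(\<lambda>z. Im (z $ i)) \<in> R"
      by (auto simp: R_def intro!: continuous_intros)
    show "\<exists>f\<in>R. f x \<noteq> f y"
    proof (cases "Re (x $ i) = Re (y $ i)")
      case True
      then have "Im (x $ i) \<noteq> Im (y $ i)" using i by (simp add: complex_eq_iff)
      then show ?thesis by (intro bexI[OF _ RI(2)])
    next
      case False
      then show ?thesis by (intro bexI[OF _ RI(1)])
    qed
  qed
  obtain C where C: "\<And>z. z \<in> torus \<Longrightarrow> \<bar>F z\<bar> \<le> C"
    using compact_imp_bounded[OF compact_continuous_image[OF F compact_torus]] by (auto simp: bounded_iff)
  have "\<exists>g\<in>R. \<forall>z\<in>torus. \<bar>F z - g z\<bar> < 1 / real (Suc k)" for k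
    by (rule Stone_Weierstrass_basic[OF F]) simp
  then obtain g where g: "\<And>k. g k \<in> R" "\<And>k z. z \<in> torus \<Longrightarrow> \<bar>F z - g k z\<bar> < 1 / real (Suc k)" by metis
  show ?thesis
  proof (rule approximable_limit[OF square_integrable_waves])
    have [measurable]: "F \<in> borel_measurable borel" by (rule Fb)
    show "(\<lambda>x. of_real (F (phase x)) * indicator E x :: complex) \<in> borel_measurable lebesgue"
      by (intro borel_lebesgue) measurable
    show "approximable lebesgue (cspan waves) (\<lambda>x. of_real (g k (phase x)) * indicator E x)" for k
    proof (intro approximable_cspan[OF square_integrable_waves] trig_waves)
      show "(\<lambda>x. of_real (g k (phase x))) \<in> trig" using g(1)[of k] unfolding R_def by blast
    qed
    have "(\<lambda>k. g k (phase x)) \<longlonglongrightarrow> F (phase x)" for x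
    proof (rule LIMSEQ_I)
      fix e :: real assume "e > 0"
      then obtain N where N: "inverse (real (Suc N)) < e" using reals_Archimedean by blast
      show "\<exists>no. \<forall>k\<ge>no. norm (g k (phase x) - F (phase x)) < e"
      proof (intro exI[of _ N] allI impI)
        fix k assume "k \<ge> N"
        have "1 / real (Suc k) \<le> 1 / real (Suc N)" using \<open>k \<ge> N\<close> by (simp add: field_simps)
        then show "norm (g k (phase x) - F (phase x)) < e"
          using g(2)[OF phase_torus, of x k] N by (simp add: abs_minus_commute inverse_eq_divide)
      qed
    qed
    then show "AE x in lebesgue. (\<lambda>k. of_real (g k (phase x)) * indicator E x :: complex) \<longlonglongrightarrow> of_real (F (phase x)) * indicator E x"
      by (intro AE_I2 tendsto_intros)
    show "integrable lebesgue (\<lambda>x. (C + 1)\<^sup>2 * indicator E x)" using integrable_E by simp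
    show "AE x in lebesgue. (cmod (of_real (g k (phase x)) * indicator E x))\<^sup>2 \<le> (C + 1)\<^sup>2 * indicator E x" for k
    proof (intro AE_I2)
      fix x
      have "1 / real (Suc k) \<le> 1" by simp
      then have "\<bar>g k (phase x)\<bar> \<le> C + 1"
        using g(2)[OF phase_torus, of x k] C[OF phase_torus, of x] by linarith
      then have "\<bar>g k (phase x)\<bar>\<^sup>2 \<le> (C + 1)\<^sup>2" by (intro power_mono) auto
      then show "(cmod (of_real (g k (phase x)) * indicator E x))\<^sup>2 \<le> (C + 1)\<^sup>2 * indicator E x"
        by (simp add: norm_mult indicator_def)
    qed
  qed
qed

lemma approximable_bounded_limit:
  assumes "\<And>k::nat. approximable lebesgue (cspan waves) (\<lambda>x. of_real (u k x) * indicator E x)"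
    and "v \<in> borel_measurable borel" and "\<And>x. (\<lambda>k. u k x) \<longlonglongrightarrow> v x" and "\<And>k x. \<bar>u k x\<bar> \<le> 1"
  shows "approximable lebesgue (cspan waves) (\<lambda>x. of_real (v x) * indicator E x)"
proof (rule approximable_limit[OF square_integrable_waves _ assms(1) _ integrable_E])
  have [measurable]: "v \<in> borel_measurable borel" by (rule assms(2))
  show "(\<lambda>x. of_real (v x) * indicator E x :: complex) \<in> borel_measurable lebesgue"
    by (intro borel_lebesgue) measurable
  show "AE x in lebesgue. (\<lambda>k. of_real (u k x) * indicator E x :: complex) \<longlonglongrightarrow> of_real (v x) * indicator E x"
    using assms(3) by (intro AE_I2 tendsto_intros)
  show "AE x in lebesgue. (cmod (of_real (u k x) * indicator E x))\<^sup>2 \<le> indicator E x" for k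
    using assms(4)[of k] by (intro AE_I2) (auto simp: norm_mult indicator_def abs_square_le_1)
qed

text \<open>The indicator is the pointwise limit of a bounded sequence of continuous functions,
  built from k times the distance to C.\<close>

lemma approximable_closed:
  assumes "closed C"
  shows "approximable lebesgue (cspan waves) (\<lambda>x. of_real (indicator C (phase x)) * indicator E x)"
proof (cases "C = {}")
  case True
  then show ?thesis using approximable_cspan[OF square_integrable_waves cspan_zero] by simp
next
  case False
  define F where "F k z = max 0 (1 - real k * infdist z C)" for k z
  have cont: "continuous_on S (F k)" for S k unfolding F_def by (intro continuous_intros)
  have [measurable]: "C \<in> sets borel" using assms by simp
  show ?thesis
  proof (rule approximable_bounded_limit)
    show "approximable lebesgue (cspan waves) (\<lambda>x. of_real (F k (phase x)) * indicator E x)" for k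
      by (intro approximable_continuous cont borel_measurable_continuous_onI)
    show "(\<lambda>x. indicator C (phase x) :: real) \<in> borel_measurable borel" by measurable
    show "\<bar>F k (phase x)\<bar> \<le> 1" for k x using infdist_nonneg[of "phase x" C] by (auto simp: F_def max_def)
    show "(\<lambda>k. F k (phase x)) \<longlonglongrightarrow> indicator C (phase x)" for x
    proof (cases "phase x \<in> C")
      case True
      then show ?thesis by (simp add: F_def)
    next
      case out: False
      then have pos: "infdist (phase x) C > 0"
        using in_closed_iff_infdist_zero[OF assms False, of "phase x"] infdist_nonneg[of "phase x" C] by linarith
      obtain N where N: "1 < real N * infdist (phase x) C" using reals_Archimedean3[OF pos] by blast
      have "F k (phase x) = 0" if "k \<ge> N" for k
      proof -
        have "real N * infdist (phase x) C \<le> real k * infdist (phase x) C" using that pos by (intro mult_right_mono) auto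
        then show ?thesis using N by (simp add: F_def)
      qed
      then have "\<forall>\<^sub>F k in sequentially. F k (phase x) = 0" by (auto simp: eventually_sequentially)
      then show ?thesis using out by (simp add: tendsto_eventually)
    qed
  qed
qed

text \<open>Induction over the sigma-algebra generated by the closed sets, which are stable under
  intersection; complements are differences, disjoint unions are bounded limits.\<close>

lemma approximable_torus_borel:
  assumes "C \<in> sets borel"
  shows "approximable lebesgue (cspan waves) (\<lambda>x. of_real (indicator C (phase x)) * indicator E x)"
proof -
  have "Int_stable (Collect closed :: (complex ^ 'n) set set)" by (auto simp: Int_stable_def)
  moreover have "Collect closed \<subseteq> Pow (UNIV :: (complex ^ 'n) set)" by simp
  moreover have "C \<in> sigma_sets UNIV (Collect closed)" using assms by (simp add: borel_eq_closed)
  ultimately show ?thesis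
  proof (induction C rule: sigma_sets_induct_disjoint)
    case (basic A)
    then show ?case by (simp add: approximable_closed)
  next
    case empty
    show ?case using approximable_closed[of "{}"] by simp
  next
    case (compl A)
    have "approximable lebesgue (cspan waves) (\<lambda>x. of_real (indicator UNIV (phase x)) * indicator E x
      + (- 1) * (of_real (indicator A (phase x)) * indicator E x))"
      by (intro approximable_add approximable_scale approximable_closed compl square_integrable_waves) auto
    moreover have "complex_of_real (indicator UNIV (phase x)) * indicator E x + (- 1) * (of_real (indicator A (phase x)) * indicator E x)
       = of_real (indicator (UNIV - A) (phase x)) * indicator E x" for x
      by (simp add: indicator_def)
    ultimately show ?case by simp
  next
    case (union A)
    have Ab[measurable]: "A i \<in> sets borel" for i using union(2) by (auto simp: borel_eq_closed)
    have part: "(\<Sum>i<k. indicator (A i) z) = (indicator (\<Union>i<k. A i) z :: real)" for k z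
      using union(1) by (subst indicator_UN_disjoint) (auto simp: disjoint_family_on_def)
    show ?case
    proof (rule approximable_bounded_limit)
      have "approximable lebesgue (cspan waves) (\<lambda>x. \<Sum>i<k. of_real (indicator (A i) (phase x)) * indicator E x)" for k
        by (intro approximable_sum square_integrable_waves union)
      then show "approximable lebesgue (cspan waves) (\<lambda>x. of_real (\<Sum>i<k. indicator (A i) (phase x)) * indicator E x)" for k
        by (simp add: sum_distrib_right)
      have [measurable]: "(\<Union>i. A i) \<in> sets borel" using Ab by blast
      show "(\<lambda>x. indicator (\<Union>i. A i) (phase x) :: real) \<in> borel_measurable borel" by measurable
      show "\<bar>\<Sum>i<k. indicator (A i) (phase x)\<bar> \<le> (1::real)" for k x unfolding part by (simp add: indicator_def)
      show "(\<lambda>k. \<Sum>i<k. indicator (A i) (phase x)) \<longlonglongrightarrow> (indicator (\<Union>i. A i) (phase x) :: real)" for x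
        unfolding part by (rule LIMSEQ_indicator_UN)
    qed
  qed
qed

text \<open>Extending A periodically by M gives a Borel set \<open>A'\<close> that agrees with A on
  E almost everywhere, because E is a tile. The map \<open>\<psi>\<close> is a Borel inverse of
  \<open>phase\<close> up to elements of M, so \<open>A'\<close> is the preimage under
  \<open>phase\<close> of a Borel set of the torus.\<close>

lemma approximable_borel:
  assumes A [measurable]: "A \<in> sets borel" and AE: "A \<subseteq> E"
  shows "approximable lebesgue (cspan waves) (\<lambda>x. of_real (indicator A x))"
proof -
  define A' where "A' = {x. \<exists>m\<in>M. x - m \<in> A}"
  have cM: "countable M" unfolding M by (rule lattice_of_countable)
  have sM: "subgrp M" unfolding M by (rule is_lattice_subgrp[OF is_lattice_lattice_of[OF W]])
  have A'b: "A' \<in> sets borel"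
  proof -
    have "A' = (\<Union>m\<in>M. {x. x - m \<in> A})" by (auto simp: A'_def)
    also have "\<dots> \<in> sets borel"
    proof (intro sets.countable_UN' cM image_subsetI)
      fix m
      show "{x. x - m \<in> A} \<in> sets borel" by measurable
    qed
    finally show ?thesis .
  qed
  have per: "x + m \<in> A' \<longleftrightarrow> x \<in> A'" if "m \<in> M" for x m
  proof
    assume "x + m \<in> A'"
    then obtain m' where "m' \<in> M" "x + m - m' \<in> A" by (auto simp: A'_def)
    then show "x \<in> A'" using subgrp_diff[OF sM \<open>m' \<in> M\<close> that]
      by (auto simp: A'_def algebra_simps intro!: bexI[of _ "m' - m"])
  next
    assume "x \<in> A'"
    then obtain m' where "m' \<in> M" "x - m' \<in> A" by (auto simp: A'_def)
    then show "x + m \<in> A'" using subgrp_add[OF sM \<open>m' \<in> M\<close> that]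
      by (auto simp: A'_def algebra_simps intro!: bexI[of _ "m' + m"])
  qed
  define \<psi> where "\<psi> z = W *v (\<chi> i. angle (z $ i) / (2 * pi))" for z :: "complex ^ 'n"
  have \<psi>b: "\<psi> \<in> borel_measurable borel"
  proof -
    have [measurable]: "(\<lambda>z :: complex ^ 'n. z $ i) \<in> borel_measurable borel" for i
      by (intro borel_measurable_continuous_onI continuous_intros)
    have "(\<lambda>z :: complex ^ 'n. \<chi> i. angle (z $ i) / (2 * pi)) \<in> borel_measurable borel"
      by (subst borel_measurable_euclidean_space) (auto simp: Basis_vec_def inner_axis)
    moreover have "(\<lambda>y. W *v y) \<in> borel_measurable borel"
      by (intro borel_measurable_continuous_onI matrix_vector_mult_linear_continuous_on)
    ultimately show ?thesis unfolding \<psi>_def by (rule measurable_compose)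
  qed
  have \<psi>: "\<psi> (phase x) \<in> A' \<longleftrightarrow> x \<in> A'" for x
  proof -
    define y where "y = matrix_inv W *v x"
    have x: "W *v y = x" using matrix_inv_vec(2)[OF W] by (simp add: y_def)
    have "angle (phase x $ i) / (2 * pi) - y $ i \<in> \<int>" for i
    proof -
      have "cis (angle (phase x $ i)) = cis (2 * pi * y $ i)"
        using cis_angle[of "phase x $ i"] phase_torus[of x]
        by (simp add: torus_def) (simp add: phase_def wave_cis y_def matrix_vector_mul_component)
      then have "cis (angle (phase x $ i) - 2 * pi * y $ i) = 1" by (simp flip: cis_divide)
      then have "cos (angle (phase x $ i) - 2 * pi * y $ i) = 1" by (metis cis.sel(1) one_complex.sel(1))
      then obtain k :: int where "angle (phase x $ i) - 2 * pi * y $ i = of_int k * 2 * pi"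
        using cos_one_2pi_int by blast
      then have "angle (phase x $ i) / (2 * pi) - y $ i = of_int k" by (simp add: field_simps)
      then show ?thesis by simp
    qed
    then have "(\<chi> i. angle (phase x $ i) / (2 * pi)) - y \<in> int_vecs" by (simp add: int_vecs_def)
    then have "\<psi> (phase x) - x \<in> M"
      unfolding M lattice_of_def \<psi>_def using x by (auto simp: matrix_vector_mult_diff_distrib intro!: image_eqI[rotated])
    then show ?thesis using per[of "\<psi> (phase x) - x" x] by simp
  qed
  have ap: "approximable lebesgue (cspan waves) (\<lambda>x. of_real (indicator (\<psi> -` A') (phase x)) * indicator E x)"
    using measurable_sets[OF \<psi>b A'b] by (intro approximable_torus_borel) simp
  show ?thesis
  proof (rule approximable_AE_eq[OF square_integrable_waves ap])
    show "(\<lambda>x. complex_of_real (indicator A x)) \<in> borel_measurable lebesgue"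
      by (rule borel_lebesgue) measurable
    have "AE x in lborel. of_real (indicator (\<psi> -` A') (phase x)) * indicator E x = (of_real (indicator A x) :: complex)"
      using E_tile
    proof eventually_elim
      case (elim x)
      have "0 \<in> M" using sM by (simp add: subgrp_def)
      have "x \<in> A" if "x \<in> E" "x - m \<in> A" "m \<in> M" for m
      proof -
        have "(THE m. m \<in> M \<and> x - m \<in> E) = m" by (rule the1_equality[OF elim]) (use that AE in blast)
        moreover have "(THE m. m \<in> M \<and> x - m \<in> E) = 0" by (rule the1_equality[OF elim]) (simp add: that \<open>0 \<in> M\<close>)
        ultimately show ?thesis using that by simp
      qed
      then have "x \<in> E \<and> x \<in> A' \<longleftrightarrow> x \<in> A"
        using AE \<open>0 \<in> M\<close> by (auto simp: A'_def intro!: bexI[of _ 0])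
      then show ?case using \<psi>[of x] by (auto simp: indicator_def)
    qed
    then show "AE x in lebesgue. of_real (indicator (\<psi> -` A') (phase x)) * indicator E x = (of_real (indicator A x) :: complex)"
      by (rule AE_completion)
  qed
qed

end

section \<open>The orthogonal basis\<close>

text \<open>Adding the constant C makes g non-negative, and its contribution cancels because tiles
  of one group have equal measure.\<close>

lemma tile_integral_eq:
  fixes g :: "real ^ 'n \<Rightarrow> real"
  assumes G: "subgrp G" "countable G" and A: "is_tile G A" "bounded A" and B: "is_tile G B" "bounded B"
    and g [measurable]: "g \<in> borel_measurable borel" and per: "\<And>x l. l \<in> G \<Longrightarrow> g (x + l) = g x" and bd: "\<And>x. \<bar>g x\<bar> \<le> C"
  shows "(\<integral>x. g x * indicator A x \<partial>lborel) = (\<integral>x. g x * indicator B x \<partial>lborel)"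
proof -
  have meas: "measure lborel A = measure lborel B" by (rule is_tile_measure_eq[OF G A(1) B(1)])
  have e: "(\<integral>x. g x * indicator S x \<partial>lborel) = enn2real (\<integral>\<^sup>+x. ennreal (g x + C) * indicator S x \<partial>lborel) - C * measure lborel S"
    if S: "is_tile G S" "bounded S" for S
  proof -
    have [measurable]: "S \<in> sets borel" using S(1) by (simp add: is_tile_def)
    have nn: "0 \<le> g x + C" for x using bd[of x] by linarith
    have iS: "integrable lborel (indicator S :: _ \<Rightarrow> real)"
      using emeasure_bounded_finite[OF S(2)] by (simp add: integrable_indicator_iff)
    have ig: "integrable lborel (\<lambda>x. g x * indicator S x)"
    proof (rule Bochner_Integration.integrable_bound)
      show "integrable lborel (\<lambda>x. C * indicator S x)" using iS by simp
      show "AE x in lborel. norm (g x * indicator S x) \<le> norm (C * indicator S x)"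
        using bd by (intro AE_I2) (auto simp: indicator_def intro: order_trans[OF _ abs_ge_self])
    qed measurable
    have "(\<integral>x. (g x + C) * indicator S x \<partial>lborel) = enn2real (\<integral>\<^sup>+x. ennreal ((g x + C) * indicator S x) \<partial>lborel)"
      by (rule integral_eq_nn_integral) (use nn in \<open>auto simp: indicator_def\<close>)
    also have "(\<integral>\<^sup>+x. ennreal ((g x + C) * indicator S x) \<partial>lborel) = (\<integral>\<^sup>+x. ennreal (g x + C) * indicator S x \<partial>lborel)"
      by (rule nn_integral_cong) (auto simp: indicator_def)
    also have "(\<integral>x. (g x + C) * indicator S x \<partial>lborel) = (\<integral>x. g x * indicator S x \<partial>lborel) + C * measure lborel S"
      using Bochner_Integration.integral_add[OF ig, of "\<lambda>x. C * indicator S x"] iS by (simp add: distrib_right)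
    finally show ?thesis by linarith
  qed
  have "(\<integral>\<^sup>+x. ennreal (g x + C) * indicator A x \<partial>lborel) = (\<integral>\<^sup>+x. ennreal (g x + C) * indicator B x \<partial>lborel)"
    by (rule tile_nn_integral_eq[OF G A(1) B(1)]) (use per in auto)
  then show ?thesis unfolding e[OF A] e[OF B] meas by simp
qed

lemma antiperiodic_tile_integral:
  fixes g :: "real ^ 'n \<Rightarrow> real"
  assumes G: "subgrp G" "countable G" and A: "is_tile G A" "bounded A"
    and g [measurable]: "g \<in> borel_measurable borel" and per: "\<And>x l. l \<in> G \<Longrightarrow> g (x + l) = g x" and bd: "\<And>x. \<bar>g x\<bar> \<le> C"
    and anti: "\<And>x. g (x + t) = - g x"
  shows "(\<integral>x. g x * indicator A x \<partial>lborel) = 0"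
proof -
  have [measurable]: "A \<in> sets borel" using A(1) by (simp add: is_tile_def)
  have "{x. x + t \<in> A} = (\<lambda>x. x - t) ` A" by (auto intro!: image_eqI[of _ _ "_ + t"])
  then have bB: "bounded {x. x + t \<in> A}" using bounded_translation_minus[OF A(2), of t] by simp
  have "(\<integral>x. g x * indicator A x \<partial>lborel) = (\<integral>x. g x * indicator A x \<partial>distr lborel borel ((+) t))"
    by (simp add: lborel_distr_plus)
  also have "\<dots> = (\<integral>x. g (t + x) * indicator A (t + x) \<partial>lborel)"
    by (rule integral_distr) auto
  also have "\<dots> = (\<integral>x. - (g x * indicator {x. x + t \<in> A} x) \<partial>lborel)"
    by (rule Bochner_Integration.integral_cong) (auto simp: anti indicator_def add.commute[of t])
  also have "\<dots> = - (\<integral>x. g x * indicator A x \<partial>lborel)"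
    using tile_integral_eq[OF G A is_tile_shift[OF A(1), of t] bB g per bd] by simp
  finally show ?thesis by simp
qed

text \<open>Translating by half a period of the wave changes its sign, but not its integral over a tile.\<close>

lemma wave_tile_integral:
  fixes \<nu> :: "real ^ 'n"
  assumes M: "subgrp M" "countable M" and A: "is_tile M A" "bounded A" and \<nu>: "\<nu> \<in> dual_lattice M" "\<nu> \<noteq> 0"
  shows "(\<integral>x. wave \<nu> x * indicator A x \<partial>lborel) = 0"
proof -
  have [measurable]: "A \<in> sets borel" using A(1) by (simp add: is_tile_def)
  define t where "t = (1 / (2 * (\<nu> \<bullet> \<nu>))) *\<^sub>R \<nu>"
  have "\<nu> \<bullet> t = 1 / 2" using \<nu>(2) by (simp add: t_def)
  then have "wave \<nu> t = cis (2 * pi * (1 / 2))" by (simp only: wave_cis)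
  also have "\<dots> = - 1" by simp
  finally have wt: "wave \<nu> (x + t) = - wave \<nu> x" for x by (simp add: wave_add_right)
  have wm: "wave \<nu> (x + m) = wave \<nu> x" if "m \<in> M" for x m
    using \<nu>(1) that by (simp add: wave_add_right wave_int dual_lattice_def)
  have int: "integrable lborel (\<lambda>x. wave \<nu> x * indicator A x)"
  proof (rule Bochner_Integration.integrable_bound)
    show "integrable lborel (indicator A :: _ \<Rightarrow> real)"
      using emeasure_bounded_finite[OF A(2)] by (simp add: integrable_indicator_iff)
    show "AE x in lborel. norm (wave \<nu> x * indicator A x) \<le> norm (indicator A x :: real)"
      by (intro AE_I2) (simp add: norm_mult indicator_def)
  qed measurable
  have "(\<integral>x. Re (wave \<nu> x) * indicator A x \<partial>lborel) = 0" "(\<integral>x. Im (wave \<nu> x) * indicator A x \<partial>lborel) = 0"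
    by (rule antiperiodic_tile_integral[OF M A, of _ 1 t]; simp add: wm wt abs_Re_le_cmod[THEN order_trans] abs_Im_le_cmod[THEN order_trans])+
  moreover have ri: "Re (wave \<nu> x * indicator A x) = Re (wave \<nu> x) * indicator A x"
    "Im (wave \<nu> x * indicator A x) = Im (wave \<nu> x) * indicator A x" for x
    by (simp_all split: split_indicator)
  moreover have "Re (\<integral>x. wave \<nu> x * indicator A x \<partial>lborel) = (\<integral>x. Re (wave \<nu> x) * indicator A x \<partial>lborel)"
    using integral_bounded_linear[OF bounded_linear_Re int] by (simp only: ri)
  moreover have "Im (\<integral>x. wave \<nu> x * indicator A x \<partial>lborel) = (\<integral>x. Im (wave \<nu> x) * indicator A x \<partial>lborel)"
    using integral_bounded_linear[OF bounded_linear_Im int] by (simp only: ri)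
  ultimately show ?thesis by (simp add: complex_eq_iff)
qed

lemma cspan_mono: "v \<in> cspan B \<Longrightarrow> B \<subseteq> B' \<Longrightarrow> v \<in> cspan B'"
  by (induction rule: cspan.induct) (auto intro: cspan.intros)

lemma approximable_mono: "approximable M V f \<Longrightarrow> V \<subseteq> V' \<Longrightarrow> approximable M V' f"
  unfolding approximable_def by blast

lemma tiles_byI:
  assumes "AE x in lborel. \<exists>!l. l \<in> L \<and> x - l \<in> E"
  shows "tiles_by E L"
  unfolding tiles_by_def
proof (rule AE_completion)
  show "AE x in lborel. ((\<lambda>l. indicat_real E (x - l)) has_sum 1) L"
    using assms
  proof eventually_elim
    case (elim x)
    define l0 where "l0 = (THE l. l \<in> L \<and> x - l \<in> E)"
    have l0: "l0 \<in> L" "x - l0 \<in> E" using theI'[OF elim] by (simp_all add: l0_def)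
    have u: "l = l0" if "l \<in> L" "x - l \<in> E" for l
      unfolding l0_def by (rule the1_equality[OF elim, symmetric]) (simp add: that)
    have "((\<lambda>l. indicat_real E (x - l)) has_sum 1) {l0}"
      using has_sum_finite[of "{l0}" "\<lambda>l. indicat_real E (x - l)"] l0 by simp
    moreover have "indicat_real E (x - l) = 0" if "l \<in> L - {l0}" for l
      using u[of l] that by (auto simp: indicator_def)
    ultimately show ?case
      using has_sum_cong_neutral[of L "{l0}" "\<lambda>l. indicat_real E (x - l)" "\<lambda>l. indicat_real E (x - l)" 1] l0(1) by auto
  qed
qed

text \<open>Every E + l is a tile of M too, so on it M alone provides orthogonality and completeness
  of the waves. L enters through almost disjointness of these sets, which makes different l
  orthogonal, and through their exhausting the space.\<close>

theorem common_domain_basis: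
  fixes L M :: "(real ^ 'n) set"
  assumes L: "is_lattice L" and M: "is_lattice M"
    and E [measurable]: "E \<in> sets borel" and E_bounded: "bounded E"
    and EL: "AE x in lborel. \<exists>!l. l \<in> L \<and> x - l \<in> E" and EM: "AE x in lborel. \<exists>!m. m \<in> M \<and> x - m \<in> E"
  shows "orthogonal_basis_L2 lebesgue (L \<times> dual_lattice M) (\<lambda>(l, \<mu>) x. wave \<mu> x * indicator E (x - l))"
proof -
  obtain W where W: "det W \<noteq> 0" "M = lattice_of W" using is_lattice_imp_lattice_of[OF M] by blast
  obtain A where A: "det A \<noteq> 0" "L = lattice_of A" using is_lattice_imp_lattice_of[OF L] by blast
  have cM: "countable M" and cL: "countable L" unfolding W(2) A(2) by (rule lattice_of_countable)+
  note Ms = is_lattice_subgrp[OF M]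
  define fam where "fam = (\<lambda>(l, \<mu>) x. wave \<mu> x * (indicator E (x - l) :: complex))"
  define El where "El l = {x. x - l \<in> E}" for l
  have El_ind: "indicator (El l) x = indicator E (x - l)" for l x by (simp add: El_def indicator_def)
  have El_tile: "is_tile M (El l)" for l
    using is_tile_shift[of M E "- l"] E EM by (simp add: is_tile_def El_def)
  then have El_borel [measurable]: "El l \<in> sets borel" for l by (simp add: is_tile_def)
  have El_bounded: "bounded (El l)" for l
  proof -
    have "El l = (+) l ` E" by (auto simp: El_def intro!: image_eqI[of _ _ "_ - l"])
    then show ?thesis using bounded_translation[OF E_bounded, of l] by simp
  qed
  have fam: "fam (l, \<mu>) = (\<lambda>x. wave \<mu> x * indicator (El l) x)" for l \<mu> by (simp add: fam_def El_ind)
  have El_AE: "AE x in lborel. \<exists>!m. m \<in> M \<and> x - m \<in> El l" for l using El_tile by (simp add: is_tile_def)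
  have waves: "waves (El l) M = (\<lambda>\<mu> x. wave \<mu> x * indicator (El l) x) ` dual_lattice M" for l
    by (rule waves_def[OF W El_borel El_bounded El_AE])
  have fam_waves: "fam (l, \<mu>) \<in> waves (El l) M" if "\<mu> \<in> dual_lattice M" for l \<mu>
    unfolding fam waves using that by blast
  have sq: "square_integrable lebesgue (fam i)" if "i \<in> L \<times> dual_lattice M" for i
    using that fam_waves square_integrable_waves[OF W El_borel El_bounded El_AE] by auto
  have nz: "\<not> (AE x in lebesgue. fam i x = 0)" for i
  proof
    obtain l \<mu> where i: "i = (l, \<mu>)" by (cases i)
    assume "AE x in lebesgue. fam i x = 0"
    then have "AE x in lborel. x \<notin> El l"
      unfolding AE_completion_iff i fam by eventually_elim (auto simp: wave_def split: split_indicator_asm)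
    then have "emeasure lborel (El l) = 0" by (subst (asm) AE_iff_measurable[OF _ refl]) auto
    then have "measure lborel (El l) = 0" by (simp add: measure_def)
    moreover have "measure lborel (El l) = measure lborel (parallelepiped W)"
      using W by (intro is_tile_measure_eq[OF Ms cM El_tile]) (simp add: is_tile_parallelepiped)
    ultimately show False using parallelepiped_measure[OF W(1)] W(1) by simp
  qed
  have orth: "l2_inner lebesgue (fam i) (fam j) = 0"
    if ij: "i \<in> L \<times> dual_lattice M" "j \<in> L \<times> dual_lattice M" "i \<noteq> j" for i j
  proof -
    obtain l \<mu> l' \<mu>' where i: "i = (l, \<mu>)" "l \<in> L" "\<mu> \<in> dual_lattice M" and j: "j = (l', \<mu>')" "l' \<in> L" "\<mu>' \<in> dual_lattice M"
      using ij by blast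
    have cnj_fam: "cnj (wave \<mu> x * indicator S x) = wave (- \<mu>) x * indicator S x" for \<mu> x and S :: "(real ^ 'n) set"
      by (simp add: cnj_wave split: split_indicator)
    have "l2_inner lebesgue (fam i) (fam j) = (\<integral>x. fam i x * cnj (fam j x) \<partial>lborel)"
      unfolding l2_inner_def i(1) j(1) fam cnj_fam by (rule integral_completion) measurable
    also have "\<dots> = 0"
    proof (cases "l = l'")
      case True
      have "fam i x * cnj (fam j x) = wave (\<mu> + - \<mu>') x * indicator (El l) x" for x
        unfolding i(1) j(1) fam wave_add True by (simp add: cnj_wave indicator_def)
      moreover have "\<mu> + - \<mu>' \<noteq> 0" using ij(3) i(1) j(1) True by simp
      ultimately show ?thesis
        using wave_tile_integral[OF Ms cM El_tile El_bounded dual_add[OF i(3) dual_uminus[OF j(3)]]] by simp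
    next
      case False
      have "AE x in lborel. fam i x * cnj (fam j x) = 0"
        using EL
      proof eventually_elim
        case (elim x)
        have "x \<notin> El l \<or> x \<notin> El l'"
        proof (rule ccontr)
          assume "\<not> (x \<notin> El l \<or> x \<notin> El l')"
          then have "(THE l. l \<in> L \<and> x - l \<in> E) = l" "(THE l. l \<in> L \<and> x - l \<in> E) = l'"
            using i(2) j(2) by (intro the1_equality[OF elim]; simp add: El_def)+
          then show False using False by simp
        qed
        then show ?case unfolding i(1) j(1) fam by (auto simp: indicator_def)
      qed
      then show ?thesis by (rule integral_eq_zero_AE)
    qed
    finally show ?thesis .
  qed
  define V where "V = fam ` (L \<times> dual_lattice M)"
  have V_sq: "square_integrable lebesgue b" if "b \<in> V" for b using that sq by (auto simp: V_def)
  have borel_piece: "approximable lebesgue (cspan V) (\<lambda>x. of_real (indicator (S \<inter> El l) x))"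
    if S: "S \<in> sets borel" and l: "l \<in> L" for S l
  proof -
    have [measurable]: "S \<in> sets borel" by (rule S)
    have "approximable lebesgue (cspan (waves (El l) M)) (\<lambda>x. of_real (indicator (S \<inter> El l) x))"
      by (intro approximable_borel[OF W El_borel El_bounded El_AE]) auto
    moreover have "waves (El l) M \<subseteq> V" unfolding waves V_def fam[symmetric] using l by auto
    ultimately show ?thesis using cspan_mono by (blast intro: approximable_mono)
  qed
  have leb: "approximable lebesgue (cspan V) (\<lambda>x. of_real (indicator S x))"
    if S: "S \<in> sets lebesgue" "emeasure lebesgue S < \<infinity>" for S
  proof -
    obtain S' N N' where S': "S = S' \<union> N" "N \<subseteq> N'" "N' \<in> null_sets lborel" "S' \<in> sets lborel"
      using S(1) by (rule sets_completionE)
    have "AE x in lborel. x \<notin> N'" using S'(3) by (rule AE_not_in)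
    then have SS: "AE x in lborel. x \<in> S' \<longleftrightarrow> x \<in> S" by eventually_elim (use S' in blast)
    \<comment> \<open>Finite initial segments of an enumeration of L, so that the partial sums below
      approximate the indicator of S one translate of E after another.\<close>
    define Lk where "Lk k = from_nat_into L ` {..<k}" for k :: nat
    have "L \<noteq> {}" using L by (auto simp: is_lattice_def)
    then have Lk: "Lk k \<subseteq> L" for k unfolding Lk_def using from_nat_into[of L] by blast
    define s where "s k x = (\<Sum>l\<in>Lk k. complex_of_real (indicator (S' \<inter> El l) x))" for k x
    \<comment> \<open>Almost every x lies in exactly one E + l, so the sequence s k x jumps at most
      once, from 0 to its limit; this yields convergence and domination together.\<close>
    have val: "AE x in lborel. \<exists>k0. \<forall>k. s k x = (if k0 \<le> k then indicator S x else 0)"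
      using SS EL
    proof eventually_elim
      case (elim x)
      define l0 where "l0 = (THE l. l \<in> L \<and> x - l \<in> E)"
      have l0: "l0 \<in> L" "x - l0 \<in> E" using theI'[OF elim(2)] by (simp_all add: l0_def)
      have u: "l = l0" if "l \<in> L" "x - l \<in> E" for l
        unfolding l0_def by (rule the1_equality[OF elim(2), symmetric]) (simp add: that)
      have sk: "s k x = (if l0 \<in> Lk k then indicator S x else 0)" for k
      proof -
        have "s k x = (\<Sum>l\<in>Lk k. if l = l0 then indicator S x else 0)"
          unfolding s_def
        proof (rule sum.cong[OF refl])
          fix l assume "l \<in> Lk k"
          then have "x \<in> El l \<longleftrightarrow> l = l0" using u[of l] l0(2) Lk[of k] by (auto simp: El_def)
          then show "complex_of_real (indicator (S' \<inter> El l) x) = (if l = l0 then indicator S x else 0)"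
            using elim(1) by (auto simp: indicator_def)
        qed
        then show ?thesis by (simp add: Lk_def)
      qed
      obtain n where "from_nat_into L n = l0" using from_nat_into_surj[OF cL l0(1)] by blast
      then have ex: "\<exists>k. l0 \<in> Lk k" by (auto simp: Lk_def intro!: exI[of _ "Suc n"])
      define k0 where "k0 = (LEAST k. l0 \<in> Lk k)"
      have "l0 \<in> Lk k0" unfolding k0_def using ex by (rule LeastI_ex)
      moreover have "Lk k \<subseteq> Lk k'" if "k \<le> k'" for k k' unfolding Lk_def using that by (intro image_mono) auto
      ultimately have "l0 \<in> Lk k \<longleftrightarrow> k0 \<le> k" for k
        using Least_le[of "\<lambda>k. l0 \<in> Lk k" k] by (auto simp: k0_def)
      then show ?case by (intro exI[of _ k0]) (simp add: sk)
    qed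
    note val' = AE_completion[OF val]
    show ?thesis
    proof (rule approximable_limit[OF V_sq])
      show "(\<lambda>x. complex_of_real (indicator S x)) \<in> borel_measurable lebesgue" using S(1) by measurable
      show "approximable lebesgue (cspan V) (s k)" for k
        unfolding s_def using Lk S'(4) by (intro approximable_sum V_sq borel_piece) auto
      show "AE x in lebesgue. (\<lambda>k. s k x) \<longlonglongrightarrow> complex_of_real (indicator S x)"
        using val'
      proof eventually_elim
        case (elim x)
        then obtain k0 where "\<And>k. s k x = (if k0 \<le> k then indicator S x else 0)" by blast
        then have "\<forall>\<^sub>F k in sequentially. s k x = complex_of_real (indicator S x)"
          by (auto simp: eventually_sequentially indicator_def)
        then show ?case by (rule tendsto_eventually)
      qed
      show "integrable lebesgue (indicator S :: _ \<Rightarrow> real)" using S by (simp add: integrable_indicator_iff)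
      show "AE x in lebesgue. (cmod (s k x))\<^sup>2 \<le> indicator S x" for k
        using val' by eventually_elim (auto simp: indicator_def)
    qed
  qed
  have dense: "\<exists>S c. finite S \<and> S \<subseteq> L \<times> dual_lattice M \<and> l2_norm lebesgue (\<lambda>x. g x - (\<Sum>i\<in>S. c i * fam i x)) < e"
    if g: "square_integrable lebesgue g" and e: "e > 0" for g e
  proof -
    have "approximable lebesgue (cspan V) g" by (rule approximable_from_indicators[OF V_sq leb g])
    moreover have "e\<^sup>2 > 0" using e by simp
    ultimately obtain v where v: "v \<in> cspan V" "(LINT x|lebesgue. (cmod (g x - v x))\<^sup>2) < e\<^sup>2"
      unfolding approximable_def by meson
    obtain S c where S: "finite S" "S \<subseteq> L \<times> dual_lattice M" "v = (\<lambda>x. \<Sum>i\<in>S. c i * fam i x)"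
      using cspan_image[OF v(1)[unfolded V_def]] by blast
    have "l2_norm lebesgue (\<lambda>x. g x - v x) < e"
      unfolding l2_norm_def using v(2) e by (intro real_less_lsqrt) auto
    then have "l2_norm lebesgue (\<lambda>x. g x - (\<Sum>i\<in>S. c i * fam i x)) < e" by (simp only: S(3))
    with S(1,2) show ?thesis by blast
  qed
  show ?thesis
    unfolding orthogonal_basis_L2_def fam_def[symmetric]
    by (intro conjI ballI allI impI sq nz orth dense)
qed

theorem mainTheorem3:
  fixes L M :: "(real ^ 'n) set"
  assumes "is_lattice L" and "is_lattice M"
    and "lattice_volume L = lattice_volume M"
  shows "\<exists>E \<in> sets lebesgue. bounded E \<and> tiles_by E L \<and> tiles_by E M \<and>
    orthogonal_basis_L2 lebesgue (L \<times> dual_lattice M)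
      (\<lambda>(l, \<mu>) x. exp (2 * pi * \<i> * (\<mu> \<bullet> x)) * indicator E (x - l))"
proof -
  obtain E where E: "E \<in> sets borel" "bounded E"
    "AE x in lborel. \<exists>!l. l \<in> L \<and> x - l \<in> E" "AE x in lborel. \<exists>!m. m \<in> M \<and> x - m \<in> E"
    using common_fundamental_domain[OF assms] by (elim bexE conjE)
  show ?thesis
  proof (intro bexI[of _ E] conjI)
    show "orthogonal_basis_L2 lebesgue (L \<times> dual_lattice M)
      (\<lambda>(l, \<mu>) x. exp (2 * pi * \<i> * (\<mu> \<bullet> x)) * indicator E (x - l))"
      using common_domain_basis[OF assms(1,2) E] unfolding wave_def .
    show "E \<in> sets lebesgue" using E(1) by simp
  qed (fact E tiles_byI[OF E(3)] tiles_byI[OF E(4)])+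
qed

end
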